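(* Let a finite planar graph (without loops or multiple edges) with vertex set $V$ be given, together with a correspondence which assigns to each vertex $v\in V$ a smooth convex body $P_v\subset\mathbb{C}$. Then there are sets $Q_v\subset\mathbb{C}$ ($v\in V$), with each $Q_v$ homothetic to $P_v$, such that $(Q_v:v\in V)$ is a packing whose nerve is the given graph.
   Context: A convex body is a bounded compact convex set in the plane which has interior points; it is smooth if its boundary is once differentiable with respect to an arc-length parameter. Two planar sets are homothetic if there is a map $z\mapsto \alpha z+\beta$ with $\alpha>0$ real and $\beta\in\mathbb{C}$ taking one onto the other. Two closed sets touch if they intersect but the interior of each is disjoint from the other; they intersect nontrivially if they intersect but do not touch. A packing is a finite indexed family of closed, connected, nonempty sets, no two of which intersect nontrivially, and such that no point is common to three of the sets and no set is a single point. Its nerve is the graph on the index set in which two distinct indices are joined by a (single) edge if and only if the corresponding sets touch. *)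

theory Defs
  imports "HOL-Analysis.Analysis"
begin

section \<open>Smooth convex bodies\<close>

definition convex_body :: "complex set \<Rightarrow> bool" where
  "convex_body K \<longleftrightarrow> compact K \<and> convex K \<and> interior K \<noteq> {}"

definition inscribed_lengths :: "(real \<Rightarrow> complex) \<Rightarrow> real \<Rightarrow> real \<Rightarrow> real set" where
  "inscribed_lengths \<gamma> a b =
     {\<Sum>i<n. dist (\<gamma> (t i)) (\<gamma> (t (Suc i))) | n t. mono t \<and> t 0 = a \<and> t n = b}"

definition has_arc_length :: "(real \<Rightarrow> complex) \<Rightarrow> real \<Rightarrow> real \<Rightarrow> real \<Rightarrow> bool" where
  "has_arc_length \<gamma> a b l \<longleftrightarrow>
     bdd_above (inscribed_lengths \<gamma> a b) \<and> Sup (inscribed_lengths \<gamma> a b) = l"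

text \<open>The closed curve \<open>S\<close>, of total length \<open>L\<close>, is traversed \<open>L\<close>-periodically, so that
  differentiability of \<open>\<gamma>\<close> on the whole line includes the point where the curve closes up.
  Continuity of \<open>\<gamma>\<close> follows from the condition on arc lengths.\<close>

definition closed_arc_length_parameter :: "complex set \<Rightarrow> real \<Rightarrow> (real \<Rightarrow> complex) \<Rightarrow> bool" where
  "closed_arc_length_parameter S L \<gamma> \<longleftrightarrow>
     L > 0 \<and> (\<forall>s. \<gamma> (s + L) = \<gamma> s) \<and> inj_on \<gamma> {0..<L} \<and> \<gamma> ` {0..<L} = S \<and>
     (\<forall>s t. s \<le> t \<longrightarrow> has_arc_length \<gamma> s t (t - s))"

definition smooth_convex_body :: "complex set \<Rightarrow> bool" where
  "smooth_convex_body K \<longleftrightarrow> convex_body K \<and>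
     (\<exists>L \<gamma>. closed_arc_length_parameter (frontier K) L \<gamma> \<and> (\<forall>s. \<gamma> differentiable (at s)))"

definition homothetic :: "complex set \<Rightarrow> complex set \<Rightarrow> bool" where
  "homothetic A B \<longleftrightarrow>
     (\<exists>(\<alpha>::real) (\<beta>::complex). \<alpha> > 0 \<and> (\<lambda>z. complex_of_real \<alpha> * z + \<beta>) ` A = B)"

section \<open>Packings and nerves\<close>

definition touch :: "complex set \<Rightarrow> complex set \<Rightarrow> bool" where
  "touch A B \<longleftrightarrow> A \<inter> B \<noteq> {} \<and> interior A \<inter> B = {} \<and> A \<inter> interior B = {}"

definition intersect_nontrivially :: "complex set \<Rightarrow> complex set \<Rightarrow> bool" where
  "intersect_nontrivially A B \<longleftrightarrow> A \<inter> B \<noteq> {} \<and> \<not> touch A B"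

definition packing :: "'v set \<Rightarrow> ('v \<Rightarrow> complex set) \<Rightarrow> bool" where
  "packing V Q \<longleftrightarrow>
     finite V \<and>
     (\<forall>v\<in>V. closed (Q v) \<and> connected (Q v) \<and> Q v \<noteq> {}) \<and>
     (\<forall>u\<in>V. \<forall>v\<in>V. u \<noteq> v \<longrightarrow> \<not> intersect_nontrivially (Q u) (Q v)) \<and>
     (\<forall>u\<in>V. \<forall>v\<in>V. \<forall>w\<in>V. u \<noteq> v \<and> u \<noteq> w \<and> v \<noteq> w \<longrightarrow> Q u \<inter> Q v \<inter> Q w = {}) \<and>
     (\<forall>v\<in>V. \<nexists>z. Q v = {z})"

text \<open>Graphs are pairs of a vertex set and a set of edges, an edge being the set of its two
  ends.\<close>

definition nerve :: "'v set \<Rightarrow> ('v \<Rightarrow> complex set) \<Rightarrow> 'v set \<times> 'v set set" where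
  "nerve V Q = (V, {{u, v} | u v. u \<in> V \<and> v \<in> V \<and> u \<noteq> v \<and> touch (Q u) (Q v)})"

section \<open>Planar graphs\<close>

definition finite_simple_graph :: "'v set \<times> 'v set set \<Rightarrow> bool" where
  "finite_simple_graph G \<longleftrightarrow> finite (fst G) \<and> (\<forall>e\<in>snd G. e \<subseteq> fst G \<and> card e = 2)"

text \<open>Vertices are drawn as distinct points \<open>p v\<close>, edges as arcs \<open>g e\<close> joining the
  points of their ends, passing through no other vertex and meeting each other only in
  common ends.\<close>

definition planar_embedding ::
  "'v set \<times> 'v set set \<Rightarrow> ('v \<Rightarrow> complex) \<Rightarrow> ('v set \<Rightarrow> real \<Rightarrow> complex) \<Rightarrow> bool" where
  "planar_embedding G p g \<longleftrightarrow>
     inj_on p (fst G) \<and>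
     (\<forall>e\<in>snd G. arc (g e) \<and> {pathstart (g e), pathfinish (g e)} = p ` e \<and>
        path_image (g e) \<inter> p ` fst G = p ` e) \<and>
     (\<forall>e\<in>snd G. \<forall>f\<in>snd G. e \<noteq> f \<longrightarrow>
        path_image (g e) \<inter> path_image (g f) \<subseteq> p ` (e \<inter> f))"

definition planar_graph :: "'v set \<times> 'v set set \<Rightarrow> bool" where
  "planar_graph G \<longleftrightarrow> (\<exists>p g. planar_embedding G p g)"

end

theory Submission
  imports Defs
begin

text \<open>The cells of a fine grid met by a planar drawing of the graph form disjoint connected sets.
  Contracting them embeds the graph, as an induced subgraph, in a triangulation of the sphere with
  a face that avoids it. It remains to pack the vertices of a triangulation.

  For bodies of bounded curvature, the unknowns are the directions of the normals at the contacts.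
  The directions at the corners of a face determine the ratios of the sizes of the three bodies, and
  the ratios and positions fit together if the directions solve a system of equations. Its pairing
  with the displacement from a fixed angle structure is positive near the boundary of the domain,
  so the theorem of Poincare and Miranda gives a solution. The contact points form polygons
  and triangles whose winding numbers about any point add up to at most one; hence the bodies
  do not overlap.

  Smooth bodies are limits of bodies of bounded curvature. No body shrinks to a point in the
  limit, because three smooth bodies with disjoint interiors have no common point.\<close>

section \<open>Linear systems and zeros of maps on a cube\<close>

text \<open>The nerve must be exactly the given graph, so the graph is not completed on its own
  vertices: auxiliary vertices carrying discs are added, and it becomes an induced subgraph. The
  three outer bodies have size one and their further contacts are not controlled, whence the face
  that avoids the graph. Bounded curvature makes the equations solvable: it compares the cross
  product of two contact chords, up to a constant factor, with a trigonometric expression in the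
  angles whose logarithm dominates when an angle tends to 0. No functional with these equations as
  gradient is used; only the sign of the pairing enters, so a theorem on zeros replaces
  minimization. In the limit two things could go wrong. Bodies could vanish: a cluster of vanishing
  bodies has at least three surviving neighbours, since two vertices do not separate a
  triangulation, and these would share a point. Bodies that are not adjacent could touch: they are
  kept apart by the ring of contacts around one of them, whose winding number is constant on any
  connected set that meets no third body.\<close>

lemma homogeneous_system_nonzero_solution:
  fixes M :: "'j \<Rightarrow> 'i \<Rightarrow> real"
  assumes "finite J" "finite I" "card J < card I"
  shows "\<exists>x. (\<exists>i\<in>I. x i \<noteq> 0) \<and> (\<forall>j\<in>J. (\<Sum>i\<in>I. M j i * x i) = 0)"
  using assms
proof (induction J arbitrary: I M rule: finite_induct)
  case empty
  then obtain i where "i \<in> I" by fastforce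
  thus ?case by (intro exI[of _ "\<lambda>_. 1"]) auto
next
  case (insert j0 J)
  show ?case
  proof (cases "\<forall>i\<in>I. M j0 i = 0")
    case True
    thus ?thesis using insert.IH[of I M] insert by simp
  next
    case False
    then obtain i1 where i1: "i1 \<in> I" "M j0 i1 \<noteq> 0" by blast
    have "card J < card (I - {i1})" using insert i1 by simp
    from insert.IH[OF _ this, of "\<lambda>j i. M j i - M j i1 * M j0 i / M j0 i1"] insert.prems
    obtain x where x: "\<exists>i\<in>I - {i1}. x i \<noteq> 0"
      "\<forall>j\<in>J. (\<Sum>i\<in>I - {i1}. (M j i - M j i1 * M j0 i / M j0 i1) * x i) = 0" by auto
    define s where "s = (\<Sum>i\<in>I - {i1}. M j0 i * x i)"
    define y where "y = x(i1 := - s / M j0 i1)"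
    have sum: "(\<Sum>i\<in>I. M j i * y i) = (\<Sum>i\<in>I - {i1}. M j i * x i) - M j i1 * s / M j0 i1" for j
    proof -
      have "(\<Sum>i\<in>I. M j i * y i) = M j i1 * y i1 + (\<Sum>i\<in>I - {i1}. M j i * y i)"
        using i1 insert.prems by (simp add: sum.remove)
      also have "(\<Sum>i\<in>I - {i1}. M j i * y i) = (\<Sum>i\<in>I - {i1}. M j i * x i)"
        by (rule sum.cong) (auto simp: y_def)
      finally show ?thesis by (simp add: y_def)
    qed
    have "(\<Sum>i\<in>I. M j i * y i) = 0" if "j \<in> J" for j
    proof -
      have "0 = (\<Sum>i\<in>I - {i1}. M j i * x i - M j i1 / M j0 i1 * (M j0 i * x i))"
        using x(2) that by (auto simp: field_simps)
      also have "\<dots> = (\<Sum>i\<in>I - {i1}. M j i * x i) - M j i1 / M j0 i1 * s"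
        by (simp add: sum_subtractf sum_distrib_left s_def)
      finally show ?thesis using sum by simp
    qed
    moreover have "(\<Sum>i\<in>I. M j0 i * y i) = 0" using sum[of j0] i1 by (simp add: s_def)
    moreover have "\<exists>i\<in>I. y i \<noteq> 0" using x(1) by (auto simp: y_def)
    ultimately show ?thesis by auto
  qed
qed

text \<open>Induction on the rows. If the hypothesis fails without row \<open>i0\<close>, some
  \<open>l\<close> kills the rows in \<open>I\<close> but not \<open>b\<close>; subtracting a
  suitable multiple of row \<open>i0\<close> from \<open>b\<close> then restores it.\<close>

lemma fredholm_alternative:
  fixes M :: "'i \<Rightarrow> 'j \<Rightarrow> real"
  assumes "finite I"
    and "\<And>l. (\<And>i. i \<in> I \<Longrightarrow> (\<Sum>j\<in>J. M i j * l j) = 0) \<Longrightarrow> (\<Sum>j\<in>J. b j * l j) = 0"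
    and "finite J"
  shows "\<exists>x. \<forall>j\<in>J. b j = (\<Sum>i\<in>I. x i * M i j)"
  using assms
proof (induction I arbitrary: b rule: finite_induct)
  case empty
  have "(\<Sum>j\<in>J. b j * b j) = 0" using empty(1)[of b] by simp
  hence "\<forall>j\<in>J. b j * b j = 0" using sum_nonneg_eq_0_iff[OF empty(2), of "\<lambda>j. b j * b j"] by simp
  thus ?case by simp
next
  case (insert i0 I)
  show ?case
  proof (cases "\<forall>l. (\<forall>i\<in>I. (\<Sum>j\<in>J. M i j * l j) = 0) \<longrightarrow> (\<Sum>j\<in>J. b j * l j) = 0")
    case True
    then obtain x where x: "\<forall>j\<in>J. b j = (\<Sum>i\<in>I. x i * M i j)"
      using insert.IH[of b] insert.prems by blast
    have "(\<Sum>i\<in>insert i0 I. (x(i0 := 0)) i * M i j) = (\<Sum>i\<in>I. x i * M i j)" for j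
      using insert by (auto intro!: sum.cong)
    thus ?thesis using x by metis
  next
    case False
    then obtain l where l: "\<And>i. i \<in> I \<Longrightarrow> (\<Sum>j\<in>J. M i j * l j) = 0" "(\<Sum>j\<in>J. b j * l j) \<noteq> 0" by blast
    define m where "m = (\<Sum>j\<in>J. M i0 j * l j)"
    have m: "m \<noteq> 0" using insert.prems(1)[of l] l m_def by auto
    \<comment> \<open>The multiple is forced: \<open>b\<close> minus \<open>t\<close> times row
      \<open>i0\<close> must pair to zero with \<open>l\<close>.\<close>
    define t where "t = (\<Sum>j\<in>J. b j * l j) / m"
    have "(\<Sum>j\<in>J. (b j - t * M i0 j) * k j) = 0" if k: "\<And>i. i \<in> I \<Longrightarrow> (\<Sum>j\<in>J. M i j * k j) = 0" for k
    proof -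
      \<comment> \<open>\<open>k\<close> minus \<open>c\<close> times \<open>l\<close> is also
        orthogonal to row \<open>i0\<close>, so the hypothesis for all rows applies to it.\<close>
      define c where "c = (\<Sum>j\<in>J. M i0 j * k j) / m"
      have lin: "(\<Sum>j\<in>J. g j * (k j - c * l j)) = (\<Sum>j\<in>J. g j * k j) - c * (\<Sum>j\<in>J. g j * l j)" for g
        by (simp add: sum_subtractf sum_distrib_left algebra_simps)
      have "(\<Sum>j\<in>J. M i j * (k j - c * l j)) = 0" if "i \<in> insert i0 I" for i
        using that k l m unfolding lin by (auto simp: c_def m_def[symmetric])
      from insert.prems(1)[OF this] have "(\<Sum>j\<in>J. b j * k j) = c * (t * m)"
        using m unfolding lin by (simp add: t_def)
      moreover have "(\<Sum>j\<in>J. (b j - t * M i0 j) * k j) = (\<Sum>j\<in>J. b j * k j) - t * (c * m)"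
        using m by (simp add: c_def sum_subtractf sum_distrib_left left_diff_distrib mult.assoc)
      ultimately show ?thesis by simp
    qed
    from insert.IH[OF this] insert.prems
    obtain x where x: "\<forall>j\<in>J. b j - t * M i0 j = (\<Sum>i\<in>I. x i * M i j)" by blast
    have "(\<Sum>i\<in>insert i0 I. (x(i0 := t)) i * M i j) = t * M i0 j + (\<Sum>i\<in>I. x i * M i j)" for j
      using insert by (auto intro!: sum.cong)
    hence "\<forall>j\<in>J. b j = (\<Sum>i\<in>insert i0 I. (x(i0 := t)) i * M i j)" using x by (auto simp: algebra_simps)
    thus ?thesis by blast
  qed
qed

lemma finite_convergent_subsequence:
  fixes X :: "nat \<Rightarrow> 'i \<Rightarrow> 'b::heine_borel"
  assumes "finite I" "\<And>i. i \<in> I \<Longrightarrow> bounded (range (\<lambda>k. X k i))"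
  shows "\<exists>r l. strict_mono (r :: nat \<Rightarrow> nat) \<and> (\<forall>i\<in>I. (\<lambda>k. X (r k) i) \<longlonglongrightarrow> l i)"
  using assms
proof (induction I rule: finite_induct)
  case empty
  show ?case by (intro exI[of _ id]) (simp add: strict_mono_def)
next
  case (insert i I)
  then obtain r l where r: "strict_mono (r :: nat \<Rightarrow> nat)" "\<forall>i\<in>I. (\<lambda>k. X (r k) i) \<longlonglongrightarrow> l i" by auto
  have "bounded (range (\<lambda>k. X (r k) i))"
    by (rule bounded_subset[OF insert.prems[of i]]) auto
  then obtain m s where s: "strict_mono (s :: nat \<Rightarrow> nat)" "((\<lambda>k. X (r k) i) \<circ> s) \<longlonglongrightarrow> m"
    using bounded_imp_convergent_subsequence by blast
  have "(\<lambda>k. X ((r \<circ> s) k) j) \<longlonglongrightarrow> (l(i := m)) j" if "j \<in> insert i I" for j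
  proof (cases "j = i")
    case True
    thus ?thesis using s by (simp add: o_def)
  next
    case False
    hence "((\<lambda>k. X (r k) j) \<circ> s) \<longlonglongrightarrow> l j" using r that LIMSEQ_subseq_LIMSEQ s by blast
    thus ?thesis using False by (simp add: o_def)
  qed
  thus ?case using strict_mono_o[OF r(1) s(1)] by blast
qed

text \<open>Discretized by Kuhn's lemma: in every subdivision of the cube some small cube shows, for
  each component, both weak signs at its corners; a limit of such cubes is a common zero. Points are
  functions of which only the values on \<open>I\<close> count, so continuity is stated for
  sequences and coordinatewise convergence.\<close>

lemma poincare_miranda:
  fixes f :: "('i \<Rightarrow> real) \<Rightarrow> 'i \<Rightarrow> real"
  assumes fin: "finite I" and R: "R > 0"
    and cont: "\<And>X x i. i \<in> I \<Longrightarrow> (\<And>j k. j \<in> I \<Longrightarrow> \<bar>X k j\<bar> \<le> R) \<Longrightarrow>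
      (\<And>j. j \<in> I \<Longrightarrow> (\<lambda>k. X k j) \<longlonglongrightarrow> x j) \<Longrightarrow> (\<lambda>k::nat. f (X k) i) \<longlonglongrightarrow> f x i"
    and lo: "\<And>x i. i \<in> I \<Longrightarrow> (\<And>j. j \<in> I \<Longrightarrow> \<bar>x j\<bar> \<le> R) \<Longrightarrow> x i = - R \<Longrightarrow> f x i \<ge> 0"
    and hi: "\<And>x i. i \<in> I \<Longrightarrow> (\<And>j. j \<in> I \<Longrightarrow> \<bar>x j\<bar> \<le> R) \<Longrightarrow> x i = R \<Longrightarrow> f x i \<le> 0"
  shows "\<exists>x. (\<forall>i\<in>I. \<bar>x i\<bar> \<le> R) \<and> (\<forall>i\<in>I. f x i = 0)"
proof -
  define n where "n = card I"
  obtain e where e: "bij_betw e {..<n} I" using ex_bij_betw_nat_finite[OF fin] by (auto simp: n_def atLeast0LessThan)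
  define d where "d = inv_into {..<n} e"
  have d: "d i < n" "e (d i) = i" if "i \<in> I" for i
    using that e inv_into_into[of i e "{..<n}"] f_inv_into_f[of i e "{..<n}"] unfolding d_def bij_betw_def by auto
  have de: "d (e j) = j" "e j \<in> I" if "j < n" for j
    using that e unfolding d_def bij_betw_def by auto
  define z where "z p q i = - R + 2 * R * real (q (d i)) / real p" for p :: nat and q :: "nat \<Rightarrow> nat" and i
  have zR: "\<bar>z p q i\<bar> \<le> R" if "0 < p" "\<forall>j<n. q j \<le> p" "i \<in> I" for p q i
  proof -
    have "real (q (d i)) / real p \<le> 1" "0 \<le> real (q (d i)) / real p" using that d by auto
    hence "R * (real (q (d i)) / real p) \<le> R * 1" "0 \<le> R * (real (q (d i)) / real p)"
      using R mult_left_mono[of "real (q (d i)) / real p" 1 R] by auto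
    thus ?thesis unfolding z_def by simp
  qed
  define change where "change p q j \<longleftrightarrow> (\<exists>u v. (\<forall>k<n. q k \<le> u k \<and> u k \<le> q k + 1) \<and>
     (\<forall>k<n. q k \<le> v k \<and> v k \<le> q k + 1) \<and> f (z p u) (e j) \<ge> 0 \<and> f (z p v) (e j) \<le> 0)" for p q j
  have "\<exists>q. (\<forall>j<n. q j < p) \<and> (\<forall>j<n. change p q j)" if p: "0 < p" for p
  proof -
    \<comment> \<open>On the faces of the cube the label is the one that \<open>kuhn_lemma\<close>
      prescribes. The sign conditions \<open>lo\<close> and \<open>hi\<close> make it agree with the
      sign of \<open>f\<close>, so that label 0 always means a nonnegative and label 1 a nonpositive
      value.\<close>
    define L where "L q j = (if q j = 0 then 0 else if q j = p then 1 else if f (z p q) (e j) \<ge> 0 then 0 else (1::nat))" for q j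
    have L0: "f (z p q) (e j) \<ge> 0" if "L q j = 0" "j < n" "\<forall>k<n. q k \<le> p" for q j
    proof (cases "q j = 0")
      case True
      show ?thesis by (rule lo) (use that zR[OF p that(3)] True de in \<open>auto simp: z_def\<close>)
    next
      case False
      thus ?thesis using that by (auto simp: L_def split: if_splits)
    qed
    have L1: "f (z p q) (e j) \<le> 0" if "L q j \<noteq> 0" "j < n" "\<forall>k<n. q k \<le> p" for q j
    proof (cases "q j = p")
      case True
      show ?thesis by (rule hi) (use that zR[OF p that(3)] True de p in \<open>auto simp: z_def\<close>)
    next
      case False
      thus ?thesis using that by (auto simp: L_def split: if_splits)
    qed
    obtain q where q: "\<forall>i<n. q i < p"
      "\<forall>i<n. \<exists>r s. (\<forall>j<n. q j \<le> r j \<and> r j \<le> q j + 1) \<and> (\<forall>j<n. q j \<le> s j \<and> s j \<le> q j + 1) \<and> L r i \<noteq> L s i"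
      by (rule kuhn_lemma[of p n L]) (use p in \<open>auto simp: L_def\<close>)
    have "change p q j" if j: "j < n" for j
    proof -
      obtain r s where rs: "\<forall>j<n. q j \<le> r j \<and> r j \<le> q j + 1" "\<forall>j<n. q j \<le> s j \<and> s j \<le> q j + 1" "L r j \<noteq> L s j"
        using q(2) j by blast
      have "r k \<le> p \<and> s k \<le> p" if "k < n" for k
      proof -
        have "q k < p" "r k \<le> q k + 1" "s k \<le> q k + 1" using q(1) rs(1,2) that by auto
        thus ?thesis by linarith
      qed
      hence le: "\<forall>k<n. r k \<le> p" "\<forall>k<n. s k \<le> p" by auto
      show ?thesis
      proof (cases "L r j = 0")
        case True
        hence "L s j \<noteq> 0" using rs(3) by simp
        thus ?thesis using rs(1,2) L0[OF True j le(1)] L1[OF _ j le(2)] unfolding change_def by blast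
      next
        case False
        hence "L s j = 0" using rs(3) by (auto simp: L_def split: if_splits)
        thus ?thesis using rs(1,2) L0[OF _ j le(2)] L1[OF False j le(1)] unfolding change_def by blast
      qed
    qed
    thus ?thesis using q(1) by blast
  qed
  hence "\<forall>p. \<exists>q. (\<forall>j<n. q j < Suc p) \<and> (\<forall>j<n. change (Suc p) q j)" by blast
  then obtain q where q: "\<And>p j. j < n \<Longrightarrow> q p j < Suc p" "\<And>p j. j < n \<Longrightarrow> change (Suc p) (q p) j" by metis
  have "bounded (range (\<lambda>p. z (Suc p) (q p) i))" if "i \<in> I" for i
    using zR[of "Suc _" "q _" i] q(1) that by (auto intro!: boundedI[of _ R] simp: less_Suc_eq_le less_imp_le)
  from finite_convergent_subsequence[OF fin this]
  obtain r x where r: "strict_mono (r :: nat \<Rightarrow> nat)" "\<And>i. i \<in> I \<Longrightarrow> (\<lambda>k. z (Suc (r k)) (q (r k)) i) \<longlonglongrightarrow> x i" by force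
  have xR: "\<bar>x i\<bar> \<le> R" if "i \<in> I" for i
  proof (rule tendsto_le[OF _ tendsto_const tendsto_rabs[OF r(2)[OF that]]])
    show "\<forall>\<^sub>F k in sequentially. \<bar>z (Suc (r k)) (q (r k)) i\<bar> \<le> R"
      using zR[of "Suc _" "q _" i] q(1) that by (auto intro!: always_eventually simp: less_Suc_eq_le less_imp_le)
  qed simp
  \<comment> \<open>The corners of one small cube differ by at most one grid unit in each
    coordinate, so every choice of corners has the same limit.\<close>
  have near: "(\<lambda>k. z (Suc (r k)) (u k) i) \<longlonglongrightarrow> x i"
    if i: "i \<in> I" and u: "\<And>k j. j < n \<Longrightarrow> q (r k) j \<le> u k j \<and> u k j \<le> q (r k) j + 1" for u i
  proof -
    have "(\<lambda>p. 2 * R * inverse (real (Suc p))) \<longlonglongrightarrow> 2 * R * 0" by (intro tendsto_mult tendsto_const LIMSEQ_inverse_real_of_nat)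
    hence "((\<lambda>p. 2 * R * inverse (real (Suc p))) \<circ> r) \<longlonglongrightarrow> 0" using r(1) by (intro LIMSEQ_subseq_LIMSEQ) auto
    hence lim: "(\<lambda>k. 2 * R / real (Suc (r k))) \<longlonglongrightarrow> 0" by (simp add: o_def divide_inverse)
    have "norm (z (Suc (r k)) (u k) i - z (Suc (r k)) (q (r k)) i) \<le> 2 * R / real (Suc (r k))" for k
    proof -
      have "\<bar>real (u k (d i)) - real (q (r k) (d i))\<bar> \<le> 1" using u[of "d i" k] d[OF i] by linarith
      moreover have "z (Suc (r k)) (u k) i - z (Suc (r k)) (q (r k)) i
        = 2 * R / real (Suc (r k)) * (real (u k (d i)) - real (q (r k) (d i)))" by (simp add: z_def diff_divide_distrib algebra_simps)
      ultimately show ?thesis using R mult_left_mono[of _ 1 "2 * R / real (Suc (r k))"]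
        by (simp only: real_norm_def abs_mult) simp
    qed
    hence "(\<lambda>k. z (Suc (r k)) (u k) i - z (Suc (r k)) (q (r k)) i) \<longlonglongrightarrow> 0"
      using Lim_null_comparison[OF always_eventually lim] by force
    from tendsto_add[OF this r(2)[OF i]] show ?thesis by simp
  qed
  have "f x i = 0" if i: "i \<in> I" for i
  proof -
    have "\<forall>k. \<exists>u v. (\<forall>j<n. q (r k) j \<le> u j \<and> u j \<le> q (r k) j + 1) \<and>
     (\<forall>j<n. q (r k) j \<le> v j \<and> v j \<le> q (r k) j + 1) \<and> f (z (Suc (r k)) u) i \<ge> 0 \<and> f (z (Suc (r k)) v) i \<le> 0"
      using q(2)[OF d(1)[OF i]] unfolding change_def d(2)[OF i] by metis
    then obtain u v where u: "\<And>k j. j < n \<Longrightarrow> q (r k) j \<le> u k j \<and> u k j \<le> q (r k) j + 1" "\<And>k. f (z (Suc (r k)) (u k)) i \<ge> 0"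
      and v: "\<And>k j. j < n \<Longrightarrow> q (r k) j \<le> v k j \<and> v k j \<le> q (r k) j + 1" "\<And>k. f (z (Suc (r k)) (v k)) i \<le> 0"
      by metis
    have inR: "\<bar>z (Suc (r k)) (w k) j\<bar> \<le> R" if "\<And>k j. j < n \<Longrightarrow> q (r k) j \<le> w k j \<and> w k j \<le> q (r k) j + 1" "j \<in> I" for w k j
    proof (rule zR)
      show "\<forall>i<n. w k i \<le> Suc (r k)" using that(1)[of _ k] q(1)[of _ "r k"] by force
    qed (use that in auto)
    have "(\<lambda>k. f (z (Suc (r k)) (u k)) i) \<longlonglongrightarrow> f x i" by (rule cont[OF i inR near]) (use u(1) in auto)
    moreover have "(\<lambda>k. f (z (Suc (r k)) (v k)) i) \<longlonglongrightarrow> f x i" by (rule cont[OF i inR near]) (use v(1) in auto)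
    ultimately have "f x i \<ge> 0 \<and> f x i \<le> 0"
      using u(2) v(2) LIMSEQ_le_const[of _ "f x i" 0] LIMSEQ_le_const2[of _ "f x i" 0] by auto
    thus ?thesis by simp
  qed
  thus ?thesis using xR by blast
qed

section \<open>Triangulations of the sphere\<close>

text \<open>A triangulation is given by its oriented faces, each listed with its three rotations.
  Instead of Euler's formula, simple connectivity is expressed by the exactness of closed
  antisymmetric functions on edges.\<close>

type_synonym 'a faces = "('a \<times> 'a \<times> 'a) set"

definition verts :: "'a faces \<Rightarrow> 'a set" where
  "verts F = {a. \<exists>b c. (a, b, c) \<in> F}"

definition adj :: "'a faces \<Rightarrow> 'a \<Rightarrow> 'a \<Rightarrow> bool" where
  "adj F a b \<longleftrightarrow> (\<exists>c. (a, b, c) \<in> F)"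

definition darts :: "'a faces \<Rightarrow> ('a \<times> 'a) set" where
  "darts F = {(a, b). adj F a b}"

definition nb :: "'a faces \<Rightarrow> 'a \<Rightarrow> 'a set" where
  "nb F a = {b. adj F a b}"

text \<open>The successor of \<open>b\<close> in the cyclic order of the neighbours around
  \<open>a\<close>.\<close>

definition nx :: "'a faces \<Rightarrow> 'a \<Rightarrow> 'a \<Rightarrow> 'a" where
  "nx F a b = (THE c. (a, b, c) \<in> F)"

locale triangulation =
  fixes F :: "'a faces"
  assumes finF: "finite F" and neF: "F \<noteq> {}"
    and rot: "\<And>a b c. (a, b, c) \<in> F \<Longrightarrow> (b, c, a) \<in> F"
    and neq: "\<And>a b c. (a, b, c) \<in> F \<Longrightarrow> a \<noteq> b"
    and uniq: "\<And>a b c d. (a, b, c) \<in> F \<Longrightarrow> (a, b, d) \<in> F \<Longrightarrow> c = d"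
    and opp: "\<And>a b c. (a, b, c) \<in> F \<Longrightarrow> \<exists>d. (b, a, d) \<in> F"
    and exact: "\<And>d :: 'a \<Rightarrow> 'a \<Rightarrow> real.
      (\<And>a b c. (a, b, c) \<in> F \<Longrightarrow> d a b = - d b a) \<Longrightarrow>
      (\<And>a b c. (a, b, c) \<in> F \<Longrightarrow> d a b + d b c + d c a = 0) \<Longrightarrow>
      \<exists>g. \<forall>a b c. (a, b, c) \<in> F \<longrightarrow> d a b = g b - g a"
    and strongly_connected: "\<And>S. S \<subseteq> F \<Longrightarrow> S \<noteq> {} \<Longrightarrow>
      (\<And>a b c. (a, b, c) \<in> S \<Longrightarrow> (b, c, a) \<in> S) \<Longrightarrow>
      (\<And>a b c d. (a, b, c) \<in> S \<Longrightarrow> (b, a, d) \<in> F \<Longrightarrow> (b, a, d) \<in> S) \<Longrightarrow> S = F"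
begin

lemma rot2: "(a, b, c) \<in> F \<Longrightarrow> (c, a, b) \<in> F"
  using rot by blast

lemma neqs: "(a, b, c) \<in> F \<Longrightarrow> a \<noteq> b \<and> b \<noteq> c \<and> a \<noteq> c"
  using neq rot by metis

lemma adj_sym: "adj F a b \<Longrightarrow> adj F b a"
  using opp unfolding adj_def by blast

lemma adj_commute: "adj F a b \<longleftrightarrow> adj F b a"
  using adj_sym by blast

lemma face_adj: "(a, b, c) \<in> F \<Longrightarrow> adj F a b \<and> adj F b c \<and> adj F c a \<and> adj F b a \<and> adj F c b \<and> adj F a c"
  using rot adj_sym unfolding adj_def by metis

lemma nx_eq: "(a, b, c) \<in> F \<Longrightarrow> nx F a b = c"
  unfolding nx_def using uniq by blast

lemma nx_face: "adj F a b \<Longrightarrow> (a, b, nx F a b) \<in> F"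
  using nx_eq unfolding adj_def by metis

lemma adj_verts: "adj F a b \<Longrightarrow> a \<in> verts F \<and> b \<in> verts F \<and> a \<noteq> b"
  using rot neq unfolding adj_def verts_def by blast

lemma face_verts: "(a, b, c) \<in> F \<Longrightarrow> a \<in> verts F \<and> b \<in> verts F \<and> c \<in> verts F"
  using rot unfolding verts_def by blast

lemma verts_adj: "a \<in> verts F \<Longrightarrow> \<exists>b. adj F a b"
  unfolding adj_def verts_def by blast

lemma finite_verts: "finite (verts F)"
  by (rule finite_subset[OF _ finite_imageI[OF finF, of fst]]) (force simp: verts_def image_iff)

lemma finite_nb: "finite (nb F a)"
  by (rule finite_subset[OF _ finite_verts]) (auto simp: nb_def dest: adj_verts)

lemma finite_darts: "finite (darts F)"
  by (rule finite_subset[OF _ finite_cartesian_product[OF finite_verts finite_verts]])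
    (auto simp: darts_def dest: adj_verts)

lemma darts_Sigma: "darts F = Sigma (verts F) (nb F)"
  using adj_verts by (auto simp: darts_def nb_def)

lemma nx_adj: "adj F a b \<Longrightarrow> adj F a (nx F a b)"
  using nx_face face_adj by blast

lemma nx_inj: "inj_on (nx F a) (nb F a)"
proof (rule inj_onI)
  fix b b' assume "b \<in> nb F a" "b' \<in> nb F a" "nx F a b = nx F a b'"
  hence "(nx F a b, a, b) \<in> F" "(nx F a b, a, b') \<in> F"
    using rot2[OF nx_face[of a b]] rot2[OF nx_face[of a b']] by (auto simp: nb_def)
  thus "b = b'" using uniq by blast
qed

lemma nx_bij: "bij_betw (nx F a) (nb F a) (nb F a)"
proof -
  have "nx F a ` nb F a = nb F a"
    by (intro endo_inj_surj finite_nb nx_inj) (auto simp: nb_def nx_adj)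
  thus ?thesis using nx_inj by (simp add: bij_betw_def)
qed

lemma sum_rot: "(\<Sum>(a, b, c)\<in>F. f a b c) = (\<Sum>(a, b, c)\<in>F. f b c a)"
proof -
  have "bij_betw (\<lambda>(a, b, c). (b, c, a)) F F"
    by (rule bij_betw_byWitness[of _ "\<lambda>(a, b, c). (c, a, b)"]) (auto intro: rot rot2)
  from sum.reindex_bij_betw[OF this, of "\<lambda>(a, b, c). f a b c"] show ?thesis
    by (simp add: case_prod_unfold)
qed

lemma sum_darts: "(\<Sum>(a, b)\<in>darts F. f a b) = (\<Sum>(a, b, c)\<in>F. f a b)"
proof -
  have "bij_betw (\<lambda>(a, b, c). (a, b)) F (darts F)"
    by (rule bij_betw_byWitness[of _ "\<lambda>(a, b). (a, b, nx F a b)"])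
      (auto simp: nx_eq nx_face darts_def adj_def)
  from sum.reindex_bij_betw[OF this, of "\<lambda>(a, b). f a b"] show ?thesis
    by (simp add: case_prod_unfold)
qed

lemma sum_flip: "(\<Sum>(a, b)\<in>darts F. f a b) = (\<Sum>(a, b)\<in>darts F. f b a)"
proof -
  have "bij_betw (\<lambda>(a, b). (b, a)) (darts F) (darts F)"
    by (rule bij_betw_byWitness[of _ "\<lambda>(a, b). (b, a)"]) (auto simp: darts_def intro: adj_sym)
  from sum.reindex_bij_betw[OF this, of "\<lambda>(a, b). f a b"] show ?thesis
    by (simp add: case_prod_unfold)
qed

lemma sum_verts: "(\<Sum>(a, b)\<in>darts F. f a b) = (\<Sum>a\<in>verts F. \<Sum>b\<in>nb F a. f a b)"
  unfolding darts_Sigma by (rule sum.Sigma[symmetric]) (auto simp: finite_verts finite_nb)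

text \<open>The faces that meet \<open>X\<close> form a set closed under crossing edges, hence all
  of \<open>F\<close>. The only edge that could lead out of it joins \<open>p\<close> and
  \<open>q\<close>; there the neighbours around \<open>p\<close> decide, as in
  \<open>key\<close>.\<close>

lemma three_connected:
  assumes x0: "x0 \<in> X" "x0 \<in> verts F" and pq: "p \<notin> X" "q \<notin> X"
    and N: "\<And>x y. x \<in> X \<Longrightarrow> adj F x y \<Longrightarrow> y \<in> X \<union> {p, q}"
  shows "verts F \<subseteq> X \<union> {p, q}"
proof -
  have key: "d \<in> X" if f: "(p', q', c) \<in> F" "c \<in> X" "(q', p', d) \<in> F" and pq': "p' \<notin> X" "q' \<notin> X"
    and N': "\<And>x y. x \<in> X \<Longrightarrow> adj F x y \<Longrightarrow> y \<in> X \<union> {p', q'}" for p' q' c d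
  proof -
    \<comment> \<open>The successor map around \<open>p'\<close> maps this set into itself. As the
      set is finite, it also contains the predecessor of \<open>q'\<close>, and this is the apex
      \<open>d\<close> on the other side of the edge.\<close>
    define A where "A = insert q' {x \<in> X. adj F p' x}"
    have A: "A \<subseteq> nb F p'" using f by (auto simp: A_def nb_def adj_def)
    have "nx F p' x \<in> A" if x: "x \<in> A" for x
    proof (cases "x = q'")
      case True
      thus ?thesis using nx_eq[OF f(1)] f face_adj by (auto simp: A_def)
    next
      case False
      hence xX: "x \<in> X" "adj F p' x" using x by (auto simp: A_def)
      have "nx F p' x \<in> X \<union> {p', q'}" using N' xX face_adj[OF nx_face[OF xX(2)]] by blast
      moreover have "nx F p' x \<noteq> p'" using neqs[OF nx_face[OF xX(2)]] by auto
      ultimately show ?thesis using nx_adj[OF xX(2)] by (auto simp: A_def)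
    qed
    hence "nx F p' ` A = A"
      by (intro endo_inj_surj finite_subset[OF A finite_nb] inj_on_subset[OF nx_inj A]) auto
    moreover have "q' \<in> A" by (simp add: A_def)
    ultimately have "q' \<in> nx F p' ` A" by simp
    then obtain x where x: "x \<in> A" "nx F p' x = q'" by blast
    have "x \<noteq> q'" using x(2) nx_eq[OF f(1)] f(2) pq' by auto
    hence "x \<in> X" "adj F p' x" using x by (auto simp: A_def)
    hence "(q', p', x) \<in> F" using nx_face rot2 x(2) by metis
    thus ?thesis using f(3) uniq \<open>x \<in> X\<close> by blast
  qed
  define S where "S = {(a, b, c). (a, b, c) \<in> F \<and> (a \<in> X \<or> b \<in> X \<or> c \<in> X)}"
  have "S = F"
  proof (rule strongly_connected)
    show "S \<noteq> {}" using x0 by (auto simp: S_def verts_def)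
    show "(b, c, a) \<in> S" if "(a, b, c) \<in> S" for a b c using that rot by (auto simp: S_def)
    show "(b, a, d) \<in> S" if abc: "(a, b, c) \<in> S" and bad: "(b, a, d) \<in> F" for a b c d
    proof (cases "a \<in> X \<or> b \<in> X")
      case True
      thus ?thesis using bad by (auto simp: S_def)
    next
      case False
      hence c: "c \<in> X" "(a, b, c) \<in> F" using abc by (auto simp: S_def)
      hence "a \<in> {p, q}" "b \<in> {p, q}" "a \<noteq> b"
        using N[of c] face_adj[OF c(2)] neqs[OF c(2)] False by auto
      hence "{p, q} = {a, b}" by auto
      hence "d \<in> X" using key[OF c(2,1) bad] False N by auto
      thus ?thesis using bad by (auto simp: S_def)
    qed
  qed (auto simp: S_def)
  show ?thesis
  proof
    fix v assume "v \<in> verts F"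
    then obtain b c where vbc: "(v, b, c) \<in> F" by (auto simp: verts_def)
    hence "v \<in> X \<or> b \<in> X \<or> c \<in> X" using \<open>S = F\<close> by (auto simp: S_def)
    thus "v \<in> X \<union> {p, q}" using N face_adj[OF vbc] by blast
  qed
qed

text \<open>So the neighbours of \<open>v\<close> form a single cycle. An invariant set
  \<open>N1\<close> yields a closed function, equal to 1 on the darts from \<open>v\<close> to
  \<open>N1\<close>. Its potential is \<open>g v + 1\<close> on \<open>N1\<close> and constant along
  edges that avoid \<open>v\<close>; since \<open>v\<close> does not separate the graph, it has this
  value at every other vertex, which puts all neighbours into \<open>N1\<close>.\<close>

lemma link_connected:
  assumes N1: "N1 \<subseteq> nb F v" "N1 \<noteq> {}" "\<And>x. x \<in> N1 \<Longrightarrow> nx F v x \<in> N1"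
  shows "N1 = nb F v"
proof -
  have im: "nx F v ` N1 = N1"
    by (intro endo_inj_surj finite_subset[OF N1(1) finite_nb] inj_on_subset[OF nx_inj N1(1)]) (use N1(3) in auto)
  have iff: "y \<in> N1 \<longleftrightarrow> x \<in> N1" if "(v, x, y) \<in> F" for x y
  proof
    assume "x \<in> N1"
    thus "y \<in> N1" using N1(3) nx_eq that by blast
  next
    assume "y \<in> N1"
    then obtain x' where "x' \<in> N1" "nx F v x' = y" using im by (metis imageE)
    hence "x' = x" using inj_onD[OF nx_inj, of v x' x] N1(1) nx_eq[OF that] that by (auto simp: nb_def adj_def)
    thus "x \<in> N1" using \<open>x' \<in> N1\<close> by simp
  qed
  have v: "v \<notin> N1" using N1(1) adj_verts by (auto simp: nb_def)
  define d :: "'a \<Rightarrow> 'a \<Rightarrow> real" where "d a b = (if a = v \<and> b \<in> N1 then 1 else if b = v \<and> a \<in> N1 then -1 else 0)" for a b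
  have "\<exists>g. \<forall>a b c. (a, b, c) \<in> F \<longrightarrow> d a b = g b - g a"
  proof (rule exact)
    show "d a b = - d b a" if "(a, b, c) \<in> F" for a b c using v by (auto simp: d_def)
    show "d a b + d b c + d c a = 0" if f: "(a, b, c) \<in> F" for a b c
      using neqs[OF f] iff[of b c] iff[of c a] iff[of a b] f rot[OF f] rot2[OF f] v by (auto simp: d_def)
  qed
  then obtain g where g: "\<And>a b. adj F a b \<Longrightarrow> d a b = g b - g a" by (auto simp: adj_def)
  define X where "X = {x \<in> verts F. x \<noteq> v \<and> g x = g v + 1}"
  have NX: "N1 \<subseteq> X"
  proof
    fix x assume x: "x \<in> N1"
    hence a: "adj F v x" using N1 by (auto simp: nb_def)
    thus "x \<in> X" using g[OF a] x v adj_verts[OF a] by (auto simp: X_def d_def)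
  qed
  obtain x0 where "x0 \<in> N1" using N1 by blast
  have "verts F \<subseteq> X \<union> {v, v}"
  proof (rule three_connected)
    show "x0 \<in> X" "x0 \<in> verts F" using \<open>x0 \<in> N1\<close> NX by (auto simp: X_def)
    show "y \<in> X \<union> {v, v}" if "x \<in> X" "adj F x y" for x y
      using g[OF that(2)] that adj_verts[OF that(2)] by (auto simp: X_def d_def)
  qed (auto simp: X_def)
  moreover have "y \<in> N1" if y: "y \<in> nb F v" "y \<in> X" for y
    using g[of v y] y by (auto simp: X_def d_def nb_def split: if_splits)
  ultimately show ?thesis using N1(1) adj_verts by (fastforce simp: nb_def)
qed

text \<open>\<open>F\<close> lists each triangle three times, so this says that the Euler
  characteristic is at least 2. If it failed, there would be fewer equations than edges for an
  antisymmetric \<open>d\<close> that is closed and has zero divergence. Such a \<open>d\<close> is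
  exact, hence orthogonal to itself, hence zero.\<close>

lemma card_faces: "card F + 12 \<le> 6 * card (verts F)"
proof -
  obtain o' :: "'a \<Rightarrow> nat" where o': "inj_on o' (verts F)"
    using finite_imp_inj_to_nat_seg[OF finite_verts] by auto
  have tot: "o' a < o' b \<or> o' b < o' a" if "adj F a b" for a b
    using adj_verts[OF that] inj_onD[OF o'] by (meson linorder_neqE_nat)
  \<comment> \<open>One orientation of every edge and, in \<open>R\<close>, one rotation of every
    triangle, selected by an arbitrary numbering of the vertices.\<close>
  define I where "I = {(a, b). adj F a b \<and> o' a < o' b}"
  define R where "R = {(a, b, c). (a, b, c) \<in> F \<and> o' a < o' b \<and> o' a < o' c}"
  have I: "finite I" "I \<subseteq> darts F" by (rule finite_subset[OF _ finite_darts]) (auto simp: I_def darts_def)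
  have R: "finite R" "R \<subseteq> F" by (rule finite_subset[OF _ finF]) (auto simp: R_def)
  have cardF: "card F = card (darts F)"
    using sum_darts[of "\<lambda>_ _. 1::nat"] by simp
  have "darts F = I \<union> prod.swap ` I" using tot adj_sym by (force simp: darts_def I_def image_iff)
  moreover have "card (I \<union> prod.swap ` I) = card I + card (prod.swap ` I)"
    by (rule card_Un_disjoint) (use I(1) in \<open>auto simp: I_def\<close>)
  ultimately have cI: "card F = 2 * card I" using cardF by (simp add: card_image)
  have split3: "(\<Sum>(a, b, c)\<in>F. f a b c) = (\<Sum>(a, b, c)\<in>R. f a b c + f b c a + f c a b)" for f :: "'a \<Rightarrow> 'a \<Rightarrow> 'a \<Rightarrow> real"
  proof -
    let ?i = "\<lambda>a b c. (if o' a < o' b \<and> o' a < o' c then 1 else 0 :: real)"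
    have one: "?i a b c + ?i b c a + ?i c a b = 1" if "(a, b, c) \<in> F" for a b c
    proof -
      have "o' a \<noteq> o' b" "o' b \<noteq> o' c" "o' a \<noteq> o' c" using tot[of a b] tot[of b c] tot[of a c] face_adj[OF that] by auto
      thus ?thesis by auto
    qed
    have "(\<Sum>(a, b, c)\<in>F. f a b c) = (\<Sum>(a, b, c)\<in>F. f a b c * ?i a b c + f a b c * ?i b c a + f a b c * ?i c a b)"
    proof (rule sum.cong[OF refl])
      fix x assume "x \<in> F"
      thus "(case x of (a, b, c) \<Rightarrow> f a b c) = (case x of (a, b, c) \<Rightarrow> f a b c * ?i a b c + f a b c * ?i b c a + f a b c * ?i c a b)"
        using one by (cases x) (simp add: distrib_left[symmetric] del: mult_if_delta)
    qed
    also have "\<dots> = (\<Sum>(a, b, c)\<in>F. f a b c * ?i a b c) + (\<Sum>(a, b, c)\<in>F. f a b c * ?i b c a) + (\<Sum>(a, b, c)\<in>F. f a b c * ?i c a b)"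
      by (simp only: sum.distrib case_prod_unfold)
    also have "(\<Sum>(a, b, c)\<in>F. f a b c * ?i c a b) = (\<Sum>(a, b, c)\<in>F. f b c a * ?i a b c)"
      using sum_rot[of "\<lambda>a b c. f a b c * ?i c a b"] .
    also have "(\<Sum>(a, b, c)\<in>F. f a b c * ?i b c a) = (\<Sum>(a, b, c)\<in>F. f c a b * ?i a b c)"
      using sum_rot[of "\<lambda>a b c. f c a b * ?i a b c"] by simp
    also have "(\<Sum>(a, b, c)\<in>F. f a b c * ?i a b c) + (\<Sum>(a, b, c)\<in>F. f c a b * ?i a b c) + (\<Sum>(a, b, c)\<in>F. f b c a * ?i a b c)
       = (\<Sum>(a, b, c)\<in>F. if o' a < o' b \<and> o' a < o' c then f a b c + f b c a + f c a b else 0)"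
      unfolding sum.distrib[symmetric] by (rule sum.cong) auto
    also have "\<dots> = (\<Sum>(a, b, c)\<in>R. f a b c + f b c a + f c a b)"
      by (rule sum.mono_neutral_cong_right[OF finF]) (auto simp: R_def split: if_splits)
    finally show ?thesis .
  qed
  have cR: "card F = 3 * card R"
    using split3[of "\<lambda>_ _ _. 1"] by simp
  obtain r0 where r0: "r0 \<in> R"
    using cR neF finF by (metis R(1) card_0_eq card.empty ex_in_conv mult_0_right)
  obtain v0 where v0: "v0 \<in> verts F" using neF by (auto simp: verts_def)
  define D :: "'a \<Rightarrow> 'a \<Rightarrow> 'a \<times> 'a \<Rightarrow> real" where "D a b i = (if i = (a, b) then 1 else if i = (b, a) then -1 else 0)" for a b i
  \<comment> \<open>One triangle and one vertex are left out: total circulation and total divergence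
    vanish by antisymmetry, so the equations at \<open>r0\<close> and \<open>v0\<close> follow from
    the others.\<close>
  define J where "J = (R - {r0}) <+> (verts F - {v0})"
  define M :: "('a \<times> 'a \<times> 'a) + 'a \<Rightarrow> 'a \<times> 'a \<Rightarrow> real" where
    "M j i = (case j of Inl (a, b, c) \<Rightarrow> D a b i + D b c i + D c a i | Inr v \<Rightarrow> (\<Sum>b\<in>nb F v. D v b i))" for j i
  have "card I \<le> card J"
  proof (rule ccontr)
    assume "\<not> card I \<le> card J"
    then obtain t where t: "\<exists>i\<in>I. t i \<noteq> 0" "\<And>j. j \<in> J \<Longrightarrow> (\<Sum>i\<in>I. M j i * t i) = 0"
      using homogeneous_system_nonzero_solution[of J I M] I R finite_verts by (auto simp: J_def)
    define d where "d a b = (if o' a < o' b then t (a, b) else - t (b, a))" for a b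
    have dsum: "(\<Sum>i\<in>I. D a b i * t i) = d a b" if ab: "adj F a b" for a b
    proof (cases "o' a < o' b")
      case True
      have "(\<Sum>i\<in>I. D a b i * t i) = (\<Sum>i\<in>I. if i = (a, b) then t i else 0)"
        by (rule sum.cong) (use True in \<open>auto simp: D_def I_def\<close>)
      thus ?thesis using True ab I by (simp add: d_def I_def)
    next
      case False
      hence ba: "(b, a) \<in> I" using tot[OF ab] adj_sym[OF ab] by (simp add: I_def)
      have "(\<Sum>i\<in>I. D a b i * t i) = (\<Sum>i\<in>I. if i = (b, a) then - t i else 0)"
      proof (rule sum.cong[OF refl])
        fix i assume "i \<in> I"
        hence "i \<noteq> (a, b)" using False by (auto simp: I_def)
        thus "D a b i * t i = (if i = (b, a) then - t i else 0)" by (simp add: D_def)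
      qed
      thus ?thesis using False ba I by (simp add: d_def)
    qed
    have anti: "d a b = - d b a" if "adj F a b" for a b using tot[OF that] by (auto simp: d_def)
    have tot0: "(\<Sum>(a, b)\<in>darts F. d a b) = 0"
    proof -
      have "(\<Sum>(a, b)\<in>darts F. d a b) = (\<Sum>(a, b)\<in>darts F. - d a b)"
        by (subst sum_flip, rule sum.cong) (auto simp: darts_def intro: anti adj_sym)
      thus ?thesis by (simp add: sum_negf case_prod_unfold)
    qed
    have clR: "d a b + d b c + d c a = 0" if f: "(a, b, c) \<in> R" "(a, b, c) \<noteq> r0" for a b c
    proof -
      have "(\<Sum>i\<in>I. M (Inl (a, b, c)) i * t i) = 0" by (rule t) (use f in \<open>auto simp: J_def\<close>)
      hence "(\<Sum>i\<in>I. D a b i * t i) + (\<Sum>i\<in>I. D b c i * t i) + (\<Sum>i\<in>I. D c a i * t i) = 0"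
        by (simp add: M_def distrib_right sum.distrib)
      thus ?thesis using dsum face_adj f R(2) by auto
    qed
    have "0 = (\<Sum>(a, b, c)\<in>R. d a b + d b c + d c a)" using tot0 sum_darts[of d] split3[of "\<lambda>a b c. d a b"] by simp
    also have "\<dots> = (case r0 of (a, b, c) \<Rightarrow> d a b + d b c + d c a)"
      using clR by (subst sum.remove[OF R(1) r0]) (auto intro!: sum.neutral)
    finally have cl: "d a b + d b c + d c a = 0" if "(a, b, c) \<in> R" for a b c
      using clR that by (cases "(a, b, c) = r0") auto
    have clF: "d a b + d b c + d c a = 0" if f: "(a, b, c) \<in> F" for a b c
    proof -
      have "(a, b, c) \<in> R \<or> (b, c, a) \<in> R \<or> (c, a, b) \<in> R"
      proof -
        have "o' a \<noteq> o' b" "o' b \<noteq> o' c" "o' a \<noteq> o' c" using tot[of a b] tot[of b c] tot[of a c] face_adj[OF f] by auto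
        thus ?thesis using f rot[OF f] rot2[OF f] unfolding R_def by auto
      qed
      thus ?thesis using cl by fastforce
    qed
    obtain g where g: "\<And>a b. adj F a b \<Longrightarrow> d a b = g b - g a"
      using exact[of d] clF anti unfolding adj_def by blast
    have div0: "(\<Sum>b\<in>nb F v. d v b) = 0" if v: "v \<in> verts F" "v \<noteq> v0" for v
    proof -
      have "0 = (\<Sum>i\<in>I. M (Inr v) i * t i)" by (rule t(2)[symmetric]) (use v in \<open>auto simp: J_def\<close>)
      also have "\<dots> = (\<Sum>b\<in>nb F v. \<Sum>i\<in>I. D v b i * t i)"
        by (simp add: M_def sum_distrib_right sum.swap[of _ I])
      also have "\<dots> = (\<Sum>b\<in>nb F v. d v b)" by (rule sum.cong) (auto simp: nb_def dsum)
      finally show ?thesis by simp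
    qed
    have "0 = (\<Sum>v\<in>verts F. \<Sum>b\<in>nb F v. d v b)" using tot0 sum_verts[of d] by simp
    also have "\<dots> = (\<Sum>b\<in>nb F v0. d v0 b)"
      using div0 by (subst sum.remove[OF finite_verts v0]) (auto intro!: sum.neutral)
    finally have div: "(\<Sum>b\<in>nb F v. d v b) = 0" if "v \<in> verts F" for v using div0 that by (cases "v = v0") auto
    have ga: "(\<Sum>(a, b)\<in>darts F. d a b * g a) = 0"
      using div by (simp add: sum_verts sum_distrib_right[symmetric])
    have "(\<Sum>(a, b)\<in>darts F. d a b * g b) = (\<Sum>(a, b)\<in>darts F. - (d a b * g a))"
    proof (subst sum_flip, rule sum.cong[OF refl])
      fix x assume "x \<in> darts F"
      then obtain a b where x: "x = (a, b)" "adj F a b" by (auto simp: darts_def)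
      thus "(case x of (a, b) \<Rightarrow> d b a * g a) = (case x of (a, b) \<Rightarrow> - (d a b * g a))"
        using anti[OF adj_sym[OF x(2)]] by simp
    qed
    hence gb: "(\<Sum>(a, b)\<in>darts F. d a b * g b) = 0" using ga by (simp add: sum_negf case_prod_unfold)
    have "(\<Sum>(a, b)\<in>darts F. d a b * d a b) = (\<Sum>(a, b)\<in>darts F. d a b * g b - d a b * g a)"
      by (rule sum.cong) (auto simp: darts_def g right_diff_distrib)
    also have "\<dots> = 0" using ga gb by (simp add: sum_subtractf case_prod_unfold)
    finally have "\<forall>x\<in>darts F. (case x of (a, b) \<Rightarrow> d a b * d a b) = 0"
      by (subst (asm) sum_nonneg_eq_0_iff[OF finite_darts]) auto
    moreover obtain a b where ab: "(a, b) \<in> I" "t (a, b) \<noteq> 0" using t(1) by auto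
    ultimately have "d a b = 0" using I(2) by fastforce
    thus False using ab by (simp add: d_def I_def)
  qed
  moreover have "card J + 2 = card R + card (verts F)"
    using r0 v0 R(1) finite_verts card_Suc_Diff1[OF R(1) r0] card_Suc_Diff1[OF finite_verts v0] by (simp add: J_def card_Plus)
  ultimately show ?thesis using cI cR by linarith
qed

end

section \<open>Bipolar orders and angle structures\<close>

text \<open>Ears, taken as shortest walks that leave and re-enter the ordered part, are inserted one
  after another.\<close>

lemma bipolar_extension:
  fixes h :: "'a \<Rightarrow> real"
  assumes "finite U" "finite D" "U \<inter> D = {}" "inj_on h D"
    and sym: "\<And>x y. A x y \<Longrightarrow> A y x"
    and cond: "\<And>X. X \<subseteq> U \<Longrightarrow> X \<noteq> {} \<Longrightarrow>
      \<exists>a b x y. a \<noteq> b \<and> a \<in> U \<union> D - X \<and> b \<in> U \<union> D - X \<and> x \<in> X \<and> y \<in> X \<and> A x a \<and> A y b"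
  shows "\<exists>h'. inj_on h' (U \<union> D) \<and> (\<forall>d\<in>D. h' d = h d) \<and>
    (\<forall>u\<in>U. \<exists>x\<in>U \<union> D. \<exists>y\<in>U \<union> D. A u x \<and> A u y \<and> h' x < h' u \<and> h' u < h' y)"
  using assms(1-4) cond
proof (induction "card U" arbitrary: U D h rule: less_induct)
  case less
  show ?case
  proof (cases "U = {}")
    case True
    thus ?thesis using less.prems by (intro exI[of _ h]) auto
  next
    case False
    then obtain x0 where x0: "x0 \<in> U" by blast
    \<comment> \<open>The component of \<open>x0\<close> in \<open>U\<close> has two distinct
      attachments, which necessarily lie in \<open>D\<close>; a path between them through the
      component is a first ear.\<close>
    define R where "R = {(x, y). A x y \<and> x \<in> U \<and> y \<in> U}"
    define X where "X = {u \<in> U. (x0, u) \<in> R\<^sup>*}"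
    have "X \<subseteq> U" "X \<noteq> {}" using x0 by (auto simp: X_def)
    then obtain a b x y where ab: "a \<noteq> b" "a \<in> U \<union> D - X" "b \<in> U \<union> D - X" "x \<in> X" "y \<in> X" "A x a" "A y b"
      using less.prems(5)[of X] by blast
    have out: "c \<in> D" if "c \<in> U \<union> D - X" "z \<in> X" "A z c" for c z
      using that rtrancl.rtrancl_into_rtrancl[of x0 z R c] by (auto simp: X_def R_def)
    have "sym R" using sym by (auto simp: R_def sym_def)
    hence "(x, x0) \<in> R\<^sup>*" using ab(4) sym_rtrancl[of R] by (auto simp: X_def sym_def)
    hence "(x, y) \<in> R\<^sup>*" using ab(5) by (auto simp: X_def)
    then obtain k where "(x, y) \<in> R ^^ k" using rtrancl_imp_relpow by blast
    then obtain f0 where f0: "f0 0 = x" "f0 k = y" "\<And>i. i < k \<Longrightarrow> (f0 i, f0 (Suc i)) \<in> R"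
      unfolding relpow_fun_conv by blast
    define W where "W n f \<longleftrightarrow> f 0 \<in> D \<and> f n \<in> D \<and> f 0 \<noteq> f n \<and> (\<forall>i. 0 < i \<and> i < n \<longrightarrow> f i \<in> U) \<and>
      (\<forall>i<n. A (f i) (f (Suc i))) \<and> 2 \<le> n" for n and f :: "nat \<Rightarrow> 'a"
    have "W (k + 2) (\<lambda>i. if i = 0 then a else if i \<le> k + 1 then f0 (i - 1) else b)" unfolding W_def
    proof (intro conjI allI impI)
      have f0U: "f0 j \<in> U" if "j \<le> k" for j
      proof (cases "j = k")
        case True
        thus ?thesis using ab f0 by (auto simp: X_def)
      next
        case False
        thus ?thesis using f0(3)[of j] that by (auto simp: R_def)
      qed
      show "(if i = 0 then a else if i \<le> k + 1 then f0 (i - 1) else b) \<in> U" if "0 < i \<and> i < k + 2" for i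
        using f0U that by auto
      show "A (if i = 0 then a else if i \<le> k + 1 then f0 (i - 1) else b)
        (if Suc i = 0 then a else if Suc i \<le> k + 1 then f0 (Suc i - 1) else b)" if i: "i < k + 2" for i
      proof (cases i)
        case 0
        thus ?thesis using ab f0 sym by auto
      next
        case (Suc j)
        hence "j = k \<or> j < k" using i by auto
        thus ?thesis using ab f0 f0(3)[of j] Suc by (auto simp: R_def)
      qed
    qed (use ab out in auto)
    hence exW: "\<exists>n f. W n f" by blast
    define n where "n = (LEAST n. \<exists>f. W n f)"
    have "\<exists>f. W n f" using LeastI_ex[OF exW] by (simp add: n_def)
    then obtain f1 where f1: "W n f1" by blast
    have "\<exists>f. W n f \<and> h (f 0) < h (f n)"
    proof (cases "h (f1 0) < h (f1 n)")
      case True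
      thus ?thesis using f1 by blast
    next
      case False
      have "h (f1 0) \<noteq> h (f1 n)" using f1 less.prems(4) by (auto simp: W_def dest: inj_onD)
      moreover have "A (f1 (n - i)) (f1 (n - Suc i))" if "i < n" for i
      proof -
        have "n - Suc i < n" "Suc (n - Suc i) = n - i" using that by auto
        hence "A (f1 (n - Suc i)) (f1 (n - i))" using f1 unfolding W_def by metis
        thus ?thesis by (rule sym)
      qed
      hence "W n (\<lambda>i. f1 (n - i))" using f1 by (auto simp: W_def)
      ultimately show ?thesis using False by (intro exI[of _ "\<lambda>i. f1 (n - i)"]) auto
    qed
    then obtain f where f: "W n f" "h (f 0) < h (f n)" by blast
    have fD: "f 0 \<in> D" "f n \<in> D" and fU: "\<And>i. 0 < i \<Longrightarrow> i < n \<Longrightarrow> f i \<in> U"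
      and fA: "\<And>i. i < n \<Longrightarrow> A (f i) (f (Suc i))" and n2: "2 \<le> n"
      using f(1) by (auto simp: W_def)
    \<comment> \<open>A shortest ear repeats no vertex: otherwise the part between two visits could
      be cut out.\<close>
    have "f i \<noteq> f j" if ij: "0 < i" "i < j" "j < n" for i j
    proof
      assume eq: "f i = f j"
      define g where "g l = (if l \<le> i then f l else f (l + (j - i)))" for l
      have n': "n - (j - i) + (j - i) = n" using ij by auto
      have "W (n - (j - i)) g" unfolding W_def
      proof (intro conjI allI impI)
        show "g l \<in> U" if "0 < l \<and> l < n - (j - i)" for l using that fU ij by (auto simp: g_def)
        show "A (g l) (g (Suc l))" if l: "l < n - (j - i)" for l
        proof (cases "l < i")
          case True
          thus ?thesis using fA[of l] ij by (simp add: g_def)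
        next
          case False
          thus ?thesis using fA[of "l + (j - i)"] l ij eq by (cases "l = i") (auto simp: g_def)
        qed
        have "\<not> n - (j - i) \<le> i" using ij by auto
        hence gn: "g (n - (j - i)) = f n" using n' by (simp add: g_def)
        show "g (n - (j - i)) \<in> D" "g 0 \<noteq> g (n - (j - i))" using gn f(1) by (auto simp: g_def W_def)
      qed (use ij fD in \<open>auto simp: g_def\<close>)
      hence "n \<le> n - (j - i)" unfolding n_def by (intro Least_le) blast
      thus False using ij by auto
    qed
    hence finj: "inj_on f {1..<n}" by (auto simp: inj_on_def) (metis linorder_neqE_nat Suc_le_eq)
    define N where "N = f ` {1..<n}"
    have NU: "N \<subseteq> U" "finite N" "N \<noteq> {}" using fU n2 by (auto simp: N_def)
    \<comment> \<open>\<open>\<delta>\<close> is the gap between \<open>h (f 0)\<close> and the next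
      larger value on \<open>D\<close>. The inner vertices of the ear get equally spaced values in
      this gap, so they differ from all old values and increase along the ear, below
      \<open>h (f n)\<close>.\<close>
    define G where "G = (\<lambda>d. h d - h (f 0)) ` {d \<in> D. h (f 0) < h d}"
    have G: "finite G" "G \<noteq> {}" "\<And>g. g \<in> G \<Longrightarrow> 0 < g" using less.prems(2) fD f(2) by (auto simp: G_def)
    define \<delta> where "\<delta> = Min G"
    have \<delta>: "0 < \<delta>" "\<And>d. d \<in> D \<Longrightarrow> h (f 0) < h d \<Longrightarrow> h (f 0) + \<delta> \<le> h d"
    proof -
      show "0 < \<delta>" using G by (simp add: \<delta>_def)
      fix d assume "d \<in> D" "h (f 0) < h d"
      hence "\<delta> \<le> h d - h (f 0)" using G(1) unfolding \<delta>_def by (intro Min_le) (auto simp: G_def)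
      thus "h (f 0) + \<delta> \<le> h d" by simp
    qed
    define h1 where "h1 u = (if u \<in> N then h (f 0) + \<delta> * real (inv_into {1..<n} f u) / real n else h u)" for u
    have h1f: "h1 (f i) = h (f 0) + \<delta> * real i / real n" if "i < n" for i
    proof (cases "i = 0")
      case True
      thus ?thesis using fD less.prems(3) NU by (auto simp: h1_def)
    next
      case False
      thus ?thesis using inv_into_f_f[OF finj, of i] that by (auto simp: h1_def N_def)
    qed
    have h1D: "h1 d = h d" if "d \<in> D" for d using that NU less.prems(3) by (auto simp: h1_def)
    have between: "h (f 0) < h1 u" "h1 u < h (f 0) + \<delta>" if u: "u \<in> N" for u
    proof -
      obtain i where i: "u = f i" "1 \<le> i" "i < n" using u by (auto simp: N_def)
      have "0 < \<delta> * real i / real n" "\<delta> * real i / real n < \<delta>" using \<delta>(1) i by (auto simp: field_simps)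
      thus "h (f 0) < h1 u" "h1 u < h (f 0) + \<delta>" using h1f[OF i(3)] i(1) by auto
    qed
    have h1inj: "inj_on h1 (D \<union> N)"
    proof (rule inj_onI)
      fix u v assume uv: "u \<in> D \<union> N" "v \<in> D \<union> N" "h1 u = h1 v"
      have dn: "h1 d \<noteq> h1 w" if "d \<in> D" "w \<in> N" for d w
        using between[OF that(2)] \<delta>(2)[OF that(1)] h1D[OF that(1)] by linarith
      have nn: "u = v" if "u \<in> N" "v \<in> N"
      proof -
        obtain i j where ij: "u = f i" "i < n" "v = f j" "j < n" using \<open>u \<in> N\<close> \<open>v \<in> N\<close> by (auto simp: N_def)
        hence "\<delta> * real i / real n = \<delta> * real j / real n" using uv(3) h1f by simp
        hence "i = j" using \<delta>(1) n2 by simp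
        thus ?thesis using ij by simp
      qed
      show "u = v" using uv dn[of u v] dn[of v u] nn h1D less.prems(4) by (auto dest: inj_onD)
    qed
    have UD: "(U - N) \<union> (D \<union> N) = U \<union> D" using NU by auto
    have "card (U - N) < card U" using NU less.prems(1) by (intro psubset_card_mono) auto
    moreover have "\<exists>a b x y. a \<noteq> b \<and> a \<in> (U - N) \<union> (D \<union> N) - Y \<and> b \<in> (U - N) \<union> (D \<union> N) - Y \<and> x \<in> Y \<and> y \<in> Y \<and> A x a \<and> A y b"
      if "Y \<subseteq> U - N" "Y \<noteq> {}" for Y unfolding UD using less.prems(5)[of Y] that by auto
    ultimately obtain h' where h': "inj_on h' (U \<union> D)" "\<forall>d\<in>D \<union> N. h' d = h1 d"
      "\<forall>u\<in>U - N. \<exists>x\<in>U \<union> D. \<exists>y\<in>U \<union> D. A u x \<and> A u y \<and> h' x < h' u \<and> h' u < h' y"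
      using less.hyps[of "U - N" "D \<union> N" h1] less.prems(1-3) NU h1inj unfolding UD by blast
    have "\<exists>x\<in>U \<union> D. \<exists>y\<in>U \<union> D. A u x \<and> A u y \<and> h' x < h' u \<and> h' u < h' y" if u: "u \<in> N" for u
    proof -
      obtain i where i: "u = f i" "1 \<le> i" "i < n" using u by (auto simp: N_def)
      then obtain j where j: "i = Suc j" by (cases i) auto
      have fin: "f l \<in> D \<union> N" if "l \<le> n" for l
        using that fD by (cases "l = 0"; cases "l = n") (auto simp: N_def)
      have hf: "h' (f l) = h1 (f l)" if "l \<le> n" for l using fin[OF that] h'(2) by blast
      have "h' (f j) < h' u" using hf[of j] hf[of i] h1f[of j] h1f[of i] i j \<delta>(1) n2 by (simp add: divide_strict_right_mono)
      moreover have "h' u < h' (f (Suc i))"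
      proof (cases "Suc i = n")
        case True
        thus ?thesis using hf[of n] hf[of i] between(2)[OF u] \<delta>(2)[OF fD(2) f(2)] h1D[OF fD(2)] i by simp
      next
        case False
        thus ?thesis using hf[of "Suc i"] hf[of i] h1f[of "Suc i"] h1f[of i] i \<delta>(1) n2 by (simp add: divide_strict_right_mono)
      qed
      moreover have "A u (f j)" "A u (f (Suc i))" using fA[of j] fA[of i] sym i j by auto
      moreover have "f j \<in> U \<union> D" "f (Suc i) \<in> U \<union> D" using fin[of j] fin[of "Suc i"] NU i j by auto
      ultimately show ?thesis by blast
    qed
    hence "\<forall>u\<in>U. \<exists>x\<in>U \<union> D. \<exists>y\<in>U \<union> D. A u x \<and> A u y \<and> h' x < h' u \<and> h' u < h' y" using h'(3) by blast
    moreover have "\<forall>d\<in>D. h' d = h d" using h'(2) h1D by simp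
    ultimately show ?thesis using h'(1) by blast
  qed
qed

lemma one_middle_of_three:
  fixes x y z :: real
  assumes "x \<noteq> y" "y \<noteq> z" "x \<noteq> z"
  shows "of_bool (y < x \<and> x < z \<or> z < x \<and> x < y) + of_bool (z < y \<and> y < x \<or> x < y \<and> y < z) +
    of_bool (x < z \<and> z < y \<or> y < z \<and> z < x) = (1 :: real)"
proof -
  have r: "y < x \<longleftrightarrow> \<not> x < y" "z < y \<longleftrightarrow> \<not> y < z" "z < x \<longleftrightarrow> \<not> x < z" using assms by auto
  have t: "x < y \<Longrightarrow> y < z \<Longrightarrow> x < z" "\<not> x < y \<Longrightarrow> \<not> y < z \<Longrightarrow> \<not> x < z" using assms by auto
  show ?thesis unfolding r using t by (cases "x < y"; cases "y < z"; cases "x < z"; simp)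
qed

text \<open>Marks the corner of a face at its vertex of middle height; times pi, it is the angle of
  a degenerate triangle.\<close>

definition mid :: "'a faces \<Rightarrow> ('a \<Rightarrow> real) \<Rightarrow> 'a \<Rightarrow> 'a \<Rightarrow> real" where
  "mid F h a b = of_bool (h b < h a \<and> h a < h (nx F a b) \<or> h (nx F a b) < h a \<and> h a < h b)"

definition bipolar :: "'a faces \<Rightarrow> 'a \<Rightarrow> 'a \<Rightarrow> ('a \<Rightarrow> real) \<Rightarrow> bool" where
  "bipolar F s t h \<longleftrightarrow> inj_on h (verts F) \<and>
     (\<forall>v\<in>verts F - {s, t}. \<exists>x y. adj F v x \<and> adj F v y \<and> h x < h v \<and> h v < h y)"

section \<open>Bipolar orders of a triangulation and their middle corners\<close>

context triangulation
begin

text \<open>Without \<open>B\<close> no single vertex separates the graph, since no pair does in the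
  triangulation; this gives an order on the other vertices. \<open>B\<close> is inserted last, at a
  height between those of \<open>a\<close> and \<open>c\<close>: these become its lower and its
  upper neighbour, and the other vertices keep theirs.\<close>

lemma ex_bipolar:
  assumes st: "s \<in> verts F" "t \<in> verts F" "s \<noteq> t" "B \<noteq> s" "B \<noteq> t" and ac: "adj F B a" "adj F B c" "a \<noteq> c"
  shows "\<exists>h. bipolar F s t h \<and> (h a < h B \<and> h B < h c \<or> h c < h B \<and> h B < h a)"
proof -
  let ?U = "verts F - {B, s, t}" let ?D = "{s, t}"
  have UD: "?U \<union> ?D = verts F - {B}" using st by auto
  have "\<exists>h' :: 'a \<Rightarrow> real. inj_on h' (?U \<union> ?D) \<and> (\<forall>d\<in>?D. h' d = (if d = s then 0 else 1)) \<and>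
    (\<forall>u\<in>?U. \<exists>x\<in>?U \<union> ?D. \<exists>y\<in>?U \<union> ?D. adj F u x \<and> adj F u y \<and> h' x < h' u \<and> h' u < h' y)"
  proof (rule bipolar_extension[where h = "\<lambda>d. if d = s then 0 else 1"])
    fix X assume X: "X \<subseteq> ?U" "X \<noteq> {}"
    show "\<exists>a b x y. a \<noteq> b \<and> a \<in> ?U \<union> ?D - X \<and> b \<in> ?U \<union> ?D - X \<and> x \<in> X \<and> y \<in> X \<and> adj F x a \<and> adj F y b"
    proof (rule ccontr)
      assume neg: "\<not> ?thesis"
      define Y where "Y = {a \<in> verts F - {B} - X. \<exists>x\<in>X. adj F x a}"
      have "\<And>a b. a \<in> Y \<Longrightarrow> b \<in> Y \<Longrightarrow> a = b" using neg unfolding UD Y_def by blast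
      then obtain p where p: "Y \<subseteq> {p}" by (metis subsetI singletonI)
      \<comment> \<open>If \<open>Y\<close> is empty, \<open>p\<close> is arbitrary and may lie in
        \<open>X\<close>; then \<open>B\<close> takes both roles.\<close>
      define p' where "p' = (if p \<in> X then B else p)"
      obtain x0 where "x0 \<in> X" using X by blast
      have "verts F \<subseteq> X \<union> {p', B}"
      proof (rule three_connected)
        show "x0 \<in> X" "x0 \<in> verts F" "p' \<notin> X" "B \<notin> X" using \<open>x0 \<in> X\<close> X by (auto simp: p'_def)
        fix x y assume "x \<in> X" "adj F x y"
        hence "y \<in> X \<or> y = B \<or> y \<in> Y" using adj_verts by (auto simp: Y_def)
        thus "y \<in> X \<union> {p', B}" using p by (auto simp: p'_def)
      qed
      hence "s \<in> {p', B}" "t \<in> {p', B}" using X st by auto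
      thus False using st by auto
    qed
  qed (use finite_verts adj_sym st in \<open>auto simp: inj_on_def\<close>)
  then obtain h' :: "'a \<Rightarrow> real" where h'0: "inj_on h' (?U \<union> ?D)"
    "\<forall>u\<in>?U. \<exists>x\<in>?U \<union> ?D. \<exists>y\<in>?U \<union> ?D. adj F u x \<and> adj F u y \<and> h' x < h' u \<and> h' u < h' y"
    by auto
  note h' = h'0[unfolded UD]
  have ac': "a \<in> verts F - {B}" "c \<in> verts F - {B}" using adj_verts[OF ac(1)] adj_verts[OF ac(2)] by auto
  define lo where "lo = min (h' a) (h' c)" define hi where "hi = max (h' a) (h' c)"
  have "h' a \<noteq> h' c" using h'(1) ac' ac(3) by (auto dest: inj_onD)
  hence "lo < hi" by (auto simp: lo_def hi_def min_def max_def)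
  hence "\<not> {lo<..<hi} \<subseteq> h' ` verts F" using finite_verts infinite_Ioo finite_subset by blast
  then obtain \<beta> where \<beta>: "lo < \<beta>" "\<beta> < hi" "\<beta> \<notin> h' ` verts F" by force
  define h where "h = h'(B := \<beta>)"
  have hB: "h a < h B \<and> h B < h c \<or> h c < h B \<and> h B < h a"
    using \<beta> ac' by (auto simp: h_def lo_def hi_def min_def max_def split: if_splits)
  have "inj_on h (verts F)" using h'(1) \<beta>(3) by (auto simp: inj_on_def h_def)
  moreover have "\<exists>x y. adj F v x \<and> adj F v y \<and> h x < h v \<and> h v < h y" if v: "v \<in> verts F - {s, t}" for v
  proof (cases "v = B")
    case True
    thus ?thesis using hB ac by blast
  next
    case False
    then obtain x y where "x \<in> verts F - {B}" "y \<in> verts F - {B}" "adj F v x" "adj F v y" "h' x < h' v" "h' v < h' y"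
      using h'(2) v by blast
    thus ?thesis using False by (intro exI[of _ x] exI[of _ y]) (auto simp: h_def)
  qed
  ultimately show ?thesis using hB unfolding bipolar_def by blast
qed

lemma mid_face:
  assumes "inj_on h (verts F)" "(a, b, c) \<in> F"
  shows "mid F h a b + mid F h b c + mid F h c a = 1"
proof -
  have "nx F a b = c" "nx F b c = a" "nx F c a = b" 
    using nx_eq[OF assms(2)] nx_eq[OF rot[OF assms(2)]] nx_eq[OF rot2[OF assms(2)]] by auto
  moreover have "h a \<noteq> h b" "h b \<noteq> h c" "h a \<noteq> h c"
    using assms(1) face_verts[OF assms(2)] neqs[OF assms(2)] by (auto dest: inj_onD)
  ultimately show ?thesis 
    using one_middle_of_three[of "h a" "h b" "h c"] unfolding mid_def by simp
qed

lemma sum_face_const: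
  assumes "\<And>a b c. (a, b, c) \<in> F \<Longrightarrow> f a b + f b c + f c a = (k :: real)"
  shows "3 * (\<Sum>(a, b)\<in>darts F. f a b) = k * card F"
proof -
  have "(\<Sum>(a, b, c)\<in>F. f a b + f b c + f c a) = (\<Sum>(a, b, c)\<in>F. k)"
    using assms by (intro sum.cong) auto
  moreover have "(\<Sum>(a, b, c)\<in>F. f b c) = (\<Sum>(a, b, c)\<in>F. f a b)" "(\<Sum>(a, b, c)\<in>F. f c a) = (\<Sum>(a, b, c)\<in>F. f a b)"
    using sum_rot[of "\<lambda>a b c. f a b"] sum_rot[of "\<lambda>a b c. f c a"] by auto
  moreover have "(\<Sum>(a, b, c)\<in>F. f a b + f b c + f c a) = (\<Sum>(a, b, c)\<in>F. f a b) + (\<Sum>(a, b, c)\<in>F. f b c) + (\<Sum>(a, b, c)\<in>F. f c a)"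
    by (simp only: sum.distrib case_prod_unfold)
  ultimately show ?thesis by (simp add: sum_darts)
qed

text \<open>Going around \<open>v\<close>, the heights of the neighbours cross \<open>h v\<close>
  upwards and downwards at least once each, so every vertex other than \<open>s\<close> and
  \<open>t\<close> has at least two middle corners. Every triangle has exactly one, and by
  \<open>card_faces\<close> there are at most twice as many triangles as vertices other than
  \<open>s\<close> and \<open>t\<close>; hence equality holds everywhere.\<close>

lemma mid_vertex:
  assumes h: "bipolar F s t h" and st: "s \<in> verts F" "t \<in> verts F" "s \<noteq> t" and v: "v \<in> verts F - {s, t}"
  shows "(\<Sum>b\<in>nb F v. mid F h v b) = 2"
proof -
  have inj: "inj_on h (verts F)" using h by (simp add: bipolar_def)
  have ge2: "(\<Sum>b\<in>nb F v. mid F h v b) \<ge> 2" if v: "v \<in> verts F - {s, t}" for v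
  proof -
    obtain x y where xy: "adj F v x" "adj F v y" "h x < h v" "h v < h y"
      using h v unfolding bipolar_def by blast
    have ne: "h b \<noteq> h v" if "adj F v b" for b using inj adj_verts[OF that] by (auto dest: inj_onD)
    have "\<exists>b\<in>nb F v. h v < h b \<and> h (nx F v b) < h v"
    proof (rule ccontr)
      assume neg: "\<not> ?thesis"
      have "{b \<in> nb F v. h v < h b} = nb F v"
      proof (rule link_connected)
        show "nx F v b \<in> {b \<in> nb F v. h v < h b}" if "b \<in> {b \<in> nb F v. h v < h b}" for b
          using neg that ne[OF nx_adj[of v b]] nx_adj[of v b] by (auto simp: nb_def not_less)
      qed (use xy in \<open>auto simp: nb_def\<close>)
      moreover have "x \<in> nb F v" using xy by (simp add: nb_def)
      ultimately have "h v < h x" by blast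
      thus False using xy by simp
    qed
    then obtain b1 where b1: "b1 \<in> nb F v" "h v < h b1" "h (nx F v b1) < h v" by blast
    have "\<exists>b\<in>nb F v. h b < h v \<and> h v < h (nx F v b)"
    proof (rule ccontr)
      assume neg: "\<not> ?thesis"
      have "{b \<in> nb F v. h b < h v} = nb F v"
      proof (rule link_connected)
        show "nx F v b \<in> {b \<in> nb F v. h b < h v}" if "b \<in> {b \<in> nb F v. h b < h v}" for b
          using neg that ne[OF nx_adj[of v b]] nx_adj[of v b] by (auto simp: nb_def not_less)
      qed (use xy in \<open>auto simp: nb_def\<close>)
      moreover have "y \<in> nb F v" using xy by (simp add: nb_def)
      ultimately have "h y < h v" by blast
      thus False using xy by simp
    qed
    then obtain b2 where b2: "b2 \<in> nb F v" "h b2 < h v" "h v < h (nx F v b2)" by blast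
    have "2 = (\<Sum>b\<in>{b1, b2}. mid F h v b)" using b1 b2 by (subst sum.insert) (auto simp: mid_def)
    also have "\<dots> \<le> (\<Sum>b\<in>nb F v. mid F h v b)"
      using b1 b2 by (intro sum_mono2 finite_nb) (auto simp: mid_def)
    finally show ?thesis .
  qed
  have "3 * (\<Sum>w\<in>verts F. \<Sum>b\<in>nb F w. mid F h w b) = card F"
    using sum_face_const[of "mid F h" 1] mid_face[OF inj] by (simp add: sum_verts)
  hence le: "(\<Sum>w\<in>verts F. \<Sum>b\<in>nb F w. mid F h w b) \<le> 2 * real (card (verts F)) - 4"
    using card_faces by linarith
  have "real (card (verts F - {s, t} - {v})) = real (card (verts F)) - 3"
    using v st finite_verts card_Diff_subset[of "{s, t, v}" "verts F"] card_mono[OF finite_verts, of "{s, t, v}"]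
    by (auto simp: Diff_insert2[symmetric] insert_commute of_nat_diff)
  moreover have "(\<Sum>w\<in>verts F. \<Sum>b\<in>nb F w. mid F h w b) \<ge> (\<Sum>w\<in>verts F - {s, t}. \<Sum>b\<in>nb F w. mid F h w b)"
    by (intro sum_mono2 finite_verts sum_nonneg) (auto simp: mid_def)
  moreover have "(\<Sum>w\<in>verts F - {s, t}. \<Sum>b\<in>nb F w. mid F h w b)
     = (\<Sum>b\<in>nb F v. mid F h v b) + (\<Sum>w\<in>verts F - {s, t} - {v}. \<Sum>b\<in>nb F w. mid F h w b)"
    using v finite_verts by (intro sum.remove) auto
  moreover have "(\<Sum>w\<in>verts F - {s, t} - {v}. \<Sum>b\<in>nb F w. mid F h w b) \<ge> (\<Sum>w\<in>verts F - {s, t} - {v}. 2)"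
    by (intro sum_mono ge2) auto
  ultimately show ?thesis using le ge2[OF v] by simp
qed

end

section \<open>Positive angle structures\<close>

context triangulation
begin

text \<open>The transpose of the operator that takes an edge function to its angle changes
  \<open>\<tau> a (nx F a b) - \<tau> a b\<close>. In the row of an edge only four corners occur,
  two at each end.\<close>

lemma medial_sum:
  fixes l' :: "'a \<Rightarrow> 'a \<Rightarrow> real"
  assumes xy: "adj F x y"
  shows "(\<Sum>(a, b)\<in>darts F. (of_bool ({x, y} = {a, nx F a b}) - of_bool ({x, y} = {a, b})) * l' a b)
    = l' x (nx F y x) + l' y (nx F x y) - l' x y - l' y x"
proof -
    have yx: "adj F y x" and "x \<noteq> y" using xy adj_sym adj_verts by auto
    have d: "(x, y) \<in> darts F" "(y, x) \<in> darts F" using xy yx by (auto simp: darts_def)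
    have fy: "(x, nx F y x, y) \<in> F" and fx: "(y, nx F x y, x) \<in> F" using nx_face xy yx rot by auto
    have d': "(x, nx F y x) \<in> darts F" "(y, nx F x y) \<in> darts F" using fx fy by (auto simp: darts_def adj_def)
    have "(\<Sum>(a, b)\<in>darts F. of_bool ({x, y} = {a, b}) * l' a b) = (\<Sum>(a, b)\<in>{(x, y), (y, x)}. l' a b)"
      by (rule sum.mono_neutral_cong_right[OF finite_darts]) (use d in \<open>auto simp: doubleton_eq_iff\<close>)
    hence s1: "(\<Sum>(a, b)\<in>darts F. of_bool ({x, y} = {a, b}) * l' a b) = l' x y + l' y x" using \<open>x \<noteq> y\<close> by simp
    have nxs: "nx F x (nx F y x) = y" "nx F y (nx F x y) = x" using nx_eq fx fy by auto
    have un: "(a, b) = (x, nx F y x) \<or> (a, b) = (y, nx F x y)" if "adj F a b" "{x, y} = {a, nx F a b}" for a b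
      using that(2) nx_eq[OF rot2[OF nx_face[OF that(1)]]] by (auto simp: doubleton_eq_iff)
    have "(\<Sum>(a, b)\<in>darts F. of_bool ({x, y} = {a, nx F a b}) * l' a b) = (\<Sum>(a, b)\<in>{(x, nx F y x), (y, nx F x y)}. l' a b)"
    proof (rule sum.mono_neutral_cong_right[OF finite_darts])
      have "{x, y} \<noteq> {a, nx F a b}" if "(a, b) \<in> darts F - {(x, nx F y x), (y, nx F x y)}" for a b
        using un[of a b] that by (auto simp: darts_def)
      thus "\<forall>i\<in>darts F - {(x, nx F y x), (y, nx F x y)}. (case i of (a, b) \<Rightarrow> of_bool ({x, y} = {a, nx F a b}) * l' a b) = 0"
        by force
      show "(case i of (a, b) \<Rightarrow> of_bool ({x, y} = {a, nx F a b}) * l' a b) = (case i of (a, b) \<Rightarrow> l' a b)"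
        if "i \<in> {(x, nx F y x), (y, nx F x y)}" for i using that nxs by (auto simp: insert_commute)
    qed (use d' in auto)
    hence s2: "(\<Sum>(a, b)\<in>darts F. of_bool ({x, y} = {a, nx F a b}) * l' a b) = l' x (nx F y x) + l' y (nx F x y)"
      using \<open>x \<noteq> y\<close> by simp
    have "(\<Sum>(a, b)\<in>darts F. (of_bool ({x, y} = {a, nx F a b}) - of_bool ({x, y} = {a, b})) * l' a b)
      = (\<Sum>(a, b)\<in>darts F. of_bool ({x, y} = {a, nx F a b}) * l' a b) - (\<Sum>(a, b)\<in>darts F. of_bool ({x, y} = {a, b}) * l' a b)"
      by (simp only: sum_subtractf case_prod_unfold left_diff_distrib)
    thus ?thesis using s1 s2 by simp
qed

text \<open>By antisymmetry the circulations of \<open>d\<close> around all faces add up to zero, so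
  the remaining face closes by itself.\<close>

lemma exact_except_one_face:
  fixes d :: "'a \<Rightarrow> 'a \<Rightarrow> real"
  assumes out: "(o1, o2, o3) \<in> F" and anti: "\<And>a b. adj F a b \<Longrightarrow> d a b = - d b a"
    and cl: "\<And>a b c. (a, b, c) \<in> F \<Longrightarrow> (a, b) \<notin> {(o1, o2), (o2, o3), (o3, o1)} \<Longrightarrow> d a b + d b c + d c a = 0"
  shows "\<exists>g. \<forall>a b. adj F a b \<longrightarrow> d a b = g b - g a"
proof -
  let ?c = "\<lambda>(a, b, c). d a b + d b c + d c a" and ?O = "{(o1, o2, o3), (o2, o3, o1), (o3, o1, o2)}"
  have "(\<Sum>(a, b)\<in>darts F. d a b) = (\<Sum>(a, b)\<in>darts F. - d a b)"
    by (subst sum_flip, rule sum.cong) (auto simp: darts_def intro: anti adj_sym)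
  hence "(\<Sum>(a, b)\<in>darts F. d a b) = 0" by (simp add: sum_negf case_prod_unfold)
  hence z: "(\<Sum>(a, b, c)\<in>F. d a b) = 0" using sum_darts[of d] by simp
  have "(\<Sum>f\<in>F. ?c f) = (\<Sum>(a, b, c)\<in>F. d a b) + (\<Sum>(a, b, c)\<in>F. d b c) + (\<Sum>(a, b, c)\<in>F. d c a)"
    by (simp only: sum.distrib case_prod_unfold)
  also have "(\<Sum>(a, b, c)\<in>F. d b c) = 0" using z sum_rot[of "\<lambda>a b c. d a b"] by simp
  also have "(\<Sum>(a, b, c)\<in>F. d c a) = 0" using z sum_rot[of "\<lambda>a b c. d c a"] by simp
  finally have tot: "(\<Sum>f\<in>F. ?c f) = 0" using z by simp
  have "(\<Sum>f\<in>F. ?c f) = (\<Sum>f\<in>?O. ?c f)"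
  proof (rule sum.mono_neutral_right[OF finF])
    show "\<forall>f\<in>F - ?O. ?c f = 0"
    proof
      fix f assume f0: "f \<in> F - ?O"
      obtain a b c where abc: "f = (a, b, c)" by (cases f) auto
      hence f: "(a, b, c) \<in> F" "(a, b, c) \<notin> ?O" using f0 by auto
      have "(a, b) \<notin> {(o1, o2), (o2, o3), (o3, o1)}"
        using f nx_eq[OF out] nx_eq[OF rot[OF out]] nx_eq[OF rot2[OF out]] nx_eq[OF f(1)] by auto
      thus "?c f = 0" using cl f abc by simp
    qed
  qed (use out rot[OF out] rot2[OF out] in auto)
  also have "\<dots> = 3 * (d o1 o2 + d o2 o3 + d o3 o1)" using neqs[OF out] by simp
  finally have o: "d o1 o2 + d o2 o3 + d o3 o1 = 0" using tot by simp
  have "\<exists>g. \<forall>a b c. (a, b, c) \<in> F \<longrightarrow> d a b = g b - g a"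
  proof (rule exact)
    show "d a b = - d b a" if "(a, b, c) \<in> F" for a b c using anti face_adj[OF that] by blast
    show "d a b + d b c + d c a = 0" if f: "(a, b, c) \<in> F" for a b c
    proof (cases "(a, b) \<in> {(o1, o2), (o2, o3), (o3, o1)}")
      case True
      thus ?thesis using o nx_eq[OF f] nx_eq[OF out] nx_eq[OF rot[OF out]] nx_eq[OF rot2[OF out]] by auto
    next
      case False
      thus ?thesis using cl f by blast
    qed
  qed
  thus ?thesis unfolding adj_def by blast
qed

text \<open>Each bipolar order gives a degenerate angle structure, with angle \<open>pi\<close> at the
  middle vertex of every face; the positive structure is an average of these. It is a coboundary
  of an edge function relative to one of them by the Fredholm alternative.\<close>

lemma ex_angle_structure:
  assumes out: "(o1, o2, o3) \<in> F"
  shows "\<exists>h \<tau>. inj_on h (verts F) \<and> (\<forall>a b. \<tau> a b = (\<tau> b a :: real)) \<and>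
    (\<forall>a b c. (a, b, c) \<in> F \<longrightarrow> (a, b) \<notin> {(o1, o2), (o2, o3), (o3, o1)} \<longrightarrow>
       0 < \<tau> a c - \<tau> a b + pi * mid F h a b) \<and>
    (\<forall>v\<in>verts F - {o1, o2, o3}. (\<Sum>b\<in>nb F v. mid F h v b) = 2)"
proof -
  let ?O = "{(o1, o2), (o2, o3), (o3, o1)}"
  note od = neqs[OF out] and ov = face_verts[OF out]
  have ex: "\<exists>h. inj_on h (verts F) \<and> (\<forall>v\<in>verts F - {o1, o2, o3}. (\<Sum>b\<in>nb F v. mid F h v b) = 2) \<and>
      mid F h (fst \<kappa>) (snd \<kappa>) = 1" if "\<kappa> \<in> darts F" for \<kappa>
  proof -
    obtain a b where "\<kappa> = (a, b)" by fastforce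
    hence ab: "\<kappa> = (a, b)" "adj F a b" using that by (auto simp: darts_def)
    \<comment> \<open>With two outer vertices other than \<open>a\<close> as poles, \<open>a\<close>
      can be made the middle vertex of the given face, while all vertices off the outer face have
      exactly two middle corners.\<close>
    have "\<exists>s t. s \<in> {o1, o2, o3} \<and> t \<in> {o1, o2, o3} \<and> s \<noteq> t \<and> a \<noteq> s \<and> a \<noteq> t"
    proof (cases "a = o1")
      case True
      thus ?thesis using od by (intro exI[of _ o2] exI[of _ o3]) auto
    next
      case False
      show ?thesis
      proof (cases "a = o2")
        case True
        thus ?thesis using od by (intro exI[of _ o1] exI[of _ o3]) auto
      next
        case False
        thus ?thesis using \<open>a \<noteq> o1\<close> od by (intro exI[of _ o1] exI[of _ o2]) auto
      qed
    qed
    then obtain s t where st: "s \<in> {o1, o2, o3}" "t \<in> {o1, o2, o3}" "s \<noteq> t" "a \<noteq> s" "a \<noteq> t" by blast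
    have stv: "s \<in> verts F" "t \<in> verts F" using st ov by auto
    have "b \<noteq> nx F a b" using neqs[OF nx_face[OF ab(2)]] by auto
    from ex_bipolar[OF stv st(3-5) ab(2) nx_adj[OF ab(2)] this]
    obtain h where h: "bipolar F s t h" "h b < h a \<and> h a < h (nx F a b) \<or> h (nx F a b) < h a \<and> h a < h b" by blast
    have "\<forall>v\<in>verts F - {o1, o2, o3}. (\<Sum>b\<in>nb F v. mid F h v b) = 2"
      using mid_vertex[OF h(1) stv st(3)] st by blast
    thus ?thesis using h ab by (intro exI[of _ h]) (auto simp: bipolar_def mid_def)
  qed
  have "\<exists>H. \<forall>\<kappa>\<in>darts F. inj_on (H \<kappa>) (verts F) \<and>
      (\<forall>v\<in>verts F - {o1, o2, o3}. (\<Sum>b\<in>nb F v. mid F (H \<kappa>) v b) = 2) \<and> mid F (H \<kappa>) (fst \<kappa>) (snd \<kappa>) = 1"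
    by (intro bchoice ballI) (rule ex)
  then obtain H where H: "\<And>\<kappa>. \<kappa> \<in> darts F \<Longrightarrow> inj_on (H \<kappa>) (verts F)"
      "\<And>\<kappa> v. \<kappa> \<in> darts F \<Longrightarrow> v \<in> verts F - {o1, o2, o3} \<Longrightarrow> (\<Sum>b\<in>nb F v. mid F (H \<kappa>) v b) = 2"
      "\<And>a b. (a, b) \<in> darts F \<Longrightarrow> mid F (H (a, b)) a b = 1" by force
  have o12: "(o1, o2) \<in> darts F" using face_adj[OF out] by (simp add: darts_def)
  define h0 where "h0 = H (o1, o2)"
  define N where "N = real (card (darts F))"
  have N: "N > 0" using o12 finite_darts by (auto simp: N_def card_gt_0_iff)
  define \<beta> where "\<beta> a b = (\<Sum>\<kappa>\<in>darts F. mid F (H \<kappa>) a b)" for a b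
  \<comment> \<open>The averaged structure minus that of \<open>h0\<close>. Both have angle sum pi
    in every face and 2 pi at every vertex off the outer face, so the corresponding sums of
    \<open>bb\<close> vanish.\<close>
  define bb where "bb a b = pi / N * \<beta> a b - pi * mid F h0 a b" for a b
  have \<beta>_pos: "\<beta> a b > 0" if "(a, b) \<in> darts F" for a b
  proof -
    have "mid F (H (a, b)) a b \<le> \<beta> a b" unfolding \<beta>_def
      by (rule member_le_sum[OF that _ finite_darts]) (auto simp: mid_def)
    thus ?thesis using H(3)[OF that] by simp
  qed
  have bb_face: "bb a b + bb b c + bb c a = 0" if f: "(a, b, c) \<in> F" for a b c
  proof -
    have "\<beta> a b + \<beta> b c + \<beta> c a = (\<Sum>\<kappa>\<in>darts F. 1)"
      unfolding \<beta>_def sum.distrib[symmetric] using mid_face[OF H(1) f] by (intro sum.cong) auto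
    hence s: "\<beta> a b + \<beta> b c + \<beta> c a = N" by (simp add: N_def)
    have "bb a b + bb b c + bb c a = pi / N * (\<beta> a b + \<beta> b c + \<beta> c a) - pi * (mid F h0 a b + mid F h0 b c + mid F h0 c a)"
      by (simp add: bb_def algebra_simps)
    thus ?thesis using s N mid_face[OF H(1)[OF o12] f] by (simp add: h0_def)
  qed
  have bb_vertex: "(\<Sum>b\<in>nb F v. bb v b) = 0" if v: "v \<in> verts F - {o1, o2, o3}" for v
  proof -
    have "(\<Sum>b\<in>nb F v. \<beta> v b) = (\<Sum>\<kappa>\<in>darts F. \<Sum>b\<in>nb F v. mid F (H \<kappa>) v b)"
      unfolding \<beta>_def by (rule sum.swap)
    also have "\<dots> = 2 * N" using H(2)[OF _ v] by (simp add: N_def)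
    finally have "(\<Sum>b\<in>nb F v. \<beta> v b) = 2 * N" .
    moreover have "(\<Sum>b\<in>nb F v. bb v b) = pi / N * (\<Sum>b\<in>nb F v. \<beta> v b) - pi * (\<Sum>b\<in>nb F v. mid F h0 v b)"
      by (simp add: bb_def sum_subtractf sum_distrib_left)
    ultimately show ?thesis using N H(2)[OF o12 v] by (simp add: h0_def)
  qed
  have bb_total: "(\<Sum>(a, b)\<in>darts F. bb a b) = 0" using sum_face_const[of bb 0] bb_face by simp
  define J where "J = darts F - ?O"
  define M :: "'a \<times> 'a \<Rightarrow> 'a \<times> 'a \<Rightarrow> real" where
    "M i j = of_bool ({fst i, snd i} = {fst j, nx F (fst j) (snd j)}) - of_bool ({fst i, snd i} = {fst j, snd j})" for i j
  have "\<exists>x. \<forall>j\<in>J. bb (fst j) (snd j) = (\<Sum>i\<in>darts F. x i * M i j)"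
  proof (rule fredholm_alternative[OF finite_darts])
    show "finite J" using finite_darts by (simp add: J_def)
    fix l assume l: "\<And>i. i \<in> darts F \<Longrightarrow> (\<Sum>j\<in>J. M i j * l j) = 0"
    define l' where "l' a b = (if (a, b) \<in> ?O then 0 else l (a, b))" for a b
    have ext: "(\<Sum>j\<in>J. f j * l j) = (\<Sum>(a, b)\<in>darts F. f (a, b) * l' a b)" for f :: "'a \<times> 'a \<Rightarrow> real"
      unfolding J_def by (rule sum.mono_neutral_cong_left[OF finite_darts]) (auto simp: l'_def split: if_splits)
    have cyc: "l' x (nx F y x) + l' y (nx F x y) = l' x y + l' y x" if xy: "adj F x y" for x y
    proof -
      have "0 = (\<Sum>(a, b)\<in>darts F. M (x, y) (a, b) * l' a b)" using l[of "(x, y)"] xy unfolding ext by (simp add: darts_def)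
      thus ?thesis using medial_sum[OF xy, of l'] by (simp add: M_def)
    qed
    define d where "d x y = l' y (nx F x y) - l' x y" for x y
    have "\<exists>g. \<forall>a b c. (a, b, c) \<in> F \<longrightarrow> d a b = g b - g a"
    proof (rule exact)
      show "d a b = - d b a" if "(a, b, c) \<in> F" for a b c using cyc[of a b] face_adj[OF that] by (simp add: d_def)
      show "d a b + d b c + d c a = 0" if "(a, b, c) \<in> F" for a b c
        using nx_eq[OF that] nx_eq[OF rot[OF that]] nx_eq[OF rot2[OF that]] by (simp add: d_def)
    qed
    then obtain g where g: "\<And>a b c. (a, b, c) \<in> F \<Longrightarrow> l' b c - l' a b = g b - g a"
      using nx_eq unfolding d_def by metis
    \<comment> \<open>\<open>l'\<close> is split into \<open>k\<close>, constant on each face, and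
      the vertex function \<open>g\<close>. The first is killed by the face sums of
      \<open>bb\<close>, the second by its vertex sums: \<open>g\<close> is constant on the outer
      vertices, where alone these sums may be nonzero, and their total vanishes.\<close>
    define k where "k a b = l' a b - g a" for a b
    have kf: "k b c = k a b" if "(a, b, c) \<in> F" for a b c using g[OF that] by (simp add: k_def)
    have "bb a b * k a b + bb b c * k b c + bb c a * k c a = 0" if f: "(a, b, c) \<in> F" for a b c
    proof -
      have "bb a b * k a b + bb b c * k b c + bb c a * k c a = (bb a b + bb b c + bb c a) * k a b"
        using kf[OF f] kf[OF rot[OF f]] by (simp add: distrib_right)
      thus ?thesis using bb_face[OF f] by simp
    qed
    hence s1: "(\<Sum>(a, b)\<in>darts F. bb a b * k a b) = 0" using sum_face_const[of "\<lambda>a b. bb a b * k a b" 0] by simp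
    have "l' o1 o2 = 0" "l' o2 o3 = 0" "l' o3 o1 = 0" by (auto simp: l'_def)
    hence go: "g o2 = g o1" "g o3 = g o1" using g[OF out] g[OF rot[OF out]] by auto
    have "(\<Sum>(a, b)\<in>darts F. bb a b * g a) = (\<Sum>v\<in>verts F. (\<Sum>b\<in>nb F v. bb v b) * g v)"
      by (simp add: sum_verts sum_distrib_right)
    also have "\<dots> = (\<Sum>v\<in>verts F. (\<Sum>b\<in>nb F v. bb v b) * g o1)"
    proof (rule sum.cong[OF refl])
      fix v assume "v \<in> verts F"
      thus "(\<Sum>b\<in>nb F v. bb v b) * g v = (\<Sum>b\<in>nb F v. bb v b) * g o1"
        using bb_vertex[of v] go by (cases "v \<in> {o1, o2, o3}") auto
    qed
    also have "\<dots> = (\<Sum>(a, b)\<in>darts F. bb a b) * g o1" by (simp add: sum_verts sum_distrib_right)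
    finally have s2: "(\<Sum>(a, b)\<in>darts F. bb a b * g a) = 0" using bb_total by simp
    have "(\<Sum>j\<in>J. bb (fst j) (snd j) * l j) = (\<Sum>(a, b)\<in>darts F. bb a b * l' a b)" unfolding ext by simp
    also have "\<dots> = (\<Sum>(a, b)\<in>darts F. bb a b * k a b + bb a b * g a)"
      by (rule sum.cong) (auto simp: k_def right_diff_distrib)
    also have "\<dots> = 0" using s1 s2 by (simp add: sum.distrib case_prod_unfold)
    finally show "(\<Sum>j\<in>J. bb (fst j) (snd j) * l j) = 0" .
  qed
  then obtain x where x: "\<And>a b. (a, b) \<in> J \<Longrightarrow> bb a b = (\<Sum>i\<in>darts F. x i * M i (a, b))" by fastforce
  define \<tau> where "\<tau> a b = (\<Sum>i\<in>darts F. x i * of_bool ({fst i, snd i} = {a, b}))" for a b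
  have "\<tau> a b = \<tau> b a" for a b by (simp add: \<tau>_def insert_commute)
  moreover have "0 < \<tau> a c - \<tau> a b + pi * mid F h0 a b" if f: "(a, b, c) \<in> F" "(a, b) \<notin> ?O" for a b c
  proof -
    have ab: "(a, b) \<in> darts F" using f by (auto simp: darts_def adj_def)
    have "bb a b = (\<Sum>i\<in>darts F. x i * M i (a, b))" by (rule x) (use ab f in \<open>auto simp: J_def\<close>)
    also have "\<dots> = \<tau> a c - \<tau> a b"
      by (simp add: M_def \<tau>_def nx_eq[OF f(1)] sum_subtractf right_diff_distrib)
    finally have "pi / N * \<beta> a b = \<tau> a c - \<tau> a b + pi * mid F h0 a b" by (simp add: bb_def)
    moreover have "0 < pi / N * \<beta> a b" using \<beta>_pos[OF ab] N by simp
    ultimately show ?thesis by linarith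
  qed
  ultimately show ?thesis using H(1,2)[OF o12] unfolding h0_def by blast
qed

end

section \<open>Boundary curves parametrized by their normals\<close>

definition cross :: "complex \<Rightarrow> complex \<Rightarrow> real" where
  "cross u v = Im (cnj u * v)"

definition ip :: "complex \<Rightarrow> complex \<Rightarrow> real" where
  "ip u v = Re (cnj u * v)"

lemma cross_eq: "cross u v = Re u * Im v - Im u * Re v"
  by (simp add: cross_def)

lemma ip_eq: "ip u v = Re u * Re v + Im u * Im v"
  by (simp add: ip_def)

lemma cross_add: "cross (u + u') v = cross u v + cross u' v" "cross u (v + v') = cross u v + cross u v'"
  "cross (u - u') v = cross u v - cross u' v" "cross u (v - v') = cross u v - cross u v'"
  by (simp_all add: cross_eq algebra_simps)

lemma cross_scale: "cross (of_real r * u) v = r * cross u v" "cross u (of_real r * v) = r * cross u v"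
  by (simp_all add: cross_eq algebra_simps)

lemma ip_add: "ip (u + u') v = ip u v + ip u' v" "ip u (v + v') = ip u v + ip u v'"
  "ip (u - u') v = ip u v - ip u' v" "ip u (v - v') = ip u v - ip u v'" "ip (- u) v = - ip u v"
  by (simp_all add: ip_eq algebra_simps)

lemma ip_scale: "ip u (of_real r * v) = r * ip u v"
  by (simp add: ip_eq algebra_simps)

lemma ip_cis: "ip (cis s) (cis t) = cos (t - s)"
  by (simp add: ip_eq cos_diff algebra_simps)

lemma cross_cis: "cross (cis s) (cis t) = sin (t - s)"
  by (simp add: cross_eq sin_diff algebra_simps)

text \<open>\<open>q t\<close> is extreme on the curve in the direction \<open>cis t\<close>: a
  convex boundary parametrized by its outer normals. Addition of such curves is Minkowski addition,
  which \<open>round_chords\<close> exploits.\<close>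

definition support_curve :: "(real \<Rightarrow> complex) \<Rightarrow> bool" where
  "support_curve q \<longleftrightarrow> (\<forall>s t. ip (cis t) (q s - q t) \<le> 0)"

text \<open>The radii of curvature lie between \<open>e\<close> and \<open>C\<close>.\<close>

definition round_curve :: "real \<Rightarrow> real \<Rightarrow> (real \<Rightarrow> complex) \<Rightarrow> bool" where
  "round_curve e C p \<longleftrightarrow> 0 < e \<and> support_curve (\<lambda>t. p t - of_real e * cis t) \<and>
     support_curve (\<lambda>t. of_real C * cis t - p t) \<and> continuous_on UNIV p \<and> (\<forall>s t. cis s = cis t \<longrightarrow> p s = p t)"

lemma round_curveD:
  assumes "round_curve e C p"
  shows "0 < e" "support_curve (\<lambda>t. p t - of_real e * cis t)" "support_curve (\<lambda>t. of_real C * cis t - p t)"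
    "continuous_on UNIV p" "cis s = cis t \<Longrightarrow> p s = p t"
proof -
  note a = assms[unfolded round_curve_def]
  show "0 < e" by (rule conjunct1[OF a])
  show "support_curve (\<lambda>t. p t - of_real e * cis t)" by (rule conjunct1[OF conjunct2[OF a]])
  show "support_curve (\<lambda>t. of_real C * cis t - p t)" by (rule conjunct1[OF conjunct2[OF conjunct2[OF a]]])
  show "continuous_on UNIV p" by (rule conjunct1[OF conjunct2[OF conjunct2[OF conjunct2[OF a]]]])
  show "cis s = cis t \<Longrightarrow> p s = p t" using conjunct2[OF conjunct2[OF conjunct2[OF conjunct2[OF a]]]] by blast
qed

lemma support_curve_cis: "support_curve cis"
  by (auto simp: support_curve_def ip_add ip_cis)

lemma support_curve_add:
  assumes "support_curve p" "support_curve q" "0 \<le> e"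
  shows "support_curve (\<lambda>t. p t + of_real e * q t)"
  unfolding support_curve_def
proof (intro allI)
  fix s t
  have "ip (cis t) (p s + of_real e * q s - (p t + of_real e * q t)) = ip (cis t) (p s - p t) + e * ip (cis t) (q s - q t)"
    by (simp add: ip_add ip_scale algebra_simps)
  moreover have "ip (cis t) (p s - p t) \<le> 0" "ip (cis t) (q s - q t) \<le> 0" using assms by (auto simp: support_curve_def)
  ultimately show "ip (cis t) (p s + of_real e * q s - (p t + of_real e * q t)) \<le> 0"
    using assms(3) mult_nonneg_nonpos[of e "ip (cis t) (q s - q t)"] by linarith
qed

lemma cone_decomposition:
  "of_real (sin (t - s)) * u = of_real (ip (cis t) u) * (\<i> * cis s) + of_real (- ip (cis s) u) * (\<i> * cis t)"
  by (simp add: complex_eq_iff ip_eq sin_diff algebra_simps)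

text \<open>The chord of \<open>p\<close> lies in the cone of tangent directions between the normals
  \<open>s\<close> and \<open>s + b\<close>, the chord of \<open>q\<close> in that between
  \<open>s + pi - c\<close> and \<open>s + pi\<close>. So the angle from the first to the second is
  between \<open>a\<close> and pi.\<close>

lemma cross_chords_nonneg:
  assumes q: "support_curve p" "support_curve q"
    and ang: "0 < a" "0 < b" "0 < c" "a + b + c = pi"
  shows "cross (p (s + b) - p s) (q (s + pi) - q (s + pi - c)) \<ge> 0"
proof -
  define u where "u = p (s + b) - p s"
  define v where "v = q (s + pi) - q (s + pi - c)"
  have "ip (cis (s + b)) (p s - p (s + b)) \<le> 0" "ip (cis s) (p (s + b) - p s) \<le> 0"
    using q(1) unfolding support_curve_def by auto
  hence u: "ip (cis (s + b)) u \<ge> 0" "ip (cis s) u \<le> 0" by (auto simp: u_def ip_add)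
  have "ip (cis (s + pi)) (q (s + pi - c) - q (s + pi)) \<le> 0" "ip (cis (s + pi - c)) (q (s + pi) - q (s + pi - c)) \<le> 0"
    using q(2) unfolding support_curve_def by auto
  hence v: "ip (cis (s + pi)) v \<ge> 0" "ip (cis (s + pi - c)) v \<le> 0" by (auto simp: v_def ip_add)
  define u1 u2 v1 v2 where "u1 = ip (cis (s + b)) u" and "u2 = - ip (cis s) u"
    and "v1 = ip (cis (s + pi)) v" and "v2 = - ip (cis (s + pi - c)) v"
  have nn: "0 \<le> u1" "0 \<le> u2" "0 \<le> v1" "0 \<le> v2" using u v by (auto simp: u1_def u2_def v1_def v2_def)
  have du: "of_real (sin b) * u = of_real u1 * (\<i> * cis s) + of_real u2 * (\<i> * cis (s + b))"
    using cone_decomposition[of "s + b" s u] by (simp add: u1_def u2_def)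
  have dv: "of_real (sin c) * v = of_real v1 * (\<i> * cis (s + pi - c)) + of_real v2 * (\<i> * cis (s + pi))"
    using cone_decomposition[of "s + pi" "s + pi - c" v] by (simp add: v1_def v2_def)
  have cc: "cross (\<i> * cis x) (\<i> * cis y) = sin (y - x)" for x y
    by (simp add: cross_eq sin_diff algebra_simps)
  have "sin b * sin c * cross u v = cross (of_real (sin b) * u) (of_real (sin c) * v)" by (simp add: cross_scale)
  also have "\<dots> = u1 * v1 * sin (pi - c) + u1 * v2 * sin pi + u2 * v1 * sin (pi - c - b) + u2 * v2 * sin (pi - b)"
  proof -
    have e: "s + pi - c - s = pi - c" "s + pi - s = pi" "s + pi - c - (s + b) = pi - c - b" "s + pi - (s + b) = pi - b" by simp_all
    show ?thesis unfolding du dv cross_add cross_scale cc e by (simp add: distrib_left mult.assoc)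
  qed
  also have "\<dots> \<ge> 0"
  proof -
    have "0 \<le> sin (pi - c)" by (rule sin_ge_zero; use ang in linarith)
    moreover have "0 \<le> sin (pi - c - b)" by (rule sin_ge_zero; use ang in linarith)
    moreover have "0 \<le> sin (pi - b)" by (rule sin_ge_zero; use ang in linarith)
    ultimately show ?thesis using nn by simp
  qed
  finally have "0 \<le> sin b * sin c * cross u v" .
  moreover have "0 < sin b" by (rule sin_gt_zero; use ang in linarith)
  moreover have "0 < sin c" by (rule sin_gt_zero; use ang in linarith)
  ultimately have "0 \<le> cross u v" using mult_pos_neg[of "sin b * sin c" "cross u v"] by (meson mult_pos_pos not_le)
  thus ?thesis by (simp add: u_def v_def)
qed

text \<open>The cross product of these two chords for the unit circle, see
  \<open>cross_cis_chords\<close>.\<close>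

definition tri_factor :: "real \<Rightarrow> real \<Rightarrow> real \<Rightarrow> real" where
  "tri_factor a b c = 4 * sin (b / 2) * sin (c / 2) * cos (a / 2)"

lemma cross_cis_chords:
  assumes "a + b + c = pi"
  shows "cross (cis (s + b) - cis s) (cis (s + pi) - cis (s + pi - c)) = tri_factor a b c"
proof -
  have e: "s + pi - (s + b) = pi - b" "s + pi - c - (s + b) = pi - (b + c)" "s + pi - s = pi" "s + pi - c - s = pi - c"
    by simp_all
  have "cross (cis (s + b) - cis s) (cis (s + pi) - cis (s + pi - c)) = (sin (pi - b) - sin (pi - (b + c))) - (sin pi - sin (pi - c))"
    unfolding cross_add cross_cis e by simp
  also have "\<dots> = sin b + sin c - sin (b + c)" by simp
  also have "\<dots> = sin b * (1 - cos c) + sin c * (1 - cos b)" by (simp add: sin_add algebra_simps)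
  also have "\<dots> = 4 * sin (b / 2) * sin (c / 2) * sin (b / 2 + c / 2)"
  proof -
    have d: "sin x = 2 * sin (x / 2) * cos (x / 2)" "1 - cos x = 2 * sin (x / 2) * sin (x / 2)" for x :: real
      using sin_double[of "x / 2"] cos_double_sin[of "x / 2"] by (auto simp: power2_eq_square)
    show ?thesis unfolding d(1)[of b] d(1)[of c] d(2)[of b] d(2)[of c] sin_add by (simp add: algebra_simps)
  qed
  also have "sin (b / 2 + c / 2) = cos (a / 2)"
  proof -
    have "b / 2 + c / 2 = pi / 2 - a / 2" using assms by (simp add: field_simps)
    thus ?thesis by (simp add: cos_sin_eq)
  qed
  finally show ?thesis by (simp add: tri_factor_def)
qed

lemma tri_factor_pos:
  assumes "0 < a" "0 < b" "0 < c" "a + b + c = pi"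
  shows "tri_factor a b c > 0"
proof -
  have "0 < sin (b / 2)" by (rule sin_gt_zero; use assms in linarith)
  moreover have "0 < sin (c / 2)" by (rule sin_gt_zero; use assms in linarith)
  moreover have "0 < cos (a / 2)" by (rule cos_gt_zero_pi; use assms in linarith)
  ultimately show ?thesis by (simp add: tri_factor_def)
qed

text \<open>By bounded curvature each curve is the sum of a circle of radius \<open>e\<close> and a
  support curve, and a circle of radius \<open>C\<close> is the sum of the curve and another support
  curve. Expanding the cross product gives four nonnegative terms, one of which is the desired
  bound. Directions matter only modulo a full turn.\<close>

lemma round_chords:
  assumes p: "round_curve e C p" and q: "round_curve e C q"
    and ang: "0 < a" "0 < b" "0 < c" "a + b + c = pi"
    and st: "cis s' = cis (s + pi - c)" "cis t' = cis (s + pi)" "cis t = cis (s + b)"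
  shows "e\<^sup>2 * tri_factor a b c \<le> cross (p t - p s) (q t' - q s')"
    and "cross (p t - p s) (q t' - q s') \<le> C\<^sup>2 * tri_factor a b c"
proof -
  have per: "p t = p (s + b)" "q t' = q (s + pi)" "q s' = q (s + pi - c)"
    using round_curveD(5)[OF p st(3)] round_curveD(5)[OF q st(2)] round_curveD(5)[OF q st(1)] by auto
  note nn = cross_chords_nonneg[OF _ _ ang, of _ _ s]
  define u where "u x = x (s + b) - x s" for x :: "real \<Rightarrow> complex"
  define v where "v x = x (s + pi) - x (s + pi - c)" for x :: "real \<Rightarrow> complex"
  have nn: "0 \<le> cross (u x) (v y)" if "support_curve x" "support_curve y" for x y
    using nn[OF that] by (simp add: u_def v_def)
  have cc: "cross (u cis) (v cis) = tri_factor a b c" using cross_cis_chords[OF ang(4)] by (simp add: u_def v_def)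
  note e = round_curveD(1)[OF p]
  define p1 q1 where "p1 = (\<lambda>t. p t - of_real e * cis t)" and "q1 = (\<lambda>t. q t - of_real e * cis t)"
  define p2 q2 where "p2 = (\<lambda>t. of_real C * cis t - p t)" and "q2 = (\<lambda>t. of_real C * cis t - q t)"
  have s: "support_curve p1" "support_curve q1" "support_curve p2" "support_curve q2" "support_curve cis"
    unfolding p1_def q1_def p2_def q2_def
    using round_curveD(2)[OF p] round_curveD(2)[OF q] round_curveD(3)[OF p] round_curveD(3)[OF q] support_curve_cis by simp_all
  have s': "support_curve p" "support_curve q"
    using support_curve_add[OF s(1,5), of e] support_curve_add[OF s(2,5), of e] e by (auto simp: p1_def q1_def)
  have "cross (u p) (v q) = cross (u p1 + of_real e * u cis) (v q1 + of_real e * v cis)"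
    by (simp add: u_def v_def p1_def q1_def algebra_simps)
  also have "\<dots> = cross (u p1) (v q1) + e * cross (u p1) (v cis) + e * cross (u cis) (v q1) + e\<^sup>2 * cross (u cis) (v cis)"
    by (simp add: cross_add cross_scale power2_eq_square algebra_simps)
  finally show "e\<^sup>2 * tri_factor a b c \<le> cross (p t - p s) (q t' - q s')"
    using nn[OF s(1,2)] nn[OF s(1,5)] nn[OF s(5,2)] e cc unfolding per by (simp add: u_def v_def)
  have "C\<^sup>2 * cross (u cis) (v cis) = cross (of_real C * u cis) (of_real C * v cis)" by (simp add: cross_scale power2_eq_square)
  also have "\<dots> = cross (u p + u p2) (v q + v q2)"
    by (simp add: u_def v_def p2_def q2_def algebra_simps)
  also have "\<dots> = cross (u p) (v q) + cross (u p) (v q2) + cross (u p2) (v q) + cross (u p2) (v q2)"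
    by (simp add: cross_add)
  finally show "cross (p t - p s) (q t' - q s') \<le> C\<^sup>2 * tri_factor a b c"
    using nn[OF s'(1) s(4)] nn[OF s(3) s'(2)] nn[OF s(3,4)] cc unfolding per by (simp add: u_def v_def)
qed

definition ln_cot :: "real \<Rightarrow> real" where
  "ln_cot x = ln (cos (x / 2)) - ln (sin (x / 2))"

lemma half_angle_pos: "0 < x \<Longrightarrow> x < pi \<Longrightarrow> 0 < sin (x / 2) \<and> 0 < cos (x / 2)"
  by (auto intro!: sin_gt_zero cos_gt_zero_pi)

text \<open>The bracket is symmetric in the three angles and cancels when paired with angle changes
  that sum to zero over the face. What remains, the logarithm of the cotangent of
  \<open>a / 2\<close>, tends to infinity as \<open>a\<close> tends to 0.\<close>

lemma ln_tri_factor: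
  assumes "0 < a" "0 < b" "0 < c" "a + b + c = pi"
  shows "ln (tri_factor a b c) = ln_cot a + (ln 4 + ln (sin (a / 2)) + ln (sin (b / 2)) + ln (sin (c / 2)))"
  using half_angle_pos[of a] half_angle_pos[of b] half_angle_pos[of c] assms
  by (simp add: tri_factor_def ln_cot_def ln_mult)

lemma ln_cot_antimono:
  assumes "0 < x" "x \<le> y" "y < pi"
  shows "ln_cot y \<le> ln_cot x"
proof -
  have "cos (y / 2) \<le> cos (x / 2)" by (rule cos_monotone_0_pi_le) (use assms in auto)
  moreover have "sin (x / 2) \<le> sin (y / 2)" by (rule sin_monotone_2pi_le) (use assms in auto)
  ultimately show ?thesis using half_angle_pos[of x] half_angle_pos[of y] assms by (simp add: ln_cot_def diff_mono)
qed

text \<open>As \<open>ln_cot\<close> is decreasing, replacing its argument \<open>x\<close> by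
  \<open>y\<close> only lowers the product; the result has a bound independent of
  \<open>x\<close>.\<close>

lemma ln_cot_term:
  assumes "0 < x" "x < pi" "0 < y" "y < pi"
  shows "(y - x) * ln_cot x \<ge> - (pi * \<bar>ln_cot y\<bar>)"
proof -
  have "(y - x) * ln_cot x \<ge> (y - x) * ln_cot y"
  proof (cases "x \<le> y")
    case True
    thus ?thesis using ln_cot_antimono[of x y] assms by (intro mult_left_mono) auto
  next
    case False
    thus ?thesis using ln_cot_antimono[of y x] assms by (intro mult_left_mono_neg) auto
  qed
  moreover have "\<bar>(y - x) * ln_cot y\<bar> \<le> pi * \<bar>ln_cot y\<bar>"
    unfolding abs_mult using assms by (intro mult_right_mono) auto
  ultimately show ?thesis by linarith
qed

lemma ln_cot_large:
  fixes m K :: real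
  assumes "0 < m"
  shows "\<exists>e. 0 < e \<and> e < m \<and> e < pi \<and> K < ln_cot e"
proof -
  \<comment> \<open>\<open>e\<close> solves \<open>ln_cot e = L + 1\<close>; that \<open>L\<close>
    is at least \<open>2 / m\<close> makes it smaller than \<open>m\<close>.\<close>
  define L where "L = max K (2 / m)"
  define e where "e = 2 * arctan (exp (- (L + 1)))"
  have "0 < e" by (simp add: e_def)
  have "e < pi" using arctan_ubound[of "exp (- (L + 1))"] by (simp add: e_def)
  have "arctan (exp (- (L + 1))) \<le> exp (- (L + 1))" using arctan_le_self[of "exp (- (L + 1))"] by simp
  also have "exp (- (L + 1)) < m / 2"
  proof -
    have "2 / m < exp (L + 1)" using exp_ge_add_one_self[of "L + 1"] by (simp add: L_def)
    hence "2 < exp (L + 1) * m" using assms by (simp add: field_simps)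
    moreover define E where "E = exp (L + 1)"
    moreover have "0 < E" by (simp add: E_def)
    ultimately have "inverse E < m / 2" by (simp add: field_simps)
    thus ?thesis by (simp only: exp_minus E_def)
  qed
  finally have "e < m" by (simp add: e_def)
  have pos: "0 < sin (e / 2) \<and> 0 < cos (e / 2)" using half_angle_pos \<open>0 < e\<close> \<open>e < pi\<close> by blast
  have "tan (e / 2) = exp (- (L + 1))" by (simp add: e_def tan_arctan)
  hence "ln (sin (e / 2) / cos (e / 2)) = - (L + 1)" by (simp add: tan_def)
  hence "ln_cot e = L + 1" using pos by (simp add: ln_cot_def ln_div)
  hence "K < ln_cot e" by (simp add: L_def)
  thus ?thesis using \<open>0 < e\<close> \<open>e < pi\<close> \<open>e < m\<close> by blast
qed

lemma tendsto_Max: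
  fixes f :: "'k \<Rightarrow> nat \<Rightarrow> real"
  assumes "finite K" "K \<noteq> {}" "\<And>k. k \<in> K \<Longrightarrow> (f k \<longlonglongrightarrow> g k)"
  shows "(\<lambda>n. Max ((\<lambda>k. f k n) ` K)) \<longlonglongrightarrow> Max (g ` K)"
  using assms
proof (induction K rule: finite_ne_induct)
  case (singleton x)
  thus ?case by simp
next
  case (insert x K)
  have "(\<lambda>n. max (f x n) (Max ((\<lambda>k. f k n) ` K))) \<longlonglongrightarrow> max (g x) (Max (g ` K))"
    using insert by (intro tendsto_max) auto
  thus ?case using insert by simp
qed

section \<open>The variational problem for the contact directions\<close>

locale angled = triangulation F for F :: "'a faces" +
  fixes o1 o2 o3 :: 'a and h :: "'a \<Rightarrow> real" and \<tau>0 :: "'a \<Rightarrow> 'a \<Rightarrow> real"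
    and p :: "'a \<Rightarrow> real \<Rightarrow> complex" and \<epsilon> C :: real
  assumes out: "(o1, o2, o3) \<in> F" and inj_h: "inj_on h (verts F)"
    and \<tau>0_sym: "\<And>a b. \<tau>0 a b = \<tau>0 b a"
    and \<tau>0_pos: "\<And>a b c. (a, b, c) \<in> F \<Longrightarrow> (a, b) \<notin> {(o1, o2), (o2, o3), (o3, o1)} \<Longrightarrow>
       0 < \<tau>0 a c - \<tau>0 a b + pi * mid F h a b"
    and round: "\<And>v. v \<in> verts F \<Longrightarrow> round_curve \<epsilon> C (p v)"
begin

definition Out where "Out = {(o1, o2), (o2, o3), (o3, o1)}"

text \<open>The unknown is one number \<open>\<tau> a b\<close> per edge. The heights
  \<open>h\<close> fix the multiples of pi: in \<open>dir\<close> the two ends of an edge get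
  opposite normals, and the corner angles of a face sum to pi whatever \<open>\<tau>\<close>
  is.\<close>

definition ang :: "('a \<Rightarrow> 'a \<Rightarrow> real) \<Rightarrow> 'a \<Rightarrow> 'a \<Rightarrow> real" where
  "ang \<tau> a b = \<tau> a (nx F a b) - \<tau> a b + pi * mid F h a b"

definition dir :: "('a \<Rightarrow> 'a \<Rightarrow> real) \<Rightarrow> 'a \<Rightarrow> 'a \<Rightarrow> real" where
  "dir \<tau> a b = \<tau> a b + (if h a < h b then 0 else pi)"

text \<open>In the face \<open>(a, b, d)\<close> the chords of the three bodies between their
  contacts, scaled by the sizes, must close up. By the linear relation between three plane vectors
  the size of \<open>a\<close> is then proportional to the cross product of the other two chords,
  which is \<open>crs \<tau> a b\<close>.\<close>

definition crs :: "('a \<Rightarrow> 'a \<Rightarrow> real) \<Rightarrow> 'a \<Rightarrow> 'a \<Rightarrow> real" where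
  "crs \<tau> a b = cross (p b (dir \<tau> b a) - p b (dir \<tau> b (nx F a b)))
     (p (nx F a b) (dir \<tau> (nx F a b) b) - p (nx F a b) (dir \<tau> (nx F a b) a))"

lemma Out_rot:
  assumes "(a, b, c) \<in> F" "(a, b) \<notin> Out"
  shows "(b, c) \<notin> Out" "(c, a) \<notin> Out"
  using assms nx_eq[OF assms(1)] nx_eq[OF rot[OF assms(1)]] nx_eq[OF rot2[OF assms(1)]]
    nx_eq[OF out] nx_eq[OF rot[OF out]] nx_eq[OF rot2[OF out]] by (auto simp: Out_def)

lemma ang_face:
  assumes "\<And>a b. \<tau> a b = \<tau> b a" "(a, b, c) \<in> F"
  shows "ang \<tau> a b + ang \<tau> b c + ang \<tau> c a = pi"
proof -
  have "nx F a b = c" "nx F b c = a" "nx F c a = b"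
    using nx_eq[OF assms(2)] nx_eq[OF rot[OF assms(2)]] nx_eq[OF rot2[OF assms(2)]] by auto
  hence "ang \<tau> a b + ang \<tau> b c + ang \<tau> c a = pi * (mid F h a b + mid F h b c + mid F h c a)"
    using assms(1)[of a b] assms(1)[of b c] assms(1)[of a c] by (simp add: ang_def algebra_simps)
  thus ?thesis using mid_face[OF inj_h assms(2)] by simp
qed

text \<open>The multiples of pi match: \<open>mid\<close> is nonzero exactly when one of the two
  neighbours is lower and the other higher than \<open>a\<close>, that is, when the offsets in
  \<open>dir\<close> differ. Equality holds up to a full turn.\<close>

lemma cis_dir_next:
  assumes "(a, b, c) \<in> F"
  shows "cis (dir \<tau> a c) = cis (dir \<tau> a b + ang \<tau> a b)"
proof -
  have "h a \<noteq> h b" "h a \<noteq> h c"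
    using face_verts[OF assms] neqs[OF assms] inj_h by (auto dest: inj_onD)
  hence "dir \<tau> a b + ang \<tau> a b = dir \<tau> a c \<or> dir \<tau> a b + ang \<tau> a b = dir \<tau> a c + 2 * pi"
    unfolding dir_def ang_def mid_def nx_eq[OF assms] by (cases "h a < h b"; cases "h a < h c"; simp)
  thus ?thesis
  proof
    assume "dir \<tau> a b + ang \<tau> a b = dir \<tau> a c"
    thus ?thesis by simp
  next
    assume e: "dir \<tau> a b + ang \<tau> a b = dir \<tau> a c + 2 * pi"
    show ?thesis unfolding e by (simp add: cis_mult[symmetric])
  qed
qed

lemma cis_dir_opp:
  assumes "adj F a b" "\<And>a b. \<tau> a b = \<tau> b a"
  shows "cis (dir \<tau> b a) = cis (dir \<tau> a b + pi)"
proof -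
  have "h a \<noteq> h b" using adj_verts[OF assms(1)] inj_h by (auto dest: inj_onD)
  thus ?thesis using assms(2)[of a b] by (auto simp: dir_def cis_mult[symmetric] not_less)
qed

lemma crs_bounds:
  assumes sym: "\<And>a b. \<tau> a b = \<tau> b a" and f: "(a, b, c) \<in> F"
    and pos: "0 < ang \<tau> a b" "0 < ang \<tau> b c" "0 < ang \<tau> c a"
  shows "\<epsilon>\<^sup>2 * tri_factor (ang \<tau> a b) (ang \<tau> b c) (ang \<tau> c a) \<le> crs \<tau> a b"
    and "crs \<tau> a b \<le> C\<^sup>2 * tri_factor (ang \<tau> a b) (ang \<tau> b c) (ang \<tau> c a)"
    and "0 < crs \<tau> a b"
proof -
  note v = face_verts[OF f]
  have d1: "cis (dir \<tau> b a) = cis (dir \<tau> b c + ang \<tau> b c)" by (rule cis_dir_next[OF rot[OF f]])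
  have d2: "cis (dir \<tau> c b) = cis (dir \<tau> b c + pi)" using cis_dir_opp[of b c] face_adj[OF f] sym by blast
  have "cis (dir \<tau> c b) = cis (dir \<tau> c a) * cis (ang \<tau> c a)" using cis_dir_next[OF rot2[OF f], of \<tau>] by (simp add: cis_mult)
  hence "cis (dir \<tau> c a) = cis (dir \<tau> c b) * cis (- ang \<tau> c a)" by (simp add: cis_mult mult.assoc)
  hence d3: "cis (dir \<tau> c a) = cis (dir \<tau> b c + pi - ang \<tau> c a)" unfolding d2 by (simp add: cis_mult)
  note rc = round_chords[OF round round pos ang_face[of \<tau>, OF sym f] d3 d2 d1]
  show b1: "\<epsilon>\<^sup>2 * tri_factor (ang \<tau> a b) (ang \<tau> b c) (ang \<tau> c a) \<le> crs \<tau> a b"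
    using rc(1) v unfolding crs_def nx_eq[OF f] by blast
  show "crs \<tau> a b \<le> C\<^sup>2 * tri_factor (ang \<tau> a b) (ang \<tau> b c) (ang \<tau> c a)"
    using rc(2) v unfolding crs_def nx_eq[OF f] by blast
  have "0 < \<epsilon>\<^sup>2" using round_curveD(1)[OF round] v by auto
  thus "0 < crs \<tau> a b" using b1 tri_factor_pos[OF pos ang_face[of \<tau>, OF sym f]] by (meson less_le_trans mult_pos_pos)
qed

lemma ln_crs_bound:
  assumes sym: "\<And>a b. \<tau> a b = \<tau> b a" and f: "(a, b, c) \<in> F"
    and pos: "0 < ang \<tau> a b" "0 < ang \<tau> b c" "0 < ang \<tau> c a"
  shows "\<bar>ln (crs \<tau> a b) - ln (tri_factor (ang \<tau> a b) (ang \<tau> b c) (ang \<tau> c a))\<bar> \<le> \<bar>ln (\<epsilon>\<^sup>2)\<bar> + \<bar>ln (C\<^sup>2)\<bar>"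
proof -
  define X where "X = tri_factor (ang \<tau> a b) (ang \<tau> b c) (ang \<tau> c a)"
  have X: "0 < X" using tri_factor_pos[OF pos ang_face[of \<tau>, OF sym f]] by (simp add: X_def)
  note b = crs_bounds[of \<tau>, OF sym f pos, folded X_def]
  have e2: "0 < \<epsilon>\<^sup>2" using round_curveD(1)[OF round] face_verts[OF f] by auto
  have "0 < C\<^sup>2 * X" using b(2,3) by linarith
  hence C2: "0 < C\<^sup>2" using X by (simp add: zero_less_mult_iff)
  have "ln (\<epsilon>\<^sup>2 * X) \<le> ln (crs \<tau> a b)" using b e2 X by (subst ln_le_cancel_iff) auto
  hence 1: "ln (\<epsilon>\<^sup>2) + ln X \<le> ln (crs \<tau> a b)" using e2 X ln_mult_pos[of "\<epsilon>\<^sup>2" X] by simp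
  have "ln (crs \<tau> a b) \<le> ln (C\<^sup>2 * X)" using b(2,3) by (subst ln_le_cancel_iff) auto
  hence 2: "ln (crs \<tau> a b) \<le> ln (C\<^sup>2) + ln X" using C2 X ln_mult_pos[of "C\<^sup>2" X] by simp
  show ?thesis using 1 2 unfolding X_def by linarith
qed

text \<open>Corners are named by darts: \<open>(a, b)\<close> stands for the corner at
  \<open>a\<close> between \<open>b\<close> and \<open>nx F a b\<close>.\<close>

definition inner :: "('a \<times> 'a) set" where "inner = darts F - Out"

lemma finite_inner: "finite inner"
  using finite_darts by (simp add: inner_def)

lemma innerD: "(a, b) \<in> inner \<Longrightarrow> (a, b, nx F a b) \<in> F \<and> (a, b) \<notin> Out"
  using nx_face by (auto simp: inner_def darts_def)

lemma inner_rot: "(a, b) \<in> inner \<Longrightarrow> (b, nx F a b) \<in> inner \<and> (nx F a b, a) \<in> inner"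
proof -
  assume ab: "(a, b) \<in> inner"
  hence f: "(a, b, nx F a b) \<in> F" and o: "(a, b) \<notin> Out" using innerD[OF ab] by auto
  thus ?thesis using Out_rot[OF f o] face_adj[OF f] by (simp add: inner_def darts_def)
qed

lemma inner_ne: "inner \<noteq> {}"
proof -
  have "(o2, o1) \<in> inner" using neqs[OF out] face_adj[OF out] by (auto simp: inner_def Out_def darts_def)
  thus ?thesis by blast
qed

lemma ang_pos0: "(a, b) \<in> inner \<Longrightarrow> 0 < ang \<tau>0 a b"
  using \<tau>0_pos innerD[of a b] unfolding ang_def Out_def by blast

lemma ang_less_pi:
  assumes sym: "\<And>a b. \<tau> a b = \<tau> b a" and pos: "\<And>a b. (a, b) \<in> inner \<Longrightarrow> 0 < ang \<tau> a b" and ab: "(a, b) \<in> inner"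
  shows "ang \<tau> a b < pi"
proof -
  have "(a, b, nx F a b) \<in> F" using innerD[OF ab] by simp
  from ang_face[of \<tau>, OF sym this] pos[of b "nx F a b"] pos[of "nx F a b" a] inner_rot[OF ab] show ?thesis by auto
qed

lemma sum_inner_face:
  assumes "\<And>a b c. (a, b, c) \<in> F \<Longrightarrow> (a, b) \<in> inner \<Longrightarrow> f a b + f b c + f c a = (0 :: real)"
  shows "(\<Sum>(a, b)\<in>inner. f a b) = 0"
proof -
  have "(\<Sum>(a, b)\<in>inner. f a b) = (\<Sum>(a, b)\<in>darts F. if (a, b) \<in> Out then 0 else f a b)"
    unfolding inner_def by (rule sum.mono_neutral_cong_left[OF finite_darts]) auto
  moreover have "3 * (\<Sum>(a, b)\<in>darts F. if (a, b) \<in> Out then 0 else f a b) = (0 :: real) * real (card F)"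
  proof (rule sum_face_const)
    fix a b c assume f: "(a, b, c) \<in> F"
    show "(if (a, b) \<in> Out then 0 else f a b) + (if (b, c) \<in> Out then 0 else f b c) + (if (c, a) \<in> Out then 0 else f c a) = 0"
    proof (cases "(a, b) \<in> Out")
      case True
      hence "(b, c) \<in> Out" "(c, a) \<in> Out" using Out_rot[OF rot[OF f]] Out_rot[OF rot2[OF f]] by auto
      thus ?thesis using True by simp
    next
      case False
      moreover have "(a, b) \<in> inner" using False face_adj[OF f] by (simp add: inner_def darts_def)
      ultimately show ?thesis using Out_rot[OF f] assms[OF f] by simp
    qed
  qed
  ultimately show ?thesis by simp
qed

text \<open>Up to a bounded error, \<open>ln (crs \<tau> a b)\<close> is
  \<open>ln_cot (ang \<tau> a b)\<close> plus a term common to the three corners of the face, which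
  drops out because the angle changes sum to zero there. Every remaining term is bounded below, and
  the corner with angle \<open>e\<close> contributes at least \<open>m / 2\<close> times
  \<open>ln_cot e\<close>, which outweighs all the others by the choice of \<open>e\<close>.\<close>

lemma coercive:
  "\<exists>e>0. (\<forall>(a, b)\<in>inner. e < ang \<tau>0 a b) \<and>
    (\<forall>\<tau>. (\<forall>a b. \<tau> a b = \<tau> b a) \<longrightarrow> (\<forall>(a, b)\<in>inner. e \<le> ang \<tau> a b) \<longrightarrow> (\<exists>(a, b)\<in>inner. ang \<tau> a b = e) \<longrightarrow>
      0 < (\<Sum>(a, b)\<in>inner. (ang \<tau>0 a b - ang \<tau> a b) * ln (crs \<tau> a b)))"
proof -
  define m where "m = Min ((\<lambda>(a, b). ang \<tau>0 a b) ` inner)"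
  have m: "0 < m" "\<And>a b. (a, b) \<in> inner \<Longrightarrow> m \<le> ang \<tau>0 a b"
  proof -
    show "0 < m" unfolding m_def using finite_inner inner_ne ang_pos0 by (subst Min_gr_iff) auto
    show "m \<le> ang \<tau>0 a b" if "(a, b) \<in> inner" for a b
      unfolding m_def using finite_inner that
      by (intro Min_le finite_imageI image_eqI[of _ _ "(a, b)"]) auto
  qed
  define E where "E = \<bar>ln (\<epsilon>\<^sup>2)\<bar> + \<bar>ln (C\<^sup>2)\<bar>"
  define B where "B = (\<Sum>(a, b)\<in>inner. pi * \<bar>ln_cot (ang \<tau>0 a b)\<bar>)"
  define B' where "B' = real (card inner) * (pi * E)"
  obtain e where e: "0 < e" "e < m / 2" "e < pi" "(B + B') / (m / 2) < ln_cot e"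
    using ln_cot_large[of "m / 2" "(B + B') / (m / 2)"] m by auto
  have W: "0 < (\<Sum>(a, b)\<in>inner. (ang \<tau>0 a b - ang \<tau> a b) * ln (crs \<tau> a b))"
    if sym: "\<And>a b. \<tau> a b = \<tau> b a" and ge: "\<And>a b. (a, b) \<in> inner \<Longrightarrow> e \<le> ang \<tau> a b"
      and x: "(x, y) \<in> inner" "ang \<tau> x y = e" for \<tau> x y
  proof -
    have pos: "0 < ang \<tau> a b" if "(a, b) \<in> inner" for a b using ge[OF that] e(1) by linarith
    have lt: "ang \<tau> a b < pi" if "(a, b) \<in> inner" for a b by (rule ang_less_pi[of \<tau>, OF sym pos that])
    have lt0: "ang \<tau>0 a b < pi" if "(a, b) \<in> inner" for a b by (rule ang_less_pi[of \<tau>0, OF \<tau>0_sym ang_pos0 that])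
    define S where "S a b = ln 4 + ln (sin (ang \<tau> a b / 2)) + ln (sin (ang \<tau> b (nx F a b) / 2)) + ln (sin (ang \<tau> (nx F a b) a / 2))" for a b
    define k where "k a b = ang \<tau>0 a b - ang \<tau> a b" for a b
    define r where "r a b = ln (crs \<tau> a b) - ln_cot (ang \<tau> a b) - S a b" for a b
    have r: "\<bar>r a b\<bar> \<le> E" if ab: "(a, b) \<in> inner" for a b
    proof -
      have f: "(a, b, nx F a b) \<in> F" using innerD[OF ab] by simp
      note i = inner_rot[OF ab]
      have ps: "0 < ang \<tau> a b" "0 < ang \<tau> b (nx F a b)" "0 < ang \<tau> (nx F a b) a" using pos ab i by auto
      show ?thesis using ln_crs_bound[of \<tau>, OF sym f ps] ln_tri_factor[OF ps ang_face[of \<tau>, OF sym f]]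
        unfolding r_def S_def E_def by (simp add: algebra_simps)
    qed
    have S0: "(\<Sum>(a, b)\<in>inner. k a b * S a b) = 0"
    proof (rule sum_inner_face)
      fix a b c assume f: "(a, b, c) \<in> F"
      have n: "nx F a b = c" "nx F b c = a" "nx F c a = b" 
        using nx_eq[OF f] nx_eq[OF rot[OF f]] nx_eq[OF rot2[OF f]] by auto
      have "S b c = S a b" "S c a = S a b" unfolding S_def n by simp_all
      hence "k a b * S a b + k b c * S b c + k c a * S c a = (k a b + k b c + k c a) * S a b" by (simp add: distrib_right)
      also have "k a b + k b c + k c a = 0" using ang_face[of \<tau>, OF sym f] ang_face[of \<tau>0, OF \<tau>0_sym f] by (simp add: k_def)
      finally show "k a b * S a b + k b c * S b c + k c a * S c a = 0" by simp
    qed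
    have kpi: "\<bar>k a b\<bar> \<le> pi" if "(a, b) \<in> inner" for a b
      using pos[OF that] lt[OF that] ang_pos0[OF that] lt0[OF that] unfolding k_def by linarith
    have "(\<Sum>(a, b)\<in>inner. k a b * r a b) \<ge> (\<Sum>(a, b)\<in>inner. - (pi * E))"
    proof (rule sum_mono, clarify)
      fix a b assume ab: "(a, b) \<in> inner"
      have "\<bar>k a b * r a b\<bar> \<le> pi * E" unfolding abs_mult by (rule mult_mono[OF kpi[OF ab] r[OF ab]]) auto
      thus "- (pi * E) \<le> k a b * r a b" by linarith
    qed
    hence 1: "(\<Sum>(a, b)\<in>inner. k a b * r a b) \<ge> - B'" by (simp add: B'_def)
    have "(\<Sum>(a, b)\<in>inner. k a b * ln_cot (ang \<tau> a b) + pi * \<bar>ln_cot (ang \<tau>0 a b)\<bar>) \<ge>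
        (\<Sum>(a, b)\<in>{(x, y)}. k a b * ln_cot (ang \<tau> a b) + pi * \<bar>ln_cot (ang \<tau>0 a b)\<bar>)"
    proof (rule sum_mono2[OF finite_inner])
      fix i assume "i \<in> inner - {(x, y)}"
      then obtain a b where i: "i = (a, b)" "(a, b) \<in> inner" by (cases i) auto
      show "0 \<le> (case i of (a, b) \<Rightarrow> k a b * ln_cot (ang \<tau> a b) + pi * \<bar>ln_cot (ang \<tau>0 a b)\<bar>)"
        using ln_cot_term[OF pos[OF i(2)] lt[OF i(2)] ang_pos0[OF i(2)] lt0[OF i(2)]] by (simp add: i k_def)
    qed (use x in auto)
    note 2 = this
    have 2: "(\<Sum>(a, b)\<in>inner. k a b * ln_cot (ang \<tau> a b)) + B \<ge> k x y * ln_cot e"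
    proof -
      have nn: "0 \<le> pi * \<bar>ln_cot (ang \<tau>0 x y)\<bar>" by simp
      have "(\<Sum>(a, b)\<in>inner. k a b * ln_cot (ang \<tau> a b) + pi * \<bar>ln_cot (ang \<tau>0 a b)\<bar>)
        = (\<Sum>(a, b)\<in>inner. k a b * ln_cot (ang \<tau> a b)) + B" by (simp add: B_def sum.distrib case_prod_unfold)
      hence "k x y * ln_cot e + pi * \<bar>ln_cot (ang \<tau>0 x y)\<bar> \<le> (\<Sum>(a, b)\<in>inner. k a b * ln_cot (ang \<tau> a b)) + B"
        using 2 x by simp
      thus ?thesis using nn by linarith
    qed
    have "0 \<le> B" "0 \<le> B'" by (auto simp: B_def B'_def E_def intro!: sum_nonneg)
    hence lc: "0 < ln_cot e" using e(4) m(1) by (smt (verit) divide_nonneg_pos half_gt_zero)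
    have "m / 2 \<le> k x y" using m(2)[OF x(1)] e(2) x(2) by (simp add: k_def)
    hence "m / 2 * ln_cot e \<le> k x y * ln_cot e" using lc by (intro mult_right_mono) auto
    moreover have "B + B' < m / 2 * ln_cot e" using e(4) m(1) by (simp add: field_simps)
    ultimately have 3: "B + B' < k x y * ln_cot e" by linarith
    have "(\<Sum>(a, b)\<in>inner. k a b * ln (crs \<tau> a b)) = (\<Sum>(a, b)\<in>inner. k a b * ln_cot (ang \<tau> a b) + k a b * S a b + k a b * r a b)"
      by (rule sum.cong) (auto simp: r_def algebra_simps)
    also have "\<dots> = (\<Sum>(a, b)\<in>inner. k a b * ln_cot (ang \<tau> a b)) + (\<Sum>(a, b)\<in>inner. k a b * S a b) + (\<Sum>(a, b)\<in>inner. k a b * r a b)"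
      by (simp add: sum.distrib case_prod_unfold)
    finally show ?thesis using 1 2 3 S0 unfolding k_def by linarith
  qed
  show ?thesis
  proof (intro exI[of _ e] conjI allI impI)
    show "\<forall>(a, b)\<in>inner. e < ang \<tau>0 a b" using m e by fastforce
    fix \<tau> :: "'a \<Rightarrow> 'a \<Rightarrow> real"
    assume a: "\<forall>a b. \<tau> a b = \<tau> b a" "\<forall>(a, b)\<in>inner. e \<le> ang \<tau> a b" "\<exists>(a, b)\<in>inner. ang \<tau> a b = e"
    obtain x y where "(x, y) \<in> inner" "ang \<tau> x y = e" using a(3) by blast
    thus "0 < (\<Sum>(a, b)\<in>inner. (ang \<tau>0 a b - ang \<tau> a b) * ln (crs \<tau> a b))"
      using a(1,2) by (intro W[of \<tau> x y]) auto
  qed (rule e(1))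
qed

end

section \<open>Existence of a solution in the contact directions\<close>

context angled
begin

definition pot :: "('a \<times> 'a) set \<Rightarrow> ('a \<times> 'a \<Rightarrow> real) \<Rightarrow> 'a \<Rightarrow> 'a \<Rightarrow> real" where
  "pot I x a b = (\<Sum>i\<in>I. x i * of_bool ({fst i, snd i} = {a, b}))"

definition dif :: "('a \<times> 'a) set \<Rightarrow> ('a \<times> 'a \<Rightarrow> real) \<Rightarrow> 'a \<Rightarrow> 'a \<Rightarrow> real" where
  "dif I x a b = pot I x a (nx F a b) - pot I x a b"

definition shifted :: "('a \<times> 'a) set \<Rightarrow> real \<Rightarrow> ('a \<times> 'a \<Rightarrow> real) \<Rightarrow> 'a \<Rightarrow> 'a \<Rightarrow> real" where
  "shifted I s x a b = \<tau>0 a b + s * pot I x a b"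

text \<open>The transpose of \<open>dif\<close>, applied to \<open>ln (crs \<tau> a b)\<close>
  (\<open>dif_grad\<close>). By \<open>medial_sum\<close> its vanishing at an edge says that the two
  faces at this edge prescribe the same ratio of the sizes of its ends, the outer face prescribing
  ratio 1.\<close>

definition grad :: "('a \<Rightarrow> 'a \<Rightarrow> real) \<Rightarrow> 'a \<times> 'a \<Rightarrow> real" where
  "grad \<tau> i = (\<Sum>(a, b)\<in>inner. (of_bool ({fst i, snd i} = {a, nx F a b}) - of_bool ({fst i, snd i} = {a, b})) * ln (crs \<tau> a b))"

lemma pot_sym: "pot I x a b = pot I x b a"
  by (simp add: pot_def insert_commute)

lemma shifted_sym: "shifted I s x a b = shifted I s x b a"
  using pot_sym \<tau>0_sym by (simp add: shifted_def)

lemma ang_shifted: "ang (shifted I s x) a b = ang \<tau>0 a b + s * dif I x a b"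
  by (simp add: ang_def shifted_def dif_def algebra_simps)

lemma dif_grad: "finite I \<Longrightarrow> (\<Sum>(a, b)\<in>inner. dif I x a b * ln (crs \<tau> a b)) = (\<Sum>i\<in>I. x i * grad \<tau> i)"
proof -
  assume "finite I"
  have "dif I x a b * l = (\<Sum>i\<in>I. x i * ((of_bool ({fst i, snd i} = {a, nx F a b}) - of_bool ({fst i, snd i} = {a, b})) * l))" for a b l
    by (simp add: dif_def pot_def sum_subtractf[symmetric] sum_distrib_right right_diff_distrib left_diff_distrib mult.assoc)
  hence "(\<Sum>(a, b)\<in>inner. dif I x a b * ln (crs \<tau> a b)) =
    (\<Sum>j\<in>inner. \<Sum>i\<in>I. x i * (case j of (a, b) \<Rightarrow> (of_bool ({fst i, snd i} = {a, nx F a b}) - of_bool ({fst i, snd i} = {a, b})) * ln (crs \<tau> a b)))"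
    by (simp add: case_prod_unfold)
  also have "\<dots> = (\<Sum>i\<in>I. x i * grad \<tau> i)"
    unfolding grad_def sum_distrib_left by (rule sum.swap)
  finally show ?thesis .
qed

lemma dif_vertex: "(\<Sum>b\<in>nb F a. dif I x a b) = 0"
  using sum.reindex_bij_betw[OF nx_bij, of "pot I x a" a] by (simp add: dif_def sum_subtractf)

lemma dif_face:
  assumes "(a, b, c) \<in> F"
  shows "dif I x a b + dif I x b c + dif I x c a = 0"
  using nx_eq[OF assms] nx_eq[OF rot[OF assms]] nx_eq[OF rot2[OF assms]]
    pot_sym[of I x a b] pot_sym[of I x b c] pot_sym[of I x a c] by (simp add: dif_def)

text \<open>The sum of the angle changes at a vertex vanishes, so the outer corners are controlled
  by the inner ones.\<close>

lemma pot_bounded: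
  assumes uv: "adj F u v" and z: "\<And>x. pot I x u v = 0"
  shows "\<exists>M. \<forall>x. (\<forall>(a, b)\<in>inner. - 2 * pi \<le> dif I x a b) \<longrightarrow> (\<forall>(a, b)\<in>darts F. \<bar>pot I x a b\<bar> \<le> M)"
proof -
  define N where "N = real (card (darts F)) * (4 * pi)"
  define Q where "Q x \<longleftrightarrow> (\<forall>(a, b)\<in>inner. - 2 * pi \<le> dif I x a b)" for x
  have in4: "\<bar>dif I x a b\<bar> \<le> 4 * pi" if q: "Q x" and ab: "(a, b) \<in> inner" for x a b
  proof -
    have "- 2 * pi \<le> dif I x a b" "- 2 * pi \<le> dif I x b (nx F a b)" "- 2 * pi \<le> dif I x (nx F a b) a"
      using q ab inner_rot[OF ab] by (auto simp: Q_def)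
    thus ?thesis using dif_face[OF conjunct1[OF innerD[OF ab]], of I x] pi_gt_zero by linarith
  qed
  have bd: "\<bar>dif I x a b\<bar> \<le> N" if q: "Q x" and ab: "(a, b) \<in> darts F" for x a b
  proof (cases "(a, b) \<in> inner")
    case True
    have "1 \<le> real (card (darts F))" using ab finite_darts by (metis One_nat_def Suc_leI card_gt_0_iff empty_iff of_nat_1 of_nat_mono)
    hence "4 * pi \<le> N" unfolding N_def by simp
    thus ?thesis using in4[OF q True] by linarith
  next
    case False
    hence o: "(a, b) \<in> Out" using ab by (simp add: inner_def)
    have bn: "b \<in> nb F a" using ab by (simp add: darts_def nb_def)
    have i: "(a, b') \<in> inner" if "b' \<in> nb F a - {b}" for b'
      using that o neqs[OF out] by (auto simp: Out_def inner_def darts_def nb_def)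
    have "dif I x a b = - (\<Sum>b'\<in>nb F a - {b}. dif I x a b')"
      using dif_vertex[of I x a] sum.remove[OF finite_nb bn, of "dif I x a"] by linarith
    hence "\<bar>dif I x a b\<bar> \<le> (\<Sum>b'\<in>nb F a - {b}. \<bar>dif I x a b'\<bar>)" by simp
    also have "\<dots> \<le> (\<Sum>b'\<in>nb F a - {b}. 4 * pi)" by (intro sum_mono in4[OF q] i)
    also have "\<dots> \<le> N"
    proof -
      have "card (nb F a - {b}) \<le> card (nb F a)" by (intro card_mono finite_nb) auto
      also have "card (nb F a) = card (Pair a ` nb F a)" by (simp add: card_image inj_on_def)
      also have "\<dots> \<le> card (darts F)" by (intro card_mono finite_darts) (auto simp: darts_def nb_def)
      finally show ?thesis by (simp add: N_def)
    qed
    finally show ?thesis .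
  qed
  define G where "G a b \<longleftrightarrow> (\<exists>M. \<forall>x. Q x \<longrightarrow> \<bar>pot I x a b\<bar> \<le> M)" for a b
  have G_sym: "G a b \<longleftrightarrow> G b a" for a b using pot_sym[of I _ a b] by (simp add: G_def)
  have G_face: "G a c \<and> G b c" if f: "(a, b, c) \<in> F" and g: "G a b" for a b c
  proof -
    obtain M where M: "\<And>x. Q x \<Longrightarrow> \<bar>pot I x a b\<bar> \<le> M" using g by (auto simp: G_def)
    have d: "(a, b) \<in> darts F" "(b, c) \<in> darts F" using face_adj[OF f] by (auto simp: darts_def)
    have "\<bar>pot I x a c\<bar> \<le> M + N \<and> \<bar>pot I x b c\<bar> \<le> M + N" if q: "Q x" for x
      using M[OF q] bd[OF q d(1)] bd[OF q d(2)] pot_sym[of I x a b]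
      unfolding dif_def nx_eq[OF f] nx_eq[OF rot[OF f]] by linarith
    thus ?thesis unfolding G_def by blast
  qed
  \<comment> \<open>Bounds spread from the normalized edge to the other edges of a face, and from
    there across edges to all faces.\<close>
  define S where "S = {(a, b, c). (a, b, c) \<in> F \<and> G a b \<and> G b c \<and> G c a}"
  have Si: "(a, b, c) \<in> S" if "(a, b, c) \<in> F" "G a b" for a b c
    using that G_face[OF that] G_sym by (auto simp: S_def)
  have "S = F"
  proof (rule strongly_connected)
    have "G u v" using z by (auto simp: G_def)
    thus "S \<noteq> {}" using Si[OF nx_face[OF uv]] by blast
    show "(b, c, a) \<in> S" if "(a, b, c) \<in> S" for a b c using that rot[of a b c] by (auto simp: S_def)
    show "(b, a, d) \<in> S" if "(a, b, c) \<in> S" "(b, a, d) \<in> F" for a b c d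
      using that Si[of b a d] G_sym[of a b] by (auto simp: S_def)
  qed (auto simp: S_def)
  have "\<forall>i\<in>darts F. \<exists>M. \<forall>x. Q x \<longrightarrow> \<bar>pot I x (fst i) (snd i)\<bar> \<le> M"
  proof
    fix i assume i: "i \<in> darts F"
    obtain a b where ab: "i = (a, b)" by (cases i) auto
    hence "(a, b, nx F a b) \<in> S" using i nx_face \<open>S = F\<close> by (simp add: darts_def)
    thus "\<exists>M. \<forall>x. Q x \<longrightarrow> \<bar>pot I x (fst i) (snd i)\<bar> \<le> M" by (simp add: S_def G_def ab)
  qed
  then obtain M where M: "\<And>i x. i \<in> darts F \<Longrightarrow> Q x \<Longrightarrow> \<bar>pot I x (fst i) (snd i)\<bar> \<le> M i" by metis
  have "\<bar>pot I x a b\<bar> \<le> (\<Sum>i\<in>darts F. \<bar>M i\<bar>)" if q: "Q x" and ab: "(a, b) \<in> darts F" for x a b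
  proof -
    have "\<bar>M (a, b)\<bar> \<le> (\<Sum>i\<in>darts F. \<bar>M i\<bar>)" by (rule member_le_sum[OF ab _ finite_darts]) auto
    thus ?thesis using M[OF ab q] by simp
  qed
  thus ?thesis unfolding Q_def by (intro exI[of _ "\<Sum>i\<in>darts F. \<bar>M i\<bar>"]) auto
qed

text \<open>Each of the three variable factors of \<open>tri_factor\<close> lies between
  \<open>sin (e / 2)\<close> and 1; for the cosine this is because \<open>pi - x\<close> is at least
  \<open>e\<close>.\<close>

lemma ln_crs_le:
  assumes e: "0 < e" and sym: "\<And>a b. \<tau> a b = \<tau> b a" and ge: "\<And>a b. (a, b) \<in> inner \<Longrightarrow> e \<le> ang \<tau> a b"
    and ab: "(a, b) \<in> inner"
  shows "\<bar>ln (crs \<tau> a b)\<bar> \<le> \<bar>ln (\<epsilon>\<^sup>2)\<bar> + \<bar>ln (C\<^sup>2)\<bar> + ln 4 + 3 * \<bar>ln (sin (e / 2))\<bar>"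
proof -
  define c where "c = nx F a b"
  have f: "(a, b, c) \<in> F" using innerD[OF ab] by (simp add: c_def)
  have i: "(b, c) \<in> inner" "(c, a) \<in> inner" using inner_rot[OF ab] by (auto simp: c_def)
  define x y z where "x = ang \<tau> a b" and "y = ang \<tau> b c" and "z = ang \<tau> c a"
  have g: "e \<le> x" "e \<le> y" "e \<le> z" using ge ab i by (auto simp: x_def y_def z_def)
  have s: "x + y + z = pi" using ang_face[of \<tau>, OF sym f] by (simp add: x_def y_def z_def)
  have se: "0 < sin (e / 2)" by (rule sin_gt_zero; use e g s in linarith)
  have sy: "sin (e / 2) \<le> sin (y / 2)" and sz: "sin (e / 2) \<le> sin (z / 2)" and sx: "sin (e / 2) \<le> cos (x / 2)"
  proof -
    show "sin (e / 2) \<le> sin (y / 2)" by (rule sin_monotone_2pi_le; use e g s in linarith)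
    show "sin (e / 2) \<le> sin (z / 2)" by (rule sin_monotone_2pi_le; use e g s in linarith)
    have "sin (e / 2) \<le> sin (pi / 2 - x / 2)" by (rule sin_monotone_2pi_le; use e g s in linarith)
    thus "sin (e / 2) \<le> cos (x / 2)" by (simp add: cos_sin_eq)
  qed
  have l: "\<bar>ln w\<bar> \<le> \<bar>ln (sin (e / 2))\<bar>" if "sin (e / 2) \<le> w" "w \<le> 1" for w
    using that se ln_le_cancel_iff[of "sin (e / 2)" w] ln_le_zero_iff[of w] by linarith
  have "ln (tri_factor x y z) = ln 4 + ln (sin (y / 2)) + ln (sin (z / 2)) + ln (cos (x / 2))"
    using se sx sy sz by (simp add: tri_factor_def ln_mult)
  moreover have "0 \<le> ln (4 :: real)" by simp
  ultimately have "\<bar>ln (tri_factor x y z)\<bar> \<le> ln 4 + 3 * \<bar>ln (sin (e / 2))\<bar>"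
    using l[OF sy sin_le_one] l[OF sz sin_le_one] l[OF sx cos_le_one] by linarith
  moreover have "\<bar>ln (crs \<tau> a b) - ln (tri_factor x y z)\<bar> \<le> \<bar>ln (\<epsilon>\<^sup>2)\<bar> + \<bar>ln (C\<^sup>2)\<bar>"
    unfolding x_def y_def z_def by (rule ln_crs_bound[of \<tau>, OF sym f]) (use g e in \<open>auto simp: x_def y_def z_def\<close>)
  ultimately show ?thesis by linarith
qed

lemma tendsto_ln_crs:
  fixes T :: "nat \<Rightarrow> 'a \<Rightarrow> 'a \<Rightarrow> real"
  assumes lim: "\<And>a b. (\<lambda>k. T k a b) \<longlonglongrightarrow> \<tau> a b" and sym: "\<And>a b. \<tau> a b = \<tau> b a"
    and pos: "\<And>a b. (a, b) \<in> inner \<Longrightarrow> 0 < ang \<tau> a b" and ab: "(a, b) \<in> inner"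
  shows "(\<lambda>k. ln (crs (T k) a b)) \<longlonglongrightarrow> ln (crs \<tau> a b)"
proof -
  have f: "(a, b, nx F a b) \<in> F" using innerD[OF ab] by simp
  have pl: "(\<lambda>k. p v (dir (T k) s t)) \<longlonglongrightarrow> p v (dir \<tau> s t)" if "v \<in> verts F" for v s t
  proof -
    have "isCont (p v) (dir \<tau> s t)" using round_curveD(4)[OF round[OF that]] by (simp add: continuous_on_eq_continuous_at)
    moreover have "(\<lambda>k. dir (T k) s t) \<longlonglongrightarrow> dir \<tau> s t" unfolding dir_def by (intro tendsto_intros lim)
    ultimately show ?thesis by (rule isCont_tendsto_compose)
  qed
  have "(\<lambda>k. crs (T k) a b) \<longlonglongrightarrow> crs \<tau> a b"
    unfolding crs_def cross_def using face_verts[OF f] by (intro tendsto_intros pl) auto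
  moreover have "0 < crs \<tau> a b"
    by (rule crs_bounds(3)[of \<tau>, OF sym f]) (use pos ab inner_rot[OF ab] in auto)
  ultimately show ?thesis by (intro tendsto_ln) auto
qed


text \<open>A cube of parameters is mapped radially into the region around \<open>\<tau>0\<close>
  where the angles are at least \<open>e\<close>; for points outside, the field gets a restoring
  term, which makes it point inwards on the faces of the cube. At a zero outside the region
  \<open>grad\<close> would be a nonnegative multiple of the displacement, at an edge function with
  some angle equal to \<open>e\<close>; this contradicts \<open>coercive\<close>. At other zeros the
  restoring term is absent.\<close>

lemma ex_critical:
  "\<exists>\<tau>. (\<forall>a b. \<tau> a b = \<tau> b a) \<and> (\<forall>(a, b)\<in>inner. 0 < ang \<tau> a b) \<and> (\<forall>x y. adj F x y \<longrightarrow> grad \<tau> (x, y) = 0)"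
proof -
  obtain e where e0: "0 < e" and ee: "\<forall>(a, b)\<in>inner. e < ang \<tau>0 a b"
    and WW: "\<forall>\<tau>. (\<forall>a b. \<tau> a b = \<tau> b a) \<longrightarrow> (\<forall>(a, b)\<in>inner. e \<le> ang \<tau> a b) \<longrightarrow> (\<exists>(a, b)\<in>inner. ang \<tau> a b = e) \<longrightarrow>
      0 < (\<Sum>(a, b)\<in>inner. (ang \<tau>0 a b - ang \<tau> a b) * ln (crs \<tau> a b))"
    using coercive by blast
  have e: "0 < e" "\<And>a b. (a, b) \<in> inner \<Longrightarrow> e < ang \<tau>0 a b" using e0 ee by auto
  have W: "0 < (\<Sum>(a, b)\<in>inner. (ang \<tau>0 a b - ang \<tau> a b) * ln (crs \<tau> a b))"
    if "\<And>a b. \<tau> a b = \<tau> b a" "\<And>a b. (a, b) \<in> inner \<Longrightarrow> e \<le> ang \<tau> a b" "(x, y) \<in> inner" "ang \<tau> x y = e" for \<tau> x y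
  proof -
    have "\<forall>a b. \<tau> a b = \<tau> b a" using that(1) by blast
    moreover have "\<forall>(a, b)\<in>inner. e \<le> ang \<tau> a b" using that(2) by auto
    moreover have "\<exists>(a, b)\<in>inner. ang \<tau> a b = e" using that(3,4) by auto
    ultimately show ?thesis using WW by blast
  qed
  \<comment> \<open>One orientation of each edge. Adding a constant to \<open>\<tau>\<close> changes
    no angle, so one edge \<open>e0\<close> is frozen; its equation follows in the end, as all
    components of \<open>grad\<close> sum to zero.\<close>
  define I' where "I' = {(a, b). adj F a b \<and> h a < h b}"
  have tot: "h a < h b \<or> h b < h a" if "adj F a b" for a b
    using adj_verts[OF that] inj_h by (metis inj_onD linorder_neqE_linordered_idom)
  have o12: "adj F o1 o2" using face_adj[OF out] by simp
  define e0 where "e0 = (if h o1 < h o2 then (o1, o2) else (o2, o1))"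
  have e0: "e0 \<in> I'" using tot[OF o12] o12 adj_sym by (auto simp: I'_def e0_def)
  define I where "I = I' - {e0}"
  have finI': "finite I'" by (rule finite_subset[OF _ finite_darts]) (auto simp: I'_def darts_def)
  hence finI: "finite I" by (simp add: I_def)
  have same: "i = j" if "i \<in> I'" "j \<in> I'" "{fst i, snd i} = {fst j, snd j}" for i j
    using that by (auto simp: I'_def doubleton_eq_iff)
  have pot_i: "pot I x (fst i) (snd i) = (if i \<in> I then x i else 0)" if "i \<in> I'" for x i
  proof -
    have "pot I x (fst i) (snd i) = (\<Sum>j\<in>I. if j = i then x j else 0)"
      unfolding pot_def by (rule sum.cong) (use same[OF _ that] in \<open>auto simp: I_def\<close>)
    thus ?thesis using finI by simp
  qed
  have "adj F (fst e0) (snd e0)" "pot I x (fst e0) (snd e0) = 0" for x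
    using e0 pot_i[OF e0] by (auto simp: I'_def I_def)
  from pot_bounded[OF this] obtain M where
    M: "\<And>x a b. (\<And>a b. (a, b) \<in> inner \<Longrightarrow> - 2 * pi \<le> dif I x a b) \<Longrightarrow> (a, b) \<in> darts F \<Longrightarrow> \<bar>pot I x a b\<bar> \<le> M" by fast
  define R where "R = \<bar>M\<bar> + 1"
  define B where "B = real (card inner) * (\<bar>ln (\<epsilon>\<^sup>2)\<bar> + \<bar>ln (C\<^sup>2)\<bar> + ln 4 + 3 * \<bar>ln (sin (e / 2))\<bar>)"
  have B: "0 \<le> B" by (simp add: B_def)
  \<comment> \<open>The Minkowski functional of the region of angles at least \<open>e\<close>,
    centred at \<open>\<tau>0\<close>. Dividing by it where it exceeds 1 is the radial
    retraction.\<close>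
  define gauge where "gauge x = Max ((\<lambda>j. - dif I x (fst j) (snd j) / (ang \<tau>0 (fst j) (snd j) - e)) ` inner)" for x
  define lam where "lam x = 1 / max 1 (gauge x)" for x
  define T where "T x = shifted I (lam x) x" for x
  \<comment> \<open>\<open>B\<close> bounds \<open>grad\<close>. On a face of the cube
    \<open>lam x\<close> is at most 1/2 and \<open>R\<close> is at least 1, so the restoring term
    has absolute value at least \<open>B\<close> and decides the sign.\<close>
  define f where "f x i = grad (T x) i - 2 * B * (1 - lam x) * x i" for x i
  have T_sym: "T x a b = T x b a" for x a b unfolding T_def by (rule shifted_sym)
  have lam: "0 < lam x" "lam x \<le> 1" for x by (auto simp: lam_def)
  have ang_T: "ang (T x) a b = ang \<tau>0 a b + lam x * dif I x a b" for x a b by (simp add: T_def ang_shifted)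
  have gauge_ge: "- dif I x a b \<le> gauge x * (ang \<tau>0 a b - e)" if ab: "(a, b) \<in> inner" for x a b
  proof -
    have "- dif I x a b / (ang \<tau>0 a b - e) \<le> gauge x"
      unfolding gauge_def using finite_inner ab by (intro Max_ge finite_imageI image_eqI[of _ _ "(a, b)"]) auto
    moreover have "0 < ang \<tau>0 a b - e" using e(2)[OF ab] by simp
    ultimately show ?thesis using pos_divide_le_eq[of "ang \<tau>0 a b - e" "- dif I x a b" "gauge x"] by blast
  qed
  have ge_e: "e \<le> ang (T x) a b" if ab: "(a, b) \<in> inner" for x a b
  proof -
    have "gauge x * (ang \<tau>0 a b - e) \<le> max 1 (gauge x) * (ang \<tau>0 a b - e)"
      using e(2)[OF ab] by (intro mult_right_mono) auto
    hence "- dif I x a b \<le> max 1 (gauge x) * (ang \<tau>0 a b - e)" using gauge_ge[OF ab, of x] by linarith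
    hence "lam x * - dif I x a b \<le> lam x * (max 1 (gauge x) * (ang \<tau>0 a b - e))"
      using lam(1)[of x] by (intro mult_left_mono) auto
    thus ?thesis by (simp add: ang_T lam_def)
  qed
  have attained: "\<exists>a b. (a, b) \<in> inner \<and> ang (T x) a b = e" if g: "1 < gauge x" for x
  proof -
    have "gauge x \<in> (\<lambda>j. - dif I x (fst j) (snd j) / (ang \<tau>0 (fst j) (snd j) - e)) ` inner"
      unfolding gauge_def using finite_inner inner_ne by (intro Max_in) auto
    then obtain a b where ab: "(a, b) \<in> inner" "gauge x = - dif I x a b / (ang \<tau>0 a b - e)" by force
    hence "- dif I x a b = gauge x * (ang \<tau>0 a b - e)" using e(2)[OF ab(1)] by simp
    hence "lam x * dif I x a b = - (ang \<tau>0 a b - e)" using g by (simp add: lam_def field_simps)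
    thus ?thesis using ab(1) by (intro exI[of _ a] exI[of _ b]) (simp add: ang_T)
  qed
  \<comment> \<open>If \<open>gauge x\<close> is less than 2, every inner entry of
    \<open>dif\<close> is at least -2 pi, and \<open>pot_bounded\<close> keeps all coordinates below
    \<open>R\<close>.\<close>
  have half: "lam x \<le> 1 / 2" if i: "i \<in> I" "\<bar>x i\<bar> = R" for x i
  proof (rule ccontr)
    assume "\<not> lam x \<le> 1 / 2"
    hence g: "gauge x < 2" by (auto simp: lam_def field_simps max_def split: if_splits)
    have "- 2 * pi \<le> dif I x a b" if ab: "(a, b) \<in> inner" for a b
    proof -
      have "gauge x * (ang \<tau>0 a b - e) \<le> 2 * (ang \<tau>0 a b - e)" using g e(2)[OF ab] by (intro mult_right_mono) auto
      thus ?thesis using gauge_ge[OF ab, of x] ang_less_pi[of \<tau>0, OF \<tau>0_sym ang_pos0 ab] e(1) by auto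
    qed
    moreover have "i \<in> I'" "(fst i, snd i) \<in> darts F" using i(1) by (auto simp: I_def I'_def darts_def)
    ultimately have "\<bar>x i\<bar> \<le> M" using M[of x "fst i" "snd i"] pot_i[of i x] i(1) by simp
    thus False using i(2) by (simp add: R_def)
  qed
  have grad_bound: "\<bar>grad (T x) i\<bar> \<le> B" for x i
  proof -
    have "\<bar>grad (T x) i\<bar> \<le> (\<Sum>(a, b)\<in>inner. \<bar>ln (\<epsilon>\<^sup>2)\<bar> + \<bar>ln (C\<^sup>2)\<bar> + ln 4 + 3 * \<bar>ln (sin (e / 2))\<bar>)"
      unfolding grad_def
    proof (rule order_trans[OF sum_abs sum_mono], clarify)
      fix a b assume ab: "(a, b) \<in> inner"
      let ?o = "of_bool ({fst i, snd i} = {a, nx F a b}) - of_bool ({fst i, snd i} = {a, b}) :: real"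
      have "\<bar>?o * ln (crs (T x) a b)\<bar> \<le> 1 * \<bar>ln (crs (T x) a b)\<bar>"
        unfolding abs_mult by (intro mult_right_mono) (auto simp: of_bool_def)
      thus "\<bar>?o * ln (crs (T x) a b)\<bar> \<le> \<bar>ln (\<epsilon>\<^sup>2)\<bar> + \<bar>ln (C\<^sup>2)\<bar> + ln 4 + 3 * \<bar>ln (sin (e / 2))\<bar>"
        using ln_crs_le[of e "T x", OF e(1) T_sym ge_e ab] by linarith
    qed
    thus ?thesis by (simp add: B_def)
  qed
  have big: "B \<le> 2 * B * (1 - lam x) * R" if "lam x \<le> 1 / 2" for x
  proof -
    have "1 * 1 \<le> (2 * (1 - lam x)) * R" using that by (intro mult_mono) (auto simp: R_def)
    from mult_left_mono[OF this B] show ?thesis by (simp add: mult.assoc mult.left_commute)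
  qed
  have "\<exists>x. (\<forall>i\<in>I. \<bar>x i\<bar> \<le> R) \<and> (\<forall>i\<in>I. f x i = 0)"
  proof (rule poincare_miranda[OF finI])
    show "0 < R" by (simp add: R_def)
    fix X :: "nat \<Rightarrow> 'a \<times> 'a \<Rightarrow> real" and x i assume i: "i \<in> I" and X: "\<And>j. j \<in> I \<Longrightarrow> (\<lambda>k. X k j) \<longlonglongrightarrow> x j"
    have pl: "(\<lambda>k. pot I (X k) a b) \<longlonglongrightarrow> pot I x a b" for a b unfolding pot_def by (intro tendsto_intros X)
    have dl: "(\<lambda>k. dif I (X k) a b) \<longlonglongrightarrow> dif I x a b" for a b unfolding dif_def by (intro tendsto_intros pl)
    have gl: "(\<lambda>k. gauge (X k)) \<longlonglongrightarrow> gauge x"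
      unfolding gauge_def using finite_inner inner_ne
    proof (rule tendsto_Max)
      fix j assume "j \<in> inner"
      hence "ang \<tau>0 (fst j) (snd j) - e \<noteq> 0" using e(2)[of "fst j" "snd j"] by simp
      thus "(\<lambda>k. - dif I (X k) (fst j) (snd j) / (ang \<tau>0 (fst j) (snd j) - e)) \<longlonglongrightarrow> - dif I x (fst j) (snd j) / (ang \<tau>0 (fst j) (snd j) - e)"
        by (intro tendsto_intros dl)
    qed
    have ll: "(\<lambda>k. lam (X k)) \<longlonglongrightarrow> lam x" unfolding lam_def by (intro tendsto_intros tendsto_max gl) auto
    have Tl: "(\<lambda>k. T (X k) a b) \<longlonglongrightarrow> T x a b" for a b unfolding T_def shifted_def by (intro tendsto_intros ll pl)
    have pos: "0 < ang (T x) a b" if "(a, b) \<in> inner" for a b using ge_e[OF that, of x] e(1) by linarith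
    have cl: "(\<lambda>k. ln (crs (T (X k)) a b)) \<longlonglongrightarrow> ln (crs (T x) a b)" if "(a, b) \<in> inner" for a b
      by (rule tendsto_ln_crs[OF Tl T_sym pos that])
    have "(\<lambda>k. grad (T (X k)) i) \<longlonglongrightarrow> grad (T x) i" unfolding grad_def
    proof (rule tendsto_sum)
      fix j assume "j \<in> inner"
      then obtain a b where j: "j = (a, b)" "(a, b) \<in> inner" by (cases j) auto
      show "(\<lambda>k. case j of (a, b) \<Rightarrow> (of_bool ({fst i, snd i} = {a, nx F a b}) - of_bool ({fst i, snd i} = {a, b})) * ln (crs (T (X k)) a b))
        \<longlonglongrightarrow> (case j of (a, b) \<Rightarrow> (of_bool ({fst i, snd i} = {a, nx F a b}) - of_bool ({fst i, snd i} = {a, b})) * ln (crs (T x) a b))"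
        unfolding j(1) prod.case by (intro tendsto_intros cl j(2))
    qed
    thus "(\<lambda>k. f (X k) i) \<longlonglongrightarrow> f x i" unfolding f_def by (intro tendsto_intros ll X i)
  next
    fix x i assume i: "i \<in> I" "x i = - R"
    hence "lam x \<le> 1 / 2" by (intro half[OF i(1)]) (simp add: R_def)
    thus "0 \<le> f x i" using big[of x] grad_bound[of x i] i(2) by (simp add: f_def)
  next
    fix x i assume i: "i \<in> I" "x i = R"
    hence "lam x \<le> 1 / 2" by (intro half[OF i(1)]) (simp add: R_def)
    thus "f x i \<le> 0" using big[of x] grad_bound[of x i] i(2) by (simp add: f_def)
  qed
  then obtain x where x: "\<And>i. i \<in> I \<Longrightarrow> grad (T x) i = 2 * B * (1 - lam x) * x i" by (auto simp: f_def)
  have "gauge x \<le> 1"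
  proof (rule ccontr)
    assume "\<not> gauge x \<le> 1"
    then obtain a b where "(a, b) \<in> inner" "ang (T x) a b = e" using attained[of x] by auto
    hence "0 < (\<Sum>(a, b)\<in>inner. (ang \<tau>0 a b - ang (T x) a b) * ln (crs (T x) a b))"
      by (intro W[OF T_sym ge_e])
    also have "\<dots> = - lam x * (\<Sum>(a, b)\<in>inner. dif I x a b * ln (crs (T x) a b))"
      unfolding sum_distrib_left by (rule sum.cong) (auto simp: ang_T)
    also have "\<dots> = - lam x * (\<Sum>i\<in>I. x i * grad (T x) i)" by (simp add: dif_grad[OF finI])
    also have "(\<Sum>i\<in>I. x i * grad (T x) i) = 2 * B * (1 - lam x) * (\<Sum>i\<in>I. x i * x i)"
      unfolding sum_distrib_left by (rule sum.cong) (auto simp: x)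
    finally have "0 < - lam x * (2 * B * (1 - lam x) * (\<Sum>i\<in>I. x i * x i))" .
    moreover have "0 \<le> lam x * (2 * B * (1 - lam x) * (\<Sum>i\<in>I. x i * x i))"
    proof -
      have "0 \<le> (\<Sum>i\<in>I. x i * x i)" by (rule sum_nonneg) simp
      thus ?thesis using lam[of x] B by simp
    qed
    ultimately show False by simp
  qed
  hence "lam x = 1" by (simp add: lam_def)
  hence zI: "grad (T x) i = 0" if "i \<in> I" for i using x[OF that] by simp
  have one: "(\<Sum>i\<in>I'. of_bool ({fst i, snd i} = {a, b})) = (1 :: real)" if ab: "adj F a b" for a b
  proof -
    obtain i where i: "i \<in> I'" "{fst i, snd i} = {a, b}"
    proof (cases "h a < h b")
      case True
      thus ?thesis using that[of "(a, b)"] ab by (simp add: I'_def)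
    next
      case False
      thus ?thesis using that[of "(b, a)"] tot[OF ab] adj_sym[OF ab] by (auto simp: I'_def)
    qed
    have "(\<Sum>i\<in>I'. of_bool ({fst i, snd i} = {a, b})) = (\<Sum>j\<in>I'. if j = i then 1 else 0 :: real)"
    proof (rule sum.cong[OF refl])
      fix j assume "j \<in> I'"
      hence "{fst j, snd j} = {a, b} \<longleftrightarrow> j = i" using same[OF _ i(1), of j] i(2) by auto
      thus "of_bool ({fst j, snd j} = {a, b}) = (if j = i then 1 else 0 :: real)" by simp
    qed
    thus ?thesis using i(1) finI' by simp
  qed
  have "(\<Sum>i\<in>I'. grad (T x) i) = (\<Sum>j\<in>inner. \<Sum>i\<in>I'. (case j of (a, b) \<Rightarrow> (of_bool ({fst i, snd i} = {a, nx F a b}) - of_bool ({fst i, snd i} = {a, b})) * ln (crs (T x) a b)))"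
    unfolding grad_def by (rule sum.swap)
  also have "\<dots> = 0"
  proof (rule sum.neutral, clarify)
    fix a b assume ab: "(a, b) \<in> inner"
    have "adj F a b" "adj F a (nx F a b)" using face_adj[OF conjunct1[OF innerD[OF ab]]] by auto
    thus "(\<Sum>i\<in>I'. (of_bool ({fst i, snd i} = {a, nx F a b}) - of_bool ({fst i, snd i} = {a, b})) * ln (crs (T x) a b)) = 0"
      using one by (simp add: sum_distrib_right[symmetric] sum_subtractf)
  qed
  also have "(\<Sum>i\<in>I'. grad (T x) i) = grad (T x) e0 + (\<Sum>i\<in>I. grad (T x) i)"
    unfolding I_def by (rule sum.remove[OF finI' e0])
  finally have z0: "grad (T x) e0 = 0" using zI by simp
  have "grad (T x) (a, b) = 0" if ab: "adj F a b" for a b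
  proof -
    have "grad (T x) (a, b) = grad (T x) (b, a)" by (simp add: grad_def insert_commute)
    moreover have "(a, b) \<in> I' \<or> (b, a) \<in> I'" using tot[OF ab] ab adj_sym[OF ab] by (auto simp: I'_def)
    moreover have "grad (T x) i = 0" if "i \<in> I'" for i using zI[of i] z0 that by (cases "i = e0") (auto simp: I_def)
    ultimately show ?thesis by auto
  qed
  moreover have "0 < ang (T x) a b" if "(a, b) \<in> inner" for a b using ge_e[OF that, of x] e(1) by linarith
  ultimately show ?thesis using T_sym by (intro exI[of _ "T x"]) auto
qed

end

text \<open>\<open>c a b\<close> is the contact point, \<open>\<theta> a b\<close> the normal of
  body \<open>a\<close> there, and \<open>\<gamma> a b\<close> the angle from it to the next normal
  around \<open>a\<close>. The outer face is seen from the unbounded side: its gaps exceed pi and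
  its contact triangle is clockwise.\<close>

definition contact_system :: "'a faces \<Rightarrow> 'a \<Rightarrow> 'a \<Rightarrow> 'a \<Rightarrow> ('a \<Rightarrow> 'a \<Rightarrow> complex) \<Rightarrow>
    ('a \<Rightarrow> 'a \<Rightarrow> real) \<Rightarrow> ('a \<Rightarrow> 'a \<Rightarrow> real) \<Rightarrow> bool" where
  "contact_system F o1 o2 o3 c \<theta> \<gamma> \<longleftrightarrow>
    (\<forall>a b. adj F a b \<longrightarrow> c a b = c b a \<and> cis (\<theta> b a) = - cis (\<theta> a b) \<and> 0 < \<gamma> a b \<and> \<gamma> a b < 2 * pi \<and>
       cis (\<theta> a (nx F a b)) = cis (\<theta> a b + \<gamma> a b)) \<and>
    (\<forall>a\<in>verts F. (\<Sum>b\<in>nb F a. \<gamma> a b) = 2 * pi) \<and>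
    (\<forall>a b d. (a, b, d) \<in> F \<longrightarrow> (if (a, b) \<in> {(o1, o2), (o2, o3), (o3, o1)}
       then pi < \<gamma> a b \<and> cross (c a b - c d a) (c b d - c d a) < 0
       else \<gamma> a b < pi \<and> 0 < cross (c a b - c d a) (c b d - c d a)))"

section \<open>Sizes and positions of the bodies\<close>

context angled
begin

text \<open>The critical equations make the logarithmic ratios of sizes antisymmetric, and around a
  face these telescope; so they are exact. Putting 0 for the logarithms at the outer corners gives
  the three outer bodies the same size.\<close>

lemma ex_radii:
  assumes sym: "\<And>a b. \<tau> a b = \<tau> b a" and pos: "\<And>a b. (a, b) \<in> inner \<Longrightarrow> 0 < ang \<tau> a b"
    and crit: "\<And>x y. adj F x y \<Longrightarrow> grad \<tau> (x, y) = 0"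
  shows "\<exists>r. (\<forall>v. 0 < r v) \<and> r o1 = 1 \<and> r o2 = 1 \<and> r o3 = (1 :: real) \<and>
    (\<forall>a b c. (a, b, c) \<in> F \<longrightarrow> (a, b) \<notin> Out \<longrightarrow> crs \<tau> a b * r b = crs \<tau> b c * r a)"
proof -
  define l where "l a b = (if (a, b) \<in> Out then 0 else ln (crs \<tau> a b))" for a b
  have cyc: "l x (nx F y x) + l y (nx F x y) = l x y + l y x" if xy: "adj F x y" for x y
  proof -
    have "(\<Sum>(a, b)\<in>darts F. (of_bool ({x, y} = {a, nx F a b}) - of_bool ({x, y} = {a, b})) * l a b) = grad \<tau> (x, y)"
      unfolding grad_def inner_def by (rule sum.mono_neutral_cong_right[OF finite_darts]) (auto simp: l_def)
    thus ?thesis using medial_sum[OF xy, of l] crit[OF xy] by simp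
  qed
  define d where "d x y = l y (nx F x y) - l x y" for x y
  have "\<exists>g. \<forall>a b c. (a, b, c) \<in> F \<longrightarrow> d a b = g b - g a"
  proof (rule exact)
    show "d a b = - d b a" if "(a, b, c) \<in> F" for a b c using cyc[of a b] face_adj[OF that] by (simp add: d_def)
    show "d a b + d b c + d c a = 0" if "(a, b, c) \<in> F" for a b c
      using nx_eq[OF that] nx_eq[OF rot[OF that]] nx_eq[OF rot2[OF that]] by (simp add: d_def)
  qed
  then obtain g where g: "\<And>a b c. (a, b, c) \<in> F \<Longrightarrow> l b c - l a b = g b - g a"
    using nx_eq unfolding d_def by metis
  have "l o1 o2 = 0" "l o2 o3 = 0" "l o3 o1 = 0" by (auto simp: l_def Out_def)
  hence go: "g o2 = g o1" "g o3 = g o1" using g[OF out] g[OF rot[OF out]] by auto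
  define r where "r v = exp (g v - g o1)" for v
  have "crs \<tau> a b * r b = crs \<tau> b c * r a" if f: "(a, b, c) \<in> F" "(a, b) \<notin> Out" for a b c
  proof -
    have ab: "(a, b) \<in> inner" using f face_adj[OF f(1)] by (simp add: inner_def darts_def)
    have i: "(b, c) \<in> inner" "(c, a) \<in> inner" using inner_rot[OF ab] nx_eq[OF f(1)] by auto
    note p = pos[OF ab] pos[OF i(1)] pos[OF i(2)]
    have c1: "0 < crs \<tau> a b" by (rule crs_bounds(3)[of \<tau>, OF sym f(1) p])
    have c2: "0 < crs \<tau> b c" by (rule crs_bounds(3)[of \<tau>, OF sym rot[OF f(1)] p(2,3,1)])
    have "ln (crs \<tau> b c) - ln (crs \<tau> a b) = g b - g a" using g[OF f(1)] f(2) i by (simp add: l_def inner_def)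
    hence "ln (crs \<tau> a b) + (g b - g o1) = ln (crs \<tau> b c) + (g a - g o1)" by simp
    hence "exp (ln (crs \<tau> a b)) * r b = exp (ln (crs \<tau> b c)) * r a" unfolding r_def exp_add[symmetric] by simp
    thus ?thesis using c1 c2 by simp
  qed
  moreover have "r o1 = 1" "r o2 = 1" "r o3 = 1" "\<And>v. 0 < r v" using go by (auto simp: r_def)
  ultimately show ?thesis by (intro exI[of _ r]) blast
qed

text \<open>In an inner face the scaled chords close up by the linear relation between three plane
  vectors, whose coefficients are their cross products. The outer face is left to
  \<open>exact_except_one_face\<close>, applied to real and imaginary parts.\<close>

lemma ex_positions:
  assumes r: "\<And>v. 0 < r v" and crs: "\<And>a b c. (a, b, c) \<in> F \<Longrightarrow> (a, b) \<notin> Out \<Longrightarrow> crs \<tau> a b * r b = crs \<tau> b c * r a"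
    and sym: "\<And>a b. \<tau> a b = \<tau> b a" and pos: "\<And>a b. (a, b) \<in> inner \<Longrightarrow> 0 < ang \<tau> a b"
  shows "\<exists>y. y o1 = 0 \<and> (\<forall>a b. adj F a b \<longrightarrow>
    y a + of_real (r a) * p a (dir \<tau> a b) = y b + of_real (r b) * p b (dir \<tau> b a))"
proof -
  define d where "d a b = of_real (r a) * p a (dir \<tau> a b) - of_real (r b) * p b (dir \<tau> b a)" for a b
  have cl: "d a b + d b c + d c a = 0" if f: "(a, b, c) \<in> F" "(a, b) \<notin> Out" for a b c
  proof -
    define u v w where "u = p a (dir \<tau> a c) - p a (dir \<tau> a b)" and "v = p b (dir \<tau> b a) - p b (dir \<tau> b c)"
      and "w = p c (dir \<tau> c b) - p c (dir \<tau> c a)"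
    have o: "(b, c) \<notin> Out" "(c, a) \<notin> Out" using Out_rot[OF f] by auto
    have n: "nx F a b = c" "nx F b c = a" "nx F c a = b" using nx_eq[OF f(1)] nx_eq[OF rot[OF f(1)]] nx_eq[OF rot2[OF f(1)]] by auto
    have k: "crs \<tau> a b = cross v w" "crs \<tau> b c = cross w u" "crs \<tau> c a = cross u v"
      unfolding crs_def n u_def v_def w_def by auto
    have "crs \<tau> a b * r b = crs \<tau> b c * r a" "crs \<tau> b c * r c = crs \<tau> c a * r b" "crs \<tau> c a * r a = crs \<tau> a b * r c"
      using crs[OF f] crs[OF rot[OF f(1)] o(1)] crs[OF rot2[OF f(1)] o(2)] by auto
    define m where "m = cross v w / r a"
    have m: "cross v w = m * r a" "cross w u = m * r b" "cross u v = m * r c"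
      using r[of a] crs[OF f] crs[OF rot2[OF f(1)] o(2)] unfolding k m_def by (auto simp: field_simps)
    have ab: "(a, b) \<in> inner" using f face_adj[OF f(1)] by (simp add: inner_def darts_def)
    have "0 < crs \<tau> a b"
      by (rule crs_bounds(3)[of \<tau>, OF sym f(1)]) (use pos ab inner_rot[OF ab] n in auto)
    hence "m \<noteq> 0" using k m by auto
    have "of_real (cross v w) * u + of_real (cross w u) * v + of_real (cross u v) * w = 0"
      by (simp add: complex_eq_iff cross_eq algebra_simps)
    hence "of_real m * (of_real (r a) * u + of_real (r b) * v + of_real (r c) * w) = 0"
      unfolding m by (simp add: algebra_simps)
    hence "of_real (r a) * u + of_real (r b) * v + of_real (r c) * w = 0" using \<open>m \<noteq> 0\<close> by simp
    moreover have "d a b + d b c + d c a = - (of_real (r a) * u + of_real (r b) * v + of_real (r c) * w)"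
      by (simp add: d_def u_def v_def w_def algebra_simps)
    ultimately show ?thesis by simp
  qed
  have "\<exists>g. \<forall>a b. adj F a b \<longrightarrow> Re (d a b) = g b - g a"
  proof (rule exact_except_one_face[OF out])
    show "Re (d a b) = - Re (d b a)" for a b by (simp add: d_def)
    show "Re (d a b) + Re (d b c) + Re (d c a) = 0" if "(a, b, c) \<in> F" "(a, b) \<notin> {(o1, o2), (o2, o3), (o3, o1)}" for a b c
      using arg_cong[OF cl[OF that[folded Out_def]], of Re] by simp
  qed
  then obtain g where g: "\<And>a b. adj F a b \<Longrightarrow> Re (d a b) = g b - g a" by blast
  have "\<exists>g. \<forall>a b. adj F a b \<longrightarrow> Im (d a b) = g b - g a"
  proof (rule exact_except_one_face[OF out])
    show "Im (d a b) = - Im (d b a)" for a b by (simp add: d_def)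
    show "Im (d a b) + Im (d b c) + Im (d c a) = 0" if "(a, b, c) \<in> F" "(a, b) \<notin> {(o1, o2), (o2, o3), (o3, o1)}" for a b c
      using arg_cong[OF cl[OF that[folded Out_def]], of Im] by simp
  qed
  then obtain g' where g': "\<And>a b. adj F a b \<Longrightarrow> Im (d a b) = g' b - g' a" by blast
  define y where "y v = Complex (g v - g o1) (g' v - g' o1)" for v
  have "y a + of_real (r a) * p a (dir \<tau> a b) = y b + of_real (r b) * p b (dir \<tau> b a)" if "adj F a b" for a b
  proof -
    have "d a b = y b - y a" using g[OF that] g'[OF that] by (simp add: y_def complex_eq_iff)
    thus ?thesis by (simp add: d_def algebra_simps)
  qed
  moreover have "y o1 = 0" by (simp add: y_def complex_eq_iff)
  ultimately show ?thesis by blast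
qed

text \<open>The unit vectors in the contact directions telescope around \<open>a\<close>.\<close>

lemma cis_sum_ang:
  assumes "a \<in> verts F"
  shows "cis (\<Sum>b\<in>nb F a. ang \<tau> a b) = 1"
proof -
  have e: "cis (\<Sum>b\<in>S. f b) = (\<Prod>b\<in>S. cis (f b))" if "finite S" for S and f :: "'a \<Rightarrow> real"
    using that by (induction S rule: finite_induct) (auto simp: cis_mult[symmetric])
  have "(\<Prod>b\<in>nb F a. cis (dir \<tau> a (nx F a b))) = (\<Prod>b\<in>nb F a. cis (dir \<tau> a b))"
    by (rule prod.reindex_bij_betw[OF nx_bij])
  moreover have "(\<Prod>b\<in>nb F a. cis (dir \<tau> a (nx F a b))) = (\<Prod>b\<in>nb F a. cis (dir \<tau> a b) * cis (ang \<tau> a b))"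
    by (rule prod.cong[OF refl]) (use cis_dir_next nx_face in \<open>auto simp: nb_def cis_mult\<close>)
  ultimately have "(\<Prod>b\<in>nb F a. cis (dir \<tau> a b)) * (\<Prod>b\<in>nb F a. cis (ang \<tau> a b)) = (\<Prod>b\<in>nb F a. cis (dir \<tau> a b))"
    by (simp add: prod.distrib)
  moreover have "(\<Prod>b\<in>nb F a. cis (dir \<tau> a b)) \<noteq> 0" using finite_nb by simp
  ultimately show ?thesis by (simp add: e[OF finite_nb])
qed

text \<open>The total angle at an outer vertex, on the side of the inner faces.\<close>

definition rest :: "('a \<Rightarrow> 'a \<Rightarrow> real) \<Rightarrow> 'a \<Rightarrow> 'a \<Rightarrow> real" where
  "rest \<tau> a b = (\<Sum>b'\<in>nb F a - {b}. ang \<tau> a b')"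

text \<open>At vertices off the outer face the terms with \<open>\<tau>\<close> cancel and the
  middle corners give 2 pi. The three outer totals add up to an odd multiple of pi, as following the
  normals around the outer face shows; it is positive, and at most pi by counting all angles with
  \<open>card_faces\<close>.\<close>

lemma rest_props:
  assumes sym: "\<And>a b. \<tau> a b = \<tau> b a" and pos: "\<And>a b. (a, b) \<in> inner \<Longrightarrow> 0 < ang \<tau> a b"
    and mid2: "\<And>v. v \<in> verts F - {o1, o2, o3} \<Longrightarrow> (\<Sum>b\<in>nb F v. mid F h v b) = 2"
  shows "\<And>a b. (a, b) \<in> Out \<Longrightarrow> 0 < rest \<tau> a b" and "rest \<tau> o1 o2 + rest \<tau> o2 o3 + rest \<tau> o3 o1 = pi"
    and "\<And>v. v \<in> verts F - {o1, o2, o3} \<Longrightarrow> (\<Sum>b\<in>nb F v. ang \<tau> v b) = 2 * pi"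
    and "\<And>a b. (a, b) \<in> Out \<Longrightarrow> cis (dir \<tau> a (nx F a b)) = cis (dir \<tau> a b + (2 * pi - rest \<tau> a b))"
proof -
  note od = neqs[OF out] and ov = face_verts[OF out]
  have o_adj: "adj F a b" if "(a, b) \<in> Out" for a b using that face_adj[OF out] by (auto simp: Out_def)
  have sum_rest: "(\<Sum>b'\<in>nb F a. ang \<tau> a b') = ang \<tau> a b + rest \<tau> a b" if "(a, b) \<in> Out" for a b
    unfolding rest_def using o_adj[OF that] by (intro sum.remove finite_nb) (simp add: nb_def)
  show rp: "0 < rest \<tau> a b" if o: "(a, b) \<in> Out" for a b
    unfolding rest_def
  proof (rule sum_pos)
    have "nx F a b \<in> nb F a - {b}" using nx_adj[OF o_adj[OF o]] neqs[OF nx_face[OF o_adj[OF o]]] by (auto simp: nb_def)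
    thus "nb F a - {b} \<noteq> {}" by blast
    show "0 < ang \<tau> a b'" if "b' \<in> nb F a - {b}" for b'
      by (rule pos) (use that o od in \<open>auto simp: Out_def inner_def darts_def nb_def\<close>)
  qed (simp add: finite_nb)
  show inner2: "(\<Sum>b\<in>nb F v. ang \<tau> v b) = 2 * pi" if v: "v \<in> verts F - {o1, o2, o3}" for v
  proof -
    have "(\<Sum>b\<in>nb F v. \<tau> v (nx F v b)) = (\<Sum>b\<in>nb F v. \<tau> v b)" by (rule sum.reindex_bij_betw[OF nx_bij])
    thus ?thesis using mid2[OF v] by (simp add: ang_def sum.distrib sum_subtractf sum_distrib_left[symmetric])
  qed
  show next_out: "cis (dir \<tau> a (nx F a b)) = cis (dir \<tau> a b + (2 * pi - rest \<tau> a b))" if o: "(a, b) \<in> Out" for a b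
  proof -
    have "a \<in> verts F" using o ov by (auto simp: Out_def)
    hence "cis (ang \<tau> a b) * cis (rest \<tau> a b) = 1" using cis_sum_ang[of a \<tau>] sum_rest[OF o] by (simp add: cis_mult)
    hence "cis (ang \<tau> a b) = cis (- rest \<tau> a b)"
      by (metis cis_inverse inverse_unique mult.commute)
    also have "\<dots> = cis (2 * pi - rest \<tau> a b)" by (simp add: cis_divide[symmetric] cis_2pi flip: cis_inverse add: divide_inverse)
    finally have "cis (ang \<tau> a b) = cis (2 * pi - rest \<tau> a b)" .
    hence "cis (dir \<tau> a b) * cis (ang \<tau> a b) = cis (dir \<tau> a b) * cis (2 * pi - rest \<tau> a b)" by simp
    thus ?thesis using cis_dir_next[OF nx_face[OF o_adj[OF o]], of \<tau>] by (simp only: cis_mult)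
  qed
  define s where "s = rest \<tau> o1 o2 + rest \<tau> o2 o3 + rest \<tau> o3 o1"
  have oo: "(o1, o2) \<in> Out" "(o2, o3) \<in> Out" "(o3, o1) \<in> Out" by (auto simp: Out_def)
  have s0: "0 < s" unfolding s_def using rp[OF oo(1)] rp[OF oo(2)] rp[OF oo(3)] by linarith
  have "s \<le> pi"
  proof -
    have "3 * (\<Sum>(a, b)\<in>darts F. ang \<tau> a b) = pi * card F"
      by (rule sum_face_const) (rule ang_face[of \<tau>, OF sym])
    moreover have "(\<Sum>(a, b)\<in>darts F. ang \<tau> a b) = (\<Sum>v\<in>verts F - {o1, o2, o3}. \<Sum>b\<in>nb F v. ang \<tau> v b) + (\<Sum>v\<in>{o1, o2, o3}. \<Sum>b\<in>nb F v. ang \<tau> v b)"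
      unfolding sum_verts by (rule sum.subset_diff) (use ov finite_verts in auto)
    moreover have "(\<Sum>v\<in>verts F - {o1, o2, o3}. \<Sum>b\<in>nb F v. ang \<tau> v b) = real (card (verts F - {o1, o2, o3})) * (2 * pi)"
      using inner2 by simp
    moreover have "real (card (verts F - {o1, o2, o3})) = real (card (verts F)) - 3"
      using ov od card_Diff_subset[of "{o1, o2, o3}" "verts F"] card_mono[OF finite_verts, of "{o1, o2, o3}"] by (auto simp: of_nat_diff)
    moreover have "(\<Sum>v\<in>{o1, o2, o3}. \<Sum>b\<in>nb F v. ang \<tau> v b) = pi + s"
      using od ang_face[of \<tau>, OF sym out] sum_rest[OF oo(1)] sum_rest[OF oo(2)] sum_rest[OF oo(3)] by (simp add: s_def)
    ultimately have "pi * card F = 3 * ((real (card (verts F)) - 3) * (2 * pi)) + 3 * pi + 3 * s" by simp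
    moreover have "pi * real (card F) \<le> pi * (6 * real (card (verts F)) - 12)"
      using card_faces by (intro mult_left_mono) auto
    ultimately show ?thesis by (simp add: algebra_simps)
  qed
  have "cis s = - 1"
  proof -
    have n: "nx F o1 o2 = o3" "nx F o2 o3 = o1" "nx F o3 o1 = o2" using nx_eq[OF out] nx_eq[OF rot[OF out]] nx_eq[OF rot2[OF out]] by auto
    have k: "cis (dir \<tau> a b) = cis (dir \<tau> a (nx F a b)) * cis (rest \<tau> a b)" if "(a, b) \<in> Out" for a b
    proof -
      have "cis (dir \<tau> a b + (2 * pi - rest \<tau> a b)) * cis (rest \<tau> a b) = cis (dir \<tau> a b + 2 * pi)" by (simp add: cis_mult)
      also have "\<dots> = cis (dir \<tau> a b)" by (simp flip: cis_mult)
      finally show ?thesis using next_out[OF that] by simp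
    qed
    have opp: "cis (dir \<tau> b a) = - cis (dir \<tau> a b)" if "adj F a b" for a b
      using cis_dir_opp[OF that, of \<tau>] sym by (simp flip: cis_mult)
    have a: "adj F o1 o2" "adj F o2 o3" "adj F o3 o1" using face_adj[OF out] by auto
    define x y z where "x = cis (dir \<tau> o1 o2)" and "y = cis (dir \<tau> o2 o3)" and "z = cis (dir \<tau> o3 o1)"
    have e: "x = - z * cis (rest \<tau> o1 o2)" "y = - x * cis (rest \<tau> o2 o3)" "z = - y * cis (rest \<tau> o3 o1)"
      using k[OF oo(1)] k[OF oo(2)] k[OF oo(3)] opp[OF a(1)] opp[OF a(2)] opp[OF a(3)] unfolding n x_def y_def z_def by auto
    have "cis s = cis (rest \<tau> o1 o2) * cis (rest \<tau> o2 o3) * cis (rest \<tau> o3 o1)" by (simp add: s_def cis_mult)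
    moreover have "x * y * z = - (x * y * z) * (cis (rest \<tau> o1 o2) * cis (rest \<tau> o2 o3) * cis (rest \<tau> o3 o1))"
      by (subst e(1), subst e(2), subst e(3)) (simp add: algebra_simps)
    moreover have "x * y * z \<noteq> 0" by (simp add: x_def y_def z_def)
    moreover have "k = - 1" if "w = - w * k" "w \<noteq> 0" for w k :: complex
    proof -
      have "w + w * k = 0" using that(1) by (simp add: eq_neg_iff_add_eq_0)
      hence "w * (1 + k) = 0" by (simp add: distrib_left)
      hence "k + 1 = 0" using that(2) by (simp add: add.commute)
      thus ?thesis by (simp add: eq_neg_iff_add_eq_0)
    qed
    ultimately show ?thesis by metis
  qed
  from arg_cong[OF this, of Re] have "cos s = cos pi" by simp
  thus "rest \<tau> o1 o2 + rest \<tau> o2 o3 + rest \<tau> o3 o1 = pi"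
    using s0 \<open>s \<le> pi\<close> cos_inj_pi[of s pi] by (simp add: s_def)
qed

end

context triangulation
begin

lemma ex_contact_system:
  assumes out: "(o1, o2, o3) \<in> F" and round: "\<And>v. v \<in> verts F \<Longrightarrow> round_curve \<epsilon> C (p v)"
  shows "\<exists>\<theta> \<gamma> r y. (\<forall>v. 0 < r v) \<and> r o1 = 1 \<and> r o2 = 1 \<and> r o3 = 1 \<and> y o1 = 0 \<and>
    contact_system F o1 o2 o3 (\<lambda>a b. y a + of_real (r a) * p a (\<theta> a b)) \<theta> \<gamma>"
proof -
  obtain h \<tau>0 where h: "inj_on h (verts F)" "\<forall>a b. \<tau>0 a b = (\<tau>0 b a :: real)"
    "\<forall>a b c. (a, b, c) \<in> F \<longrightarrow> (a, b) \<notin> {(o1, o2), (o2, o3), (o3, o1)} \<longrightarrow> 0 < \<tau>0 a c - \<tau>0 a b + pi * mid F h a b"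
    "\<forall>v\<in>verts F - {o1, o2, o3}. (\<Sum>b\<in>nb F v. mid F h v b) = 2"
    using ex_angle_structure[OF out] by blast
  interpret angled F o1 o2 o3 h \<tau>0 p \<epsilon> C
  proof unfold_locales
    show "\<tau>0 a b = \<tau>0 b a" for a b using h(2) by blast
    show "0 < \<tau>0 a c - \<tau>0 a b + pi * mid F h a b" if "(a, b, c) \<in> F" "(a, b) \<notin> {(o1, o2), (o2, o3), (o3, o1)}" for a b c
      using h(3) that by blast
  qed (use out h(1) round in auto)
  obtain \<tau> where \<tau>: "\<forall>a b. \<tau> a b = \<tau> b a" "\<forall>(a, b)\<in>inner. 0 < ang \<tau> a b" "\<forall>x y. adj F x y \<longrightarrow> grad \<tau> (x, y) = 0"
    using ex_critical by blast
  have sym: "\<tau> a b = \<tau> b a" for a b using \<tau>(1) by blast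
  have pos: "0 < ang \<tau> a b" if "(a, b) \<in> inner" for a b using \<tau>(2) that by auto
  have mid2: "(\<Sum>b\<in>nb F v. mid F h v b) = 2" if "v \<in> verts F - {o1, o2, o3}" for v using h(4) that by blast
  have crit: "grad \<tau> (x, y) = 0" if "adj F x y" for x y using \<tau>(3) that by blast
  obtain r where r: "\<And>v. 0 < r v" "r o1 = 1" "r o2 = 1" "r o3 = 1"
    and rc: "\<And>a b c. (a, b, c) \<in> F \<Longrightarrow> (a, b) \<notin> Out \<Longrightarrow> crs \<tau> a b * r b = crs \<tau> b c * r a"
    using ex_radii[of \<tau>, OF sym pos crit] by blast
  obtain y where y: "y o1 = 0" "\<And>a b. adj F a b \<Longrightarrow> y a + of_real (r a) * p a (dir \<tau> a b) = y b + of_real (r b) * p b (dir \<tau> b a)"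
    using ex_positions[of r \<tau>, OF r(1) rc sym pos] by blast
  have rp1: "0 < rest \<tau> a b" if "(a, b) \<in> Out" for a b by (rule rest_props(1)[of \<tau>, OF sym pos mid2 that])
  have rp2: "rest \<tau> o1 o2 + rest \<tau> o2 o3 + rest \<tau> o3 o1 = pi" by (rule rest_props(2)[of \<tau>, OF sym pos mid2])
  have rp3: "(\<Sum>b\<in>nb F v. ang \<tau> v b) = 2 * pi" if "v \<in> verts F - {o1, o2, o3}" for v
    by (rule rest_props(3)[of \<tau>, OF sym pos mid2 that])
  have rp4: "cis (dir \<tau> a (nx F a b)) = cis (dir \<tau> a b + (2 * pi - rest \<tau> a b))" if "(a, b) \<in> Out" for a b
    by (rule rest_props(4)[of \<tau>, OF sym pos mid2 that])
  note rp = rp1 rp2 rp3 rp4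
  \<comment> \<open>At an outer corner the sign of \<open>ang\<close> is not controlled; the gap is
    what the inner faces leave of a full turn, the same angle modulo 2 pi.\<close>
  define \<gamma> where "\<gamma> a b = (if (a, b) \<in> Out then 2 * pi - rest \<tau> a b else ang \<tau> a b)" for a b
  define c where "c a b = y a + of_real (r a) * p a (dir \<tau> a b)" for a b
  have c_sym: "c a b = c b a" if "adj F a b" for a b using y(2)[OF that] by (simp add: c_def)
  have opp: "cis (dir \<tau> b a) = - cis (dir \<tau> a b)" if "adj F a b" for a b
    using cis_dir_opp[of a b \<tau>, OF that sym] by (simp flip: cis_mult)
  have oo: "(o1, o2) \<in> Out" "(o2, o3) \<in> Out" "(o3, o1) \<in> Out" by (auto simp: Out_def)
  have rest_lt: "rest \<tau> a b < pi" if "(a, b) \<in> Out" for a b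
    using that rp(1)[OF oo(1)] rp(1)[OF oo(2)] rp(1)[OF oo(3)] rp(2) by (auto simp: Out_def)
  have inn: "(a, b) \<in> inner" if "adj F a b" "(a, b) \<notin> Out" for a b using that by (simp add: inner_def darts_def)
  have g: "0 < \<gamma> a b" "\<gamma> a b < 2 * pi" "cis (dir \<tau> a (nx F a b)) = cis (dir \<tau> a b + \<gamma> a b)" if ab: "adj F a b" for a b
  proof -
    show "0 < \<gamma> a b" "\<gamma> a b < 2 * pi"
      using rest_lt[of a b] rp(1)[of a b] pos[of a b] ang_less_pi[of \<tau> a b, OF sym pos] inn[OF ab] by (auto simp: \<gamma>_def)
    show "cis (dir \<tau> a (nx F a b)) = cis (dir \<tau> a b + \<gamma> a b)"
      using rp(4)[of a b] cis_dir_next[OF nx_face[OF ab], of \<tau>] by (simp add: \<gamma>_def)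
  qed
  have gs: "(\<Sum>b\<in>nb F a. \<gamma> a b) = 2 * pi" if a: "a \<in> verts F" for a
  proof (cases "a \<in> {o1, o2, o3}")
    case False
    hence "(\<Sum>b\<in>nb F a. \<gamma> a b) = (\<Sum>b\<in>nb F a. ang \<tau> a b)" by (intro sum.cong) (auto simp: \<gamma>_def Out_def)
    thus ?thesis using rp(3)[of a] a False by simp
  next
    case True
    then obtain b where o: "(a, b) \<in> Out" by (auto simp: Out_def)
    have ab: "b \<in> nb F a" using o face_adj[OF out] by (auto simp: Out_def nb_def)
    have "(\<Sum>b'\<in>nb F a. \<gamma> a b') = \<gamma> a b + (\<Sum>b'\<in>nb F a - {b}. \<gamma> a b')" by (rule sum.remove[OF finite_nb ab])
    also have "(\<Sum>b'\<in>nb F a - {b}. \<gamma> a b') = rest \<tau> a b"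
      unfolding rest_def by (rule sum.cong) (use o neqs[OF out] in \<open>auto simp: \<gamma>_def Out_def\<close>)
    finally show ?thesis using o by (simp add: \<gamma>_def)
  qed
  have chord: "c b s - c b t = of_real (r b) * (p b (dir \<tau> b s) - p b (dir \<tau> b t))" for b s t
    by (simp add: c_def algebra_simps)
  have ori: "if (a, b) \<in> Out then pi < \<gamma> a b \<and> cross (c a b - c d a) (c b d - c d a) < 0
       else \<gamma> a b < pi \<and> 0 < cross (c a b - c d a) (c b d - c d a)" if f: "(a, b, d) \<in> F" for a b d
  proof (cases "(a, b) \<in> Out")
    case True
    note n = nx_eq[OF f] nx_eq[OF rot[OF f]] nx_eq[OF rot2[OF f]]
    have o: "(b, d) \<in> Out" "(d, a) \<in> Out" using True Out_rot[OF rot[OF f]] Out_rot[OF rot2[OF f]] by auto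
    have k: "cis (dir \<tau> a b) = cis (dir \<tau> a (nx F a b)) * cis (rest \<tau> a b)" if "(a, b) \<in> Out" for a b
    proof -
      have "cis (dir \<tau> a b + (2 * pi - rest \<tau> a b)) * cis (rest \<tau> a b) = cis (dir \<tau> a b + 2 * pi)" by (simp add: cis_mult)
      also have "\<dots> = cis (dir \<tau> a b)" by (simp flip: cis_mult)
      finally show ?thesis using rp(4)[OF that] by simp
    qed
    have s: "rest \<tau> a b + rest \<tau> d a + rest \<tau> b d = pi"
      using True rp(2) n nx_eq[OF out] nx_eq[OF rot[OF out]] nx_eq[OF rot2[OF out]] by (auto simp: Out_def)
    have t1: "cis (dir \<tau> d a) = cis (dir \<tau> d b + rest \<tau> d a)" using k[OF o(2)] n by (simp add: cis_mult)
    have bd: "cis (dir \<tau> b d) = cis (dir \<tau> d b + pi)" using opp[of d b] face_adj[OF f] by (simp flip: cis_mult)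
    have "cis (dir \<tau> b d) * cis (- rest \<tau> b d) = cis (dir \<tau> b a)" using k[OF o(1)] n by (simp add: mult.assoc cis_mult)
    hence ba: "cis (dir \<tau> b a) = cis (dir \<tau> d b + pi - rest \<tau> b d)" unfolding bd by (simp add: cis_mult)
    have v: "b \<in> verts F" "d \<in> verts F" using face_verts[OF f] by auto
    have "0 < tri_factor (rest \<tau> a b) (rest \<tau> d a) (rest \<tau> b d)" by (rule tri_factor_pos[OF rp(1)[OF True] rp(1)[OF o(2)] rp(1)[OF o(1)] s])
    hence "0 < \<epsilon>\<^sup>2 * tri_factor (rest \<tau> a b) (rest \<tau> d a) (rest \<tau> b d)"
      using round_curveD(1)[OF round[OF v(1)]] by simp
    hence "0 < cross (p d (dir \<tau> d a) - p d (dir \<tau> d b)) (p b (dir \<tau> b d) - p b (dir \<tau> b a))"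
      using round_chords(1)[OF round[OF v(2)] round[OF v(1)] rp(1)[OF True] rp(1)[OF o(2)] rp(1)[OF o(1)] s ba bd t1]
      by linarith
    hence "0 < cross (c d a - c d b) (c b d - c b a)" unfolding chord cross_scale using r(1)[of d] r(1)[of b] by simp
    moreover have "c b a = c a b" "c d b = c b d" using c_sym face_adj[OF f] by auto
    ultimately have "cross (c a b - c d a) (c b d - c d a) < 0" by (simp add: cross_eq algebra_simps)
    thus ?thesis using True rest_lt[OF True] by (simp add: \<gamma>_def)
  next
    case False
    have ab: "(a, b) \<in> inner" using inn False face_adj[OF f] by blast
    have n: "nx F a b = d" using nx_eq[OF f] .
    have "0 < crs \<tau> a b" by (rule crs_bounds(3)[of \<tau>, OF sym f]) (use pos ab inner_rot[OF ab] n in auto)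
    hence "0 < cross (c b a - c b d) (c d b - c d a)" unfolding chord cross_scale crs_def n using r(1)[of d] r(1)[of b] by simp
    moreover have "c b a = c a b" "c d b = c b d" using c_sym face_adj[OF f] by auto
    ultimately have "0 < cross (c a b - c d a) (c b d - c d a)" by (simp add: cross_eq algebra_simps)
    thus ?thesis using False ang_less_pi[of \<tau> a b, OF sym pos ab] by (simp add: \<gamma>_def)
  qed
  have "contact_system F o1 o2 o3 c (dir \<tau>) \<gamma>"
    unfolding contact_system_def
    using c_sym opp g gs ori[unfolded Out_def] by blast
  thus ?thesis using r y(1) unfolding c_def by blast
qed

end

section \<open>Angles seen from a point\<close>

definition sees :: "complex \<Rightarrow> complex \<Rightarrow> complex \<Rightarrow> real" where
  "sees z p q = Arg ((q - z) / (p - z))"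

definition off_line :: "complex \<Rightarrow> complex \<Rightarrow> complex \<Rightarrow> bool" where
  "off_line z p q \<longleftrightarrow> p \<noteq> z \<and> q \<noteq> z \<and> (p \<noteq> q \<longrightarrow> cross (q - p) (z - p) \<noteq> 0)"

lemma Im_quotient:
  assumes "p \<noteq> z"
  shows "Im ((q - z) / (p - z)) = cross (q - p) (z - p) / (cmod (p - z))\<^sup>2"
  by (simp add: Im_divide cross_eq cmod_power2 algebra_simps)

lemma sees_refl: "p \<noteq> z \<Longrightarrow> sees z p p = 0"
  by (simp add: sees_def)

lemma off_line_commute: "off_line z p q \<longleftrightarrow> off_line z q p"
proof -
  have "cross (p - q) (z - q) = - cross (q - p) (z - p)" by (simp add: cross_eq algebra_simps)
  thus ?thesis by (auto simp: off_line_def)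
qed

lemma sees_bounds: "- pi < sees z p q" "sees z p q \<le> pi"
  by (simp_all add: sees_def mpi_less_Arg Arg_le_pi)

lemma sees_pos_iff:
  assumes "p \<noteq> z"
  shows "0 < sees z p q \<and> sees z p q < pi \<longleftrightarrow> 0 < cross (q - p) (z - p)"
  using assms by (simp add: sees_def Arg_lt_pi Im_quotient zero_less_divide_iff)

lemma sees_neg_iff:
  assumes "p \<noteq> z"
  shows "sees z p q < 0 \<longleftrightarrow> cross (q - p) (z - p) < 0"
  using assms Arg_less_0[of "(q - z) / (p - z)"] by (auto simp: sees_def Im_quotient zero_le_divide_iff not_le[symmetric])

lemma sees_less_pi:
  assumes "off_line z p q"
  shows "sees z p q < pi"
proof (cases "p = q")
  case True
  thus ?thesis using assms sees_refl by (simp add: off_line_def)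
next
  case False
  thus ?thesis using assms sees_pos_iff[of p z q] sees_neg_iff[of p z q] pi_gt_zero
    by (smt (verit) off_line_def)
qed

lemma sees_flip:
  assumes "off_line z p q"
  shows "sees z q p = - sees z p q"
proof (cases "p = q")
  case True
  thus ?thesis using assms sees_refl by (simp add: off_line_def)
next
  case False
  have "Im ((q - z) / (p - z)) \<noteq> 0" using assms False by (simp add: Im_quotient off_line_def)
  hence "(q - z) / (p - z) \<notin> \<real>" by (auto simp: complex_is_Real_iff)
  thus ?thesis using Arg_inverse[of "(q - z) / (p - z)"] by (simp add: sees_def)
qed

lemma cis_sees:
  assumes "p \<noteq> z" "q \<noteq> z"
  shows "cis (sees z p q) = sgn ((q - z) / (p - z))"
  using assms by (simp add: sees_def cis_Arg)

lemma cis_eq_1_iff: "cis x = 1 \<longleftrightarrow> (\<exists>k :: int. x = 2 * pi * of_int k)"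
  by (auto simp: cis_conv_exp exp_eq_1 algebra_simps)

text \<open>The quotients multiply to 1. The condition on the products holds whenever the end points
  are a rearrangement of the starting points, as in a closed polygon.\<close>

lemma sum_sees:
  assumes "finite I" "\<And>i. i \<in> I \<Longrightarrow> f i \<noteq> z" "\<And>i. i \<in> I \<Longrightarrow> g i \<noteq> z"
    and "(\<Prod>i\<in>I. f i - z) = (\<Prod>i\<in>I. g i - z)"
  shows "\<exists>k :: int. (\<Sum>i\<in>I. sees z (f i) (g i)) = 2 * pi * of_int k"
proof -
  have "cis (\<Sum>i\<in>I. sees z (f i) (g i)) = sgn (\<Prod>i\<in>I. (g i - z) / (f i - z))"
    using assms(1-3)
  proof (induction I rule: finite_induct)
    case (insert i I)
    thus ?case by (simp add: cis_mult[symmetric] cis_sees sgn_mult sgn_divide)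
  qed simp
  also have "(\<Prod>i\<in>I. (g i - z) / (f i - z)) = 1"
    using assms by (simp add: prod_dividef)
  finally show ?thesis by (simp add: cis_eq_1_iff)
qed

text \<open>2 pi times the winding number of the triangle about \<open>z\<close>.\<close>

definition turn :: "complex \<Rightarrow> complex \<Rightarrow> complex \<Rightarrow> complex \<Rightarrow> real" where
  "turn z p q r = sees z p q + sees z q r + sees z r p"

lemma turn_cases:
  assumes "off_line z p q" "off_line z q r" "off_line z r p"
  shows "turn z p q r = 0 \<or> turn z p q r = 2 * pi \<or> turn z p q r = - 2 * pi"
proof -
  have "cis (turn z p q r) = sgn ((q - z) / (p - z)) * sgn ((r - z) / (q - z)) * sgn ((p - z) / (r - z))"
    using assms by (simp add: turn_def cis_mult[symmetric] cis_sees off_line_def)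
  also have "\<dots> = sgn ((q - z) / (p - z) * ((r - z) / (q - z)) * ((p - z) / (r - z)))" by (simp only: sgn_mult)
  also have "(q - z) / (p - z) * ((r - z) / (q - z)) * ((p - z) / (r - z)) = 1" using assms by (simp add: off_line_def)
  finally have "cis (turn z p q r) = 1" by simp
  then obtain k :: int where k: "turn z p q r = 2 * pi * of_int k" unfolding cis_eq_1_iff by blast
  have "\<bar>turn z p q r\<bar> < 3 * pi"
    using sees_bounds[of z] sees_less_pi[OF assms(1)] sees_less_pi[OF assms(2)] sees_less_pi[OF assms(3)]
    unfolding turn_def by (smt (verit))
  hence "\<bar>of_int k\<bar> * (2 * pi) < 3 / 2 * (2 * pi)" unfolding k by (simp add: abs_mult)
  hence "\<bar>of_int k :: real\<bar> < 3 / 2" by (subst (asm) mult_less_cancel_right_pos) auto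
  hence "k = 0 \<or> k = 1 \<or> k = - 1" by linarith
  thus ?thesis using k by auto
qed

lemma turn_neg:
  assumes "off_line z p q" "off_line z q r" "off_line z r p" "turn z p q r = - 2 * pi"
  shows "cross (q - p) (z - p) < 0" "cross (r - q) (z - q) < 0" "cross (p - r) (z - r) < 0"
proof -
  have "sees z p q < 0" "sees z q r < 0" "sees z r p < 0"
    using assms(4) sees_bounds(1)[of z p q] sees_bounds(1)[of z q r] sees_bounds(1)[of z r p] unfolding turn_def by auto
  thus "cross (q - p) (z - p) < 0" "cross (r - q) (z - q) < 0" "cross (p - r) (z - r) < 0"
    using assms sees_neg_iff[of p z q] sees_neg_iff[of q z r] sees_neg_iff[of r z p] unfolding off_line_def by auto
qed

lemma cross_triangle: "cross (q - p) (z - p) + cross (r - q) (z - q) + cross (p - r) (z - r) = cross (q - p) (r - p)"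
  by (simp add: cross_eq algebra_simps)

text \<open>A negative turn needs three negative angles; then \<open>z\<close> lies to the right of
  all three sides, and the triangle is clockwise.\<close>

lemma turn_ccw:
  assumes "off_line z p q" "off_line z q r" "off_line z r p" "0 \<le> cross (q - p) (r - p)"
  shows "turn z p q r = 0 \<or> turn z p q r = 2 * pi"
proof (rule ccontr)
  assume "\<not> ?thesis"
  hence "turn z p q r = - 2 * pi" using turn_cases[OF assms(1-3)] by blast
  from turn_neg[OF assms(1-3) this] show False using cross_triangle[of q p z r] assms(4) by linarith
qed

lemma turn_cw:
  assumes "off_line z p q" "off_line z q r" "off_line z r p" "cross (q - p) (r - p) \<le> 0"
  shows "turn z p q r = 0 \<or> turn z p q r = - 2 * pi"
proof -
  have "turn z p r q = - turn z p q r"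
    using sees_flip[OF assms(1)] sees_flip[OF assms(2)] sees_flip[OF assms(3)] by (simp add: turn_def)
  moreover have "turn z p r q = 0 \<or> turn z p r q = 2 * pi"
    by (rule turn_ccw) (use assms off_line_commute in \<open>auto simp: cross_eq algebra_simps\<close>)
  ultimately show ?thesis by linarith
qed

lemma turn_inside:
  assumes "off_line z p q" "off_line z q r" "off_line z r p"
    and "0 < cross (q - p) (z - p)" "0 < cross (r - q) (z - q)" "0 < cross (p - r) (z - r)"
  shows "turn z p q r = 2 * pi"
proof -
  have "0 < sees z p q" "0 < sees z q r" "0 < sees z r p"
    using assms sees_pos_iff[of p z q] sees_pos_iff[of q z r] sees_pos_iff[of r z p] by (auto simp: off_line_def)
  hence "0 < turn z p q r" by (simp add: turn_def)
  moreover have "0 < cross (q - p) (r - p)" using assms cross_triangle[of q p z r] by linarith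
  hence "turn z p q r = 0 \<or> turn z p q r = 2 * pi" using turn_ccw assms by simp
  ultimately show ?thesis by linarith
qed

text \<open>Up to a common factor the three cross products are barycentric coordinates, so
  \<open>z\<close> is a convex combination of the vertices.\<close>

lemma triangle_norm_bound:
  assumes "cross (q - p) (z - p) < 0" "cross (r - q) (z - q) < 0" "cross (p - r) (z - r) < 0"
    and "norm p \<le> M" "norm q \<le> M" "norm r \<le> M"
  shows "norm z \<le> M"
proof -
  define x y w where "x = - cross (r - q) (z - q)" and "y = - cross (p - r) (z - r)" and "w = - cross (q - p) (z - p)"
  have pos: "0 < x" "0 < y" "0 < w" using assms by (auto simp: x_def y_def w_def)
  have "of_real (x + y + w) * z = of_real x * p + of_real y * q + of_real w * r"
    by (simp add: x_def y_def w_def complex_eq_iff cross_eq algebra_simps)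
  hence "norm (of_real (x + y + w) * z) \<le> norm (of_real x * p) + norm (of_real y * q) + norm (of_real w * r)"
    by (metis norm_add_leD norm_triangle_ineq norm_triangle_mono order_refl)
  also have "\<dots> \<le> x * M + y * M + w * M"
    using pos assms by (intro add_mono) (auto simp: norm_mult intro!: mult_left_mono)
  finally have "(x + y + w) * norm z \<le> (x + y + w) * M" using pos by (simp add: norm_mult algebra_simps del: of_real_add)
  thus ?thesis using pos by (simp add: mult_le_cancel_left_pos)
qed

text \<open>Finitely many lines and points are negligible, a nonempty open set is not.\<close>

lemma ex_off_lines:
  fixes U :: "complex set"
  assumes "open U" "U \<noteq> {}" "finite P"
  shows "\<exists>z\<in>U. \<forall>p\<in>P. \<forall>q\<in>P. off_line z p q"
proof -
  define L where "L p q = {z. cross (q - p) (z - p) = 0}" for p q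
  have L: "negligible (L p q)" if "p \<noteq> q" for p q
  proof -
    have "L p q = {z. (- \<i> * (q - p)) \<bullet> z = (- \<i> * (q - p)) \<bullet> p}"
      by (auto simp: L_def cross_eq inner_complex_def algebra_simps)
    thus ?thesis using negligible_hyperplane[of "- \<i> * (q - p)" "(- \<i> * (q - p)) \<bullet> p"] that by simp
  qed
  define S where "S = {(p, q). p \<in> P \<and> q \<in> P \<and> p \<noteq> q}"
  have finS: "finite S" by (rule finite_subset[of _ "P \<times> P"]) (use assms(3) in \<open>auto simp: S_def\<close>)
  define B where "B = P \<union> \<Union>((\<lambda>i. L (fst i) (snd i)) ` S)"
  have "negligible (\<Union>((\<lambda>i. L (fst i) (snd i)) ` S))"
  proof (rule negligible_Union)
    fix t assume "t \<in> (\<lambda>i. L (fst i) (snd i)) ` S"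
    then obtain i where "i \<in> S" "t = L (fst i) (snd i)" by blast
    thus "negligible t" using L by (auto simp: S_def)
  qed (use finS in simp)
  hence "negligible B" unfolding B_def using negligible_Un[OF negligible_finite[OF assms(3)]] by auto
  hence "\<not> U \<subseteq> B" using open_not_negligible[OF assms(1,2)] negligible_subset by blast
  then obtain z where z: "z \<in> U" "z \<notin> B" by blast
  thus ?thesis by (intro bexI[of _ z]) (auto simp: B_def S_def L_def off_line_def)
qed

section \<open>Support normals in cyclic order\<close>

text \<open>If the triangle were clockwise, two expressions for its area in terms of the support
  defects \<open>a\<close> to \<open>f\<close> would give \<open>d < c\<close> and
  \<open>c * f + d * e < d * f\<close>, which is absurd for nonnegative numbers.\<close>

lemma support_three:
  assumes "0 < cross e1 e2" "0 < cross e2 e3"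
    and "ip e1 (x2 - x1) \<le> 0" "ip e1 (x3 - x1) \<le> 0" "ip e2 (x1 - x2) \<le> 0" "ip e2 (x3 - x2) \<le> 0"
      "ip e3 (x1 - x3) \<le> 0" "ip e3 (x2 - x3) \<le> 0"
  shows "0 \<le> cross (x2 - x1) (x3 - x1)"
proof (rule ccontr)
  assume "\<not> ?thesis"
  hence neg: "cross (x2 - x1) (x3 - x1) < 0" by simp
  define a b c d e f where "a = - ip e1 (x2 - x1)" and "b = - ip e1 (x3 - x1)" and "c = - ip e2 (x1 - x2)"
    and "d = - ip e2 (x3 - x2)" and "e = - ip e3 (x1 - x3)" and "f = - ip e3 (x2 - x3)"
  have nn: "0 \<le> a" "0 \<le> b" "0 \<le> c" "0 \<le> d" "0 \<le> e" "0 \<le> f" using assms by (auto simp: a_def b_def c_def d_def e_def f_def)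
  have "cross e1 e2 * cross (x2 - x1) (x3 - x1) = - a * (c - d) + b * c"
    by (simp add: a_def b_def c_def d_def cross_eq ip_eq algebra_simps)
  moreover have "cross e1 e2 * cross (x2 - x1) (x3 - x1) < 0" using neg assms(1) by (rule mult_pos_neg[rotated])
  ultimately have "b * c < a * (c - d)" by (simp add: algebra_simps)
  hence "0 < a * (c - d)" using nn by (meson le_less_trans mult_nonneg_nonneg)
  hence 1: "d < c" using nn by (auto simp: zero_less_mult_iff)
  have "cross e2 e3 * cross (x2 - x1) (x3 - x1) = c * e - (c - d) * (e - f)"
    by (simp add: c_def d_def e_def f_def cross_eq ip_eq algebra_simps)
  moreover have "cross e2 e3 * cross (x2 - x1) (x3 - x1) < 0" using neg assms(2) by (rule mult_pos_neg[rotated])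
  moreover have "c * e - (c - d) * (e - f) = c * f + d * e - d * f" by (simp add: algebra_simps)
  ultimately have "c * f + d * e < d * f" by simp
  moreover have "d * f \<le> c * f" "0 \<le> d * e" using 1 nn by (auto intro: mult_right_mono)
  ultimately show False by linarith
qed

lemma cross_cyclic: "cross (x3 - x2) (x1 - x2) = cross (x2 - x1) (x3 - x1)"
  by (simp add: cross_eq algebra_simps)

text \<open>Of three gaps that add up to 2 pi at least two are less than pi; the triple is rotated
  so that these are the two that \<open>support_three\<close> requires.\<close>

lemma support_three_cis:
  assumes s: "0 < s" "0 < g" "s + g < 2 * pi"
    and e: "e1 = cis t" "e2 = cis (t + s)" "e3 = cis (t + s + g)"
    and "ip e1 (x2 - x1) \<le> 0" "ip e1 (x3 - x1) \<le> 0" "ip e2 (x1 - x2) \<le> 0" "ip e2 (x3 - x2) \<le> 0"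
      "ip e3 (x1 - x3) \<le> 0" "ip e3 (x2 - x3) \<le> 0"
  shows "0 \<le> cross (x2 - x1) (x3 - x1)"
proof -
  have "cross e3 e1 = sin (- (s + g))" unfolding e cross_cis by (rule arg_cong[of _ _ sin]) simp
  hence c: "cross e1 e2 = sin s" "cross e2 e3 = sin g" "cross e3 e1 = sin (2 * pi - (s + g))"
    unfolding e cross_cis sin_minus by (simp_all add: sin_diff[of "2 * pi"])
  consider "s < pi" "g < pi" | "g < pi" "2 * pi - (s + g) < pi" | "s < pi" "2 * pi - (s + g) < pi" using s by linarith
  thus ?thesis
  proof cases
    case 1
    thus ?thesis using support_three[of e1 e2 e3 x2 x1 x3] assms c sin_gt_zero[of s] sin_gt_zero[of g] by simp
  next
    case 2
    have "0 < sin g" by (rule sin_gt_zero; use s 2 in linarith)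
    moreover have "0 < sin (2 * pi - (s + g))" by (rule sin_gt_zero; use s 2 in linarith)
    ultimately have "0 \<le> cross (x3 - x2) (x1 - x2)" using assms c by (intro support_three[of e2 e3 e1]) simp_all
    thus ?thesis by (simp add: cross_cyclic[of x3 x2 x1])
  next
    case 3
    have "0 < sin s" by (rule sin_gt_zero; use s 3 in linarith)
    moreover have "0 < sin (2 * pi - (s + g))" by (rule sin_gt_zero; use s 3 in linarith)
    ultimately have "0 \<le> cross (x1 - x3) (x2 - x3)" using assms c by (intro support_three[of e3 e1 e2]) simp_all
    thus ?thesis by (simp add: cross_cyclic[of x2 x1 x3])
  qed
qed

text \<open>A point of the cap cut off by the chord \<open>u\<close> lies in the triangle with apex \<open>q\<close>; both
  lemmas come from the relation between the three products with one normal.\<close>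

lemma cap_left:
  assumes n: "norm e1 = 1" "0 < cross e1 e2" and z: "cross u z < 0" "ip e1 z < 0"
    and u: "ip e1 u \<le> 0" "0 \<le> ip e2 u" and q: "0 \<le> ip e1 q" "cross u q \<le> 0"
  shows "0 \<le> cross q z"
proof -
  have e: "Re e1 * Re e1 + Im e1 * Im e1 = 1" using n(1) by (metis cmod_power2 one_power2 power2_eq_square)
  have "ip e1 u \<noteq> 0"
  proof
    assume 0: "ip e1 u = 0"
    have "ip e2 u * (Re e1 * Re e1 + Im e1 * Im e1) = ip e1 u * ip e1 e2 + cross e1 u * cross e1 e2"
      by (simp add: ip_eq cross_eq algebra_simps)
    hence "0 \<le> cross e1 u * cross e1 e2" using 0 e u by simp
    hence "0 \<le> cross e1 u" using n(2) by (simp add: zero_le_mult_iff)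
    moreover have "cross u z * (Re e1 * Re e1 + Im e1 * Im e1) = ip e1 u * cross e1 z - cross e1 u * ip e1 z"
      by (simp add: ip_eq cross_eq algebra_simps)
    ultimately have "0 \<le> cross u z" using 0 e z(2) by (simp add: mult_nonneg_nonpos)
    thus False using z(1) by simp
  qed
  hence neg: "ip e1 u < 0" using u by simp
  have "ip e1 q * cross u z + ip e1 u * cross z q + ip e1 z * cross q u = 0" by (simp add: ip_eq cross_eq algebra_simps)
  moreover have "ip e1 q * cross u z \<le> 0" using q z by (simp add: mult_nonneg_nonpos)
  moreover have "cross q u = - cross u q" by (simp add: cross_eq)
  hence "ip e1 z * cross q u \<le> 0" using q z mult_nonpos_nonpos[of "ip e1 z" "cross u q"] by simp
  ultimately have "0 \<le> ip e1 u * cross z q" by linarith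
  hence "cross z q \<le> 0" using neg by (simp add: zero_le_mult_iff)
  thus ?thesis by (simp add: cross_eq mult.commute)
qed

lemma cap_right:
  assumes n: "norm e2 = 1" "0 < cross e1 e2" and z: "0 < cross u z" "ip e2 z < 0"
    and u: "ip e2 u \<le> 0" "0 \<le> ip e1 u" and q: "0 \<le> ip e2 q" "0 \<le> cross u q"
  shows "0 \<le> cross z q"
proof -
  \<comment> \<open>Complex conjugation reverses orientation and exchanges the two ends of the
    chord.\<close>
  have cn: "cross (cnj x) (cnj y) = - cross x y" "ip (cnj x) (cnj y) = ip x y" for x y by (simp_all add: cross_eq ip_eq)
  have an: "cross x y = - cross y x" for x y by (simp add: cross_eq mult.commute)
  have "0 \<le> cross (cnj q) (cnj z)"
    by (rule cap_left[of "cnj e2" "cnj e1" "cnj u"]) (use assms an[of e2 e1] in \<open>auto simp: cn\<close>)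
  thus ?thesis by (simp add: cn an[of q z])
qed

section \<open>Contact systems do not overlap\<close>

text \<open>Around every vertex the contact points form a convex polygon, and every face gives a contact
  triangle. The winding numbers of all polygons and inner triangles about a point add up to that
  of the outer contact triangle, hence to at most one.\<close>

locale contacts = triangulation F for F :: "'a faces" +
  fixes o1 o2 o3 :: 'a and c :: "'a \<Rightarrow> 'a \<Rightarrow> complex" and \<theta> \<gamma> :: "'a \<Rightarrow> 'a \<Rightarrow> real" and Q :: "'a \<Rightarrow> complex set"
  assumes out: "(o1, o2, o3) \<in> F" and sys: "contact_system F o1 o2 o3 c \<theta> \<gamma>"
    and c_in: "\<And>a b. adj F a b \<Longrightarrow> c a b \<in> Q a"
    and supp: "\<And>a b z. adj F a b \<Longrightarrow> z \<in> Q a \<Longrightarrow> ip (cis (\<theta> a b)) (z - c a b) \<le> 0"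
begin

definition Out where "Out = {(o1, o2), (o2, o3), (o3, o1)}"

lemma c_sym: "adj F a b \<Longrightarrow> c a b = c b a"
  and opp_dir: "adj F a b \<Longrightarrow> cis (\<theta> b a) = - cis (\<theta> a b)"
  and gap_pos: "adj F a b \<Longrightarrow> 0 < \<gamma> a b"
  and gap_less: "adj F a b \<Longrightarrow> \<gamma> a b < 2 * pi"
  and gap_next: "adj F a b \<Longrightarrow> cis (\<theta> a (nx F a b)) = cis (\<theta> a b + \<gamma> a b)"
  using sys unfolding contact_system_def by auto

lemma gap_sum: "a \<in> verts F \<Longrightarrow> (\<Sum>b\<in>nb F a. \<gamma> a b) = 2 * pi"
  using sys unfolding contact_system_def by blast

lemma orient_out: "(a, b, d) \<in> F \<Longrightarrow> (a, b) \<in> Out \<Longrightarrow> cross (c a b - c d a) (c b d - c d a) < 0"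
  and gap_in: "(a, b, d) \<in> F \<Longrightarrow> (a, b) \<notin> Out \<Longrightarrow> \<gamma> a b < pi"
  and orient_in: "(a, b, d) \<in> F \<Longrightarrow> (a, b) \<notin> Out \<Longrightarrow> 0 < cross (c a b - c d a) (c b d - c d a)"
  using sys unfolding contact_system_def Out_def by auto

lemma Out_rot:
  assumes "(a, b, d) \<in> F" "(a, b) \<notin> Out"
  shows "(b, d) \<notin> Out" "(d, a) \<notin> Out"
  using assms nx_eq[OF assms(1)] nx_eq[OF rot[OF assms(1)]] nx_eq[OF rot2[OF assms(1)]]
    nx_eq[OF out] nx_eq[OF rot[OF out]] nx_eq[OF rot2[OF out]] by (auto simp: Out_def)

lemma contacts_distinct:
  assumes f: "(a, b, d) \<in> F"
  shows "c a b \<noteq> c d a" "c a b \<noteq> c b d" "c b d \<noteq> c d a"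
proof -
  have "cross (c a b - c d a) (c b d - c d a) \<noteq> 0" using orient_out[OF f] orient_in[OF f] by fastforce
  thus "c a b \<noteq> c d a" "c a b \<noteq> c b d" "c b d \<noteq> c d a" by (auto simp: cross_eq)
qed

text \<open>Measuring directions from that of \<open>D\<close>, exactly one corner wraps around, since the gaps
  add up to one full turn.\<close>

lemma no_wrap:
  assumes D: "adj F a D" and B: "adj F a B" "B \<noteq> D" "nx F a B \<noteq> D"
  shows "\<exists>s. 0 < s \<and> s + \<gamma> a B < 2 * pi \<and> cis (\<theta> a B) = cis (\<theta> a D + s)"
proof -
  define t where "t b = Arg2pi (cis (\<theta> a b - \<theta> a D))" for b
  have t: "0 \<le> t b" "t b < 2 * pi" "cis (\<theta> a b) = cis (\<theta> a D + t b)" for b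
  proof -
    show "0 \<le> t b" "t b < 2 * pi" by (simp_all add: t_def Arg2pi_ge_0 Arg2pi_lt_2pi)
    have "cis (t b) = cis (\<theta> a b - \<theta> a D)"
      using Arg2pi_eq[of "cis (\<theta> a b - \<theta> a D)"] by (simp add: t_def cis_conv_exp)
    hence "cis (\<theta> a D) * cis (t b) = cis (\<theta> a D) * cis (\<theta> a b - \<theta> a D)" by simp
    thus "cis (\<theta> a b) = cis (\<theta> a D + t b)" by (simp add: cis_mult)
  qed
  have tD: "t D = 0" by (simp add: t_def Arg2pi_eq_0)
  have "\<exists>n :: int. (n = 0 \<or> n = 1) \<and> \<gamma> a b = t (nx F a b) - t b + 2 * pi * of_int n" if b: "adj F a b" for b
  proof -
    have "cis (\<theta> a D + t (nx F a b)) = cis (\<theta> a D + t b) * cis (\<gamma> a b)"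
      using gap_next[OF b] t(3)[of b] t(3)[of "nx F a b"] by (simp flip: cis_mult)
    hence "cis (\<theta> a D + t b) * cis (t (nx F a b) - t b) = cis (\<theta> a D + t b) * cis (\<gamma> a b)"
      by (simp add: cis_mult)
    hence "cis (\<gamma> a b) = cis (t (nx F a b) - t b)" by simp
    hence "cis (\<gamma> a b) * cis (- (t (nx F a b) - t b)) = cis (t (nx F a b) - t b) * cis (- (t (nx F a b) - t b))" by simp
    hence "cis (\<gamma> a b - (t (nx F a b) - t b)) = 1" unfolding cis_mult by (simp add: algebra_simps)
    then obtain n :: int where n: "\<gamma> a b - (t (nx F a b) - t b) = 2 * pi * of_int n" unfolding cis_eq_1_iff by blast
    have l: "- (2 * pi) < \<gamma> a b - (t (nx F a b) - t b)" "\<gamma> a b - (t (nx F a b) - t b) < 2 * (2 * pi)"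
      using gap_pos[OF b] gap_less[OF b] t(1,2)[of b] t(1,2)[of "nx F a b"] by auto
    have "- 1 * (2 * pi) < of_int n * (2 * pi)" "of_int n * (2 * pi) < 2 * (2 * pi)" using l unfolding n by (simp_all add: mult.commute)
    hence "- 1 < (of_int n :: real)" "of_int n < (2 :: real)"
      using mult_less_cancel_right_pos[of "2 * pi" "- 1" "of_int n"] mult_less_cancel_right_pos[of "2 * pi" "of_int n" 2] pi_gt_zero by simp_all
    hence "n = 0 \<or> n = 1" by linarith
    thus ?thesis using n by (intro exI[of _ n]) auto
  qed
  hence "\<forall>b\<in>nb F a. \<exists>n :: int. (n = 0 \<or> n = 1) \<and> \<gamma> a b = t (nx F a b) - t b + 2 * pi * of_int n" by (simp add: nb_def)
  then obtain n :: "'a \<Rightarrow> int" where n: "\<And>b. b \<in> nb F a \<Longrightarrow> n b = 0 \<or> n b = 1"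
    "\<And>b. b \<in> nb F a \<Longrightarrow> \<gamma> a b = t (nx F a b) - t b + 2 * pi * of_int (n b)" by metis
  have "(\<Sum>b\<in>nb F a. \<gamma> a b) = (\<Sum>b\<in>nb F a. t (nx F a b)) - (\<Sum>b\<in>nb F a. t b) + 2 * pi * (\<Sum>b\<in>nb F a. of_int (n b))"
    using n(2) by (simp add: sum.distrib sum_subtractf sum_distrib_left)
  moreover have "(\<Sum>b\<in>nb F a. t (nx F a b)) = (\<Sum>b\<in>nb F a. t b)" by (rule sum.reindex_bij_betw[OF nx_bij])
  moreover have "a \<in> verts F" using adj_verts[OF D] by blast
  ultimately have "2 * pi * (\<Sum>b\<in>nb F a. of_int (n b)) = 2 * pi * 1" using gap_sum by simp
  hence sum1: "(\<Sum>b\<in>nb F a. of_int (n b)) = (1 :: real)" by simp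
  \<comment> \<open>The predecessor of a corner with direction 0 must wrap, as gaps are positive.
    This holds for the predecessor of \<open>D\<close>, and would hold for that of \<open>B\<close>
    if the direction of \<open>B\<close> were 0; only one corner wraps.\<close>
  have wrap: "n b = 1" if "b \<in> nb F a" "t (nx F a b) = 0" for b
    using n(1)[OF that(1)] n(2)[OF that(1)] that gap_pos[of a b] t(1)[of b] by (auto simp: nb_def)
  have unique: "b = b'" if "b \<in> nb F a" "b' \<in> nb F a" "n b = 1" "n b' = 1" for b b'
  proof (rule ccontr)
    assume "b \<noteq> b'"
    hence "2 = (\<Sum>x\<in>{b, b'}. of_int (n x) :: real)" using that by simp
    also have "\<dots> \<le> (\<Sum>x\<in>nb F a. of_int (n x))"
    proof (rule sum_mono2[OF finite_nb])
      show "0 \<le> (of_int (n x) :: real)" if "x \<in> nb F a - {b, b'}" for x using n(1)[of x] that by auto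
    qed (use that in auto)
    finally show False using sum1 by simp
  qed
  have pred: "\<exists>b'\<in>nb F a. nx F a b' = b" if "adj F a b" for b
    using nx_bij[of a] that unfolding bij_betw_def nb_def by (metis (no_types, lifting) imageE mem_Collect_eq)
  obtain P where P: "P \<in> nb F a" "nx F a P = D" using pred[OF D] by blast
  have nP: "n P = 1" using wrap[OF P(1)] P(2) tD by simp
  have Bn: "B \<in> nb F a" using B by (simp add: nb_def)
  have "n B = 0" using n(1)[OF Bn] unique[OF Bn P(1) _ nP] P(2) B(3) by auto
  hence "\<gamma> a B = t (nx F a B) - t B" using n(2)[OF Bn] by simp
  hence "t B + \<gamma> a B < 2 * pi" using t(2)[of "nx F a B"] by linarith
  moreover have "t B \<noteq> 0"
  proof
    assume z: "t B = 0"
    obtain P' where P': "P' \<in> nb F a" "nx F a P' = B" using pred[OF B(1)] by blast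
    hence "n P' = 1" using wrap z by simp
    hence "P' = P" using unique P' P nP by blast
    thus False using P' P B(2) by simp
  qed
  hence "0 < t B" using t(1)[of B] by linarith
  ultimately show ?thesis using t(3)[of B] by blast
qed

lemma polygon_convex:
  assumes D: "adj F a D" and B: "adj F a B"
  shows "0 \<le> cross (c a B - c a D) (c a (nx F a B) - c a D)"
proof (cases "B = D \<or> nx F a B = D")
  case True
  thus ?thesis by (auto simp: cross_eq)
next
  case False
  obtain s where s: "0 < s" "s + \<gamma> a B < 2 * pi" "cis (\<theta> a B) = cis (\<theta> a D + s)"
    using no_wrap[OF D B] False by blast
  have C: "adj F a (nx F a B)" using nx_adj[OF B] .
  have e: "cis (\<theta> a (nx F a B)) = cis (\<theta> a D + s + \<gamma> a B)" using gap_next[OF B] s(3) by (simp flip: cis_mult)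
  show ?thesis
    by (rule support_three_cis[OF s(1) gap_pos[OF B] s(2) refl s(3) e])
      (use supp c_in D B C in auto)
qed

definition pts :: "complex set" where "pts = (\<lambda>(a, b). c a b) ` darts F"

definition generic :: "complex \<Rightarrow> bool" where
  "generic z \<longleftrightarrow> (\<forall>p\<in>pts. \<forall>q\<in>pts. off_line z p q)"

lemma ex_generic:
  assumes "open U" "U \<noteq> {}"
  shows "\<exists>z\<in>U. generic z"
  unfolding generic_def using ex_off_lines[OF assms, of pts] finite_darts by (simp add: pts_def)

lemma c_pts: "adj F a b \<Longrightarrow> c a b \<in> pts"
  by (force simp: pts_def darts_def)

lemma genericD: "generic z \<Longrightarrow> adj F a b \<Longrightarrow> adj F a' b' \<Longrightarrow> off_line z (c a b) (c a' b')"
  using c_pts by (simp add: generic_def)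

lemma generic_ne: "generic z \<Longrightarrow> adj F a b \<Longrightarrow> c a b \<noteq> z"
  using genericD[of z a b a b] by (simp add: off_line_def)

definition poly :: "complex \<Rightarrow> 'a \<Rightarrow> real" where
  "poly z a = (\<Sum>b\<in>nb F a. sees z (c a b) (c a (nx F a b)))"

definition tri :: "complex \<Rightarrow> 'a \<Rightarrow> 'a \<Rightarrow> 'a \<Rightarrow> real" where
  "tri z a b d = turn z (c d a) (c a b) (c b d)"

lemma poly_int:
  assumes "generic z"
  shows "\<exists>k :: int. poly z a = 2 * pi * of_int k"
  unfolding poly_def
proof (rule sum_sees[OF finite_nb])
  show "c a b \<noteq> z" "c a (nx F a b) \<noteq> z" if "b \<in> nb F a" for b
    using generic_ne[OF assms] nx_adj that by (auto simp: nb_def)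
  show "(\<Prod>b\<in>nb F a. c a b - z) = (\<Prod>b\<in>nb F a. c a (nx F a b) - z)"
    by (rule prod.reindex_bij_betw[OF nx_bij, symmetric])
qed

text \<open>The polygon is cut into a fan of triangles with apex \<open>c a D\<close>. The angles
  along the diagonals cancel, and by \<open>polygon_convex\<close> no triangle is clockwise.\<close>

lemma poly_nonneg:
  assumes g: "generic z"
  shows "0 \<le> poly z a"
proof (cases "nb F a = {}")
  case True
  thus ?thesis by (simp add: poly_def)
next
  case False
  then obtain D where D: "adj F a D" by (auto simp: nb_def)
  have fl: "sees z (c a b) (c a D) = - sees z (c a D) (c a b)" if "b \<in> nb F a" for b
    using sees_flip[OF genericD[OF g D, of a b]] that by (simp add: nb_def)
  have "(\<Sum>b\<in>nb F a. turn z (c a D) (c a b) (c a (nx F a b))) =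
      (\<Sum>b\<in>nb F a. sees z (c a D) (c a b)) + poly z a + (\<Sum>b\<in>nb F a. sees z (c a (nx F a b)) (c a D))"
    by (simp add: turn_def poly_def sum.distrib)
  also have "(\<Sum>b\<in>nb F a. sees z (c a (nx F a b)) (c a D)) = (\<Sum>b\<in>nb F a. sees z (c a b) (c a D))"
    by (rule sum.reindex_bij_betw[OF nx_bij])
  also have "\<dots> = - (\<Sum>b\<in>nb F a. sees z (c a D) (c a b))" using fl by (simp add: sum_negf)
  finally have "poly z a = (\<Sum>b\<in>nb F a. turn z (c a D) (c a b) (c a (nx F a b)))" by simp
  also have "0 \<le> \<dots>"
  proof (rule sum_nonneg)
    fix b assume "b \<in> nb F a"
    hence b: "adj F a b" "adj F a (nx F a b)" using nx_adj by (auto simp: nb_def)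
    have "turn z (c a D) (c a b) (c a (nx F a b)) = 0 \<or> turn z (c a D) (c a b) (c a (nx F a b)) = 2 * pi"
      by (rule turn_ccw) (use genericD[OF g] D b polygon_convex[OF D b(1)] in auto)
    thus "0 \<le> turn z (c a D) (c a b) (c a (nx F a b))" by auto
  qed
  finally show ?thesis .
qed

lemma off_tri:
  assumes "generic z" "(a, b, d) \<in> F"
  shows "off_line z (c d a) (c a b)" "off_line z (c a b) (c b d)" "off_line z (c b d) (c d a)"
  using genericD[OF assms(1)] face_adj[OF assms(2)] by auto

lemma tri_in:
  assumes "generic z" "(a, b, d) \<in> F" "(a, b) \<notin> Out"
  shows "tri z a b d = 0 \<or> tri z a b d = 2 * pi"
  unfolding tri_def using turn_ccw[OF off_tri[OF assms(1,2)]] orient_in[OF assms(2,3)] by simp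

lemma tri_out:
  assumes "generic z" "(a, b, d) \<in> F" "(a, b) \<in> Out"
  shows "tri z a b d = 0 \<or> tri z a b d = - 2 * pi"
  unfolding tri_def using turn_cw[OF off_tri[OF assms(1,2)]] orient_out[OF assms(2,3)] by simp

lemma tri_rot: "tri z b d a = tri z a b d"
  by (simp add: tri_def turn_def)

text \<open>Each side of a polygon is, reversed, a side of exactly one contact triangle, so all
  angles cancel. The factor 3 comes from the three rotations of each face in
  \<open>F\<close>.\<close>

lemma total:
  assumes g: "generic z"
  shows "3 * (\<Sum>a\<in>verts F. poly z a) + (\<Sum>(a, b, d)\<in>F. tri z a b d) = 0"
proof -
  have "(\<Sum>a\<in>verts F. poly z a) = (\<Sum>(a, b)\<in>darts F. sees z (c a b) (c a (nx F a b)))"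
    by (simp add: poly_def sum_verts)
  also have "\<dots> = (\<Sum>(a, b, d)\<in>F. - sees z (c d a) (c a b))"
    unfolding sum_darts
  proof (rule sum.cong[OF refl])
    fix x assume x: "x \<in> F"
    obtain a b d where abd: "x = (a, b, d)" by (cases x) auto
    hence f: "(a, b, d) \<in> F" using x by simp
    have "sees z (c a b) (c a d) = - sees z (c d a) (c a b)"
      using sees_flip[OF off_tri(1)[OF g f]] c_sym[of a d] face_adj[OF f] by simp
    thus "(case x of (a, b, d) \<Rightarrow> sees z (c a b) (c a (nx F a b))) = (case x of (a, b, d) \<Rightarrow> - sees z (c d a) (c a b))"
      by (simp add: abd nx_eq[OF f])
  qed
  finally have p: "(\<Sum>a\<in>verts F. poly z a) = - (\<Sum>(a, b, d)\<in>F. sees z (c d a) (c a b))"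
    by (simp add: sum_negf case_prod_unfold)
  have "(\<Sum>(a, b, d)\<in>F. tri z a b d) = (\<Sum>(a, b, d)\<in>F. sees z (c d a) (c a b)) + (\<Sum>(a, b, d)\<in>F. sees z (c a b) (c b d)) + (\<Sum>(a, b, d)\<in>F. sees z (c b d) (c d a))"
    by (simp add: tri_def turn_def sum.distrib case_prod_unfold)
  moreover have "(\<Sum>(a, b, d)\<in>F. sees z (c a b) (c b d)) = (\<Sum>(a, b, d)\<in>F. sees z (c d a) (c a b))"
    using sum_rot[of "\<lambda>a b d. sees z (c d a) (c a b)"] by simp
  moreover have "(\<Sum>(a, b, d)\<in>F. sees z (c b d) (c d a)) = (\<Sum>(a, b, d)\<in>F. sees z (c d a) (c a b))"
    using sum_rot[of "\<lambda>a b d. sees z (c b d) (c d a)"] by simp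
  ultimately show ?thesis using p by simp
qed

end

text \<open>Off the segment the quotient avoids the branch cut of \<open>Arg\<close>.\<close>

lemma sees_continuous:
  assumes "\<And>z. z \<in> B \<Longrightarrow> z \<notin> closed_segment p q"
  shows "continuous_on B (\<lambda>z. sees z p q)"
proof -
  have ne: "p \<noteq> z" if "z \<in> B" for z using assms[OF that] by auto
  have "(q - z) / (p - z) \<notin> \<real>\<^sub>\<le>\<^sub>0" if z: "z \<in> B" for z
  proof
    assume "(q - z) / (p - z) \<in> \<real>\<^sub>\<le>\<^sub>0"
    then obtain t where t: "(q - z) / (p - z) = - of_real t" "0 \<le> t" by (force elim: nonpos_Reals_cases intro: that[of "- _"])
    hence "q - z = - of_real t * (p - z)" using ne[OF z] by (simp add: field_simps)
    hence "of_real (1 + t) * z = q + of_real t * p" by (simp add: algebra_simps)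
    hence "z = (q + of_real t * p) / of_real (1 + t)" using t(2) by (simp add: field_simps del: of_real_add)
    also have "\<dots> = (1 - 1 / (1 + t)) *\<^sub>R p + (1 / (1 + t)) *\<^sub>R q"
    proof -
      have "1 - 1 / (1 + t) = t / (1 + t)" using t(2) by (simp add: field_simps)
      thus ?thesis by (simp add: scaleR_conv_of_real add_divide_distrib)
    qed
    finally have "z \<in> closed_segment p q" unfolding in_segment using t(2) by (intro exI[of _ "1 / (1 + t)"]) auto
    thus False using assms z by blast
  qed
  thus ?thesis unfolding sees_def using ne by (intro continuous_intros) auto
qed

section \<open>Disjoint interiors and rings of contacts\<close>

locale convex_contacts = contacts +
  assumes convQ: "\<And>a. convex (Q a)"
begin

lemma interior_strict:
  assumes ab: "adj F a b" and z: "z \<in> interior (Q a)"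
  shows "ip (cis (\<theta> a b)) (z - c a b) < 0"
proof -
  obtain e where e: "0 < e" "ball z e \<subseteq> Q a" using z by (auto simp: mem_interior)
  have "z + of_real (e / 2) * cis (\<theta> a b) \<in> ball z e" using e by (simp add: dist_norm norm_mult)
  hence "ip (cis (\<theta> a b)) (z + of_real (e / 2) * cis (\<theta> a b) - c a b) \<le> 0" using e supp[OF ab] by blast
  moreover have "ip (cis (\<theta> a b)) (z + of_real (e / 2) * cis (\<theta> a b) - c a b) = ip (cis (\<theta> a b)) (z - c a b) + e / 2"
    using ip_cis[of "\<theta> a b" "\<theta> a b"] by (simp add: ip_add ip_scale del: of_real_divide)
  ultimately show ?thesis using e by linarith
qed

text \<open>The apex \<open>c b d\<close> belongs to the bodies of \<open>b\<close> and
  \<open>d\<close>, so it lies beyond the support lines of body \<open>a\<close> at both contacts.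
  The cap that the chord cuts off from body \<open>a\<close> lies between the chord and these lines,
  hence in the triangle.\<close>

lemma cap_in_triangle:
  assumes g: "generic z" and f: "(a, b, d) \<in> F" "(a, b) \<notin> Out" and z: "z \<in> interior (Q a)"
    and right: "cross (c a d - c a b) (z - c a b) < 0"
  shows "tri z a b d = 2 * pi"
proof -
  note ad = face_adj[OF f(1)]
  define q where "q = c b d"
  define e1 e2 where "e1 = cis (\<theta> a b)" and "e2 = cis (\<theta> a d)"
  have "cross e1 e2 = sin (\<gamma> a b)"
    using gap_next[of a b] ad by (simp add: nx_eq[OF f(1)] e1_def e2_def cross_cis)
  hence e12: "0 < cross e1 e2" using gap_pos[of a b] gap_in[OF f] ad sin_gt_zero by auto
  have z1: "ip e1 (z - c a b) < 0" and z2: "ip e2 (z - c a d) < 0"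
    using interior_strict z ad by (auto simp: e1_def e2_def)
  have u1: "ip e1 (c a d - c a b) \<le> 0" and u2: "ip e2 (c a b - c a d) \<le> 0"
    using supp c_in ad by (auto simp: e1_def e2_def)
  have "ip (cis (\<theta> b a)) (q - c b a) \<le> 0" "ip (cis (\<theta> d a)) (q - c d a) \<le> 0"
    using supp[of b a q] supp[of d a q] c_in[of b d] c_in[of d b] c_sym[of b d] ad by (auto simp: q_def)
  hence q1: "0 \<le> ip e1 (q - c a b)" and q2: "0 \<le> ip e2 (q - c a d)"
    using opp_dir[of a b] opp_dir[of a d] c_sym[of a b] c_sym[of a d] ad by (auto simp: e1_def e2_def ip_add)
  have ori: "0 < cross (c a b - c a d) (q - c a d)" using orient_in[OF f] c_sym[of a d] ad by (simp add: q_def)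
  have n: "norm e1 = 1" "norm e2 = 1" by (simp_all add: e1_def e2_def)
  have u1': "0 \<le> ip e1 (c a b - c a d)" and u2': "0 \<le> ip e2 (c a d - c a b)" using u1 u2 by (simp_all add: ip_add)
  have cq: "cross (c a d - c a b) (q - c a b) \<le> 0" using ori by (simp add: cross_eq algebra_simps)
  have right': "0 < cross (c a b - c a d) (z - c a d)" using right by (simp add: cross_eq algebra_simps)
  have "0 \<le> cross (q - c a b) (z - c a b)" by (rule cap_left[OF n(1) e12 right z1 u1 u2' q1 cq])
  moreover have "0 \<le> cross (z - c a d) (q - c a d)"
    by (rule cap_right[OF n(2) e12 right' z2 u2 u1' q2 less_imp_le[OF ori]])
  hence "0 \<le> cross (c a d - q) (z - q)" by (simp add: cross_eq algebra_simps)
  moreover note off = off_tri[OF g f(1)] and ds = contacts_distinct[OF f(1)]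
  have "c d a = c a d" using c_sym ad by simp
  moreover have "cross (q - c a b) (z - c a b) \<noteq> 0" "cross (c a d - q) (z - q) \<noteq> 0"
    using off(2,3) ds \<open>c d a = c a d\<close> by (auto simp: off_line_def q_def)
  moreover have "0 < cross (c a b - c d a) (z - c d a)" using right \<open>c d a = c a d\<close> by (simp add: cross_eq algebra_simps)
  ultimately show ?thesis unfolding tri_def using turn_inside[OF off] by (simp add: q_def)
qed

text \<open>A point to the left of all sides is inside the polygon; a point to the right of some
  side is in a cap, hence in a contact triangle. The side belonging to the outer face has no inner
  triangle beyond it, so its cap is excluded by the hypothesis \<open>left\<close>.\<close>

lemma contribution:
  assumes g: "generic z" and z: "z \<in> interior (Q a)" and a: "a \<in> verts F"
    and left: "\<And>b. (a, b) \<in> Out \<Longrightarrow> 0 < cross (c a (nx F a b) - c a b) (z - c a b)"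
  shows "2 * pi \<le> poly z a \<or> (\<exists>b d. (a, b, d) \<in> F \<and> (a, b) \<notin> Out \<and> tri z a b d = 2 * pi)"
proof (cases "\<forall>b\<in>nb F a. 0 < cross (c a (nx F a b) - c a b) (z - c a b)")
  case True
  have "0 < poly z a" unfolding poly_def
  proof (rule sum_pos[OF finite_nb])
    show "nb F a \<noteq> {}" using verts_adj[OF a] by (auto simp: nb_def)
    show "0 < sees z (c a b) (c a (nx F a b))" if "b \<in> nb F a" for b
      using True that sees_pos_iff[of "c a b" z "c a (nx F a b)"] generic_ne[OF g, of a b] by (auto simp: nb_def)
  qed
  moreover obtain k :: int where k: "poly z a = 2 * pi * of_int k" using poly_int[OF g] by blast
  ultimately have "0 < k" by (simp add: zero_less_mult_iff)
  hence "1 \<le> (of_int k :: real)" by simp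
  thus ?thesis unfolding k by simp
next
  case False
  then obtain b where b: "adj F a b" "\<not> 0 < cross (c a (nx F a b) - c a b) (z - c a b)" by (auto simp: nb_def)
  define d where "d = nx F a b"
  have f: "(a, b, d) \<in> F" using nx_face[OF b(1)] by (simp add: d_def)
  have o: "(a, b) \<notin> Out" using left b by blast
  have "c a d \<noteq> c a b" using contacts_distinct[OF f] c_sym[of a d] face_adj[OF f] by auto
  hence "cross (c a d - c a b) (z - c a b) < 0"
    using b(2) genericD[OF g b(1), of a d] face_adj[OF f] by (auto simp: off_line_def d_def)
  thus ?thesis using cap_in_triangle[OF g f o z] f o by blast
qed

definition star :: "'a \<Rightarrow> 'a faces" where
  "star a = {(x, y, w). (x, y, w) \<in> F \<and> (x, y) \<notin> Out \<and> (x = a \<or> y = a \<or> w = a)}"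

text \<open>6 pi times the number of times that the polygon of \<open>a\<close> and its inner
  contact triangles cover \<open>z\<close>; the polygon is tripled because each triangle is listed
  in three rotations.\<close>

definition weight :: "complex \<Rightarrow> 'a \<Rightarrow> real" where
  "weight z a = 3 * poly z a + (\<Sum>(x, y, w)\<in>star a. tri z x y w)"

lemma star_sub: "star a \<subseteq> F" "finite (star a)"
  using finite_subset[OF _ finF, of "star a"] by (auto simp: star_def)

lemma tri_star_nonneg: "generic z \<Longrightarrow> i \<in> star a \<Longrightarrow> 0 \<le> (case i of (x, y, w) \<Rightarrow> tri z x y w)"
  using tri_in by (fastforce simp: star_def)

lemma weight_ge:
  assumes g: "generic z" and z: "z \<in> interior (Q a)" and a: "a \<in> verts F"
    and left: "\<And>b. (a, b) \<in> Out \<Longrightarrow> 0 < cross (c a (nx F a b) - c a b) (z - c a b)"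
  shows "6 * pi \<le> weight z a"
proof -
  have s: "0 \<le> (\<Sum>(x, y, w)\<in>star a. tri z x y w)" by (rule sum_nonneg[OF tri_star_nonneg[OF g]])
  consider "2 * pi \<le> poly z a" | b d where "(a, b, d) \<in> F" "(a, b) \<notin> Out" "tri z a b d = 2 * pi"
    using contribution[OF g z a left] by blast
  thus ?thesis
  proof cases
    case 1
    thus ?thesis using s by (simp add: weight_def)
  next
    case 2
    have n: "a \<noteq> b" "b \<noteq> d" "a \<noteq> d" using neqs[OF 2(1)] by auto
    have "(\<Sum>(x, y, w)\<in>{(a, b, d), (b, d, a), (d, a, b)}. tri z x y w) \<le> (\<Sum>(x, y, w)\<in>star a. tri z x y w)"
    proof (rule sum_mono2[OF star_sub(2)])
      show "{(a, b, d), (b, d, a), (d, a, b)} \<subseteq> star a"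
        using 2 rot[OF 2(1)] rot2[OF 2(1)] Out_rot[OF 2(1,2)] by (auto simp: star_def)
      show "0 \<le> (case i of (x, y, w) \<Rightarrow> tri z x y w)" if "i \<in> star a - {(a, b, d), (b, d, a), (d, a, b)}" for i
        by (rule tri_star_nonneg[OF g]) (use that in blast)
    qed
    moreover have "(\<Sum>(x, y, w)\<in>{(a, b, d), (b, d, a), (d, a, b)}. tri z x y w) = 6 * pi"
      using n 2(3) tri_rot[of z a b d] tri_rot[of z b d a] by simp
    ultimately show ?thesis using poly_nonneg[OF g, of a] by (simp add: weight_def)
  qed
qed

text \<open>Vertices that are not adjacent share no face, so their stars are disjoint. Everything
  that is dropped from the identity \<open>total\<close> is nonnegative, and the outer triangle
  remains on the right-hand side.\<close>

lemma weight_sum: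
  assumes g: "generic z" and A: "A \<subseteq> verts F" "\<And>a a'. a \<in> A \<Longrightarrow> a' \<in> A \<Longrightarrow> \<not> adj F a a'"
  shows "(\<Sum>a\<in>A. weight z a) \<le> - 3 * tri z o1 o2 o3"
proof -
  have fA: "finite A" using A(1) finite_verts finite_subset by blast
  let ?O = "{(o1, o2, o3), (o2, o3, o1), (o3, o1, o2)}"
  let ?t = "\<lambda>(x, y, w). tri z x y w"
  have OF: "?O \<subseteq> F" using out rot[OF out] rot2[OF out] by auto
  have inn: "(x, y) \<notin> Out" if "(x, y, w) \<in> F - ?O" for x y w
    using that nx_eq[OF out] nx_eq[OF rot[OF out]] nx_eq[OF rot2[OF out]] nx_eq[of x y w] by (auto simp: Out_def)
  have nn: "0 \<le> ?t i" if "i \<in> F - ?O" for i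
  proof -
    obtain x y w where "i = (x, y, w)" by (cases i) auto
    thus ?thesis using that inn[of x y w] tri_in[OF g, of x y w] by auto
  qed
  have dis: "star a \<inter> star a' = {}" if "a \<in> A" "a' \<in> A" "a \<noteq> a'" for a a'
    using A(2)[OF that(1,2)] that(3) face_adj by (fastforce simp: star_def)
  have "(\<Sum>a\<in>A. \<Sum>i\<in>star a. ?t i) = (\<Sum>i\<in>(\<Union>a\<in>A. star a). ?t i)"
    by (rule sum.UNION_disjoint[symmetric]) (use fA star_sub dis in auto)
  also have "\<dots> \<le> (\<Sum>i\<in>F - ?O. ?t i)"
    by (rule sum_mono2) (use finF nn in \<open>auto simp: star_def Out_def\<close>)
  also have "\<dots> = (\<Sum>i\<in>F. ?t i) - (\<Sum>i\<in>?O. ?t i)" by (rule sum_diff[OF finF OF])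
  also have "(\<Sum>i\<in>?O. ?t i) = 3 * tri z o1 o2 o3"
    using neqs[OF out] tri_rot[of z o1 o2 o3] tri_rot[of z o2 o3 o1] by simp
  finally have "(\<Sum>a\<in>A. \<Sum>i\<in>star a. ?t i) \<le> (\<Sum>i\<in>F. ?t i) - 3 * tri z o1 o2 o3" .
  moreover have "(\<Sum>a\<in>A. poly z a) \<le> (\<Sum>a\<in>verts F. poly z a)"
    by (rule sum_mono2[OF finite_verts A(1)]) (use poly_nonneg[OF g] in auto)
  moreover have "(\<Sum>a\<in>A. weight z a) = 3 * (\<Sum>a\<in>A. poly z a) + (\<Sum>a\<in>A. \<Sum>i\<in>star a. ?t i)"
    by (simp add: weight_def sum.distrib sum_distrib_left)
  ultimately show ?thesis using total[OF g] by linarith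
qed

lemma not_adj_self: "\<not> adj F a a"
  using adj_verts by blast

lemma weight_upper:
  assumes "generic z" "a \<in> verts F"
  shows "weight z a \<le> - 3 * tri z o1 o2 o3"
  using weight_sum[OF assms(1), of "{a}"] assms(2) not_adj_self by simp

lemma weight_two:
  assumes "generic z" "a \<in> verts F" "b \<in> verts F" "a \<noteq> b" "\<not> adj F a b"
  shows "weight z a + weight z b \<le> - 3 * tri z o1 o2 o3"
  using weight_sum[OF assms(1), of "{a, b}"] assms not_adj_self adj_sym by fastforce

lemma tri_out_cases: "generic z \<Longrightarrow> tri z o1 o2 o3 = 0 \<or> tri z o1 o2 o3 = - 2 * pi"
  using tri_out[OF _ out] by (simp add: Out_def)

text \<open>The weight is positive and bounded by the turn of the outer triangle, which therefore is
  not 0: the point lies inside the outer contact triangle.\<close>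

lemma inner_vertex:
  assumes g: "generic z" and v: "v \<in> verts F - {o1, o2, o3}" and z: "z \<in> interior (Q v)"
  shows "tri z o1 o2 o3 = - 2 * pi" "6 * pi \<le> weight z v"
proof -
  show "6 * pi \<le> weight z v" by (rule weight_ge[OF g z]) (use v in \<open>auto simp: Out_def\<close>)
  hence "tri z o1 o2 o3 \<noteq> 0" using weight_upper[OF g, of v] v pi_gt_zero by force
  thus "tri z o1 o2 o3 = - 2 * pi" using tri_out_cases[OF g] by blast
qed

text \<open>Supplies the hypothesis \<open>left\<close> of \<open>contribution\<close> at outer
  vertices: points inside the outer contact triangle are on the right side of its edges.\<close>

lemma outer_left:
  assumes g: "generic z" and t: "tri z o1 o2 o3 = - 2 * pi" and o: "(a, b) \<in> Out"
  shows "0 < cross (c a (nx F a b) - c a b) (z - c a b)"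
proof -
  define d where "d = nx F a b"
  have ab: "adj F a b" using o face_adj[OF out] by (auto simp: Out_def)
  have f: "(a, b, d) \<in> F" using nx_face[OF ab] by (simp add: d_def)
  have "tri z a b d = - 2 * pi"
    using o t tri_rot[of z o1 o2 o3] tri_rot[of z o2 o3 o1] nx_eq[OF out] nx_eq[OF rot[OF out]] nx_eq[OF rot2[OF out]]
    by (auto simp: Out_def d_def)
  hence "cross (c a b - c d a) (z - c d a) < 0" using turn_neg(1)[OF off_tri[OF g f]] by (simp add: tri_def)
  moreover have "c d a = c a d" using c_sym face_adj[OF f] by simp
  ultimately show ?thesis unfolding d_def[symmetric] by (simp add: cross_eq algebra_simps)
qed

text \<open>Adjacent bodies lie on opposite sides of the common support line at their contact. For
  others a common generic point would have total weight 12 pi, twice what the outer triangle admits.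
  As the outer vertices are mutually adjacent, one of the two bodies is an inner one, which puts the
  point inside the outer triangle.\<close>

lemma interiors_disjoint:
  assumes ab: "a \<in> verts F" "b \<in> verts F" "a \<noteq> b"
  shows "interior (Q a) \<inter> interior (Q b) = {}"
proof (rule ccontr)
  assume ne: "interior (Q a) \<inter> interior (Q b) \<noteq> {}"
  show False
  proof (cases "adj F a b")
    case True
    obtain z where z: "z \<in> interior (Q a)" "z \<in> interior (Q b)" using ne by blast
    have "ip (cis (\<theta> a b)) (z - c a b) < 0" "ip (cis (\<theta> b a)) (z - c b a) < 0"
      using interior_strict True adj_sym[OF True] z by auto
    thus False using opp_dir[OF True] c_sym[OF True] by (simp add: ip_add)
  next
    case False
    obtain z where z: "z \<in> interior (Q a)" "z \<in> interior (Q b)" "generic z"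
      using ex_generic[of "interior (Q a) \<inter> interior (Q b)"] ne by auto
    have t: "tri z o1 o2 o3 = - 2 * pi"
    proof (cases "a \<in> {o1, o2, o3}")
      case True
      hence "b \<notin> {o1, o2, o3}" using False ab(3) face_adj[OF out] by auto
      thus ?thesis using inner_vertex(1)[OF z(3) _ z(2)] ab by blast
    next
      case False
      thus ?thesis using inner_vertex(1)[OF z(3) _ z(1)] ab by blast
    qed
    have "6 * pi \<le> weight z a" "6 * pi \<le> weight z b"
      using weight_ge[OF z(3,1) ab(1) outer_left[OF z(3) t]] weight_ge[OF z(3,2) ab(2) outer_left[OF z(3) t]] by auto
    thus False using weight_two[OF z(3) ab False] t pi_gt_zero by simp
  qed
qed

lemma inner_norm_bound:
  assumes v: "v \<in> verts F - {o1, o2, o3}" and z: "z \<in> interior (Q v)"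
    and M: "norm (c o1 o2) \<le> M" "norm (c o2 o3) \<le> M" "norm (c o3 o1) \<le> M"
  shows "norm z \<le> M"
proof (rule ccontr)
  assume "\<not> norm z \<le> M"
  hence "interior (Q v) \<inter> - cball 0 M \<noteq> {}" using z by auto
  then obtain w where w: "w \<in> interior (Q v)" "w \<notin> cball 0 M" "generic w"
    using ex_generic[of "interior (Q v) \<inter> - cball 0 M"] by force
  have "turn w (c o3 o1) (c o1 o2) (c o2 o3) = - 2 * pi"
    using inner_vertex(1)[OF w(3) v w(1)] by (simp add: tri_def)
  from triangle_norm_bound[OF turn_neg[OF off_tri[OF w(3) out] this] M(3,1,2)] show False using w(2) by simp
qed

text \<open>The sides shared by the polygon of \<open>u\<close> and its triangles cancel. What
  remains is the closed polygon that runs from \<open>c u b\<close> to \<open>c b (nx F u b)\<close>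
  and on to \<open>c u (nx F u b)\<close>, that is, through the bodies of the neighbours of
  \<open>u\<close>.\<close>

lemma weight_ring:
  assumes g: "generic z" and u: "u \<in> verts F - {o1, o2, o3}"
  shows "weight z u = 3 * (\<Sum>b\<in>nb F u. sees z (c u b) (c b (nx F u b)) + sees z (c b (nx F u b)) (c u (nx F u b)))"
proof -
  let ?t = "\<lambda>x y w. tri z x y w"
  have first: "(\<Sum>(x, y, w)\<in>F. of_bool (x = u) * ?t x y w) = (\<Sum>b\<in>nb F u. ?t u b (nx F u b))"
  proof -
    have "(\<Sum>(x, y, w)\<in>F. of_bool (x = u) * ?t x y w) = (\<Sum>(x, y)\<in>darts F. of_bool (x = u) * ?t x y (nx F x y))"
      unfolding sum_darts by (rule sum.cong) (auto dest: nx_eq)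
    also have "\<dots> = (\<Sum>x\<in>verts F. of_bool (x = u) * (\<Sum>b\<in>nb F x. ?t x b (nx F x b)))"
      by (simp add: sum_verts sum_distrib_left)
    also have "\<dots> = (\<Sum>x\<in>verts F. if x = u then (\<Sum>b\<in>nb F x. ?t x b (nx F x b)) else 0)"
      by (rule sum.cong) auto
    finally show ?thesis using u finite_verts by simp
  qed
  have "(\<Sum>(x, y, w)\<in>star u. ?t x y w) = (\<Sum>(x, y, w)\<in>F. of_bool (x = u) * ?t x y w + of_bool (y = u) * ?t x y w + of_bool (w = u) * ?t x y w)"
  proof (rule sum.mono_neutral_cong_left[OF finF star_sub(1)])
    show "\<forall>i\<in>F - star u. (case i of (x, y, w) \<Rightarrow> of_bool (x = u) * ?t x y w + of_bool (y = u) * ?t x y w + of_bool (w = u) * ?t x y w) = 0"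
    proof
      fix i assume i: "i \<in> F - star u"
      obtain x y w where xyw: "i = (x, y, w)" by (cases i) auto
      have "u \<noteq> x \<and> u \<noteq> y \<and> u \<noteq> w"
      proof (cases "(x, y) \<in> Out")
        case True
        hence "{x, y, w} = {o1, o2, o3}"
          using i nx_eq[of x y w] nx_eq[OF out] nx_eq[OF rot[OF out]] nx_eq[OF rot2[OF out]] unfolding xyw Out_def by auto
        thus ?thesis using u by auto
      next
        case False
        thus ?thesis using i unfolding xyw star_def by auto
      qed
      thus "(case i of (x, y, w) \<Rightarrow> of_bool (x = u) * ?t x y w + of_bool (y = u) * ?t x y w + of_bool (w = u) * ?t x y w) = 0"
        by (auto simp: xyw)
    qed
    show "(case i of (x, y, w) \<Rightarrow> ?t x y w) = (case i of (x, y, w) \<Rightarrow> of_bool (x = u) * ?t x y w + of_bool (y = u) * ?t x y w + of_bool (w = u) * ?t x y w)"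
      if "i \<in> star u" for i
    proof -
      obtain x y w where xyw: "i = (x, y, w)" by (cases i) auto
      have "(x, y, w) \<in> F" "x = u \<or> y = u \<or> w = u" using that unfolding xyw star_def by auto
      thus ?thesis using neqs[of x y w] unfolding xyw by auto
    qed
  qed
  also have "\<dots> = (\<Sum>(x, y, w)\<in>F. of_bool (x = u) * ?t x y w) + (\<Sum>(x, y, w)\<in>F. of_bool (y = u) * ?t x y w) + (\<Sum>(x, y, w)\<in>F. of_bool (w = u) * ?t x y w)"
    by (simp only: sum.distrib case_prod_unfold)
  also have "(\<Sum>(x, y, w)\<in>F. of_bool (y = u) * ?t x y w) = (\<Sum>(x, y, w)\<in>F. of_bool (x = u) * ?t x y w)"
    using sum_rot[of "\<lambda>x y w. of_bool (x = u) * ?t x y w"] by (simp add: tri_rot)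
  also have "(\<Sum>(x, y, w)\<in>F. of_bool (w = u) * ?t x y w) = (\<Sum>(x, y, w)\<in>F. of_bool (x = u) * ?t x y w)"
    using sum_rot[of "\<lambda>x y w. of_bool (w = u) * ?t x y w"] by (simp add: tri_rot)
  finally have "weight z u = 3 * (\<Sum>b\<in>nb F u. sees z (c u b) (c u (nx F u b)) + ?t u b (nx F u b))"
    unfolding first by (simp add: weight_def poly_def sum.distrib)
  also have "(\<Sum>b\<in>nb F u. sees z (c u b) (c u (nx F u b)) + ?t u b (nx F u b)) =
    (\<Sum>b\<in>nb F u. sees z (c u b) (c b (nx F u b)) + sees z (c b (nx F u b)) (c u (nx F u b)))"
  proof (rule sum.cong[OF refl])
    fix b assume "b \<in> nb F u"
    hence f: "(u, b, nx F u b) \<in> F" using nx_face by (simp add: nb_def)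
    have "c (nx F u b) u = c u (nx F u b)" using c_sym face_adj[OF f] by simp
    thus "sees z (c u b) (c u (nx F u b)) + ?t u b (nx F u b) = sees z (c u b) (c b (nx F u b)) + sees z (c b (nx F u b)) (c u (nx F u b))"
      using sees_flip[OF off_tri(1)[OF g f]] by (simp add: tri_def turn_def)
  qed
  finally show ?thesis .
qed

text \<open>The ring around \<open>u\<close> lies in bodies that \<open>B\<close> avoids, so its
  winding number is constant on \<open>B\<close>. But it is positive at generic interior points of
  body \<open>u\<close> and, since the weights of \<open>u\<close> and \<open>w\<close> share the
  bound 6 pi, not positive at those of body \<open>w\<close>.\<close>

lemma separated_by_ring:
  assumes u: "u \<in> verts F - {o1, o2, o3}" and w: "w \<in> verts F - {o1, o2, o3}" and uw: "u \<noteq> w" "\<not> adj F u w"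
    and B: "open B" "connected B" "B \<inter> interior (Q u) \<noteq> {}" "B \<inter> interior (Q w) \<noteq> {}"
    and free: "\<And>v. v \<in> verts F - {u, w} \<Longrightarrow> B \<inter> Q v = {}"
  shows False
proof -
  define ring where "ring z = (\<Sum>b\<in>nb F u. sees z (c u b) (c b (nx F u b)) + sees z (c b (nx F u b)) (c u (nx F u b)))" for z
  have seg: "z \<notin> closed_segment (c u b) (c b (nx F u b)) \<and> z \<notin> closed_segment (c b (nx F u b)) (c u (nx F u b))"
    if b: "b \<in> nb F u" and z: "z \<in> B" for b z
  proof -
    define d where "d = nx F u b"
    have f: "(u, b, d) \<in> F" using b nx_face by (simp add: nb_def d_def)
    note ad = face_adj[OF f]
    have "b \<in> verts F - {u, w}" "d \<in> verts F - {u, w}" using face_verts[OF f] neqs[OF f] uw ad by auto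
    hence zn: "z \<notin> Q b" "z \<notin> Q d" using free z by auto
    have cs: "c u b = c b u" "c b d = c d b" "c u d = c d u" using c_sym ad by auto
    have "closed_segment (c u b) (c b d) \<subseteq> Q b" 
      by (rule closed_segment_subset[OF _ _ convQ]) (use c_in[of b u] c_in[of b d] ad cs in auto)
    moreover have "closed_segment (c b d) (c u d) \<subseteq> Q d" 
      by (rule closed_segment_subset[OF _ _ convQ]) (use c_in[of d b] c_in[of d u] ad cs in auto)
    ultimately show ?thesis using zn unfolding d_def by blast
  qed
  have cont: "continuous_on B ring" unfolding ring_def using seg
    by (intro continuous_on_sum continuous_on_add sees_continuous) auto
  have int: "\<exists>k :: int. ring z = 2 * pi * of_int k" if z: "z \<in> B" for z
  proof -
    let ?f = "\<lambda>i. case i of Inl b \<Rightarrow> c u b | Inr b \<Rightarrow> c b (nx F u b)"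
    let ?g = "\<lambda>i. case i of Inl b \<Rightarrow> c b (nx F u b) | Inr b \<Rightarrow> c u (nx F u b)"
    have ne: "c u b \<noteq> z" "c b (nx F u b) \<noteq> z" "c u (nx F u b) \<noteq> z" if "b \<in> nb F u" for b
      using seg[OF that z] by auto
    have "\<exists>k :: int. (\<Sum>i\<in>nb F u <+> nb F u. sees z (?f i) (?g i)) = 2 * pi * of_int k"
    proof (rule sum_sees)
      have "(\<Prod>b\<in>nb F u. c u (nx F u b) - z) = (\<Prod>b\<in>nb F u. c u b - z)" by (rule prod.reindex_bij_betw[OF nx_bij])
      thus "(\<Prod>i\<in>nb F u <+> nb F u. ?f i - z) = (\<Prod>i\<in>nb F u <+> nb F u. ?g i - z)"
        by (simp add: prod.Plus finite_nb o_def mult.commute)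
    qed (use finite_nb ne in \<open>auto split: sum.split\<close>)
    thus ?thesis by (simp add: ring_def sum.Plus finite_nb o_def sum.distrib)
  qed
  obtain z1 where z1: "z1 \<in> B" "z1 \<in> interior (Q u)" "generic z1"
    using ex_generic[of "B \<inter> interior (Q u)"] B by auto
  obtain z2 where z2: "z2 \<in> B" "z2 \<in> interior (Q w)" "generic z2"
    using ex_generic[of "B \<inter> interior (Q w)"] B by auto
  have uv: "u \<in> verts F" "w \<in> verts F" using u w by auto
  have "2 * pi \<le> ring z1"
    using inner_vertex(2)[OF z1(3) u z1(2)] weight_ring[OF z1(3) u] by (simp add: ring_def)
  moreover have "ring z2 \<le> 0"
    using inner_vertex[OF z2(3) w z2(2)] weight_two[OF z2(3) uv uw] weight_ring[OF z2(3) u] by (simp add: ring_def)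
  moreover have "connected (ring ` B)" by (rule connected_continuous_image[OF cont B(2)])
  ultimately have "pi \<in> ring ` B"
    using connectedD_interval[of "ring ` B" "ring z2" "ring z1" pi] z1(1) z2(1) pi_gt_zero by auto
  then obtain z where "z \<in> B" "ring z = pi" by auto
  then obtain k :: int where "pi = 2 * pi * of_int k" using int by metis
  hence "(1 :: real) = 2 * of_int k" by simp
  hence "(1 :: int) = 2 * k" by linarith
  thus False by presburger
qed

end

section \<open>Approximation by bodies with bounded curvature\<close>

lemma ip_le_norm: "ip (cis t) z \<le> norm z"
  using complex_Re_le_cmod[of "cnj (cis t) * z"] by (simp add: ip_def norm_mult)

lemma ip_self: "ip z z = (norm z)\<^sup>2"
  unfolding cmod_power2 by (simp add: ip_eq power2_eq_square)

lemma norm_le_ip: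
  assumes "\<And>t. ip (cis t) z \<le> M"
  shows "norm z \<le> M"
proof -
  have "z = of_real (norm z) * cis (Arg z)" using rcis_cmod_Arg[of z] by (simp add: rcis_def)
  hence "ip (cis (Arg z)) z = norm z * ip (cis (Arg z)) (cis (Arg z))" by (metis ip_scale)
  thus ?thesis using assms[of "Arg z"] by (simp add: ip_cis)
qed

lemma continuous_ip: "continuous_on S (ip u)"
  unfolding ip_def by (intro continuous_intros)

text \<open>The intersection of discs of radius \<open>C\<close> is strictly curved: with two points it
  contains the lens spanned by them.\<close>

lemma disc_hull_minimizer:
  assumes ne: "y0 \<in> P" and C: "0 < C" and x: "\<And>y. y \<in> P \<Longrightarrow> norm (x - y) \<le> C" and x': "\<And>y. y \<in> P \<Longrightarrow> norm (x' - y) \<le> C"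
    and min: "\<And>w. (\<And>y. y \<in> P \<Longrightarrow> norm (w - y) \<le> C) \<Longrightarrow> ip (cis t) x \<le> ip (cis t) w"
  shows "norm (x + of_real C * cis t - x') \<le> C"
proof (rule ccontr)
  assume neg: "\<not> ?thesis"
  define d where "d = x' - x"
  define k where "k = ip (cis t) d"
  define D where "D = (norm d)\<^sup>2"
  have k0: "0 \<le> k" using min[OF x'] by (simp add: k_def d_def ip_add)
  have gen: "ip (x + of_real C * e - x') (x + of_real C * e - x') = C\<^sup>2 * ip e e - 2 * C * ip e d + ip d d" for e
    by (simp add: d_def ip_eq power2_eq_square algebra_simps)
  have "C\<^sup>2 < (norm (x + of_real C * cis t - x'))\<^sup>2" using neg C by (simp add: power_strict_mono)
  also have "\<dots> = C\<^sup>2 * ip (cis t) (cis t) - 2 * C * k + D"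
    unfolding ip_self[symmetric] D_def k_def by (rule gen)
  finally have Dk: "2 * C * k < D" by (simp add: ip_cis)
  have D0: "0 < D" using Dk k0 C by (meson le_less_trans mult_nonneg_nonneg less_imp_le zero_le_numeral)
  \<comment> \<open>By strict convexity the point at parameter \<open>\<tau>\<close> of the segment
    from \<open>x\<close> to \<open>x'\<close> has a slack \<open>\<tau> * (1 - \<tau>) * D\<close>
    in the squared distances, so it may be moved by \<open>\<sigma>\<close> against
    \<open>cis t\<close>. This undercuts the minimum as soon as
    \<open>2 * C * k < (1 - \<tau>) * D\<close>; the value chosen is half of the critical
    one.\<close>
  define \<tau> where "\<tau> = (D - 2 * C * k) / (2 * D)"
  have \<tau>: "0 < \<tau>" "\<tau> \<le> 1 / 2" using Dk D0 k0 C by (auto simp: \<tau>_def field_simps)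
  define \<sigma> where "\<sigma> = \<tau> * (1 - \<tau>) * D / (2 * C)"
  have "norm d \<le> norm (x' - y0) + norm (x - y0)"
    using norm_triangle_ineq4[of "x' - y0" "x - y0"] by (simp add: d_def)
  hence "norm d \<le> 2 * C" using x[OF ne] x'[OF ne] by linarith
  hence "D \<le> (2 * C)\<^sup>2" unfolding D_def by (intro power_mono) auto
  hence "D \<le> 4 * C * C" by (simp add: power2_eq_square)
  moreover have "\<tau> * (1 - \<tau>) \<le> 1 / 2 * 1" using \<tau> by (intro mult_mono) auto
  ultimately have "\<tau> * (1 - \<tau>) * D \<le> 1 / 2 * (4 * C * C)" using D0 \<tau> by (intro mult_mono) auto
  hence \<sigma>C: "\<sigma> \<le> C" using C by (simp add: \<sigma>_def field_simps)
  have \<sigma>0: "0 \<le> \<sigma>" using \<tau> D0 C by (simp add: \<sigma>_def)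
  define w where "w = x + of_real \<tau> * d - of_real \<sigma> * cis t"
  have "norm (w - y) \<le> C" if y: "y \<in> P" for y
  proof -
    have e: "(norm (x + of_real \<tau> * d - y))\<^sup>2 = (1 - \<tau>) * (norm (x - y))\<^sup>2 + \<tau> * (norm (x' - y))\<^sup>2 - \<tau> * (1 - \<tau>) * D"
      unfolding D_def d_def cmod_power2 by (simp add: power2_eq_square algebra_simps)
    have "(norm (x - y))\<^sup>2 \<le> C\<^sup>2" "(norm (x' - y))\<^sup>2 \<le> C\<^sup>2" using x[OF y] x'[OF y] by (auto intro: power_mono)
    hence "(1 - \<tau>) * (norm (x - y))\<^sup>2 \<le> (1 - \<tau>) * C\<^sup>2" "\<tau> * (norm (x' - y))\<^sup>2 \<le> \<tau> * C\<^sup>2"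
      using \<tau> by (auto intro!: mult_left_mono)
    hence "(norm (x + of_real \<tau> * d - y))\<^sup>2 \<le> C\<^sup>2 - \<tau> * (1 - \<tau>) * D" unfolding e by (simp add: algebra_simps)
    also have "\<dots> = C\<^sup>2 - 2 * C * \<sigma>" using C by (simp add: \<sigma>_def)
    also have "\<dots> \<le> (C - \<sigma>)\<^sup>2" by (simp add: power2_eq_square algebra_simps)
    finally have "norm (x + of_real \<tau> * d - y) \<le> C - \<sigma>" by (rule power2_le_imp_le) (use \<sigma>C in simp)
    moreover have "norm (w - y) \<le> norm (x + of_real \<tau> * d - y) + norm (of_real \<sigma> * cis t)"
      using norm_triangle_ineq4[of "x + of_real \<tau> * d - y" "of_real \<sigma> * cis t"] by (simp add: w_def algebra_simps)
    ultimately show ?thesis using \<sigma>0 by (simp add: norm_mult)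
  qed
  hence "ip (cis t) x \<le> ip (cis t) w" by (rule min)
  hence "\<sigma> \<le> \<tau> * k" by (simp add: w_def ip_add ip_scale ip_cis k_def)
  hence "\<tau> * ((1 - \<tau>) * D) \<le> \<tau> * (2 * C * k)" using C by (simp add: \<sigma>_def field_simps)
  hence "(1 - \<tau>) * D \<le> 2 * C * k" using \<tau>(1) by simp
  moreover have "(1 - \<tau>) * D = (D + 2 * C * k) / 2" using D0 by (simp add: \<tau>_def field_simps)
  ultimately show False using Dk by auto
qed

text \<open>Both chords lie in one cone of opening at most pi/2, so their inner product is
  nonnegative and neither is longer than their sum, a chord of the circle.\<close>

lemma support_chords_close:
  assumes p: "support_curve p" and q: "support_curve q" and sum: "\<And>t. p t + q t = of_real C * cis t"
    and st: "0 < s - t" "s - t \<le> pi / 2"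
  shows "norm (q s - q t) \<le> \<bar>C\<bar> * norm (cis s - cis t)"
proof -
  define a b where "a = p s - p t" and "b = q s - q t"
  have "ip (cis t) (p s - p t) \<le> 0" "ip (cis s) (p t - p s) \<le> 0" "ip (cis t) (q s - q t) \<le> 0" "ip (cis s) (q t - q s) \<le> 0"
    using p q by (auto simp: support_curve_def)
  hence nn: "0 \<le> - ip (cis t) a" "0 \<le> ip (cis s) a" "0 \<le> - ip (cis t) b" "0 \<le> ip (cis s) b" by (auto simp: a_def b_def ip_add)
  define a1 a2 b1 b2 where "a1 = ip (cis s) a" and "a2 = - ip (cis t) a" and "b1 = ip (cis s) b" and "b2 = - ip (cis t) b"
  have da: "of_real (sin (s - t)) * a = of_real a1 * (\<i> * cis t) + of_real a2 * (\<i> * cis s)"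
    using cone_decomposition[of s t a] by (simp add: a1_def a2_def)
  have db: "of_real (sin (s - t)) * b = of_real b1 * (\<i> * cis t) + of_real b2 * (\<i> * cis s)"
    using cone_decomposition[of s t b] by (simp add: b1_def b2_def)
  have cc: "ip (\<i> * cis x) (\<i> * cis y) = cos (y - x)" for x y by (simp add: ip_eq cos_diff algebra_simps)
  have sc: "ip (of_real r * u) v = r * ip u v" for r u v by (simp add: ip_eq algebra_simps)
  have "sin (s - t) * sin (s - t) * ip a b = ip (of_real (sin (s - t)) * a) (of_real (sin (s - t)) * b)" by (simp only: sc ip_scale mult.assoc)
  also have "\<dots> = a1 * b1 + a1 * b2 * cos (s - t) + a2 * b1 * cos (t - s) + a2 * b2"
    unfolding da db ip_add ip_scale sc cc by (simp add: algebra_simps)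
  also have "\<dots> \<ge> 0"
  proof -
    have "0 \<le> cos (s - t)" "cos (t - s) = cos (s - t)" using st cos_ge_zero[of "s - t"] cos_minus[of "s - t"] by auto
    moreover have "0 \<le> a1" "0 \<le> a2" "0 \<le> b1" "0 \<le> b2" using nn by (simp_all add: a1_def a2_def b1_def b2_def)
    ultimately show ?thesis by simp
  qed
  finally have "0 \<le> sin (s - t) * sin (s - t) * ip a b" .
  moreover have "0 < sin (s - t)" by (rule sin_gt_zero; use st pi_gt_zero in linarith)
  ultimately have "0 \<le> ip a b" by (meson mult_pos_pos not_le mult_pos_neg)
  have "a + b = of_real C * (cis s - cis t)"
  proof -
    have "a + b = (p s + q s) - (p t + q t)" by (simp add: a_def b_def)
    thus ?thesis by (simp add: sum right_diff_distrib)
  qed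
  moreover have "(norm (a + b))\<^sup>2 = (norm a)\<^sup>2 + 2 * ip a b + (norm b)\<^sup>2"
    unfolding ip_self[symmetric] by (simp add: ip_eq algebra_simps)
  ultimately have "(norm b)\<^sup>2 \<le> (norm (of_real C * (cis s - cis t)))\<^sup>2" using \<open>0 \<le> ip a b\<close> by simp
  hence "norm b \<le> norm (of_real C * (cis s - cis t))" by (rule power2_le_imp_le) simp
  thus ?thesis by (simp add: b_def norm_mult)
qed

lemma support_curves_continuous:
  assumes p: "support_curve p" and q: "support_curve q" and sum: "\<And>t. p t + q t = of_real C * cis t"
  shows "continuous_on UNIV q"
proof (rule continuous_at_imp_continuous_on, rule ballI)
  fix t :: real
  have b: "norm (q s - q t) \<le> \<bar>C\<bar> * norm (cis s - cis t)" if "\<bar>s - t\<bar> < pi / 2" for s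
  proof -
    consider "0 < s - t" | "s = t" | "0 < t - s" by linarith
    thus ?thesis
    proof cases
      case 1
      thus ?thesis using support_chords_close[OF p q sum, of s t] that by auto
    next
      case 3
      thus ?thesis using support_chords_close[OF p q sum, of t s] that by (auto simp: norm_minus_commute)
    qed auto
  qed
  have "(q \<longlongrightarrow> q t) (at t)"
  proof (rule LIM_zero_cancel, rule Lim_null_comparison)
    show "\<forall>\<^sub>F s in at t. norm (q s - q t) \<le> \<bar>C\<bar> * norm (cis s - cis t)"
      unfolding eventually_at using b pi_gt_zero by (intro exI[of _ "pi / 2"]) (auto simp: dist_norm)
    have "((\<lambda>s. \<bar>C\<bar> * norm (cis s - cis t)) \<longlongrightarrow> \<bar>C\<bar> * norm (cis t - cis t)) (at t)"
      by (intro tendsto_intros)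
    thus "((\<lambda>s. \<bar>C\<bar> * norm (cis s - cis t)) \<longlongrightarrow> 0) (at t)" by simp
  qed
  thus "isCont q t" by (simp add: isCont_def)
qed

text \<open>\<open>P'\<close> consists of the centres of the discs of radius \<open>C\<close> that
  contain \<open>P\<close>, and \<open>X e\<close> is its lowest point in the direction
  \<open>e\<close>. The curve \<open>q1\<close> bounds the intersection of these discs; enlarging it
  by \<open>\<epsilon>\<close> gives radii of curvature between \<open>\<epsilon>\<close> and
  \<open>C + \<epsilon>\<close>. The bound on \<open>R\<^sup>2\<close> lets a disc reaching only
  \<open>\<epsilon>\<close> beyond \<open>P\<close> in a given direction still contain
  \<open>P\<close>, so the support function grows by at most \<open>2 * \<epsilon>\<close> in
  all.\<close>

lemma round_approximation:
  assumes P: "compact P" "P \<noteq> {}" "P \<subseteq> cball 0 R" and \<epsilon>: "0 < \<epsilon>" and C: "0 < C" "\<epsilon> + 2 * R \<le> C" "R\<^sup>2 \<le> 2 * C * \<epsilon> - \<epsilon>\<^sup>2"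
  shows "\<exists>p. round_curve \<epsilon> (C + \<epsilon>) p \<and> (\<forall>z\<in>P. \<forall>t. ip (cis t) z \<le> ip (cis t) (p t)) \<and>
    (\<forall>t. \<exists>z\<in>P. ip (cis t) (p t) \<le> ip (cis t) z + 2 * \<epsilon>)"
proof -
  obtain y0 where y0: "y0 \<in> P" using P by blast
  have PR: "norm z \<le> R" if "z \<in> P" for z using P(3) that by auto
  hence R0: "0 \<le> R" using y0 norm_ge_zero order_trans by blast
  define P' where "P' = (\<Inter>y\<in>P. cball y C)"
  have P': "x \<in> P' \<longleftrightarrow> (\<forall>y\<in>P. norm (x - y) \<le> C)" for x by (auto simp: P'_def dist_norm norm_minus_commute)
  have "compact P'"
  proof -
    have "closed P'" unfolding P'_def by (intro closed_INT) auto
    moreover have "P' \<subseteq> cball y0 C" using y0 by (auto simp: P'_def)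
    ultimately show ?thesis using bounded_subset[OF bounded_cball] compact_eq_bounded_closed by blast
  qed
  moreover have "0 \<in> P'" unfolding P' using PR C R0 \<epsilon> by force
  ultimately have "\<exists>x\<in>P'. \<forall>w\<in>P'. ip e x \<le> ip e w" for e
    using continuous_attains_inf[of P' "ip e"] continuous_ip by blast
  hence "\<forall>e. \<exists>x. x \<in> P' \<and> (\<forall>w\<in>P'. ip e x \<le> ip e w)" by blast
  then obtain X where X: "\<And>e. X e \<in> P'" "\<And>e w. w \<in> P' \<Longrightarrow> ip e (X e) \<le> ip e w" by metis
  define q1 q2 where "q1 t = X (cis t) + of_real C * cis t" and "q2 t = - X (cis t)" for t
  have "norm (q1 s - x) \<le> C" if "x \<in> P'" for s x
    unfolding q1_def by (rule disc_hull_minimizer[OF y0 C(1)]) (use X P' that in auto)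
  have s1: "support_curve q1" unfolding support_curve_def
  proof (intro allI)
    fix s t
    have "ip (cis t) (q1 s - q1 t) = ip (cis t) (q1 s - X (cis t)) - C" by (simp add: q1_def ip_add ip_scale ip_cis)
    also have "\<dots> \<le> norm (q1 s - X (cis t)) - C" using ip_le_norm by simp
    also have "\<dots> \<le> 0" using \<open>\<And>x s. x \<in> P' \<Longrightarrow> norm (q1 s - x) \<le> C\<close>[OF X(1)] by simp
    finally show "ip (cis t) (q1 s - q1 t) \<le> 0" .
  qed
  have s2: "support_curve q2" unfolding support_curve_def
  proof (intro allI)
    fix s t
    have e: "q2 s - q2 t = X (cis t) - X (cis s)" by (simp add: q2_def)
    show "ip (cis t) (q2 s - q2 t) \<le> 0" unfolding e ip_add using X by simp
  qed
  have "continuous_on UNIV q2" by (rule support_curves_continuous[OF s1 s2, of C]) (simp add: q1_def q2_def)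
  define p where "p t = X (cis t) + of_real (C + \<epsilon>) * cis t" for t
  have "continuous_on UNIV (\<lambda>t. - q2 t + of_real (C + \<epsilon>) * cis t)"
    using \<open>continuous_on UNIV q2\<close> by (intro continuous_intros)
  moreover have "p = (\<lambda>t. - q2 t + of_real (C + \<epsilon>) * cis t)" by (auto simp: p_def q2_def)
  ultimately have pc: "continuous_on UNIV p" by simp
  have "(\<lambda>t. p t - of_real \<epsilon> * cis t) = q1" by (auto simp: p_def q1_def algebra_simps)
  moreover have "(\<lambda>t. of_real (C + \<epsilon>) * cis t - p t) = q2" by (auto simp: p_def q2_def)
  ultimately have "round_curve \<epsilon> (C + \<epsilon>) p" unfolding round_curve_def using s1 s2 pc \<epsilon> by (auto simp: p_def)
  moreover have ipp: "ip (cis t) (p t) = ip (cis t) (X (cis t)) + C + \<epsilon>" for t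
    unfolding p_def ip_add ip_scale ip_cis by simp
  have "ip (cis t) z \<le> ip (cis t) (p t)" if z: "z \<in> P" for z t
  proof -
    have "ip (cis t) (z - X (cis t)) \<le> norm (z - X (cis t))" by (rule ip_le_norm)
    also have "\<dots> \<le> C" using X(1)[of "cis t"] z P' by (simp add: norm_minus_commute)
    finally show ?thesis using ipp[of t] \<epsilon> by (simp add: ip_add)
  qed
  moreover have "\<exists>z\<in>P. ip (cis t) (p t) \<le> ip (cis t) z + 2 * \<epsilon>" for t
  proof -
    obtain z0 where z0: "z0 \<in> P" "\<And>z. z \<in> P \<Longrightarrow> ip (cis t) z \<le> ip (cis t) z0"
      using continuous_attains_sup[OF P(1,2) continuous_ip] by blast
    define h where "h = ip (cis t) z0"
    have "of_real (h + \<epsilon> - C) * cis t \<in> P'" unfolding P'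
    proof
      fix y assume y: "y \<in> P"
      define a b where "a = ip (cis t) y" and "b = cross (cis t) y"
      have ab: "a\<^sup>2 + b\<^sup>2 = (norm y)\<^sup>2"
      proof -
        have "a\<^sup>2 + b\<^sup>2 = (norm (cnj (cis t) * y))\<^sup>2" by (simp only: a_def b_def ip_def cross_def cmod_power2)
        thus ?thesis by (simp add: norm_mult)
      qed
      have "cnj (cis t) * (of_real r * cis t - y) = of_real r - cnj (cis t) * y" for r
        by (simp add: right_diff_distrib mult.left_commute cis_cnj cis_mult)
      hence nr: "norm (of_real r * cis t - y) = norm (of_real r - cnj (cis t) * y)" for r
        by (metis complex_mod_cnj mult_1 norm_cis norm_mult)
      have n: "(norm (of_real (h + \<epsilon> - C) * cis t - y))\<^sup>2 = (h + \<epsilon> - C - a)\<^sup>2 + b\<^sup>2"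
        unfolding nr cmod_power2 a_def b_def ip_def cross_def by (simp add: power2_commute del: of_real_add of_real_diff)
      have "a \<le> h" using z0(2)[OF y] by (simp add: a_def h_def)
      moreover have "\<bar>a\<bar> \<le> R" "\<bar>h\<bar> \<le> R"
      proof -
        have "\<bar>ip (cis t) w\<bar> \<le> norm w" for w
          using abs_Re_le_cmod[of "cnj (cis t) * w"] by (simp add: ip_def norm_mult)
        from order_trans[OF this PR[OF y]] order_trans[OF this PR[OF z0(1)]]
        show "\<bar>a\<bar> \<le> R" "\<bar>h\<bar> \<le> R" unfolding a_def h_def by auto
      qed
      ultimately have "0 \<le> C - \<epsilon> - (h - a)" "C - \<epsilon> - (h - a) \<le> C - \<epsilon>" using C by auto
      hence "(C - \<epsilon> - (h - a))\<^sup>2 \<le> (C - \<epsilon>)\<^sup>2" by (intro power_mono)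
      moreover have "(h + \<epsilon> - C - a)\<^sup>2 = (C - \<epsilon> - (h - a))\<^sup>2" by (simp add: power2_eq_square algebra_simps)
      moreover have "b\<^sup>2 \<le> R\<^sup>2"
      proof -
        have "b\<^sup>2 \<le> (norm y)\<^sup>2" using ab by (metis le_add_same_cancel2 zero_le_power2)
        also have "\<dots> \<le> R\<^sup>2" using PR[OF y] by (intro power_mono) auto
        finally show ?thesis .
      qed
      ultimately have "(norm (of_real (h + \<epsilon> - C) * cis t - y))\<^sup>2 \<le> (C - \<epsilon>)\<^sup>2 + R\<^sup>2" unfolding n by linarith
      also have "\<dots> \<le> C\<^sup>2" using C(3) by (simp add: power2_eq_square algebra_simps)
      finally show "norm (of_real (h + \<epsilon> - C) * cis t - y) \<le> C" by (rule power2_le_imp_le) (use C in simp)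
    qed
    from X(2)[OF this, of "cis t"] have "ip (cis t) (X (cis t)) \<le> h + \<epsilon> - C" unfolding ip_scale ip_cis by simp
    hence "ip (cis t) (p t) \<le> h + 2 * \<epsilon>" using ipp[of t] by linarith
    thus ?thesis using z0(1) unfolding h_def by blast
  qed
  ultimately show ?thesis by blast
qed

section \<open>Smooth bodies\<close>

text \<open>Uniqueness of the outer unit normal replaces differentiability of the boundary. Interior
  points have no normal, so nothing is demanded there.\<close>

definition smooth_body :: "complex set \<Rightarrow> bool" where
  "smooth_body P \<longleftrightarrow> compact P \<and> convex P \<and> interior P \<noteq> {} \<and>
    (\<forall>z\<in>P. \<forall>s t. (\<forall>w\<in>P. ip (cis s) (w - z) \<le> 0) \<longrightarrow> (\<forall>w\<in>P. ip (cis t) (w - z) \<le> 0) \<longrightarrow> cis s = cis t)"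

definition place :: "complex \<Rightarrow> real \<Rightarrow> complex set \<Rightarrow> complex set" where
  "place y r P = (\<lambda>z. of_real r * z + y) ` P"

lemma place_scaleR: "place y r P = (\<lambda>z. y + r *\<^sub>R z) ` P"
  unfolding place_def by (rule image_cong) (auto simp: scaleR_conv_of_real)

lemma compact_place: "compact P \<Longrightarrow> compact (place y r P)"
  unfolding place_def by (intro compact_continuous_image continuous_intros)

lemma convex_place: "convex P \<Longrightarrow> convex (place y r P)"
  unfolding place_scaleR by (rule convex_affinity)

lemma interior_place:
  assumes "z \<in> interior P" "r \<noteq> 0"
  shows "of_real r * z + y \<in> interior (place y r P)"
proof -
  have "open (place y r (interior P))" unfolding place_scaleR using assms(2) by (intro open_affinity) auto
  moreover have "place y r (interior P) \<subseteq> place y r P" using interior_subset by (auto simp: place_def)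
  ultimately have "place y r (interior P) \<subseteq> interior (place y r P)" by (rule interior_maximal[rotated])
  moreover have "of_real r * z + y \<in> place y r (interior P)" unfolding place_def using assms(1) by (rule imageI)
  ultimately show ?thesis by blast
qed

lemma place_place: "r \<noteq> 0 \<Longrightarrow> place (- y / of_real r) (1 / r) (place y r P) = P"
  by (auto simp: place_def image_image add_divide_distrib)

lemma interior_placeD:
  assumes "w \<in> interior (place y r P)" "r \<noteq> 0"
  shows "(w - y) / of_real r \<in> interior P"
proof -
  have "of_real (1 / r) * w + - y / of_real r \<in> interior (place (- y / of_real r) (1 / r) (place y r P))"
    by (rule interior_place) (use assms in auto)
  moreover have "of_real (1 / r) * w + - y / of_real r = (w - y) / of_real r" by (simp add: diff_divide_distrib)
  ultimately show ?thesis using place_place[OF assms(2), of y P] by simp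
qed

lemma smooth_place:
  assumes P: "smooth_body P" and r: "0 < r"
  shows "smooth_body (place y r P)"
  unfolding smooth_body_def
proof (intro conjI ballI allI impI)
  show "compact (place y r P)" "convex (place y r P)" using P by (auto simp: smooth_body_def compact_place convex_place)
  show "interior (place y r P) \<noteq> {}" using P r interior_place[of _ P r y] by (fastforce simp: smooth_body_def)
next
  fix z s t
  assume z: "z \<in> place y r P" and st: "\<forall>w\<in>place y r P. ip (cis s) (w - z) \<le> 0" "\<forall>w\<in>place y r P. ip (cis t) (w - z) \<le> 0"
  obtain z' where z': "z' \<in> P" "z = of_real r * z' + y" using z by (auto simp: place_def)
  have k: "ip (cis a) (w - z') \<le> 0" if "\<forall>w\<in>place y r P. ip (cis a) (w - z) \<le> 0" "w \<in> P" for a w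
  proof -
    have "ip (cis a) (of_real r * w + y - z) \<le> 0" using that by (auto simp: place_def)
    moreover have "of_real r * w + y - z = of_real r * (w - z')" by (simp add: z' right_diff_distrib)
    ultimately show ?thesis using r by (simp add: ip_scale mult_le_0_iff)
  qed
  show "cis s = cis t" using P z'(1) k[OF st(1)] k[OF st(2)] unfolding smooth_body_def by blast
qed

lemma separating_normal:
  assumes "convex A" "convex B" "interior A \<noteq> {}" "interior B \<noteq> {}" "interior A \<inter> interior B = {}" "z \<in> A" "z \<in> B"
  shows "\<exists>t. (\<forall>w\<in>A. ip (cis t) (w - z) \<le> 0) \<and> (\<forall>w\<in>B. ip (cis (t + pi)) (w - z) \<le> 0)"
proof -
  obtain a b where ab: "a \<noteq> 0" "\<forall>x\<in>interior A. a \<bullet> x \<le> b" "\<forall>x\<in>interior B. b \<le> a \<bullet> x"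
    using separating_hyperplane_sets[of "interior A" "interior B"] assms convex_interior by blast
  have A: "a \<bullet> x \<le> b" if "x \<in> A" for x
  proof -
    have "closure (interior A) \<subseteq> {x. a \<bullet> x \<le> b}" using ab(2) by (intro closure_minimal closed_halfspace_le) auto
    thus ?thesis using that closure_subset convex_closure_interior[OF assms(1,3)] by auto
  qed
  have B: "b \<le> a \<bullet> x" if "x \<in> B" for x
  proof -
    have "closure (interior B) \<subseteq> {x. b \<le> a \<bullet> x}"
      using ab(3) closed_halfspace_ge[where a = a and b = b] by (intro closure_minimal) auto
    thus ?thesis using that closure_subset convex_closure_interior[OF assms(2,4)] by auto
  qed
  have zb: "a \<bullet> z = b" using A[OF assms(6)] B[OF assms(7)] by simp
  define t where "t = Arg a"
  have "a = of_real (norm a) * cis t" using rcis_cmod_Arg[of a] by (simp add: rcis_def t_def)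
  hence "a \<bullet> x = norm a * ip (cis t) x" for x
    by (metis inner_mult_left inner_scaleR_left scaleR_conv_of_real ip_eq inner_complex_def)
  hence k: "a \<bullet> w - b = norm a * ip (cis t) (w - z)" for w using zb by (simp add: ip_add right_diff_distrib)
  have "ip (cis t) (w - z) \<le> 0" if "w \<in> A" for w
  proof -
    have "norm a * ip (cis t) (w - z) \<le> 0" using A[OF that] k[of w] by linarith
    thus ?thesis using ab(1) by (simp add: mult_le_0_iff)
  qed
  moreover have "ip (cis (t + pi)) (w - z) \<le> 0" if "w \<in> B" for w
  proof -
    have "0 \<le> norm a * ip (cis t) (w - z)" using B[OF that] k[of w] by linarith
    hence "0 \<le> ip (cis t) (w - z)" using ab(1) by (simp add: zero_le_mult_iff)
    moreover have "cis (t + pi) = - cis t" by (simp flip: cis_mult)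
    ultimately show ?thesis by (simp add: ip_add)
  qed
  ultimately show ?thesis by blast
qed

text \<open>Separating lines through \<open>z\<close> give opposite normals to any two of the
  bodies, and each body has just one normal at \<open>z\<close>; three unit vectors cannot be
  pairwise opposite.\<close>

lemma no_triple_point:
  assumes "smooth_body A" "smooth_body B" "smooth_body C"
    and "interior A \<inter> interior B = {}" "interior A \<inter> interior C = {}" "interior B \<inter> interior C = {}"
    and "z \<in> A" "z \<in> B" "z \<in> C"
  shows False
proof -
  have s: "\<exists>t. (\<forall>w\<in>X. ip (cis t) (w - z) \<le> 0) \<and> (\<forall>w\<in>Y. ip (cis (t + pi)) (w - z) \<le> 0)"
    if "smooth_body X" "smooth_body Y" "interior X \<inter> interior Y = {}" "z \<in> X" "z \<in> Y" for X Y
    using separating_normal[of X Y z] that by (auto simp: smooth_body_def)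
  obtain a where a: "\<forall>w\<in>A. ip (cis a) (w - z) \<le> 0" "\<forall>w\<in>B. ip (cis (a + pi)) (w - z) \<le> 0" using s[OF assms(1,2,4,7,8)] by blast
  obtain b where b: "\<forall>w\<in>A. ip (cis b) (w - z) \<le> 0" "\<forall>w\<in>C. ip (cis (b + pi)) (w - z) \<le> 0" using s[OF assms(1,3,5,7,9)] by blast
  obtain c where c: "\<forall>w\<in>B. ip (cis c) (w - z) \<le> 0" "\<forall>w\<in>C. ip (cis (c + pi)) (w - z) \<le> 0" using s[OF assms(2,3,6,8,9)] by blast
  have u: "cis s = cis t" if "smooth_body X" "z \<in> X" "\<forall>w\<in>X. ip (cis s) (w - z) \<le> 0" "\<forall>w\<in>X. ip (cis t) (w - z) \<le> 0" for X s t
    using that unfolding smooth_body_def by blast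
  have "cis a = cis b" "cis (a + pi) = cis c" "cis (b + pi) = cis (c + pi)"
    using u[OF assms(1,7) a(1) b(1)] u[OF assms(2,8) a(2) c(1)] u[OF assms(3,9) b(2) c(2)] by auto
  hence "cis a = - cis a" by (simp flip: cis_mult)
  thus False by simp
qed

lemma mem_by_support:
  assumes P: "closed P" "convex P" and z: "\<And>t. \<exists>w\<in>P. ip (cis t) z \<le> ip (cis t) w"
  shows "z \<in> P"
proof (rule ccontr)
  assume "z \<notin> P"
  then obtain a b where ab: "a \<bullet> z < b" "\<forall>x\<in>P. b < a \<bullet> x" using separating_hyperplane_closed_point[OF P(2,1)] by blast
  define t where "t = Arg (- a)"
  have "- a = of_real (norm a) * cis t" using rcis_cmod_Arg[of "- a"] by (simp add: rcis_def t_def)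
  hence k: "- (a \<bullet> x) = norm a * ip (cis t) x" for x
    by (metis inner_minus_left inner_scaleR_left scaleR_conv_of_real ip_eq inner_complex_def)
  obtain w where w: "w \<in> P" "ip (cis t) z \<le> ip (cis t) w" using z by blast
  hence "norm a * ip (cis t) z \<le> norm a * ip (cis t) w" by (intro mult_left_mono) auto
  hence "a \<bullet> w \<le> a \<bullet> z" using k[of z] k[of w] by linarith
  thus False using ab w by force
qed

section \<open>Approximate packings\<close>

context triangulation
begin

text \<open>\<open>B v\<close> is the round body around the copy of \<open>P v\<close>; the
  inequality with \<open>e\<close> compares their support functions. The last clause is
  \<open>separated_by_ring\<close> for discs, in a form from which the limit can be treated.\<close>

definition approx_packing where
  "approx_packing o1 o2 o3 P R e y r B \<longleftrightarrow>
    (\<forall>v. 0 < r v) \<and> r o1 = 1 \<and> r o2 = 1 \<and> r o3 = 1 \<and> y o1 = 0 \<and> norm (y o2) \<le> 2 * (R + 2) \<and> norm (y o3) \<le> 2 * (R + 2) \<and>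
    (\<forall>v\<in>verts F. place (y v) (r v) (P v) \<subseteq> B v) \<and>
    (\<forall>v\<in>verts F. \<forall>z\<in>B v. \<forall>t. \<exists>w\<in>P v. ip (cis t) (z - y v) \<le> r v * (ip (cis t) w + 2 * e)) \<and>
    (\<forall>u\<in>verts F. \<forall>v\<in>verts F. u \<noteq> v \<longrightarrow> interior (B u) \<inter> interior (B v) = {}) \<and>
    (\<forall>u v. adj F u v \<longrightarrow> B u \<inter> B v \<noteq> {}) \<and>
    (\<forall>v\<in>verts F - {o1, o2, o3}. \<forall>z\<in>interior (B v). norm z \<le> 3 * (R + 2)) \<and>
    (\<forall>u\<in>verts F - {o1, o2, o3}. \<forall>w\<in>verts F - {o1, o2, o3}. \<forall>x d. u \<noteq> w \<longrightarrow> \<not> adj F u w \<longrightarrow>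
      ball x d \<inter> interior (B u) \<noteq> {} \<longrightarrow> ball x d \<inter> interior (B w) \<noteq> {} \<longrightarrow>
      (\<exists>v\<in>verts F - {u, w}. ball x d \<inter> B v \<noteq> {}))"

lemma ex_approx_packing:
  assumes out: "(o1, o2, o3) \<in> F" and sm: "\<And>v. v \<in> verts F \<Longrightarrow> smooth_body (P v)"
    and PR: "\<And>v. v \<in> verts F \<Longrightarrow> P v \<subseteq> cball 0 R" and e: "0 < e" "e \<le> 1"
  shows "\<exists>y r B. approx_packing o1 o2 o3 P R e y r B"
proof -
  have ov: "o1 \<in> verts F" "o2 \<in> verts F" "o3 \<in> verts F" using face_verts[OF out] by auto
  have Pne: "P v \<noteq> {}" if "v \<in> verts F" for v using sm[OF that] interior_subset by (fastforce simp: smooth_body_def)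
  have R0: "0 \<le> R" using PR[OF ov(1)] Pne[OF ov(1)] by (metis all_not_in_conv mem_cball_0 norm_ge_zero order_trans subsetD)
  \<comment> \<open>Large enough for \<open>round_approximation\<close>: the last summand serves for
    \<open>C3\<close>, the others for \<open>C1\<close> and \<open>C2\<close>.\<close>
  define C where "C = 1 + e + 2 * R + (R\<^sup>2 + e\<^sup>2) / (2 * e)"
  have q0: "0 \<le> (R\<^sup>2 + e\<^sup>2) / (2 * e)" using e by simp
  have C1: "0 < C" unfolding C_def using q0 R0 e by linarith
  have C2: "e + 2 * R \<le> C" unfolding C_def using q0 R0 e by linarith
  have "2 * e * ((R\<^sup>2 + e\<^sup>2) / (2 * e)) \<le> 2 * e * C" using R0 e unfolding C_def by (intro mult_left_mono) auto
  moreover have "2 * e * ((R\<^sup>2 + e\<^sup>2) / (2 * e)) = R\<^sup>2 + e\<^sup>2" using e by simp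
  ultimately have C3: "R\<^sup>2 \<le> 2 * C * e - e\<^sup>2" by (simp add: mult.commute mult.left_commute)
  have "\<forall>v\<in>verts F. \<exists>p. round_curve e (C + e) p \<and> (\<forall>z\<in>P v. \<forall>t. ip (cis t) z \<le> ip (cis t) (p t)) \<and>
    (\<forall>t. \<exists>z\<in>P v. ip (cis t) (p t) \<le> ip (cis t) z + 2 * e)"
    using round_approximation[OF _ Pne PR e(1) C1 C2 C3] sm by (auto simp: smooth_body_def)
  hence "\<exists>p. \<forall>v\<in>verts F. round_curve e (C + e) (p v) \<and> (\<forall>z\<in>P v. \<forall>t. ip (cis t) z \<le> ip (cis t) (p v t)) \<and>
    (\<forall>t. \<exists>z\<in>P v. ip (cis t) (p v t) \<le> ip (cis t) z + 2 * e)" by (rule bchoice)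
  then obtain p where p: "\<And>v. v \<in> verts F \<Longrightarrow> round_curve e (C + e) (p v)"
    "\<And>v z t. v \<in> verts F \<Longrightarrow> z \<in> P v \<Longrightarrow> ip (cis t) z \<le> ip (cis t) (p v t)"
    "\<And>v t. v \<in> verts F \<Longrightarrow> \<exists>z\<in>P v. ip (cis t) (p v t) \<le> ip (cis t) z + 2 * e" by blast
  have ps: "support_curve (p v)" if "v \<in> verts F" for v
    using support_curve_add[OF round_curveD(2)[OF p(1)[OF that]] support_curve_cis, of e] e by simp
  have pn: "norm (p v t) \<le> R + 2" if v: "v \<in> verts F" for v t
  proof (rule norm_le_ip)
    fix s
    have "ip (cis s) (p v t) \<le> ip (cis s) (p v s)" using ps[OF v] by (auto simp: support_curve_def ip_add)
    moreover obtain z where "z \<in> P v" "ip (cis s) (p v s) \<le> ip (cis s) z + 2 * e" using p(3)[OF v] by blast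
    moreover have "ip (cis s) z \<le> R" using ip_le_norm[of s z] PR[OF v] \<open>z \<in> P v\<close> by force
    ultimately show "ip (cis s) (p v t) \<le> R + 2" using e by linarith
  qed
  from ex_contact_system[of o1 o2 o3 e "C + e" p, OF out p(1)]
  obtain \<theta> \<gamma> r y where r0: "\<forall>v. 0 < r v" "r o1 = 1" "r o2 = 1" "r o3 = 1" "y o1 = 0"
    and cs: "contact_system F o1 o2 o3 (\<lambda>a b. y a + of_real (r a) * p a (\<theta> a b)) \<theta> \<gamma>"
    by auto
  note r = spec[OF r0(1)] r0(2-5)
  define c where "c a b = y a + of_real (r a) * p a (\<theta> a b)" for a b
  define B where "B v = {z. \<forall>t. ip (cis t) (z - (y v + of_real (r v) * p v t)) \<le> 0}" for v
  have Bint: "B v = (\<Inter>t. {z. cis t \<bullet> z \<le> cis t \<bullet> (y v + of_real (r v) * p v t)})" for v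
  proof -
    have "cis t \<bullet> z = ip (cis t) z" for t z by (simp add: ip_eq inner_complex_def)
    thus ?thesis unfolding B_def by (simp add: ip_add(4) set_eq_iff)
  qed
  have cB: "y v + of_real (r v) * p v s \<in> B v" if "v \<in> verts F" for v s
  proof -
    have "ip (cis t) (y v + of_real (r v) * p v s - (y v + of_real (r v) * p v t)) \<le> 0" for t
    proof -
      have "y v + of_real (r v) * p v s - (y v + of_real (r v) * p v t) = of_real (r v) * (p v s - p v t)" by (simp add: right_diff_distrib)
      moreover have "ip (cis t) (p v s - p v t) \<le> 0" using ps[OF that] by (simp add: support_curve_def)
      ultimately show ?thesis using r(1)[of v] by (simp only: ip_scale) (simp add: mult_nonneg_nonpos less_imp_le)
    qed
    thus ?thesis by (simp add: B_def)
  qed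
  interpret convex_contacts F o1 o2 o3 c \<theta> \<gamma> B
  proof unfold_locales
    show "contact_system F o1 o2 o3 c \<theta> \<gamma>" using cs unfolding c_def .
    show "c a b \<in> B a" if "adj F a b" for a b using cB adj_verts[OF that] by (simp add: c_def)
    show "ip (cis (\<theta> a b)) (z - c a b) \<le> 0" if "adj F a b" "z \<in> B a" for a b z using that by (simp add: B_def c_def)
    show "convex (B a)" for a unfolding Bint by (intro convex_INT convex_halfspace_le)
  qed (rule out)
  have adj: "adj F o1 o2" "adj F o2 o3" "adj F o1 o3" using face_adj[OF out] by auto
  have n1: "norm (c o1 b) \<le> R + 2" for b using pn[OF ov(1)] r by (simp add: c_def)
  have ny: "norm (y a) \<le> 2 * (R + 2)" if "adj F o1 a" "r a = 1" for a
  proof -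
    have "y a = c o1 a - p a (\<theta> a o1)" using c_sym[OF that(1)] that(2) by (simp add: c_def algebra_simps)
    thus ?thesis using norm_triangle_ineq4[of "c o1 a" "p a (\<theta> a o1)"] n1[of a] pn[of a "\<theta> a o1"] adj_verts[OF that(1)] by simp
  qed
  have "norm (c o2 o3) \<le> 3 * (R + 2)"
    using norm_triangle_ineq[of "y o2" "p o2 (\<theta> o2 o3)"] ny[OF adj(1) r(3)] pn[OF ov(2), of "\<theta> o2 o3"] r(3) by (simp add: c_def)
  moreover have "norm (c o1 o2) \<le> 3 * (R + 2)" "norm (c o3 o1) \<le> 3 * (R + 2)"
    using n1[of o2] n1[of o3] c_sym[OF adj(3)] R0 by auto
  ultimately have bound: "norm z \<le> 3 * (R + 2)" if "v \<in> verts F - {o1, o2, o3}" "z \<in> interior (B v)" for v z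
    using inner_norm_bound[OF that] by blast
  have sub: "place (y v) (r v) (P v) \<subseteq> B v" if v: "v \<in> verts F" for v
  proof
    fix z assume "z \<in> place (y v) (r v) (P v)"
    then obtain w where w: "w \<in> P v" "z = of_real (r v) * w + y v" by (auto simp: place_def)
    have "ip (cis t) (z - (y v + of_real (r v) * p v t)) \<le> 0" for t
    proof -
      have "z - (y v + of_real (r v) * p v t) = of_real (r v) * (w - p v t)" by (simp add: w right_diff_distrib)
      moreover have "ip (cis t) (w - p v t) \<le> 0" using p(2)[OF v w(1)] by (simp add: ip_add)
      ultimately show ?thesis using r(1)[of v] by (simp only: ip_scale) (simp add: mult_nonneg_nonpos less_imp_le)
    qed
    thus "z \<in> B v" by (simp add: B_def)
  qed
  have close: "\<exists>w\<in>P v. ip (cis t) (z - y v) \<le> r v * (ip (cis t) w + 2 * e)" if v: "v \<in> verts F" and z: "z \<in> B v" for v z t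
  proof -
    obtain w where w: "w \<in> P v" "ip (cis t) (p v t) \<le> ip (cis t) w + 2 * e" using p(3)[OF v] by blast
    have "ip (cis t) (z - (y v + of_real (r v) * p v t)) \<le> 0" using z by (simp add: B_def)
    hence "ip (cis t) (z - y v) \<le> r v * ip (cis t) (p v t)" by (simp add: ip_add ip_scale)
    also have "\<dots> \<le> r v * (ip (cis t) w + 2 * e)" using w(2) r(1)[of v] by (intro mult_left_mono) auto
    finally show ?thesis using w(1) by blast
  qed
  have tch: "B u \<inter> B v \<noteq> {}" if "adj F u v" for u v
    using c_in[OF that] c_in[OF adj_sym[OF that]] c_sym[OF that] by auto
  have ring: "\<exists>v\<in>verts F - {u, w}. ball x d \<inter> B v \<noteq> {}"
    if "u \<in> verts F - {o1, o2, o3}" "w \<in> verts F - {o1, o2, o3}" "u \<noteq> w" "\<not> adj F u w"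
      "ball x d \<inter> interior (B u) \<noteq> {}" "ball x d \<inter> interior (B w) \<noteq> {}" for u w x d
    using separated_by_ring[OF that(1-4) open_ball convex_connected[OF convex_ball] that(5,6)] by blast
  have "approx_packing o1 o2 o3 P R e y r B"
    unfolding approx_packing_def
    using r ny[OF adj(1) r(3)] ny[OF adj(3) r(4)] sub close interiors_disjoint tch bound ring by simp
  thus ?thesis by blast
qed

end

text \<open>\<open>Z\<close> is an exceptional set: its members may have contacts with vertices that
  are not adjacent to them.\<close>

definition contact_packing where
  "contact_packing F Z P y r \<longleftrightarrow> (\<forall>v\<in>verts F. 0 < r v) \<and>
    (\<forall>u\<in>verts F. \<forall>v\<in>verts F. u \<noteq> v \<longrightarrow> interior (place (y u) (r u) (P u)) \<inter> interior (place (y v) (r v) (P v)) = {}) \<and>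
    (\<forall>u v. adj F u v \<longrightarrow> place (y u) (r u) (P u) \<inter> place (y v) (r v) (P v) \<noteq> {}) \<and>
    (\<forall>u\<in>verts F - Z. \<forall>v\<in>verts F - Z. u \<noteq> v \<longrightarrow> \<not> adj F u v \<longrightarrow>
       place (y u) (r u) (P u) \<inter> place (y v) (r v) (P v) = {}) \<and>
    (\<forall>u\<in>verts F. \<forall>v\<in>verts F. \<forall>w\<in>verts F. u \<noteq> v \<and> u \<noteq> w \<and> v \<noteq> w \<longrightarrow>
       place (y u) (r u) (P u) \<inter> place (y v) (r v) (P v) \<inter> place (y w) (r w) (P w) = {})"

section \<open>Passage to the limit\<close>

context triangulation
begin

theorem ex_packing:
  assumes out: "(o1, o2, o3) \<in> F" and sm: "\<And>v. v \<in> verts F \<Longrightarrow> smooth_body (P v)"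
  shows "\<exists>y r. contact_packing F {o1, o2, o3} P y r"
proof -
  note ov = face_verts[OF out] and od = neqs[OF out]
  have cP: "compact (P v)" "convex (P v)" "P v \<noteq> {}" "interior (P v) \<noteq> {}" if "v \<in> verts F" for v
    using sm[OF that] interior_subset[of "P v"] by (auto simp: smooth_body_def)
  have "bounded (\<Union>v\<in>verts F. P v)" by (intro bounded_UN ballI compact_imp_bounded finite_verts cP(1))
  then obtain R where "\<forall>x\<in>(\<Union>v\<in>verts F. P v). norm x \<le> R" unfolding bounded_iff by blast
  hence PR: "P v \<subseteq> cball 0 R" if "v \<in> verts F" for v using that by auto
  have R0: "0 \<le> R" using PR[of o1] ov cP(3)[of o1] by (metis all_not_in_conv mem_cball_0 norm_ge_zero order_trans subsetD)
  define e where "e n = 1 / real (Suc n)" for n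
  have e: "0 < e n" "e n \<le> 1" for n by (auto simp: e_def)
  have "\<forall>n. \<exists>x. approx_packing o1 o2 o3 P R (e n) (fst x) (fst (snd x)) (snd (snd x))"
    using ex_approx_packing[OF out sm PR e] by fastforce
  then obtain X where X: "\<And>n. approx_packing o1 o2 o3 P R (e n) (fst (X n)) (fst (snd (X n))) (snd (snd (X n)))" by metis
  define y r B where "y n = fst (X n)" and "r n = fst (snd (X n))" and "B n = snd (snd (X n))" for n
  have ap: "approx_packing o1 o2 o3 P R (e n) (y n) (r n) (B n)" for n using X by (simp add: y_def r_def B_def)
  have r0: "0 < r n v" and ro: "r n o1 = 1" "r n o2 = 1" "r n o3 = 1"
    and yo: "y n o1 = 0" "norm (y n o2) \<le> 2 * (R + 2)" "norm (y n o3) \<le> 2 * (R + 2)" for n v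
    using ap[of n] unfolding approx_packing_def by auto
  have sub: "place (y n v) (r n v) (P v) \<subseteq> B n v" if "v \<in> verts F" for n v
    using ap[of n] that unfolding approx_packing_def by auto
  have close: "\<exists>w\<in>P v. ip (cis t) (z - y n v) \<le> r n v * (ip (cis t) w + 2 * e n)" if "v \<in> verts F" "z \<in> B n v" for n v z t
    using ap[of n] that unfolding approx_packing_def by auto
  have disj: "interior (B n u) \<inter> interior (B n v) = {}" if "u \<in> verts F" "v \<in> verts F" "u \<noteq> v" for n u v
    using ap[of n] that unfolding approx_packing_def by blast
  have tch: "B n u \<inter> B n v \<noteq> {}" if "adj F u v" for n u v
    using ap[of n] that unfolding approx_packing_def by blast
  have bnd: "norm z \<le> 3 * (R + 2)" if "v \<in> verts F - {o1, o2, o3}" "z \<in> interior (B n v)" for n v z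
    using ap[of n] that unfolding approx_packing_def by blast
  have ring: "\<exists>v\<in>verts F - {u, w}. ball x d \<inter> B n v \<noteq> {}"
    if "u \<in> verts F - {o1, o2, o3}" "w \<in> verts F - {o1, o2, o3}" "u \<noteq> w" "\<not> adj F u w"
      "ball x d \<inter> interior (B n u) \<noteq> {}" "ball x d \<inter> interior (B n w) \<noteq> {}" for n u w x d
    using ap[of n] that unfolding approx_packing_def by blast
  have intB: "of_real (r n v) * w + y n v \<in> interior (B n v)" if "v \<in> verts F" "w \<in> interior (P v)" for n v w
    using interior_place[OF that(2), of "r n v" "y n v"] r0[of n v] interior_mono[OF sub[OF that(1), of n]] by auto
  \<comment> \<open>The outer bodies are normalized. For the others, two fixed interior points of
    \<open>P v\<close> have images in a fixed disc, which bounds the scale and then the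
    position.\<close>
  have bdd: "\<exists>M. \<forall>n. norm (y n v) \<le> M \<and> r n v \<le> M" if v: "v \<in> verts F" for v
  proof (cases "v \<in> {o1, o2, o3}")
    case True
    have "norm (y n v) \<le> 2 * (R + 2) \<and> r n v \<le> 2 * (R + 2)" for n using True ro[of n] yo[of n] R0 by auto
    thus ?thesis by blast
  next
    case False
    hence v': "v \<in> verts F - {o1, o2, o3}" using v by blast
    obtain w where w: "w \<in> interior (P v)" using cP(4)[OF v] by blast
    then obtain \<eta> where \<eta>: "0 < \<eta>" "ball w \<eta> \<subseteq> interior (P v)" using open_interior open_contains_ball by blast
    define w' where "w' = w + of_real (\<eta> / 2)"
    have w': "w' \<in> interior (P v)" using \<eta> by (auto simp: w'_def dist_norm simp del: of_real_divide intro!: subsetD[OF \<eta>(2)])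
    define M where "M = 3 * (R + 2)"
    have rb: "r n v \<le> 4 * M / \<eta>" for n
    proof -
      have "norm ((of_real (r n v) * w' + y n v) - (of_real (r n v) * w + y n v)) \<le> M + M"
        using norm_triangle_ineq4 bnd[OF v' intB[OF v w']] bnd[OF v' intB[OF v w]] unfolding M_def by (meson add_mono order_trans)
      moreover have "(of_real (r n v) * w' + y n v) - (of_real (r n v) * w + y n v) = of_real (r n v * (\<eta> / 2))"
        by (simp add: w'_def algebra_simps)
      ultimately have "\<bar>r n v * (\<eta> / 2)\<bar> \<le> M + M" by (simp only: norm_of_real)
      thus ?thesis using \<eta>(1) r0[of n v] by (simp add: field_simps)
    qed
    have "norm (y n v) \<le> M + 4 * M / \<eta> * norm w" for n
    proof -
      have "norm (y n v) \<le> norm (of_real (r n v) * w + y n v) + norm (of_real (r n v) * w)"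
        using norm_triangle_ineq4[of "of_real (r n v) * w + y n v" "of_real (r n v) * w"] by simp
      also have "\<dots> \<le> M + 4 * M / \<eta> * norm w"
        using bnd[OF v' intB[OF v w], of n] mult_right_mono[OF rb[of n] norm_ge_zero[of w]] r0[of n v] unfolding M_def
        by (simp add: norm_mult)
      finally show ?thesis .
    qed
    thus ?thesis using rb by (intro exI[of _ "max (M + 4 * M / \<eta> * norm w) (4 * M / \<eta>)"]) (auto simp: le_max_iff_disj)
  qed
  have "bounded (range (\<lambda>n. (y n v, r n v)))" if v: "v \<in> verts F" for v
  proof -
    obtain M where M: "\<And>n. norm (y n v) \<le> M \<and> r n v \<le> M" using bdd[OF v] by blast
    have "norm (y n v, r n v) \<le> M + M" for n
      using norm_Pair_le[of "y n v" "r n v"] M[of n] r0[of n v] by simp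
    thus ?thesis by (auto intro: boundedI)
  qed
  from finite_convergent_subsequence[OF finite_verts this]
  obtain s l where s: "strict_mono (s :: nat \<Rightarrow> nat)" and l: "\<forall>v\<in>verts F. (\<lambda>k. (y (s k) v, r (s k) v)) \<longlonglongrightarrow> l v" by fast
  define Y \<rho> where "Y v = fst (l v)" and "\<rho> v = snd (l v)" for v
  have Yl: "(\<lambda>k. y (s k) v) \<longlonglongrightarrow> Y v" and rl: "(\<lambda>k. r (s k) v) \<longlonglongrightarrow> \<rho> v" if "v \<in> verts F" for v
    using tendsto_fst[OF bspec[OF l that]] tendsto_snd[OF bspec[OF l that]] by (auto simp: Y_def \<rho>_def)
  have el: "(\<lambda>k. e (s k)) \<longlonglongrightarrow> 0"
  proof -
    have "e \<longlonglongrightarrow> 0" unfolding e_def using LIMSEQ_inverse_real_of_nat by (simp add: divide_inverse)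
    from LIMSEQ_subseq_LIMSEQ[OF this s] show ?thesis by (simp add: o_def)
  qed
  have \<rho>0: "0 \<le> \<rho> v" if "v \<in> verts F" for v
    by (rule LIMSEQ_le_const[OF rl[OF that]]) (use r0 in \<open>auto intro: less_imp_le\<close>)
  have \<rho>o: "\<rho> o1 = 1" "\<rho> o2 = 1" "\<rho> o3 = 1"
    using rl[of o1] rl[of o2] rl[of o3] ov ro by (auto simp: LIMSEQ_const_iff)
  define Q where "Q v = place (Y v) (\<rho> v) (P v)" for v
  have Qc: "compact (Q v)" "convex (Q v)" if "v \<in> verts F" for v
    using cP[OF that] by (auto simp: Q_def compact_place convex_place)
  \<comment> \<open>Membership in the limit body is tested by support functions, and those of the
    round bodies exceed those of the copies by a vanishing amount.\<close>
  have limB: "z \<in> Q v" if v: "v \<in> verts F" and t: "strict_mono (t :: nat \<Rightarrow> nat)" and x: "\<And>k. x k \<in> B (s (t k)) v" "x \<longlonglongrightarrow> z" for v t x z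
  proof (rule mem_by_support[OF compact_imp_closed[OF Qc(1)[OF v]] Qc(2)[OF v]])
    fix a
    obtain w where w: "w \<in> P v" "\<And>w'. w' \<in> P v \<Longrightarrow> ip (cis a) w' \<le> ip (cis a) w"
      using continuous_attains_sup[OF cP(1,3)[OF v] continuous_ip] by blast
    have sq: "(\<lambda>k. f (t k)) \<longlonglongrightarrow> m" if "f \<longlonglongrightarrow> m" for f :: "nat \<Rightarrow> 'z :: topological_space" and m
      using LIMSEQ_subseq_LIMSEQ[OF that t] by (simp add: o_def)
    have "ip (cis a) (x k - y (s (t k)) v) \<le> r (s (t k)) v * (ip (cis a) w + 2 * e (s (t k)))" for k
    proof -
      obtain w' where "w' \<in> P v" "ip (cis a) (x k - y (s (t k)) v) \<le> r (s (t k)) v * (ip (cis a) w' + 2 * e (s (t k)))"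
        using close[OF v x(1)] by blast
      moreover have "r (s (t k)) v * (ip (cis a) w' + 2 * e (s (t k))) \<le> r (s (t k)) v * (ip (cis a) w + 2 * e (s (t k)))"
        using w(2)[OF \<open>w' \<in> P v\<close>] r0[of "s (t k)" v] by (intro mult_left_mono) auto
      ultimately show ?thesis by linarith
    qed
    moreover have "(\<lambda>k. ip (cis a) (x k - y (s (t k)) v)) \<longlonglongrightarrow> ip (cis a) (z - Y v)"
      unfolding ip_def by (intro tendsto_intros x(2) sq[OF Yl[OF v]])
    moreover have "(\<lambda>k. r (s (t k)) v * (ip (cis a) w + 2 * e (s (t k)))) \<longlonglongrightarrow> \<rho> v * (ip (cis a) w + 2 * 0)"
      by (intro tendsto_intros sq[OF rl[OF v]] sq[OF el])
    ultimately have "ip (cis a) (z - Y v) \<le> \<rho> v * (ip (cis a) w + 2 * 0)" by (intro LIMSEQ_le) auto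
    hence "ip (cis a) z \<le> ip (cis a) (of_real (\<rho> v) * w + Y v)" by (simp add: ip_add ip_scale)
    moreover have "of_real (\<rho> v) * w + Y v \<in> Q v" using w(1) unfolding Q_def place_def by (rule imageI)
    ultimately show "\<exists>w\<in>Q v. ip (cis a) z \<le> ip (cis a) w" by blast
  qed
  have ev: "\<forall>\<^sub>F k in sequentially. z \<in> interior (B (s k) v)" if v: "v \<in> verts F" and z: "z \<in> interior (Q v)" and p: "0 < \<rho> v" for v z
  proof -
    have "(z - Y v) / of_real (\<rho> v) \<in> interior (P v)" using interior_placeD z p by (simp add: Q_def)
    moreover have "(\<lambda>k. (z - y (s k) v) / of_real (r (s k) v)) \<longlonglongrightarrow> (z - Y v) / of_real (\<rho> v)"
      using p by (intro tendsto_intros Yl[OF v] rl[OF v]) auto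
    ultimately have "\<forall>\<^sub>F k in sequentially. (z - y (s k) v) / of_real (r (s k) v) \<in> interior (P v)"
      using topological_tendstoD open_interior by blast
    thus ?thesis
    proof (rule eventually_mono)
      fix k assume "(z - y (s k) v) / of_real (r (s k) v) \<in> interior (P v)"
      from intB[OF v this, of "s k"] show "z \<in> interior (B (s k) v)" using r0[of "s k" v] by simp
    qed
  qed
  have Qdisj: "interior (Q u) \<inter> interior (Q v) = {}" if uv: "u \<in> verts F" "v \<in> verts F" "u \<noteq> v" "0 < \<rho> u" "0 < \<rho> v" for u v
  proof (rule ccontr)
    assume "interior (Q u) \<inter> interior (Q v) \<noteq> {}"
    then obtain z where "z \<in> interior (Q u)" "z \<in> interior (Q v)" by blast
    hence "\<forall>\<^sub>F k in sequentially. z \<in> interior (B (s k) u) \<and> z \<in> interior (B (s k) v)"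
      using ev uv eventually_conj by blast
    then obtain k where "z \<in> interior (B (s k) u)" "z \<in> interior (B (s k) v)" unfolding eventually_sequentially by blast
    thus False using disj[OF uv(1-3), of "s k"] by blast
  qed
  have Bb: "\<exists>M. \<forall>n. \<forall>x\<in>B n v. norm x \<le> M" if v: "v \<in> verts F" for v
  proof -
    obtain M where M: "\<And>n. norm (y n v) \<le> M \<and> r n v \<le> M" using bdd[OF v] by blast
    have "norm x \<le> M + M * (R + 2)" if x: "x \<in> B n v" for n x
    proof -
      have "norm (x - y n v) \<le> M * (R + 2)"
      proof (rule norm_le_ip)
        fix t
        obtain w where w: "w \<in> P v" "ip (cis t) (x - y n v) \<le> r n v * (ip (cis t) w + 2 * e n)" using close[OF v x] by blast
        have "ip (cis t) w \<le> R" using ip_le_norm[of t w] PR[OF v] w(1) by force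
        hence "r n v * (ip (cis t) w + 2 * e n) \<le> r n v * (R + 2)" using e(2)[of n] r0[of n v] by (intro mult_left_mono) auto
        also have "\<dots> \<le> M * (R + 2)" using M[of n] R0 by (intro mult_right_mono) auto
        finally show "ip (cis t) (x - y n v) \<le> M * (R + 2)" using w(2) by linarith
      qed
      thus ?thesis using norm_triangle_ineq[of "y n v" "x - y n v"] M[of n] by simp
    qed
    thus ?thesis by blast
  qed
  have conv: "\<exists>z t. strict_mono (t :: nat \<Rightarrow> nat) \<and> (\<lambda>k. x (t k)) \<longlonglongrightarrow> z"
    if v: "v \<in> verts F" and x: "\<And>k. x k \<in> B (g k) v" for v x g
  proof -
    obtain M where "\<And>n w. w \<in> B n v \<Longrightarrow> norm w \<le> M" using Bb[OF v] by blast
    hence "bounded (range x)" using x by (auto intro!: boundedI)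
    from bounded_imp_convergent_subsequence[OF this] show ?thesis by (auto simp: o_def)
  qed
  have Qtch: "Q u \<inter> Q v \<noteq> {}" if uv: "adj F u v" for u v
  proof -
    have vv: "u \<in> verts F" "v \<in> verts F" using adj_verts[OF uv] by auto
    have "\<forall>k. \<exists>x. x \<in> B (s k) u \<and> x \<in> B (s k) v" using tch[OF uv] by blast
    then obtain x where x: "\<And>k. x k \<in> B (s k) u" "\<And>k. x k \<in> B (s k) v" by metis
    obtain z t where t: "strict_mono (t :: nat \<Rightarrow> nat)" "(\<lambda>k. x (t k)) \<longlonglongrightarrow> z" using conv[OF vv(1) x(1)] by force
    have "z \<in> Q u" "z \<in> Q v" using limB[OF vv(1) t(1) x(1) t(2)] limB[OF vv(2) t(1) x(2) t(2)] by auto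
    thus ?thesis by blast
  qed
  have sQ: "smooth_body (Q v)" if "v \<in> verts F" "0 < \<rho> v" for v unfolding Q_def by (rule smooth_place[OF sm[OF that(1)] that(2)])
  have triple: False if v: "a \<in> verts F" "b \<in> verts F" "c \<in> verts F" and n: "a \<noteq> b" "a \<noteq> c" "b \<noteq> c"
    and p: "0 < \<rho> a" "0 < \<rho> b" "0 < \<rho> c" and z: "z \<in> Q a" "z \<in> Q b" "z \<in> Q c" for a b c z
    by (rule no_triple_point[OF sQ[OF v(1) p(1)] sQ[OF v(2) p(2)] sQ[OF v(3) p(3)] Qdisj[OF v(1,2) n(1) p(1,2)] Qdisj[OF v(1,3) n(2) p(1,3)] Qdisj[OF v(2,3) n(3) p(2,3)] z])
  have \<rho>pos: "0 < \<rho> v" if v: "v \<in> verts F" for v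
  proof (rule ccontr)
    assume "\<not> 0 < \<rho> v"
    define D where "D = {w \<in> verts F. \<rho> w = 0}"
    have vD: "v \<in> D" using \<open>\<not> 0 < \<rho> v\<close> \<rho>0[OF v] v by (auto simp: D_def)
    have QD: "Q w = {Y w}" if "w \<in> D" for w using that cP(3)[of w] by (auto simp: D_def Q_def place_def)
    \<comment> \<open>The cluster of vanishing vertices around \<open>v\<close>: consecutive ones
      touch, so all of them shrink to the point \<open>Y v\<close>. The outer vertices, having size
      1, are not among them.\<close>
    define Z where "Z = {w. (v, w) \<in> {(a, b). adj F a b \<and> a \<in> D \<and> b \<in> D}\<^sup>*}"
    have Z: "w \<in> D \<and> Y w = Y v" if "w \<in> Z" for w
    proof -
      have "(v, w) \<in> {(a, b). adj F a b \<and> a \<in> D \<and> b \<in> D}\<^sup>*" using that by (simp add: Z_def)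
      thus ?thesis
      proof (induction rule: rtrancl_induct)
        case base
        thus ?case using vD by simp
      next
        case (step a b)
        hence "Q a \<inter> Q b \<noteq> {}" "a \<in> D" "b \<in> D" using Qtch by auto
        thus ?case using QD step by auto
      qed
    qed
    have vZ: "v \<in> Z" by (simp add: Z_def)
    have oZ: "o1 \<notin> Z" "o2 \<notin> Z" "o3 \<notin> Z" using Z \<rho>o by (auto simp: D_def)
    \<comment> \<open>The neighbours of the cluster keep positive size and contain
      \<open>Y v\<close>. By \<open>three_connected\<close> there are at least three of them,
      against \<open>no_triple_point\<close>.\<close>
    define N where "N = {w. w \<notin> Z \<and> (\<exists>u\<in>Z. adj F u w)}"
    have N: "w \<in> verts F \<and> 0 < \<rho> w \<and> Y v \<in> Q w" if w: "w \<in> N" for w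
    proof -
      obtain u where u: "u \<in> Z" "adj F u w" "w \<notin> Z" using w by (auto simp: N_def)
      have uD: "u \<in> D" "Y u = Y v" using Z[OF u(1)] by auto
      have wv: "w \<in> verts F" using adj_verts[OF u(2)] by simp
      have "w \<notin> D"
      proof
        assume "w \<in> D"
        hence "w \<in> Z" using u(1,2) uD unfolding Z_def by (auto intro: rtrancl_into_rtrancl)
        thus False using u(3) by simp
      qed
      hence "0 < \<rho> w" using \<rho>0[OF wv] wv by (auto simp: D_def less_le)
      moreover have "Y v \<in> Q w" using Qtch[OF u(2)] QD[OF uD(1)] uD(2) by auto
      ultimately show ?thesis using wv by simp
    qed
    have ext: "\<exists>c\<in>N. c \<noteq> p \<and> c \<noteq> q" if pq: "p \<notin> Z" "q \<notin> Z" for p q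
    proof (rule ccontr)
      assume neg: "\<not> ?thesis"
      have "verts F \<subseteq> Z \<union> {p, q}"
        by (rule three_connected[OF vZ v pq]) (use neg in \<open>auto simp: N_def\<close>)
      hence "o1 \<in> {p, q}" "o2 \<in> {p, q}" "o3 \<in> {p, q}" using ov oZ by auto
      thus False using od by auto
    qed
    have NZ: "c \<notin> Z" if "c \<in> N" for c using that by (simp add: N_def)
    obtain a where a: "a \<in> N" using ext[OF oZ(1,1)] by blast
    obtain b where b: "b \<in> N" "b \<noteq> a" using ext[OF NZ[OF a] NZ[OF a]] by blast
    obtain c where c: "c \<in> N" "c \<noteq> a" "c \<noteq> b" using ext[OF NZ[OF a] NZ[OF b(1)]] by blast
    show False using triple[of a b c "Y v"] N[OF a] N[OF b(1)] N[OF c(1)] b(2) c(2,3) by auto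
  qed
  \<comment> \<open>A common point \<open>z\<close> would have positive distance \<open>d\<close>
    from all other bodies. In the approximations the disc of radius \<open>d / 2\<close> meets both
    interiors and therefore some third body; one index occurs infinitely often, and in the limit its
    body comes within \<open>d / 2\<close> of \<open>z\<close>.\<close>
  have Qapart: "Q u \<inter> Q w = {}" if u: "u \<in> verts F - {o1, o2, o3}" and w: "w \<in> verts F - {o1, o2, o3}" and uw: "u \<noteq> w" "\<not> adj F u w" for u w
  proof (rule ccontr)
    assume "Q u \<inter> Q w \<noteq> {}"
    then obtain z where z: "z \<in> Q u" "z \<in> Q w" by blast
    have uv: "u \<in> verts F" "w \<in> verts F" using u w by auto
    have "z \<notin> (\<Union>v\<in>verts F - {u, w}. Q v)" using triple[OF uv] z uw \<rho>pos uv by auto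
    moreover have "closed (\<Union>v\<in>verts F - {u, w}. Q v)"
      using finite_verts Qc(1) by (intro closed_UN) (auto intro: compact_imp_closed)
    ultimately obtain d where d: "0 < d" "\<And>x v. v \<in> verts F - {u, w} \<Longrightarrow> x \<in> Q v \<Longrightarrow> d \<le> dist z x"
      using separate_point_closed[of "\<Union>v\<in>verts F - {u, w}. Q v" z] by (metis UN_I)
    have near: "\<exists>x. x \<in> ball z (d / 2) \<and> x \<in> interior (Q a)" if "a \<in> verts F" "z \<in> Q a" for a
    proof -
      have "z \<in> closure (interior (Q a))"
        using convex_closure_interior[OF Qc(2)[OF that(1)]] sQ[OF that(1) \<rho>pos[OF that(1)]] that(2) closure_subset
        by (auto simp: smooth_body_def)
      then obtain x where "x \<in> interior (Q a)" "dist x z < d / 2" using d(1) unfolding closure_approachable by (meson half_gt_zero)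
      thus ?thesis by (auto simp: dist_commute)
    qed
    obtain x1 x2 where x12: "x1 \<in> ball z (d / 2)" "x1 \<in> interior (Q u)" "x2 \<in> ball z (d / 2)" "x2 \<in> interior (Q w)"
      using near[OF uv(1) z(1)] near[OF uv(2) z(2)] by blast
    have E: "\<forall>\<^sub>F k in sequentially. x1 \<in> interior (B (s k) u) \<and> x2 \<in> interior (B (s k) w)"
      using ev[OF uv(1) x12(2) \<rho>pos[OF uv(1)]] ev[OF uv(2) x12(4) \<rho>pos[OF uv(2)]] by (rule eventually_conj)
    then obtain k0 where k0: "\<And>k. k0 \<le> k \<Longrightarrow> x1 \<in> interior (B (s k) u) \<and> x2 \<in> interior (B (s k) w)"
      unfolding eventually_sequentially by blast
    have "\<exists>v\<in>verts F - {u, w}. ball z (d / 2) \<inter> B (s (k + k0)) v \<noteq> {}" for k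
      by (rule ring[OF u w uw]) (use k0[of "k + k0"] x12 in auto)
    hence "\<forall>k. \<exists>v x. v \<in> verts F - {u, w} \<and> x \<in> ball z (d / 2) \<and> x \<in> B (s (k + k0)) v" by blast
    then obtain V where "\<forall>k. \<exists>x. V k \<in> verts F - {u, w} \<and> x \<in> ball z (d / 2) \<and> x \<in> B (s (k + k0)) (V k)" by (rule choice[elim_format]) blast
    then obtain x where "\<forall>k. V k \<in> verts F - {u, w} \<and> x k \<in> ball z (d / 2) \<and> x k \<in> B (s (k + k0)) (V k)" by (rule choice[elim_format]) blast
    hence V: "\<And>k. V k \<in> verts F - {u, w}" and x: "\<And>k. x k \<in> ball z (d / 2) \<and> x k \<in> B (s (k + k0)) (V k)" by auto
    have "\<exists>v\<in>verts F - {u, w}. infinite {k. V k = v}"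
    proof (rule ccontr)
      assume "\<not> ?thesis"
      hence "finite (\<Union>v\<in>verts F - {u, w}. {k. V k = v})" using finite_verts by auto
      moreover have "(\<Union>v\<in>verts F - {u, w}. {k. V k = v}) = UNIV" using V by blast
      ultimately show False by simp
    qed
    then obtain v where v: "v \<in> verts F - {u, w}" "infinite {k. V k = v}" by blast
    obtain t :: "nat \<Rightarrow> nat" where t: "strict_mono t" "\<And>k. V (t k) = v" using infinite_enumerate[OF v(2)] by auto
    have vv: "v \<in> verts F" using v by blast
    have xB: "x (t k) \<in> B (s (t k + k0)) v" for k using x[of "t k"] t(2)[of k] by simp
    obtain z' t' where t': "strict_mono (t' :: nat \<Rightarrow> nat)" "(\<lambda>k. x (t (t' k))) \<longlonglongrightarrow> z'" using conv[OF vv xB] by force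
    have "strict_mono (\<lambda>k. t (t' k) + k0)" using t(1) t'(1) by (simp add: strict_mono_def)
    from limB[OF vv this xB t'(2)] have "z' \<in> Q v" .
    hence "d \<le> dist z z'" using d(2)[OF v(1)] by blast
    moreover have "dist z z' \<le> d / 2"
    proof (rule tendsto_upperbound)
      show "(\<lambda>k. dist z (x (t (t' k)))) \<longlonglongrightarrow> dist z z'" by (intro tendsto_intros t'(2))
      show "\<forall>\<^sub>F k in sequentially. dist z (x (t (t' k))) \<le> d / 2" using x by (intro always_eventually) (auto intro: less_imp_le)
    qed simp
    ultimately show False using d(1) by linarith
  qed
  have "Q u \<inter> Q v \<inter> Q w = {}" if "u \<in> verts F" "v \<in> verts F" "w \<in> verts F" "u \<noteq> v \<and> u \<noteq> w \<and> v \<noteq> w" for u v w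
    using triple[of u v w] that \<rho>pos by blast
  thus ?thesis
    using \<rho>pos Qdisj Qtch Qapart unfolding contact_packing_def Q_def by (intro exI[of _ Y] exI[of _ \<rho>]) simp
qed

end

section \<open>Smooth convex bodies have unique normals\<close>

text \<open>Coordinates are taken relative to \<open>u\<close>, which points from \<open>z\<close>
  to the centre of the ball. If \<open>q - p\<close> were too close to the direction of
  \<open>u\<close>, then \<open>q\<close> would lie on a segment from \<open>p\<close> to a point
  \<open>c'\<close> of the ball and thus in the interior.\<close>

lemma frontier_chord_cone:
  assumes K: "convex K" and e: "0 < e" "ball c e \<subseteq> K" and u: "u = c - z" "e \<le> norm u"
    and p: "p \<in> K" "norm (p - z) < e / 2" and q: "q \<notin> interior K" "norm (q - z) < e / 2"
  shows "Re ((q - p) / u) \<le> 2 * norm u / e * \<bar>Im ((q - p) / u)\<bar>"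
proof (rule ccontr)
  define a b where "a = Re ((q - p) / u)" and "b = Im ((q - p) / u)"
  assume "\<not> ?thesis"
  hence ab: "2 * norm u / e * \<bar>b\<bar> < a" by (simp add: a_def b_def)
  have u0: "u \<noteq> 0" using e u by auto
  have a0: "0 < a" using ab e by (smt (verit, best) divide_nonneg_pos mult_nonneg_nonneg norm_ge_zero abs_ge_zero)
  have "norm (q - p) < e" using norm_triangle_ineq4[of "q - z" "p - z"] p q by simp
  hence "norm ((q - p) / u) \<le> 1" using u u0 by (simp add: norm_divide)
  hence a1: "a \<le> 1" using complex_Re_le_cmod[of "(q - p) / u"] by (simp add: a_def)
  have qp: "q - p = u * Complex a b" using u0 by (simp add: a_def b_def)
  define c' where "c' = p + u * Complex 1 (b / a)"
  have "norm (c' - c) = norm ((p - z) + u * (\<i> * of_real (b / a)))"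
    by (simp add: c'_def u(1) Complex_eq algebra_simps)
  also have "\<dots> \<le> norm (p - z) + norm u * \<bar>b / a\<bar>"
    using norm_triangle_ineq[of "p - z" "u * (\<i> * of_real (b / a))"] by (simp add: norm_mult norm_divide)
  also have "norm u * \<bar>b / a\<bar> \<le> e / 2" using ab a0 e by (simp add: field_simps abs_divide)
  finally have "c' \<in> ball c e" using p by (simp add: dist_norm norm_minus_commute)
  hence "c' \<in> interior K" using e(2) by (meson interior_maximal open_ball subsetD)
  from mem_interior_convex_shrink[OF K this p(1) a0 a1] have "p - a *\<^sub>R (p - c') \<in> interior K" .
  moreover have "p - a *\<^sub>R (p - c') = q"
  proof -
    have "p - a *\<^sub>R (p - c') = p + u * (of_real a * Complex 1 (b / a))"
      by (simp add: c'_def scaleR_conv_of_real algebra_simps)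
    also have "of_real a * Complex 1 (b / a) = Complex a b" using a0 by (simp add: complex_eq_iff)
    finally show ?thesis using qp by (simp add: algebra_simps)
  qed
  ultimately show False using q by simp
qed

lemma periodic_int:
  assumes "\<And>s. f (s + L) = f s"
  shows "f (s + of_int k * L) = f (s :: real)"
proof -
  have n: "f (s + real n * L) = f s" for s n
  proof (induction n)
    case (Suc n)
    thus ?case using assms[of "s + real n * L"] by (simp add: algebra_simps)
  qed simp
  show ?thesis
  proof (cases "0 \<le> k")
    case True
    thus ?thesis using n[of s "nat k"] by simp
  next
    case False
    thus ?thesis using n[of "s + of_int k * L" "nat (- k)"] by simp
  qed
qed

lemma arc_length_param_inj:
  assumes "closed_arc_length_parameter S L \<gamma>" "s < t" "t < s + L"
  shows "\<gamma> s \<noteq> \<gamma> t"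
proof
  assume eq: "\<gamma> s = \<gamma> t"
  have L: "0 < L" and per: "\<And>s. \<gamma> (s + L) = \<gamma> s" and inj: "inj_on \<gamma> {0..<L}"
    using assms(1) by (auto simp: closed_arc_length_parameter_def)
  define k where "k = \<lfloor>s / L\<rfloor>"
  have k: "of_int k * L \<le> s" "s < (of_int k + 1) * L"
    using floor_divide_lower[OF L, of s] floor_divide_upper[OF L, of s] by (simp_all add: k_def)
  define s' t' where "s' = s - of_int k * L" and "t' = t - of_int k * L"
  have s': "0 \<le> s'" "s' < L" using k by (simp_all add: s'_def algebra_simps)
  have st: "s' < t'" "t' < s' + L" using assms(2,3) by (simp_all add: s'_def t'_def)
  have "\<gamma> s' = \<gamma> t'"
    using periodic_int[of \<gamma> L s' k, OF per] periodic_int[of \<gamma> L t' k, OF per] eq by (simp add: s'_def t'_def)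
  thus False
  proof (cases "t' < L")
    case True
    thus ?thesis using inj_onD[OF inj \<open>\<gamma> s' = \<gamma> t'\<close>] s' st by simp
  next
    case False
    have "\<gamma> s' = \<gamma> (t' - L)" using per[of "t' - L"] \<open>\<gamma> s' = \<gamma> t'\<close> by simp
    thus ?thesis using inj_onD[OF inj, of s' "t' - L"] s' st False by simp
  qed
qed

lemma arc_length_param_mem:
  assumes "closed_arc_length_parameter S L \<gamma>"
  shows "\<gamma> s \<in> S"
proof -
  have L: "0 < L" and per: "\<And>s. \<gamma> (s + L) = \<gamma> s" and im: "\<gamma> ` {0..<L} = S"
    using assms by (auto simp: closed_arc_length_parameter_def)
  have "\<gamma> (s + of_int (- \<lfloor>s / L\<rfloor>) * L) = \<gamma> s" by (rule periodic_int[of \<gamma> L, OF per])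
  moreover have "s + of_int (- \<lfloor>s / L\<rfloor>) * L \<in> {0..<L}"
    using floor_divide_lower[OF L, of s] floor_divide_upper[OF L, of s] by (simp add: distrib_right)
  ultimately show ?thesis using im by (metis imageI)
qed

lemma chord_inscribed: "s \<le> t \<Longrightarrow> dist (\<gamma> s) (\<gamma> t) \<in> inscribed_lengths \<gamma> s t"
  unfolding inscribed_lengths_def mem_Collect_eq
  by (rule exI[of _ 1], rule exI[of _ "\<lambda>i. if i = 0 then s else t"]) (auto simp: mono_def)

lemma arc_length_dist_le:
  assumes "has_arc_length \<gamma> s t l" "s \<le> t"
  shows "dist (\<gamma> s) (\<gamma> t) \<le> l"
  using assms(1) chord_inscribed[OF assms(2)] unfolding has_arc_length_def by (metis cSup_upper)

text \<open>A continuous injective \<open>h\<close> is monotone, so its increments along a partition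
  add up without cancellation.\<close>

lemma arc_length_le_chord:
  assumes l: "has_arc_length \<gamma> s t l" "s \<le> t" and C: "0 \<le> C"
    and h: "continuous_on {s..t} h" "inj_on h {s..t}"
    and lip: "\<And>a b. a \<in> {s..t} \<Longrightarrow> b \<in> {s..t} \<Longrightarrow> dist (\<gamma> a) (\<gamma> b) \<le> C * \<bar>h b - h a :: real\<bar>"
  shows "l \<le> C * \<bar>h t - h s\<bar>"
proof -
  have "x \<le> C * \<bar>h t - h s\<bar>" if x: "x \<in> inscribed_lengths \<gamma> s t" for x
  proof -
    obtain n \<tau> where \<tau>: "x = (\<Sum>i<n. dist (\<gamma> (\<tau> i)) (\<gamma> (\<tau> (Suc i))))" "mono \<tau>" "\<tau> 0 = s" "\<tau> n = t"
      using x by (auto simp: inscribed_lengths_def)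
    have r: "\<tau> i \<in> {s..t}" if "i \<le> n" for i
      using monoD[OF \<tau>(2), of 0 i] monoD[OF \<tau>(2), of i n] that \<tau> by simp
    have "(\<Sum>i<m. dist (\<gamma> (\<tau> i)) (\<gamma> (\<tau> (Suc i)))) \<le> C * \<bar>h (\<tau> m) - h s\<bar>" if "m \<le> n" for m
      using that
    proof (induction m)
      case (Suc m)
      have m: "s \<le> \<tau> m" "\<tau> m \<le> \<tau> (Suc m)" "\<tau> (Suc m) \<le> t"
        using r[of m] r[of "Suc m"] Suc.prems monoD[OF \<tau>(2), of m "Suc m"] by auto
      have "\<bar>h (\<tau> m) - h s\<bar> + \<bar>h (\<tau> (Suc m)) - h (\<tau> m)\<bar> = \<bar>h (\<tau> (Suc m)) - h s\<bar>"
      proof (cases "s < \<tau> m \<and> \<tau> m < \<tau> (Suc m)")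
        case True
        have "{s..\<tau> (Suc m)} \<subseteq> {s..t}" using m by auto
        hence "(h s < h (\<tau> m) \<and> h (\<tau> m) < h (\<tau> (Suc m))) \<or> (h (\<tau> (Suc m)) < h (\<tau> m) \<and> h (\<tau> m) < h s)"
          using True by (intro continuous_inj_imp_mono continuous_on_subset[OF h(1)] inj_on_subset[OF h(2)]) auto
        thus ?thesis by auto
      qed (use m in \<open>auto simp: not_less\<close>)
      moreover have "dist (\<gamma> (\<tau> m)) (\<gamma> (\<tau> (Suc m))) \<le> C * \<bar>h (\<tau> (Suc m)) - h (\<tau> m)\<bar>"
        using lip r Suc.prems by simp
      moreover have "(\<Sum>i<m. dist (\<gamma> (\<tau> i)) (\<gamma> (\<tau> (Suc i)))) \<le> C * \<bar>h (\<tau> m) - h s\<bar>" using Suc by simp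
      ultimately show ?case by (metis (no_types, lifting) add_mono distrib_left sum.lessThan_Suc)
    qed (use C in simp)
    from this[of n] show ?thesis using \<tau> by simp
  qed
  moreover have "inscribed_lengths \<gamma> s t \<noteq> {}" using chord_inscribed[OF l(2)] by blast
  ultimately show ?thesis using l(1) cSup_least unfolding has_arc_length_def by metis
qed

text \<open>Near a boundary point the boundary is a Lipschitz graph over a line, so its arcs are at most a
  constant times as long as their chords.\<close>

lemma arc_length_derivative_nonzero:
  assumes K: "convex K" "closed K" "interior K \<noteq> {}" and \<gamma>: "closed_arc_length_parameter (frontier K) L \<gamma>"
    and D: "(\<gamma> has_vector_derivative D) (at s0)"
  shows "D \<noteq> 0"
proof
  assume D0: "D = 0"
  note fr = arc_length_param_mem[OF \<gamma>]
  have L: "0 < L" and len: "\<And>s t. s \<le> t \<Longrightarrow> has_arc_length \<gamma> s t (t - s)"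
    using \<gamma> by (auto simp: closed_arc_length_parameter_def)
  have lip1: "dist (\<gamma> s) (\<gamma> t) \<le> \<bar>t - s\<bar>" for s t
    using arc_length_dist_le[OF len, of s t] arc_length_dist_le[OF len, of t s] by (cases "s \<le> t") (auto simp: dist_commute)
  have cont: "continuous_on UNIV \<gamma>"
    by (rule lipschitz_on_continuous_on[of 1], rule lipschitz_onI) (use lip1 in \<open>auto simp: dist_real_def abs_minus_commute\<close>)
  define z where "z = \<gamma> s0"
  obtain c e where c: "0 < e" "ball c e \<subseteq> K" using K(3) by (metis all_not_in_conv mem_interior)
  define u where "u = c - z"
  have zi: "z \<notin> interior K" "z \<in> K" using fr[of s0] K(2) by (auto simp: z_def frontier_def)
  have eu: "e \<le> norm u"
  proof (rule ccontr)
    assume "\<not> e \<le> norm u"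
    hence "z \<in> ball c e" by (simp add: u_def dist_norm)
    thus False using zi c by (meson interior_maximal open_ball subsetD)
  qed
  define A where "A = 2 * norm u / e"
  define C where "C = norm u * (A + 1)"
  have "0 < norm u" using eu c(1) by linarith
  hence A0: "0 < A" using c(1) by (simp add: A_def)
  define h where "h s = Im (\<gamma> s / u)" for s
  have u0: "u \<noteq> 0" using eu c by auto
  have C0: "0 < C" using A0 u0 by (simp add: C_def)
  define \<delta> where "\<delta> = min (e / 2) (L / 2)"
  have \<delta>: "0 < \<delta>" using c L by (simp add: \<delta>_def)
  have \<delta>L: "\<delta> \<le> L / 2" by (simp add: \<delta>_def)
  have near: "norm (\<gamma> s - z) < e / 2" if "\<bar>s - s0\<bar> < \<delta>" for s
    using lip1[of s s0] that by (simp add: z_def dist_norm \<delta>_def abs_minus_commute)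
  have lip: "dist (\<gamma> s) (\<gamma> t) \<le> C * \<bar>h t - h s\<bar>" if st: "\<bar>s - s0\<bar> < \<delta>" "\<bar>t - s0\<bar> < \<delta>" for s t
  proof -
    have ki: "\<gamma> x \<in> K" "\<gamma> x \<notin> interior K" for x using fr[of x] K(2) by (auto simp: frontier_def)
    define w where "w = (\<gamma> t - \<gamma> s) / u"
    have w': "(\<gamma> s - \<gamma> t) / u = - w" by (simp add: w_def diff_divide_distrib)
    have im: "Im w = h t - h s" by (simp add: w_def h_def diff_divide_distrib)
    have "Re w \<le> A * \<bar>Im w\<bar>" "- Re w \<le> A * \<bar>Im w\<bar>"
      using frontier_chord_cone[OF K(1) c u_def eu ki(1) near[OF st(1)] ki(2) near[OF st(2)]]
        frontier_chord_cone[OF K(1) c u_def eu ki(1) near[OF st(2)] ki(2) near[OF st(1)]]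
      by (simp_all add: A_def w_def[symmetric] w')
    hence "norm w \<le> (A + 1) * \<bar>h t - h s\<bar>" using cmod_le[of w] im by (simp add: distrib_right)
    hence "norm u * norm w \<le> C * \<bar>h t - h s\<bar>"
      using mult_left_mono[of "norm w" "(A + 1) * \<bar>h t - h s\<bar>" "norm u"] by (simp add: C_def mult.assoc)
    moreover have "norm u * norm w = dist (\<gamma> s) (\<gamma> t)" using u0 by (simp add: w_def norm_divide dist_norm norm_minus_commute)
    ultimately show ?thesis by simp
  qed
  have long: "t - s \<le> C * \<bar>h t - h s\<bar>" if st: "s \<le> t" "\<bar>s - s0\<bar> < \<delta>" "\<bar>t - s0\<bar> < \<delta>" for s t
  proof (rule arc_length_le_chord[OF len[OF st(1)] st(1)])
    have r: "\<bar>a - s0\<bar> < \<delta>" if "a \<in> {s..t}" for a using that st by auto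
    show "continuous_on {s..t} h" unfolding h_def using u0 by (intro continuous_intros continuous_on_subset[OF cont]) auto
    show "dist (\<gamma> a) (\<gamma> b) \<le> C * \<bar>h b - h a\<bar>" if "a \<in> {s..t}" "b \<in> {s..t}" for a b by (rule lip[OF r[OF that(1)] r[OF that(2)]])
    show "inj_on h {s..t}"
    proof (rule inj_onI, rule ccontr)
      fix a b assume ab: "a \<in> {s..t}" "b \<in> {s..t}" "h a = h b" "a \<noteq> b"
      hence "\<gamma> a = \<gamma> b" using lip[OF r[OF ab(1)] r[OF ab(2)]] by simp
      moreover have "\<bar>a - b\<bar> < L" using r[OF ab(1)] r[OF ab(2)] \<delta>L by linarith
      ultimately show False using arc_length_param_inj[OF \<gamma>, of a b] arc_length_param_inj[OF \<gamma>, of b a] ab(4) by fastforce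
    qed
  qed (use C0 in simp)
  have hl: "\<bar>h t - h s\<bar> \<le> norm (\<gamma> t - \<gamma> s) / norm u" for s t
    using abs_Im_le_cmod[of "(\<gamma> t - \<gamma> s) / u"] unfolding norm_divide by (simp add: h_def diff_divide_distrib)
  \<comment> \<open>Small enough that a vanishing derivative would bound the length
    \<open>y - s0\<close> of an arc by half of itself.\<close>
  define \<epsilon> where "\<epsilon> = norm u / (2 * C)"
  have \<epsilon>: "0 < \<epsilon>" using u0 C0 by (simp add: \<epsilon>_def)
  obtain d where d: "0 < d" "\<And>y. norm (y - s0) < d \<Longrightarrow> norm (\<gamma> y - \<gamma> s0) \<le> \<epsilon> * norm (y - s0)"
    using D \<epsilon> unfolding has_vector_derivative_def has_derivative_at_alt D0 by auto
  define y where "y = s0 + min d \<delta> / 2"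
  have y: "0 < y - s0" "y - s0 < d" "y - s0 < \<delta>" using d(1) \<delta> by (auto simp: y_def min_def)
  have "y - s0 \<le> C * (norm (\<gamma> y - \<gamma> s0) / norm u)"
    using long[of s0 y] y hl[of y s0] C0 \<delta> mult_left_mono[OF hl[of y s0], of C] by simp
  also have "\<dots> \<le> C * (\<epsilon> * (y - s0) / norm u)"
    using d(2)[of y] y C0 u0 by (intro mult_left_mono divide_right_mono) auto
  also have "\<dots> = (y - s0) / 2" using C0 u0 by (simp add: \<epsilon>_def)
  finally show False using y by simp
qed

lemma normals_parallel:
  assumes "ip (cis s) D = 0" "ip (cis t) D = 0" "D \<noteq> 0"
  shows "cis s = cis t \<or> cis s = - cis t"
proof -
  have s: "cos s * Re D + sin s * Im D = 0" and t: "cos t * Re D + sin t * Im D = 0" using assms by (simp_all add: ip_eq)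
  have "sin (s - t) * Re D = 0" "sin (s - t) * Im D = 0"
  proof -
    have "sin (s - t) * Re D = sin s * (cos t * Re D + sin t * Im D) - sin t * (cos s * Re D + sin s * Im D)"
      by (simp add: sin_diff algebra_simps)
    thus "sin (s - t) * Re D = 0" using s t by simp
    have "sin (s - t) * Im D = cos t * (cos s * Re D + sin s * Im D) - cos s * (cos t * Re D + sin t * Im D)"
      by (simp add: sin_diff algebra_simps)
    thus "sin (s - t) * Im D = 0" using s t by simp
  qed
  hence "sin (s - t) = 0" using assms(3) by (auto simp: complex_eq_iff)
  hence "(cos (s - t))\<^sup>2 = 1" using sin_cos_squared_add[of "s - t"] by simp
  hence "cos (s - t) = 1 \<or> cos (s - t) = -1" by (simp add: power2_eq_1_iff)
  hence "cis (s - t) = 1 \<or> cis (s - t) = -1" using \<open>sin (s - t) = 0\<close> by (auto simp: complex_eq_iff)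
  moreover have "cis s = cis (s - t) * cis t" by (simp add: cis_mult)
  ultimately show ?thesis by auto
qed

text \<open>A normal at a boundary point is orthogonal to the derivative there, which is not zero;
  so two normals are equal or opposite. Opposite ones would confine \<open>K\<close> to a
  line.\<close>

lemma smooth_convex_body_imp_smooth_body:
  assumes "smooth_convex_body K"
  shows "smooth_body K"
proof -
  have K: "compact K" "convex K" "interior K \<noteq> {}" and "\<exists>L \<gamma>. closed_arc_length_parameter (frontier K) L \<gamma> \<and> (\<forall>s. \<gamma> differentiable (at s))"
    using assms by (auto simp: smooth_convex_body_def convex_body_def)
  then obtain L \<gamma> where \<gamma>: "closed_arc_length_parameter (frontier K) L \<gamma>" and diff: "\<And>s. \<gamma> differentiable (at s)" by blast
  have cl: "closed K" using K(1) by (rule compact_imp_closed)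
  have "cis s = cis t" if z: "z \<in> K" and st: "\<forall>w\<in>K. ip (cis s) (w - z) \<le> 0" "\<forall>w\<in>K. ip (cis t) (w - z) \<le> 0" for z s t
  proof -
    have step: "ip (cis s) (v + of_real \<eta> * cis s - z) = ip (cis s) (v - z) + \<eta>" for v s and \<eta> :: real
    proof -
      have "v + of_real \<eta> * cis s - z = (v - z) + of_real \<eta> * cis s" by simp
      thus ?thesis by (simp only: ip_add ip_scale ip_cis) simp
    qed
    have "z \<notin> interior K"
    proof
      assume "z \<in> interior K"
      then obtain e where e: "0 < e" "ball z e \<subseteq> K" by (auto simp: mem_interior)
      hence "z + of_real (e / 2) * cis s \<in> K" by (intro subsetD[OF e(2)]) (simp add: dist_norm norm_mult)
      hence "ip (cis s) (z + of_real (e / 2) * cis s - z) \<le> 0" using st(1) by blast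
      moreover have "ip (cis s) (z - z) = 0" by (simp add: ip_eq)
      ultimately show False using e(1) unfolding step by simp
    qed
    hence "z \<in> frontier K" using z closure_subset by (auto simp: frontier_def)
    moreover have "\<gamma> ` {0..<L} = frontier K"
      using \<gamma> by (auto simp: closed_arc_length_parameter_def)
    ultimately obtain s0 where s0: "\<gamma> s0 = z" by (metis imageE)
    have fr: "\<gamma> x \<in> K" for x using arc_length_param_mem[OF \<gamma>, of x] cl by (auto simp: frontier_def)
    define D where "D = vector_derivative \<gamma> (at s0)"
    have D: "(\<gamma> has_vector_derivative D) (at s0)" using diff unfolding D_def by (simp add: vector_derivative_works)
    have D0: "D \<noteq> 0" by (rule arc_length_derivative_nonzero[OF K(2) cl K(3) \<gamma> D])
    have orth: "ip (cis a) D = 0" if a: "\<forall>w\<in>K. ip (cis a) (w - z) \<le> 0" for a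
    proof -
      have ipi: "ip (cis a) = (\<lambda>w. cis a \<bullet> w)" by (rule ext) (simp add: ip_eq inner_complex_def)
      have "((\<lambda>x. ip (cis a) (\<gamma> x)) has_vector_derivative ip (cis a) D) (at s0)"
        unfolding ipi by (rule bounded_linear.has_vector_derivative[OF bounded_linear_inner_right D])
      hence "DERIV (\<lambda>x. ip (cis a) (\<gamma> x)) s0 :> ip (cis a) D" by (simp add: has_real_derivative_iff_has_vector_derivative)
      thus ?thesis
      proof (rule DERIV_local_max[of _ _ _ 1])
        have "ip (cis a) (\<gamma> x) \<le> ip (cis a) z" for x using bspec[OF a fr[of x]] by (simp add: ip_eq algebra_simps)
        thus "\<forall>y. \<bar>s0 - y\<bar> < 1 \<longrightarrow> ip (cis a) (\<gamma> y) \<le> ip (cis a) (\<gamma> s0)" using s0 by simp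
      qed simp
    qed
    show ?thesis
    proof (rule ccontr)
      assume "cis s \<noteq> cis t"
      hence "cis t = - cis s" using normals_parallel[OF orth[OF st(1)] orth[OF st(2)] D0] by auto
      hence zero: "ip (cis s) (w - z) = 0" if "w \<in> K" for w
        using st that by (force simp: ip_def)
      obtain c e where c: "0 < e" "ball c e \<subseteq> K" using K(3) by (metis all_not_in_conv mem_interior)
      have "c \<in> K" "c + of_real (e / 2) * cis s \<in> K"
        using c by (auto intro!: subsetD[OF c(2)] simp: dist_norm norm_mult)
      thus False using zero[of c] zero[of "c + of_real (e / 2) * cis s"] c(1) unfolding step by simp
    qed
  qed
  thus ?thesis using K unfolding smooth_body_def by blast
qed

text \<open>Discs are the bodies given to the auxiliary vertices.\<close>

lemma smooth_body_disc: "smooth_body (cball 0 1)"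
proof -
  have "z = cis s" if z: "z \<in> cball 0 1" and s: "\<forall>w\<in>cball 0 1. ip (cis s) (w - z) \<le> 0" for z s
  proof -
    have "ip (cis s) (cis s - z) \<le> 0" using s by simp
    hence "1 \<le> ip (cis s) z"
      using sin_cos_squared_add[of s] by (simp add: ip_eq right_diff_distrib power2_eq_square)
    moreover have "(norm (z - cis s))\<^sup>2 = (norm z)\<^sup>2 + 1 - 2 * ip (cis s) z"
    proof -
      have "(norm (z - cis s))\<^sup>2 = (Re z)\<^sup>2 + (Im z)\<^sup>2 + ((sin s)\<^sup>2 + (cos s)\<^sup>2) - 2 * ip (cis s) z"
        unfolding cmod_power2 by (simp add: ip_eq power2_diff algebra_simps)
      thus ?thesis unfolding cmod_power2 by simp
    qed
    moreover have "(norm z)\<^sup>2 \<le> 1" using z by (simp add: power_le_one)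
    ultimately have "(norm (z - cis s))\<^sup>2 \<le> 0" by linarith
    thus ?thesis by simp
  qed
  hence "\<forall>z\<in>cball 0 1. \<forall>s t. (\<forall>w\<in>cball 0 1. ip (cis s) (w - z) \<le> 0) \<longrightarrow> (\<forall>w\<in>cball 0 1. ip (cis t) (w - z) \<le> 0) \<longrightarrow> cis s = cis t"
    by metis
  thus ?thesis by (simp add: smooth_body_def)
qed

lemma interior_disjoint_convex:
  fixes A B :: "'a :: euclidean_space set"
  assumes "convex B" "interior B \<noteq> {}" "interior A \<inter> interior B = {}"
  shows "interior A \<inter> B = {}"
proof -
  have "interior A \<inter> closure (interior B) = {}" using assms(3) by (simp add: open_Int_closure_eq_empty)
  thus ?thesis using closure_subset[of B] convex_closure_interior[of B] assms(1,2) by blast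
qed

section \<open>Barycentric subdivision with contracted trees\<close>

text \<open>Serves as the name of a face, independent of the rotation in which it is listed.\<close>

definition orbit :: "'a \<Rightarrow> 'a \<Rightarrow> 'a \<Rightarrow> 'a faces" where
  "orbit a b c = {(a, b, c), (b, c, a), (c, a, b)}"

text \<open>In the barycentric subdivision the centre of a face is surrounded by a hexagon of its
  vertices and edges. After merging vertices by \<open>p\<close> and edges by \<open>q\<close>,
  these are the sides of the hexagon that have not collapsed, labelled by the face.\<close>

definition steps :: "('a \<Rightarrow> 'b) \<Rightarrow> ('a \<Rightarrow> 'a \<Rightarrow> 'b) \<Rightarrow> 'a faces \<Rightarrow> ('b \<times> 'b \<times> 'a faces) set" where
  "steps p q F = {(s, t, f). s \<noteq> t \<and>
     (\<exists>x y z. (x, y, z) \<in> F \<and> f = orbit x y z \<and> (s = p x \<and> t = q x y \<or> s = q x y \<and> t = p y))}"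

text \<open>Joins each side to the centre \<open>Inr f\<close> of its face; for the sides of the
  hexagons this is the barycentric subdivision after merging.\<close>

definition coned :: "('b \<times> 'b \<times> 'f) set \<Rightarrow> (('b + 'f) \<times> ('b + 'f) \<times> ('b + 'f)) set" where
  "coned S = (\<Union>(s, t, f)\<in>S. {(Inl s, Inl t, Inr f), (Inl t, Inr f, Inl s), (Inr f, Inl s, Inl t)})"

lemma coned_mem:
  "(Inl s, Inl t, c) \<in> coned S \<longleftrightarrow> (\<exists>f. c = Inr f \<and> (s, t, f) \<in> S)"
  "(Inl t, Inr f, c) \<in> coned S \<longleftrightarrow> (\<exists>s. c = Inl s \<and> (s, t, f) \<in> S)"
  "(Inr f, Inl s, c) \<in> coned S \<longleftrightarrow> (\<exists>t. c = Inl t \<and> (s, t, f) \<in> S)"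
  "(Inr f, Inr f', c) \<notin> coned S"
  by (auto simp: coned_def)

lemma orbit_rot: "orbit b c a = orbit a b c"
  by (auto simp: orbit_def)

lemma orbit_eqD: "orbit a b c = orbit x y z \<Longrightarrow> (a, b, c) = (x, y, z) \<or> (a, b, c) = (y, z, x) \<or> (a, b, c) = (z, x, y)"
proof -
  assume "orbit a b c = orbit x y z"
  moreover have "(a, b, c) \<in> orbit a b c" by (simp add: orbit_def)
  ultimately have "(a, b, c) \<in> orbit x y z" by simp
  thus ?thesis by (auto simp: orbit_def)
qed

text \<open>Equal corners of the hexagon are always joined by a collapsed stretch, so the remaining
  sides follow one another without visiting a corner twice.\<close>

lemma hexagon_steps:
  fixes c0 c1 c2 c3 c4 c5 :: 'b
  assumes "c0 = c2 \<Longrightarrow> c1 = c0" "c2 = c4 \<Longrightarrow> c3 = c2" "c4 = c0 \<Longrightarrow> c5 = c4"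
    and "c1 = c3 \<Longrightarrow> (c1 = c0 \<or> c1 = c2) \<and> (c3 = c2 \<or> c3 = c4)" "c3 = c5 \<Longrightarrow> (c3 = c2 \<or> c3 = c4) \<and> (c5 = c4 \<or> c5 = c0)"
      "c5 = c1 \<Longrightarrow> (c5 = c4 \<or> c5 = c0) \<and> (c1 = c0 \<or> c1 = c2)"
    and "c1 = c4 \<Longrightarrow> c1 = c0 \<or> c1 = c2" "c3 = c0 \<Longrightarrow> c3 = c2 \<or> c3 = c4" "c5 = c2 \<Longrightarrow> c5 = c4 \<or> c5 = c0"
    and R: "\<And>s t. R s t \<longleftrightarrow> s \<noteq> t \<and> (s = c0 \<and> t = c1 \<or> s = c1 \<and> t = c2 \<or> s = c2 \<and> t = c3 \<or> s = c3 \<and> t = c4 \<or> s = c4 \<and> t = c5 \<or> s = c5 \<and> t = c0)"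
  shows "R s t \<Longrightarrow> R s t' \<Longrightarrow> t = t'" "R s t \<Longrightarrow> R s' t \<Longrightarrow> s = s'" "R s t \<Longrightarrow> \<exists>u. R t u" "R s t \<Longrightarrow> \<exists>u. R u s"
proof -
  show "R s t \<Longrightarrow> R s t' \<Longrightarrow> t = t'" unfolding R using assms(1-9) by (smt (verit, best))
  show "R s t \<Longrightarrow> R s' t \<Longrightarrow> s = s'" unfolding R using assms(1-9) by (smt (verit, best))
  show "R s t \<Longrightarrow> \<exists>u. R t u" unfolding R by metis
  show "R s t \<Longrightarrow> \<exists>u. R u s" unfolding R by metis
qed

lemma ex_function_of_relation:
  assumes "\<And>k v v'. (k, v) \<in> R \<Longrightarrow> (k, v') \<in> R \<Longrightarrow> v = v'"
  shows "\<exists>G. \<forall>k v. (k, v) \<in> R \<longrightarrow> G k = v"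
proof (intro exI allI impI)
  fix k v assume "(k, v) \<in> R"
  thus "(THE v. (k, v) \<in> R) = v" using assms by blast
qed

section \<open>Quotients of the barycentric subdivision\<close>

context triangulation
begin

lemma adj_face: "adj F x y \<Longrightarrow> \<exists>z. (x, y, z) \<in> F"
  by (simp add: adj_def)

text \<open>The vertices of the subdivision that lie on vertices and edges of \<open>F\<close> are merged according
  to \<open>p\<close> and \<open>q\<close>. Every class that meets the vertices is spanned by a tree of edges with equal
  values of \<open>p\<close>; an edge may moreover be merged with one of its ends, but at most one edge
  between any two classes of vertices.\<close>

theorem triangulation_quotient:
  fixes p :: "'a \<Rightarrow> 'b" and n :: "'a \<Rightarrow> nat"
  assumes q_sym: "\<And>x y. adj F x y \<Longrightarrow> q x y = q y x"
    and qq: "\<And>x y x' y'. adj F x y \<Longrightarrow> adj F x' y' \<Longrightarrow> q x y = q x' y' \<Longrightarrow> {x, y} = {x', y'} \<or> q x y = p x \<or> q x y = p y"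
    and qp: "\<And>x y z. adj F x y \<Longrightarrow> z \<in> verts F \<Longrightarrow> q x y = p z \<Longrightarrow> q x y = p x \<or> q x y = p y"
    and pp: "\<And>x y. adj F x y \<Longrightarrow> p x = p y \<Longrightarrow> q x y = p x"
    and contact: "\<And>x y x' y'. adj F x y \<Longrightarrow> adj F x' y' \<Longrightarrow> p x \<noteq> p y \<Longrightarrow> q x y = p x \<Longrightarrow> p x' = p x \<Longrightarrow> p y' = p y \<Longrightarrow>
      q x' y' = p x' \<or> q x' y' = p y' \<Longrightarrow> x = x' \<and> y = y'"
    and conn: "\<And>x y. x \<in> verts F \<Longrightarrow> y \<in> verts F \<Longrightarrow> p x = p y \<Longrightarrow> (x, y) \<in> {(x, y). adj F x y \<and> p x = p y}\<^sup>*"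
    and rank: "\<And>x y y'. adj F x y \<Longrightarrow> adj F x y' \<Longrightarrow> p y = p x \<Longrightarrow> p y' = p x \<Longrightarrow> n y \<le> n x \<Longrightarrow> n y' \<le> n x \<Longrightarrow> y = y'"
  shows "triangulation (coned (steps p q F))"
proof -
  define S where "S = steps p q F"
  define c where "c x y z = (\<lambda>s t. s \<noteq> t \<and> (s = p x \<and> t = q x y \<or> s = q x y \<and> t = p y \<or> s = p y \<and> t = q y z \<or> s = q y z \<and> t = p z
    \<or> s = p z \<and> t = q z x \<or> s = q z x \<and> t = p x))" for x y z
  have S_c: "(s, t, orbit x y z) \<in> S \<longleftrightarrow> c x y z s t" if f: "(x, y, z) \<in> F" for x y z s t
  proof
    assume "(s, t, orbit x y z) \<in> S"
    then obtain x' y' z' where "s \<noteq> t" "orbit x y z = orbit x' y' z'" "s = p x' \<and> t = q x' y' \<or> s = q x' y' \<and> t = p y'"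
      by (auto simp: S_def steps_def)
    thus "c x y z s t" using orbit_eqD[of x' y' z' x y z] by (auto simp: c_def)
  next
    assume "c x y z s t"
    thus "(s, t, orbit x y z) \<in> S"
      using f rot[OF f] rot2[OF f] orbit_rot[of y z x] orbit_rot[of z x y] unfolding c_def S_def steps_def by blast
  qed
  have SE: "\<exists>x y z. (x, y, z) \<in> F \<and> f = orbit x y z" if "(s, t, f) \<in> S" for s t f using that by (auto simp: S_def steps_def)
  have Sneq: "s \<noteq> t" if "(s, t, f) \<in> S" for s t f using that by (auto simp: S_def steps_def)
  have hex: "c x y z s t \<Longrightarrow> c x y z s t' \<Longrightarrow> t = t'" "c x y z s t \<Longrightarrow> c x y z s' t \<Longrightarrow> s = s'"
    "c x y z s t \<Longrightarrow> \<exists>u. c x y z t u" "c x y z s t \<Longrightarrow> \<exists>u. c x y z u s" if f: "(x, y, z) \<in> F" for x y z s t s' t'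
  proof -
    note a = face_adj[OF f] and v = face_verts[OF f] and d = neqs[OF f]
    have A: "p x = p y \<Longrightarrow> q x y = p x" "p y = p z \<Longrightarrow> q y z = p y" "p z = p x \<Longrightarrow> q z x = p z" using pp a by auto
    have B: "q x y = q y z \<Longrightarrow> (q x y = p x \<or> q x y = p y) \<and> (q y z = p y \<or> q y z = p z)"
      "q y z = q z x \<Longrightarrow> (q y z = p y \<or> q y z = p z) \<and> (q z x = p z \<or> q z x = p x)"
      "q z x = q x y \<Longrightarrow> (q z x = p z \<or> q z x = p x) \<and> (q x y = p x \<or> q x y = p y)"
      using qq[of x y y z] qq[of y z x y] qq[of y z z x] qq[of z x y z] qq[of z x x y] qq[of x y z x] a d by (auto simp: doubleton_eq_iff)
    have C: "q x y = p z \<Longrightarrow> q x y = p x \<or> q x y = p y" "q y z = p x \<Longrightarrow> q y z = p y \<or> q y z = p z" "q z x = p y \<Longrightarrow> q z x = p z \<or> q z x = p x"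
      using qp[of x y z] qp[of y z x] qp[of z x y] a v by auto
    note h = hexagon_steps[of "p x" "p y" "q x y" "p z" "q y z" "q z x" "c x y z", OF A B C]
    show "c x y z s t \<Longrightarrow> c x y z s t' \<Longrightarrow> t = t'" by (rule h(1)) (auto simp: c_def)
    show "c x y z s t \<Longrightarrow> c x y z s' t \<Longrightarrow> s = s'" by (rule h(2)) (auto simp: c_def)
    show "c x y z s t \<Longrightarrow> \<exists>u. c x y z t u" by (rule h(3)) (auto simp: c_def)
    show "c x y z s t \<Longrightarrow> \<exists>u. c x y z u s" by (rule h(4)) (auto simp: c_def)
  qed
  have U2: "t = t'" if "(s, t, f) \<in> S" "(s, t', f) \<in> S" for s t t' f
    using SE[OF that(1)] that hex(1) S_c by metis
  have U3: "s = s'" if "(s, t, f) \<in> S" "(s', t, f) \<in> S" for s s' t f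
    using SE[OF that(1)] that hex(2) S_c by metis
  have O2: "\<exists>u. (t, u, f) \<in> S" "\<exists>u. (u, s, f) \<in> S" if st: "(s, t, f) \<in> S" for s t f
  proof -
    obtain x y z where x: "(x, y, z) \<in> F" "f = orbit x y z" using SE[OF st] by blast
    show "\<exists>u. (t, u, f) \<in> S" "\<exists>u. (u, s, f) \<in> S" using hex(3,4)[OF x(1)] st unfolding x(2) S_c[OF x(1)] by auto
  qed
  have K1: "x = x' \<and> y = y'" if a: "adj F x y" "adj F x' y'" and e: "p x = p x'" "q x y = q x' y'" "p x \<noteq> q x y" for x y x' y'
  proof (cases "{x, y} = {x', y'}")
    case True
    thus ?thesis using e pp[OF a(1)] by (auto simp: doubleton_eq_iff)
  next
    case False
    hence "q x y = p y" "q x' y' = p y'" using qq[OF a] qq[OF a(2,1)] e by auto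
    hence "y = y' \<and> x = x'"
      using e q_sym[OF a(1)] q_sym[OF a(2)] by (intro contact[OF adj_sym[OF a(1)] adj_sym[OF a(2)]]) auto
    thus ?thesis by blast
  qed
  have K2: False if a: "adj F x y" "adj F x' y'" and e: "p x = q x' y'" "q x y = p y'" "p x \<noteq> q x y" for x y x' y'
  proof -
    have y: "q x y = p y" using qp[OF a(1), of y'] adj_verts[OF a(2)] e by auto
    have x': "q x' y' = p x'" using qp[OF a(2), of x] adj_verts[OF a(1)] e by auto
    have "y = y' \<and> x = x'"
      using e y x' q_sym[OF a(1)] q_sym[OF a(2)] by (intro contact[OF adj_sym[OF a(1)] adj_sym[OF a(2)]]) auto
    thus False using e y x' by auto
  qed
  have dart: "\<exists>x y z. (x, y, z) \<in> F \<and> f = orbit x y z \<and> (s = p x \<and> t = q x y \<or> s = q x y \<and> t = p y)" if "(s, t, f) \<in> S" for s t f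
    using that by (auto simp: S_def steps_def)
  have Sin: "s \<noteq> t \<Longrightarrow> s = p x \<and> t = q x y \<or> s = q x y \<and> t = p y \<Longrightarrow> (s, t, orbit x y z) \<in> S" if "(x, y, z) \<in> F" for x y z s t
    using that unfolding S_def steps_def by blast
  \<comment> \<open>A step determines its dart and thereby its face: otherwise two different edges
    between the same two classes would be merged with an end (\<open>K1\<close> and
    \<open>K2\<close>), against \<open>contact\<close>.\<close>
  have U1: "f = f'" if st: "(s, t, f) \<in> S" "(s, t, f') \<in> S" for s t f f'
  proof -
    obtain x y z where x: "(x, y, z) \<in> F" "f = orbit x y z" "s = p x \<and> t = q x y \<or> s = q x y \<and> t = p y" using dart[OF st(1)] by blast
    obtain x' y' z' where x': "(x', y', z') \<in> F" "f' = orbit x' y' z'" "s = p x' \<and> t = q x' y' \<or> s = q x' y' \<and> t = p y'" using dart[OF st(2)] by blast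
    have a: "adj F x y" "adj F y x" "adj F x' y'" "adj F y' x'" using face_adj[OF x(1)] face_adj[OF x'(1)] by auto
    have "x = x' \<and> y = y'"
      using x(3) x'(3) Sneq[OF st(1)] K1[OF a(1,3)] K1[OF a(2,4)] K2[OF a(1,3)] K2[OF a(3,1)] q_sym[OF a(1)] q_sym[OF a(3)] by auto
    thus ?thesis using x x' uniq by metis
  qed
  have O1: "\<exists>f'. (t, s, f') \<in> S" if st: "(s, t, f) \<in> S" for s t f
  proof -
    obtain x y z where x: "(x, y, z) \<in> F" "s = p x \<and> t = q x y \<or> s = q x y \<and> t = p y" using dart[OF st(1)] by blast
    obtain z' where z': "(y, x, z') \<in> F" using opp[OF x(1)] by blast
    have "q x y = q y x" using q_sym face_adj[OF x(1)] by blast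
    thus ?thesis using Sin[OF z', of t s] x(2) Sneq[OF st] by auto
  qed
  \<comment> \<open>A face cannot collapse completely: its corner of largest rank would have two
    neighbours in its class that do not exceed it.\<close>
  have some_step: "\<exists>s t. (s, t, orbit x y z) \<in> S" if f: "(x, y, z) \<in> F" for x y z
  proof (rule ccontr)
    assume "\<not> ?thesis"
    hence "\<not> c x y z s t" for s t using S_c[OF f] by blast
    from this[of "p x" "q x y"] this[of "q x y" "p y"] this[of "p y" "q y z"] this[of "q y z" "p z"]
    have e: "p x = q x y" "q x y = p y" "p y = q y z" "q y z = p z" unfolding c_def by auto
    note d = neqs[OF f] and a = face_adj[OF f]
    have "n y \<le> n x \<and> n z \<le> n x \<or> n x \<le> n y \<and> n z \<le> n y \<or> n x \<le> n z \<and> n y \<le> n z" by linarith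
    moreover have "p y = p x" "p z = p x" "p x = p y" "p z = p y" "p x = p z" "p y = p z" unfolding e by simp_all
    ultimately show False using rank[of x y z] rank[of y x z] rank[of z x y] d a by blast
  qed
  have "triangulation (coned S)"
  proof
    show "finite (coned S)"
    proof -
      have "S \<subseteq> (\<Union>(x, y, z)\<in>F. {(p x, q x y, orbit x y z), (q x y, p y, orbit x y z)})" by (auto simp: S_def steps_def)
      hence "finite S" by (rule finite_subset) (use finF in auto)
      thus ?thesis by (auto simp: coned_def)
    qed
    obtain x y z where xyz: "(x, y, z) \<in> F" using neF by auto
    obtain s t where "(s, t, orbit x y z) \<in> S" using some_step[OF xyz] by blast
    hence "(Inl s, Inl t, Inr (orbit x y z)) \<in> coned S" by (simp add: coned_mem)
    thus "coned S \<noteq> {}" by blast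
    show "(b, c, a) \<in> coned S" if "(a, b, c) \<in> coned S" for a b c using that by (auto simp: coned_def)
    show "a \<noteq> b" if "(a, b, c) \<in> coned S" for a b c using that Sneq by (auto simp: coned_def)
    show "c = d" if "(a, b, c) \<in> coned S" "(a, b, d) \<in> coned S" for a b c d
      using that U1 U2 U3 by (cases a; cases b) (auto simp: coned_mem)
    show "\<exists>d. (b, a, d) \<in> coned S" if abc: "(a, b, c) \<in> coned S" for a b c
    proof (cases a; cases b)
      fix s t assume [simp]: "a = Inl s" "b = Inl t"
      show ?thesis using abc O1[of s t] by (auto simp: coned_mem)
    next
      fix t f assume [simp]: "a = Inl t" "b = Inr f"
      obtain s where "(s, t, f) \<in> S" using abc by (auto simp: coned_mem)
      thus ?thesis using O2(1)[of s t f] by (auto simp: coned_mem)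
    next
      fix f s assume [simp]: "a = Inr f" "b = Inl s"
      obtain t where "(s, t, f) \<in> S" using abc by (auto simp: coned_mem)
      thus ?thesis using O2(2)[of s t f] by (auto simp: coned_mem)
    next
      fix f f' assume "a = Inr f" "b = Inr f'"
      thus ?thesis using abc by (simp add: coned_mem)
    qed
  next
    fix d :: "'b + 'a faces \<Rightarrow> 'b + 'a faces \<Rightarrow> real"
    assume anti: "\<And>a b c. (a, b, c) \<in> coned S \<Longrightarrow> d a b = - d b a"
      and closed: "\<And>a b c. (a, b, c) \<in> coned S \<Longrightarrow> d a b + d b c + d c a = 0"
    define e where "e s t = (if s = t then 0 else d (Inl s) (Inl t))" for s t
    have d_f: "d (Inl s) (Inl t) = d (Inr f) (Inl t) - d (Inr f) (Inl s)" "d (Inl s) (Inl t) = - d (Inl t) (Inl s)" "d (Inl t) (Inr f) = - d (Inr f) (Inl t)"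
      if "(s, t, f) \<in> S" for s t f
      using closed[of "Inl s" "Inl t" "Inr f"] anti[of "Inl s" "Inl t" "Inr f"] anti[of "Inl t" "Inr f" "Inl s"] that by (auto simp: coned_mem)
    have e_f: "e (p x) (q x y) = d (Inr (orbit x y z)) (Inl (q x y)) - d (Inr (orbit x y z)) (Inl (p x))"
      "e (q x y) (p y) = d (Inr (orbit x y z)) (Inl (p y)) - d (Inr (orbit x y z)) (Inl (q x y))"
      if "(x, y, z) \<in> F" for x y z
      using d_f(1)[OF Sin[OF that]] by (auto simp: e_def)
    have e_anti: "e (p x) (q x y) = - e (q x y) (p x)" "e (q x y) (p y) = - e (p y) (q x y)" if "adj F x y" for x y
      using adj_face[OF that] d_f(2)[OF Sin] by (auto simp: e_def)
    \<comment> \<open>The function on the quotient, pulled back to \<open>F\<close> along the two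
      halves of each edge; collapsed halves count zero.\<close>
    define \<delta> where "\<delta> x y = e (p x) (q x y) + e (q x y) (p y)" for x y
    have \<delta>f: "\<delta> x y = d (Inr (orbit x y z)) (Inl (p y)) - d (Inr (orbit x y z)) (Inl (p x))" if "(x, y, z) \<in> F" for x y z
      using e_f[OF that] by (simp add: \<delta>_def)
    have "\<exists>g. \<forall>x y z. (x, y, z) \<in> F \<longrightarrow> \<delta> x y = g y - g x"
    proof (rule exact)
      show "\<delta> x y = - \<delta> y x" if "(x, y, z) \<in> F" for x y z
      proof -
        have a: "adj F x y" "adj F y x" using face_adj[OF that] by auto
        show ?thesis using e_anti[OF a(1)] q_sym[OF a(1)] by (simp add: \<delta>_def)
      qed
      show "\<delta> x y + \<delta> y z + \<delta> z x = 0" if f: "(x, y, z) \<in> F" for x y z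
        using \<delta>f[OF f] \<delta>f[OF rot[OF f]] \<delta>f[OF rot2[OF f]] orbit_rot[of y z x] orbit_rot[of z x y] by simp
    qed
    then obtain g where g: "\<And>x y. adj F x y \<Longrightarrow> \<delta> x y = g y - g x" by (auto simp: adj_def)
    have gp: "g x = g y" if "x \<in> verts F" "y \<in> verts F" "p x = p y" for x y
      using conn[OF that]
    proof (induction rule: rtrancl_induct)
      case (step y z)
      hence "adj F y z" "p y = p z" by auto
      hence "\<delta> y z = 0" using pp[of y z] by (simp add: \<delta>_def e_def)
      thus ?case using g[OF \<open>adj F y z\<close>] step.IH by simp
    qed simp
    have gq: "g x + e (p x) (q x y) = g z" if a: "adj F x y" and z: "z \<in> verts F" "q x y = p z" for x y z
    proof -
      consider "q x y = p x" | "q x y = p y" using qp[OF a z] by blast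
      thus ?thesis
      proof cases
        case 1
        thus ?thesis using gp[of x z] adj_verts[OF a] z by (simp add: e_def)
      next
        case 2
        hence "g y = g z" using gp[of y z] adj_verts[OF a] z by simp
        thus ?thesis using g[OF a] 2 by (simp add: \<delta>_def e_def)
      qed
    qed
    have gqq: "g x + e (p x) (q x y) = g x' + e (p x') (q x' y')" if a: "adj F x y" "adj F x' y'" and eq: "q x y = q x' y'" for x y x' y'
    proof (cases "{x, y} = {x', y'}")
      case True
      have "g x + e (p x) (q x y) = g y + e (p y) (q y x)"
        using g[OF a(1)] e_anti[OF a(1)] q_sym[OF a(1)] by (simp add: \<delta>_def)
      thus ?thesis using True by (auto simp: doubleton_eq_iff)
    next
      case False
      then obtain z where "z \<in> verts F" "q x y = p z" using qq[OF a eq] adj_verts[OF a(1)] by blast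
      thus ?thesis using gq a eq by metis
    qed
    \<comment> \<open>The value at the centre of the face, computed from one corner; by
      \<open>h_rot\<close> the other corners give the same.\<close>
    define h where "h x y z = g x - d (Inr (orbit x y z)) (Inl (p x))" for x y z
    have h_rot: "h y z x = h x y z" if f: "(x, y, z) \<in> F" for x y z
      using \<delta>f[OF f] g[of x y] face_adj[OF f] orbit_rot[of y z x] by (simp add: h_def)
    define R where "R = {(Inl (p x), g x) | x. x \<in> verts F} \<union> {(Inl (q x y), g x + e (p x) (q x y)) | x y. adj F x y}
      \<union> {(Inr (orbit x y z), h x y z) | x y z. (x, y, z) \<in> F}"
    have "\<exists>G. \<forall>k v. (k, v) \<in> R \<longrightarrow> G k = v"
    proof (rule ex_function_of_relation)
      fix k v v' assume R: "(k, v) \<in> R" "(k, v') \<in> R"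
      show "v = v'"
      proof (cases k)
        case (Inl s)
        have wl: "(\<exists>x\<in>verts F. s = p x \<and> w = g x) \<or> (\<exists>x y. adj F x y \<and> s = q x y \<and> w = g x + e (p x) (q x y))" if "(k, w) \<in> R" for w
          using that Inl by (auto simp: R_def)
        note w = wl[OF R(1)] wl[OF R(2)]
        show ?thesis
        proof (cases "\<exists>x\<in>verts F. s = p x")
          case True
          then obtain x where x: "x \<in> verts F" "s = p x" by blast
          have "u = g x" if u: "(k, u) \<in> R" for u
          proof -
            consider x' where "x' \<in> verts F" "s = p x'" "u = g x'" | x' y' where "adj F x' y'" "s = q x' y'" "u = g x' + e (p x') (q x' y')"
              using wl[OF u] by blast
            thus ?thesis
            proof cases
              case (1 x')
              thus ?thesis using gp[of x' x] x by simp
            next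
              case (2 x' y')
              thus ?thesis using gq[OF 2(1) x(1)] x by simp
            qed
          qed
          from this[OF R(1)] this[OF R(2)] show ?thesis by simp
        next
          case False
          then obtain x y x' y' where xy: "adj F x y" "adj F x' y'" "s = q x y" "s = q x' y'"
            "v = g x + e (p x) (q x y)" "v' = g x' + e (p x') (q x' y')" using w by blast
          show ?thesis unfolding xy(5,6) using gqq[OF xy(1,2)] xy(3,4) by metis
        qed
      next
        case (Inr f)
        obtain x y z where 1: "(x, y, z) \<in> F" "f = orbit x y z" "v = h x y z" using R(1) Inr by (auto simp: R_def)
        obtain x' y' z' where 2: "f = orbit x' y' z'" "v' = h x' y' z'" using R(2) Inr by (auto simp: R_def)
        show ?thesis using orbit_eqD[of x' y' z' x y z] 1 2 h_rot[OF 1(1)] h_rot[OF rot[OF 1(1)]] by auto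
      qed
    qed
    then obtain G where G: "\<And>k v. (k, v) \<in> R \<Longrightarrow> G k = v" by blast
    have Gp: "G (Inl (p x)) = g x" if "x \<in> verts F" for x using that by (intro G) (auto simp: R_def)
    have Gq: "G (Inl (q x y)) = g x + e (p x) (q x y)" if "adj F x y" for x y using that by (intro G) (auto simp: R_def)
    have Gf: "G (Inr (orbit x y z)) = h x y z" if "(x, y, z) \<in> F" for x y z using that by (intro G) (auto simp: R_def)
    have main: "d (Inl s) (Inl t) = G (Inl t) - G (Inl s)" "d (Inl t) (Inr f) = G (Inr f) - G (Inl t)" "d (Inr f) (Inl s) = G (Inl s) - G (Inr f)"
      if st: "(s, t, f) \<in> S" for s t f
    proof -
      obtain x y z where x: "(x, y, z) \<in> F" "f = orbit x y z" and o: "s = p x \<and> t = q x y \<or> s = q x y \<and> t = p y" using dart[OF st(1)] by blast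
      have a: "adj F x y" and v: "x \<in> verts F" "y \<in> verts F" using face_adj[OF x(1)] face_verts[OF x(1)] by auto
      have Gf': "d (Inr f) (Inl w) = G (Inl w) - G (Inr f)" if "w = p x \<or> w = q x y \<or> w = p y" for w
        using that Gp[OF v(1)] Gp[OF v(2)] Gq[OF a] Gf[OF x(1)] e_f[OF x(1)] g[OF a] unfolding x(2) h_def \<delta>_def by auto
      show "d (Inr f) (Inl s) = G (Inl s) - G (Inr f)" using Gf' o by blast
      moreover have "d (Inr f) (Inl t) = G (Inl t) - G (Inr f)" using Gf' o by blast
      ultimately show "d (Inl s) (Inl t) = G (Inl t) - G (Inl s)" "d (Inl t) (Inr f) = G (Inr f) - G (Inl t)"
        using d_f(1,3)[OF st] by auto
    qed
    show "\<exists>g. \<forall>a b c. (a, b, c) \<in> coned S \<longrightarrow> d a b = g b - g a"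
      by (rule exI[of _ G]) (use main in \<open>auto simp: coned_def\<close>)
  next
    fix Z assume Z: "Z \<subseteq> coned S" "Z \<noteq> {}" and Zrot: "\<And>a b c. (a, b, c) \<in> Z \<Longrightarrow> (b, c, a) \<in> Z"
      and Zopp: "\<And>a b c d. (a, b, c) \<in> Z \<Longrightarrow> (b, a, d) \<in> coned S \<Longrightarrow> (b, a, d) \<in> Z"
    define H where "H = {(s, t, f). (Inl s, Inl t, Inr f) \<in> Z}"
    have HS: "(s, t, f) \<in> S" if "(s, t, f) \<in> H" for s t f using that Z(1) by (auto simp: H_def coned_def)
    have ZH: "\<exists>s t. (s, t, f) \<in> H" if "(a, b, c) \<in> Z" "Inr f \<in> {a, b, c}" for a b c f
      using that Zrot[of a b c] Zrot[of b c a] subsetD[OF Z(1) that(1)] by (auto simp: H_def coned_def)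
    have Hnext: "(t, u, f) \<in> H" if "(s, t, f) \<in> H" "(t, u, f) \<in> S" for s t u f
    proof -
      have "(Inl t, Inr f, Inl s) \<in> Z" using that(1) Zrot by (auto simp: H_def)
      moreover have "(Inr f, Inl t, Inl u) \<in> coned S" using that(2) by (auto simp: coned_mem)
      ultimately have "(Inr f, Inl t, Inl u) \<in> Z" by (rule Zopp)
      thus ?thesis using Zrot by (auto simp: H_def)
    qed
    \<comment> \<open>The faces of \<open>F\<close> that have been reached. By \<open>all\<close>, a
      reached face is reached in all its sides; by \<open>cross\<close>, only an edge with both ends
      in one class can block the way to the next face.\<close>
    define \<Phi> where "\<Phi> = {(x, y, z) \<in> F. \<exists>s t. (s, t, orbit x y z) \<in> H}"
    have all: "(s, t, orbit x y z) \<in> H" if \<Phi>: "(x, y, z) \<in> \<Phi>" and st: "(s, t, orbit x y z) \<in> S" for x y z s t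
    proof -
      have f: "(x, y, z) \<in> F" using \<Phi> by (auto simp: \<Phi>_def)
      define Q where "Q s \<longleftrightarrow> (\<exists>t. (s, t, orbit x y z) \<in> H)" for s
      have nxt: "Q b" if Qa: "Q a" "a = b \<or> (a, b, orbit x y z) \<in> S" for a b
      proof (cases "a = b")
        case False
        hence ab: "(a, b, orbit x y z) \<in> S" using Qa by blast
        obtain b' where "(a, b', orbit x y z) \<in> H" using Qa by (auto simp: Q_def)
        hence "(a, b, orbit x y z) \<in> H" using U2[OF ab] HS by metis
        moreover obtain u where "(b, u, orbit x y z) \<in> S" using O2(1)[OF ab] by blast
        ultimately show ?thesis using Hnext unfolding Q_def by blast
      qed (use that in simp)
      have nxt': "Q a \<Longrightarrow> a = b \<or> c x y z a b \<Longrightarrow> Q b" for a b using nxt S_c[OF f] by blast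
      have cyc: "Q (p x) \<Longrightarrow> Q (q x y)" "Q (q x y) \<Longrightarrow> Q (p y)" "Q (p y) \<Longrightarrow> Q (q y z)" "Q (q y z) \<Longrightarrow> Q (p z)"
        "Q (p z) \<Longrightarrow> Q (q z x)" "Q (q z x) \<Longrightarrow> Q (p x)"
        using nxt'[of "p x" "q x y"] nxt'[of "q x y" "p y"] nxt'[of "p y" "q y z"] nxt'[of "q y z" "p z"] nxt'[of "p z" "q z x"] nxt'[of "q z x" "p x"]
        unfolding c_def by auto
      obtain s' t' where h: "(s', t', orbit x y z) \<in> H" using \<Phi> by (auto simp: \<Phi>_def)
      have "Q s'" using h unfolding Q_def by blast
      moreover have "c x y z s' t'" using HS[OF h] unfolding S_c[OF f] .
      moreover have "c x y z s t" using st unfolding S_c[OF f] .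
      ultimately have "Q s" using cyc unfolding c_def by blast
      thus ?thesis using U2[OF st] HS unfolding Q_def by metis
    qed
    have \<Phi>rot: "(y, z, x) \<in> \<Phi>" if "(x, y, z) \<in> \<Phi>" for x y z
      using that rot orbit_rot[of y z x] by (auto simp: \<Phi>_def)
    have cross: "p x = p y" if \<Phi>: "(x, y, z) \<in> \<Phi>" and f: "(y, x, z') \<in> F" "(y, x, z') \<notin> \<Phi>" for x y z z'
    proof (rule ccontr)
      assume "p x \<noteq> p y"
      have xyz: "(x, y, z) \<in> F" using \<Phi> by (auto simp: \<Phi>_def)
      have sym: "q x y = q y x" using q_sym face_adj[OF xyz] by blast
      obtain s t where st: "s \<noteq> t" "s = p x \<and> t = q x y \<or> s = q x y \<and> t = p y" using \<open>p x \<noteq> p y\<close> by metis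
      have "(s, t, orbit x y z) \<in> H" by (rule all[OF \<Phi> Sin[OF xyz st]])
      moreover have "(t, s, orbit y x z') \<in> S" using st sym by (intro Sin[OF f(1)]) auto
      ultimately have "(t, s, orbit y x z') \<in> H"
        using Zopp[of "Inl s" "Inl t"] by (auto simp: H_def coned_mem)
      thus False using f by (auto simp: \<Phi>_def)
    qed
    have "\<Phi> = F"
    proof (rule ccontr)
      assume ne: "\<Phi> \<noteq> F"
      \<comment> \<open>The edges across which membership in \<open>\<Phi>\<close> changes; their
        ends are in one class. At an end of largest rank there is only one such edge, but going once
        around a vertex membership changes an even number of times.\<close>
      define B where "B = {(x, y). \<exists>z z'. (x, y, z) \<in> F \<and> (y, x, z') \<in> F \<and> ((x, y, z) \<in> \<Phi> \<longleftrightarrow> (y, x, z') \<notin> \<Phi>)}"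
      have Bsym: "(y, x) \<in> B" if "(x, y) \<in> B" for x y using that by (auto simp: B_def)
      have Badj: "adj F x y \<and> p y = p x" if "(x, y) \<in> B" for x y
        using that cross unfolding B_def adj_def by (auto dest: sym)
      have "B \<noteq> {}"
      proof
        assume B0: "B = {}"
        have "\<Phi> = F"
        proof (rule strongly_connected)
          show "\<Phi> \<subseteq> F" by (auto simp: \<Phi>_def)
          obtain a b c' where abc: "(a, b, c') \<in> Z" using Z(2) by auto
          then obtain f where "Inr f \<in> {a, b, c'}" using Z(1) by (auto simp: coned_def)
          then obtain s t where "(s, t, f) \<in> H" using ZH[OF abc] by blast
          thus "\<Phi> \<noteq> {}" using SE[OF HS] unfolding \<Phi>_def by blast
          show "(b, c, a) \<in> \<Phi>" if "(a, b, c) \<in> \<Phi>" for a b c using \<Phi>rot that .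
          show "(b, a, d) \<in> \<Phi>" if ab: "(a, b, c) \<in> \<Phi>" "(b, a, d) \<in> F" for a b c d
          proof (rule ccontr)
            assume "(b, a, d) \<notin> \<Phi>"
            moreover have "(a, b, c) \<in> F" using ab by (auto simp: \<Phi>_def)
            ultimately have "(a, b) \<in> B" using ab unfolding B_def by blast
            thus False using B0 by blast
          qed
        qed
        thus False using ne by blast
      qed
      moreover have "finite B" by (rule finite_subset[OF _ finite_darts]) (use Badj in \<open>auto simp: darts_def\<close>)
      ultimately have M: "finite (n ` fst ` B)" "n ` fst ` B \<noteq> {}" by auto
      obtain x y0 where x: "(x, y0) \<in> B" "n x = Max (n ` fst ` B)" using Max_in[OF M] by fastforce
      have x: "(x, y0) \<in> B" "\<And>y. y \<in> fst ` B \<Longrightarrow> n y \<le> n x" using x Max_ge[OF M(1)] by auto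
      have y0: "y = y0" if "(x, y) \<in> B" for y
        using rank[of x y y0] Badj[OF that] Badj[OF x(1)] x(2)[of y] x(2)[of y0] Bsym[OF that] Bsym[OF x(1)] by (force simp: image_iff)
      have ad: "adj F x y0" using Badj[OF x(1)] by blast
      define A where "A = {y \<in> nb F x. (x, y, nx F x y) \<in> \<Phi>}"
      have step: "nx F x y \<in> A \<longleftrightarrow> y \<in> A" if y: "y \<in> nb F x" "nx F x y \<noteq> y0" for y
      proof -
        define w where "w = nx F x y"
        have f: "(x, y, w) \<in> F" using y nx_face by (auto simp: nb_def w_def)
        hence f': "(w, x, y) \<in> F" "adj F x w" using rot2 face_adj by auto
        have g: "(x, w, nx F x w) \<in> F" using nx_face f'(2) by blast
        have "(x, w) \<notin> B" using y0 y(2) by (auto simp: w_def)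
        hence "(x, w, nx F x w) \<in> \<Phi> \<longleftrightarrow> (w, x, y) \<in> \<Phi>" using f'(1) g unfolding B_def by blast
        moreover have "(w, x, y) \<in> \<Phi> \<longleftrightarrow> (x, y, w) \<in> \<Phi>" using \<Phi>rot by blast
        ultimately show ?thesis using y f'(2) by (auto simp: A_def nb_def w_def)
      qed
      obtain y1 where y1: "y1 \<in> nb F x" "nx F x y1 = y0"
        using nx_bij[of x] ad unfolding bij_betw_def nb_def by (metis (mono_tags, lifting) imageE mem_Collect_eq)
      have inv: "y1 \<in> C" if C: "C \<subseteq> nb F x" "y0 \<in> C" "\<And>y. y \<in> C \<Longrightarrow> nx F x y \<in> C" for C
      proof -
        have "nx F x ` C = C"
          by (intro endo_inj_surj finite_subset[OF C(1) finite_nb] inj_on_subset[OF nx_inj C(1)]) (use C(3) in auto)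
        then obtain y where "y \<in> C" "nx F x y = y0" using C(2) by (metis imageE)
        hence "y = y1" using inj_onD[OF nx_inj, of x y y1] y1 C(1) by auto
        thus ?thesis using \<open>y \<in> C\<close> by simp
      qed
      have nbc: "nx F x y \<in> nb F x" if "y \<in> nb F x" for y using that nx_adj by (auto simp: nb_def)
      have "y1 \<in> A \<longleftrightarrow> y0 \<in> A"
      proof
        assume "y0 \<in> A"
        thus "y1 \<in> A" using step by (intro inv) (auto simp: A_def)
      next
        assume y1A: "y1 \<in> A"
        show "y0 \<in> A"
        proof (rule ccontr)
          assume "y0 \<notin> A"
          hence "y1 \<in> nb F x - A" using step nbc ad by (intro inv) (auto simp: nb_def)
          thus False using y1A by blast
        qed
      qed
      hence "(x, y0, nx F x y0) \<in> \<Phi> \<longleftrightarrow> (x, y1, y0) \<in> \<Phi>" using y1 ad by (auto simp: A_def nb_def)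
      moreover have "(x, y1, y0) \<in> \<Phi> \<longleftrightarrow> (y0, x, y1) \<in> \<Phi>" using \<Phi>rot by blast
      moreover obtain z z' where z: "(x, y0, z) \<in> F" "(y0, x, z') \<in> F" "(x, y0, z) \<in> \<Phi> \<longleftrightarrow> (y0, x, z') \<notin> \<Phi>"
        using x(1) unfolding B_def by blast
      moreover have "(x, y1, y0) \<in> F" using y1 nx_face[of x y1] by (simp add: nb_def)
      hence "z' = y1" by (rule uniq[OF z(2) rot2])
      moreover have "nx F x y0 = z" by (rule nx_eq[OF z(1)])
      ultimately show False by metis
    qed
    hence "(s, t, f) \<in> H" if "(s, t, f) \<in> S" for s t f using all that SE[OF that] by blast
    hence "(Inl s, Inl t, Inr f) \<in> Z" if "(s, t, f) \<in> S" for s t f using that by (auto simp: H_def)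
    hence "coned S \<subseteq> Z" unfolding coned_def using Zrot by blast
    thus "Z = coned S" using Z(1) by blast
  qed
  thus ?thesis by (simp add: S_def)
qed

end

text \<open>Vertices, edges and faces of the original triangulation, in this order.\<close>

type_synonym 'a sd = "('a + 'a set) + 'a faces"

text \<open>\<open>n\<close> is the distance from \<open>r\<close>, and \<open>par x\<close> the
  predecessor of \<open>x\<close> on a shortest path.\<close>

lemma ex_spanning_tree:
  assumes "\<And>x. x \<in> W \<Longrightarrow> (r, x) \<in> {(x, y). x \<in> W \<and> y \<in> W \<and> R x y}\<^sup>*"
  shows "\<exists>(n :: 'a \<Rightarrow> nat) par. \<forall>x\<in>W - {r}. par x \<in> W \<and> R (par x) x \<and> n (par x) < n x"
proof -
  define Q where "Q = {(x, y). x \<in> W \<and> y \<in> W \<and> R x y}"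
  define n where "n x = (LEAST k. (r, x) \<in> Q ^^ k)" for x
  have "\<exists>y. y \<in> W \<and> R y x \<and> n y < n x" if x: "x \<in> W - {r}" for x
  proof -
    have "\<exists>k. (r, x) \<in> Q ^^ k" using assms[of x] x rtrancl_imp_relpow[of "(r, x)"] by (auto simp: Q_def)
    hence k: "(r, x) \<in> Q ^^ n x" unfolding n_def by (rule LeastI_ex)
    obtain m where m: "n x = Suc m" using k x by (cases "n x") auto
    then obtain y where y: "(r, y) \<in> Q ^^ m" "(y, x) \<in> Q" using k by auto
    have "n y \<le> m" unfolding n_def by (rule Least_le[of "\<lambda>k. (r, y) \<in> Q ^^ k", OF y(1)])
    thus ?thesis using y(2) m by (auto simp: Q_def)
  qed
  thus ?thesis by (intro exI[of _ n]) metis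
qed

section \<open>Realizing prescribed adjacencies by contraction\<close>

context triangulation
begin

text \<open>The quotient in which nothing is merged.\<close>

lemma triangulation_sd: "triangulation (coned (steps Inl (\<lambda>x y. Inr {x, y}) F))"
proof (rule triangulation_quotient[where n = "\<lambda>_. 0"])
  show "y = y'" if "adj F x y" "Inl y = Inl x" for x y y' using that adj_verts by blast
  show "Inr {x, y} = Inl x" if "adj F x y" "Inl x = Inl y" for x y using that adj_verts by blast
qed (auto simp: insert_commute)

text \<open>Each \<open>W u\<close> is thickened to a tree in the barycentric subdivision: its vertices together
  with the edges of a spanning tree and, as additional leaves, the edges leading to the neighbours
  that are to be connected with \<open>u\<close>. Contracting these trees and one edge for each contact
  realizes the prescribed adjacencies and no others.\<close>

theorem ex_contracted_triangulation:
  fixes W :: "'v \<Rightarrow> 'a set"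
  assumes WF: "\<And>u. u \<in> V \<Longrightarrow> W u \<subseteq> verts F" and Wne: "\<And>u. u \<in> V \<Longrightarrow> W u \<noteq> {}"
    and Wdisj: "\<And>u v x. u \<in> V \<Longrightarrow> v \<in> V \<Longrightarrow> x \<in> W u \<Longrightarrow> x \<in> W v \<Longrightarrow> u = v"
    and Wconn: "\<And>u x y. u \<in> V \<Longrightarrow> x \<in> W u \<Longrightarrow> y \<in> W u \<Longrightarrow> (x, y) \<in> {(x, y). x \<in> W u \<and> y \<in> W u \<and> adj F x y}\<^sup>*"
    and E: "\<And>e. e \<in> E \<Longrightarrow> \<exists>u v x y. e = {u, v} \<and> u \<in> V \<and> v \<in> V \<and> u \<noteq> v \<and> x \<in> W u \<and> y \<in> W v \<and> adj F x y"
  shows "\<exists>T (\<rho> :: 'v \<Rightarrow> ('v + 'a sd + 'a sd set) + 'a sd faces) o1 o2 o3.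
    triangulation T \<and> inj_on \<rho> V \<and> \<rho> ` V \<subseteq> verts T \<and>
    (\<forall>u\<in>V. \<forall>v\<in>V. u \<noteq> v \<longrightarrow> (adj T (\<rho> u) (\<rho> v) \<longleftrightarrow> {u, v} \<in> E)) \<and>
    (o1, o2, o3) \<in> T \<and> \<rho> ` V \<inter> {o1, o2, o3} = {}"
proof -
  define L :: "'a sd faces" where "L = coned (steps Inl (\<lambda>x y. Inr {x, y}) F)"
  interpret L: triangulation L unfolding L_def by (rule triangulation_sd)
  have LF: "(Inl (Inl x), Inl (Inr {x, y}), Inr (orbit x y z)) \<in> L" if "(x, y, z) \<in> F" for x y z
    unfolding L_def coned_mem steps_def using that by blast
  have L1: "adj L (Inl (Inl x)) (Inl (Inr {x, y}))" if "adj F x y" for x y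
    using that LF unfolding adj_def by blast
  have LVE: "x \<in> e" if "adj L (Inl (Inl x)) (Inl (Inr e))" for x e
    using that by (auto simp: adj_def L_def coned_mem steps_def)
  have LEV: "x \<in> e" if "adj L (Inl (Inr e)) (Inl (Inl x))" for x e using LVE L.adj_sym[OF that] .
  have LVV: "\<not> adj L (Inl (Inl x)) (Inl (Inl y))" "\<not> adj L (Inl (Inr e)) (Inl (Inr e'))" for x y e e'
    by (auto simp: adj_def L_def coned_mem steps_def)
  define r where "r u = (SOME x. x \<in> W u)" for u
  have r: "r u \<in> W u" if "u \<in> V" for u using Wne[OF that] by (simp add: r_def some_in_eq)
  have "\<exists>n par. \<forall>x\<in>W u - {r u}. par x \<in> W u \<and> adj F (par x) x \<and> (n (par x) :: nat) < n x" if "u \<in> V" for u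
    using Wconn[OF that r[OF that]] by (rule ex_spanning_tree)
  then obtain n' par where np: "\<And>u x. u \<in> V \<Longrightarrow> x \<in> W u \<Longrightarrow> x \<noteq> r u \<Longrightarrow> par u x \<in> W u \<and> adj F (par u x) x \<and> (n' u (par u x) :: nat) < n' u x"
    by (metis DiffI singletonD)
  define n where "n x = n' (THE u. u \<in> V \<and> x \<in> W u) x" for x
  have n: "n x = n' u x" if "u \<in> V" "x \<in> W u" for u x
  proof -
    have "(THE u. u \<in> V \<and> x \<in> W u) = u" using Wdisj that by (intro the_equality) auto
    thus ?thesis by (simp add: n_def)
  qed
  have par: "par u x \<in> W u" "adj F (par u x) x" "n (par u x) < n x" if "u \<in> V" "x \<in> W u" "x \<noteq> r u" for u x
    using np[OF that] n[OF that(1)] that(2) by auto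
  obtain cu cv cx cy where c: "\<And>e. e \<in> E \<Longrightarrow> e = {cu e, cv e} \<and> cu e \<in> V \<and> cv e \<in> V \<and> cu e \<noteq> cv e \<and> cx e \<in> W (cu e) \<and> cy e \<in> W (cv e) \<and> adj F (cx e) (cy e)"
    using E by metis
  define X :: "'v \<Rightarrow> 'a sd set" where "X u = {Inl (Inl x) | x. x \<in> W u} \<union> {Inl (Inr {x, par u x}) | x. x \<in> W u \<and> x \<noteq> r u}
    \<union> {Inl (Inr {cx e, cy e}) | e. e \<in> E \<and> cu e = u}" for u
  have cW: "cx e \<in> W u \<longleftrightarrow> u = cu e" "cy e \<in> W u \<longleftrightarrow> u = cv e" if "e \<in> E" "u \<in> V" for e u
    using c[OF that(1)] Wdisj that(2) by auto
  have XV: "Inl (Inl x) \<in> X u \<longleftrightarrow> x \<in> W u" for x u by (auto simp: X_def)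
  have XE: "(\<exists>x. x \<in> W u \<and> x \<noteq> r u \<and> e = {x, par u x}) \<or> (\<exists>k\<in>E. cu k = u \<and> e = {cx k, cy k})" if "Inl (Inr e) \<in> X u" for e u
    using that by (auto simp: X_def)
  have XF: "Inr f \<notin> X u" for f u by (auto simp: X_def)
  have e_eq: "k = k'" if "k \<in> E" "k' \<in> E" "{cx k, cy k} = {cx k', cy k'}" for k k'
  proof -
    have "cu k = cu k' \<and> cv k = cv k' \<or> cu k = cv k' \<and> cv k = cu k'"
      using that(3) cW[OF that(1)] cW[OF that(2)] c[OF that(1)] c[OF that(2)] unfolding doubleton_eq_iff by metis
    thus ?thesis using c[OF that(1)] c[OF that(2)] by (metis insert_commute)
  qed
  have Xdisj: "u = v" if uv: "u \<in> V" "v \<in> V" and s: "s \<in> X u" "s \<in> X v" for u v s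
  proof (cases s)
    case (Inl s')
    show ?thesis
    proof (cases s')
      case (Inl x)
      thus ?thesis using s \<open>s = Inl s'\<close> XV Wdisj uv by blast
    next
      case (Inr e)
      have tree: "e \<subseteq> W w \<and> e \<noteq> {}" if "w \<in> V" "x \<in> W w" "x \<noteq> r w" "e = {x, par w x}" for w x using par(1)[OF that(1-3)] that by auto
      have cont: "\<not> e \<subseteq> W w" if "w \<in> V" "k \<in> E" "e = {cx k, cy k}" for w k
        using that cW[OF that(2,1)] c[OF that(2)] by auto
      have D: "e \<subseteq> W w \<and> e \<noteq> {} \<or> (\<exists>k\<in>E. cu k = w \<and> e = {cx k, cy k})" if "w \<in> V" "Inl (Inr e) \<in> X w" for w
        using XE[OF that(2)] tree[OF that(1)] by blast
      have "Inl (Inr e) \<in> X u" "Inl (Inr e) \<in> X v" using s \<open>s = Inl s'\<close> Inr by auto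
      from D[OF uv(1) this(1)] D[OF uv(2) this(2)] show ?thesis
      proof (elim disjE bexE conjE)
        assume "e \<subseteq> W u" "e \<subseteq> W v" "e \<noteq> {}"
        thus ?thesis using Wdisj[OF uv] by blast
      next
        fix k k' assume "k \<in> E" "k' \<in> E" "e = {cx k, cy k}" "e = {cx k', cy k'}" "cu k = u" "cu k' = v"
        thus ?thesis using e_eq[of k k'] by simp
      next
        fix k assume "k \<in> E" "e = {cx k, cy k}" "e \<subseteq> W u"
        thus ?thesis using cont uv by blast
      next
        fix k assume "k \<in> E" "e = {cx k, cy k}" "e \<subseteq> W v"
        thus ?thesis using cont uv by blast
      qed
    qed
  qed (use s XF in simp)
  define p :: "'a sd \<Rightarrow> 'v + 'a sd + 'a sd set" where "p s = (if \<exists>u\<in>V. s \<in> X u then Inl (THE u. u \<in> V \<and> s \<in> X u) else Inr (Inl s))" for s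
  have p_in: "p s = Inl u" if "u \<in> V" "s \<in> X u" for u s
  proof -
    have "(THE u. u \<in> V \<and> s \<in> X u) = u" using Xdisj that by (intro the_equality) auto
    thus ?thesis using that by (auto simp: p_def)
  qed
  have p_out: "p s = Inr (Inl s)" if "\<And>u. u \<in> V \<Longrightarrow> s \<notin> X u" for s using that by (auto simp: p_def)
  have p_cases: "(\<exists>u\<in>V. s \<in> X u \<and> p s = Inl u) \<or> p s = Inr (Inl s)" for s using p_in p_out by blast
  have p_eq: "\<exists>u\<in>V. s \<in> X u \<and> t \<in> X u" if "p s = p t" "s \<noteq> t" for s t
    using p_cases[of s] p_cases[of t] that by auto
  \<comment> \<open>The tree of \<open>cu e\<close> has as a leaf the edge from \<open>cx e\<close>
    to \<open>cy e\<close>. The pair in \<open>K\<close> leads from this leaf to the vertex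
    \<open>cy e\<close> of the other tree; it is the one edge merged to create the contact.\<close>
  define K :: "('a sd \<times> 'a sd) set" where "K = {(Inl (Inr {cx e, cy e}), Inl (Inl (cy e))) | e. e \<in> E}"
  have KD: "\<exists>e\<in>E. s = Inl (Inr {cx e, cy e}) \<and> t = Inl (Inl (cy e)) \<and> p s = Inl (cu e) \<and> p t = Inl (cv e)" if "(s, t) \<in> K" for s t
  proof -
    obtain e where e: "e \<in> E" "s = Inl (Inr {cx e, cy e})" "t = Inl (Inl (cy e))" using \<open>(s, t) \<in> K\<close> by (auto simp: K_def)
    have "s \<in> X (cu e)" "t \<in> X (cv e)" using e c[OF e(1)] by (auto simp: X_def)
    thus ?thesis using p_in c[OF e(1)] e by blast
  qed
  \<comment> \<open>Inside a class everything is merged, and a contact edge goes to the class of its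
    leaf. All other edges remain as vertices of their own, which keeps the classes apart.\<close>
  define q where "q s t = (if p s = p t then p s else if (s, t) \<in> K then p s else if (t, s) \<in> K then p t else Inr (Inr {s, t}))" for s t
  have q_cases: "q s t = p s \<or> q s t = p t \<or> q s t = Inr (Inr {s, t})" for s t by (simp add: q_def)
  have pII: "p s \<noteq> Inr (Inr z)" "Inr (Inr z) \<noteq> p s" for s z using p_cases[of s] by auto
  \<comment> \<open>For a vertex of a tree, the edge to its parent is the only neighbour in the
    class of no larger rank; for a tree edge, it is the parent. A leaf ranks above its ends, of
    which only one is in its class. This is what the hypothesis \<open>rank\<close> asks
    for.\<close>
  define rk :: "'a sd \<Rightarrow> nat" where "rk s = (case s of Inl (Inl x) \<Rightarrow> 2 * n x | Inl (Inr e) \<Rightarrow>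
    if \<exists>u\<in>V. e \<subseteq> W u then 2 * Max (n ` e) - 1 else 2 * Max (n ` e) + 1 | Inr f \<Rightarrow> 0)" for s
  have rkV: "rk (Inl (Inl x)) = 2 * n x" for x by (simp add: rk_def)
  have rkT: "rk (Inl (Inr {x, par u x})) = 2 * n x - 1" "0 < n x" if "u \<in> V" "x \<in> W u" "x \<noteq> r u" for u x
    using par[OF that] that by (auto simp: rk_def)
  have rkC: "2 * n x < rk (Inl (Inr {cx e, cy e}))" if "e \<in> E" "x \<in> {cx e, cy e}" for e x
  proof -
    have "\<not> (\<exists>u\<in>V. {cx e, cy e} \<subseteq> W u)" using cW[OF that(1)] c[OF that(1)] by auto
    moreover have "n x \<le> Max (n ` {cx e, cy e})" using that(2) by (intro Max_ge) auto
    ultimately show ?thesis by (auto simp: rk_def)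
  qed
  let ?T = "coned (steps p q L)"
  have T: "triangulation ?T"
  proof (rule L.triangulation_quotient[where n = rk])
    fix s t assume a: "adj L s t"
    show "q s t = q t s" using KD[of s t] KD[of t s] by (auto simp: q_def insert_commute)
    show "q s t = p s" if "p s = p t" using that by (simp add: q_def)
    show "{s, t} = {s', t'} \<or> q s t = p s \<or> q s t = p t" if "q s t = q s' t'" for s' t'
      using q_cases[of s t] q_cases[of s' t'] that pII by (metis sum.inject(2))
    show "q s t = p s \<or> q s t = p t" if "q s t = p z" for z using q_cases[of s t] that pII by metis
    show "s = s' \<and> t = t'" if h: "p s \<noteq> p t" "q s t = p s" "p s' = p s" "p t' = p t" "q s' t' = p s' \<or> q s' t' = p t'" for s' t'
    proof -
      have "(s, t) \<in> K" using h(1,2) pII by (auto simp: q_def split: if_splits)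
      then obtain e where e: "e \<in> E" "s = Inl (Inr {cx e, cy e})" "t = Inl (Inl (cy e))" "p s = Inl (cu e)" "p t = Inl (cv e)" using KD by blast
      have "(s', t') \<in> K \<or> (t', s') \<in> K" using h pII by (auto simp: q_def split: if_splits)
      thus ?thesis
      proof
        assume "(s', t') \<in> K"
        then obtain e' where e': "e' \<in> E" "s' = Inl (Inr {cx e', cy e'})" "t' = Inl (Inl (cy e'))" "p s' = Inl (cu e')" "p t' = Inl (cv e')" using KD by blast
        hence "e = e'" using e h c[OF e(1)] c[OF e'(1)] by simp
        thus ?thesis using e e' by simp
      next
        assume "(t', s') \<in> K"
        then obtain e' where e': "e' \<in> E" "p t' = Inl (cu e')" "p s' = Inl (cv e')" using KD by blast
        hence "e = e'" using e h c[OF e(1)] c[OF e'(1)] by (simp add: insert_commute)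
        thus ?thesis using e e' h c[OF e(1)] by simp
      qed
    qed
  next
    fix s t assume "s \<in> verts L" "t \<in> verts L" and pst: "p s = p t"
    define R where "R = {(x, y). adj L x y \<and> p x = p y}"
    have R: "(Inl (Inl x), Inl (Inr {x, y})) \<in> R" if "adj F x y" "u \<in> V" "x \<in> W u" "Inl (Inr {x, y}) \<in> X u" for u x y
      using L1[OF that(1)] p_in[OF that(2), of "Inl (Inl x)"] p_in[OF that(2,4)] XV that(3) by (auto simp: R_def)
    have symR: "sym (R\<^sup>*)" by (rule sym_rtrancl) (auto simp: R_def sym_def L.adj_commute)
    have V: "(Inl (Inl x), Inl (Inl (r u))) \<in> R\<^sup>*" if "u \<in> V" "x \<in> W u" for u x
      using that(2)
    proof (induction "n x" arbitrary: x rule: less_induct)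
      case less
      show ?case
      proof (cases "x = r u")
        case False
        note px = par[OF that(1) less.prems False]
        have mem: "Inl (Inr {x, par u x}) \<in> X u" using less.prems False by (auto simp: X_def)
        hence mem': "Inl (Inr {par u x, x}) \<in> X u" by (simp add: insert_commute)
        have "(Inl (Inl x), Inl (Inr {x, par u x})) \<in> R" by (rule R[OF adj_sym[OF px(2)] that(1) less.prems mem])
        moreover have "(Inl (Inr {x, par u x}), Inl (Inl (par u x))) \<in> R\<^sup>*"
          using symD[OF symR r_into_rtrancl[OF R[OF px(2) that(1) px(1) mem']]] by (simp add: insert_commute)
        moreover have "(Inl (Inl (par u x)), Inl (Inl (r u))) \<in> R\<^sup>*" by (rule less.hyps[OF px(3) px(1)])
        ultimately show ?thesis by (meson rtrancl_trans converse_rtrancl_into_rtrancl)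
      qed simp
    qed
    have root: "(s, Inl (Inl (r u))) \<in> R\<^sup>*" if "u \<in> V" "s \<in> X u" for u s
    proof -
      have "(\<exists>x. s = Inl (Inl x) \<and> x \<in> W u) \<or> (\<exists>x y. s = Inl (Inr {x, y}) \<and> x \<in> W u \<and> adj F x y)"
        using that(2) adj_sym[OF par(2)[OF that(1)]] c unfolding X_def by blast
      then consider x where "s = Inl (Inl x)" "x \<in> W u" | x y where "s = Inl (Inr {x, y})" "x \<in> W u" "adj F x y" by blast
      thus ?thesis
      proof cases
        case (2 x y)
        have "(s, Inl (Inl x)) \<in> R\<^sup>*" using symD[OF symR] R[OF 2(3) that(1) 2(2)] that(2) 2(1) by blast
        thus ?thesis using V[OF that(1) 2(2)] by simp
      qed (use V that in simp)
    qed
    thus "(s, t) \<in> {(x, y). adj L x y \<and> p x = p y}\<^sup>*"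
      unfolding R_def[symmetric]
    proof (cases "s = t")
      case False
      then obtain u where u: "u \<in> V" "s \<in> X u" "t \<in> X u" using p_eq[OF pst] by blast
      show "(s, t) \<in> R\<^sup>*" by (rule rtrancl_trans[OF root[OF u(1,2)] symD[OF symR root[OF u(1,3)]]])
    qed simp
  next
    fix s t t' assume a: "adj L s t" "adj L s t'" and pt: "p t = p s" "p t' = p s" and le: "rk t \<le> rk s" "rk t' \<le> rk s"
    obtain u where u: "u \<in> V" "s \<in> X u" "t \<in> X u" "t' \<in> X u"
      using p_eq[OF pt(1)] p_eq[OF pt(2)] Xdisj L.adj_verts[OF a(1)] L.adj_verts[OF a(2)] by metis
    show "t = t'"
    proof (cases s)
      case (Inl s')
      show ?thesis
      proof (cases s')
        case (Inl x)
        have x: "x \<in> W u" using u(2) XV \<open>s = Inl s'\<close> Inl by simp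
        have "t = Inl (Inr {x, par u x})" if t: "adj L s t" "t \<in> X u" "rk t \<le> rk s" for t
        proof -
          obtain e where e: "t = Inl (Inr e)"
            using t LVV(1) XF \<open>s = Inl s'\<close> Inl by (metis sumE)
          have xe: "x \<in> e" using LVE t(1) e \<open>s = Inl s'\<close> Inl by simp
          have le: "rk t \<le> 2 * n x" using t(3) \<open>s = Inl s'\<close> Inl by (simp add: rkV)
          from XE[OF t(2)[unfolded e]] show ?thesis
          proof (elim disjE exE bexE conjE)
            fix w assume w: "w \<in> W u" "w \<noteq> r u" "e = {w, par u w}"
            have "x = w"
            proof (rule ccontr)
              assume "x \<noteq> w"
              hence "n x < n w" using par(3)[OF u(1) w(1,2)] w xe by auto
              thus False using le rkT[OF u(1) w(1,2)] w e by simp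
            qed
            thus ?thesis using w e by simp
          next
            fix k assume "k \<in> E" "e = {cx k, cy k}"
            thus ?thesis using rkC[of k x] xe le e by simp
          qed
        qed
        thus ?thesis using a u le by blast
      next
        case (Inr e)
        have tV: "\<exists>y. t = Inl (Inl y) \<and> y \<in> e \<and> y \<in> W u \<and> 2 * n y \<le> rk s" if t: "adj L s t" "t \<in> X u" "rk t \<le> rk s" for t
        proof -
          obtain y where y: "t = Inl (Inl y)" using t LVV(2) XF \<open>s = Inl s'\<close> Inr by (metis sumE)
          thus ?thesis using t LEV \<open>s = Inl s'\<close> Inr XV rkV by auto
        qed
        from tV[OF a(1) u(3) le(1)] tV[OF a(2) u(4) le(2)] obtain y y' where
          y: "t = Inl (Inl y)" "y \<in> e" "y \<in> W u" "2 * n y \<le> rk s" "t' = Inl (Inl y')" "y' \<in> e" "y' \<in> W u" "2 * n y' \<le> rk s" by blast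
        from XE[OF u(2)[unfolded \<open>s = Inl s'\<close> Inr]] show ?thesis
        proof (elim disjE exE bexE conjE)
          fix w assume w: "w \<in> W u" "w \<noteq> r u" "e = {w, par u w}"
          have "rk s < 2 * n w" using rkT[OF u(1) w(1,2)] w \<open>s = Inl s'\<close> Inr by simp
          hence "y \<noteq> w" "y' \<noteq> w" using y(4,8) by auto
          thus ?thesis using y w by auto
        next
          fix k assume k: "k \<in> E" "cu k = u" "e = {cx k, cy k}"
          have "cy k \<notin> W u" using cW[OF k(1) u(1)] c[OF k(1)] k(2) by auto
          thus ?thesis using y k by auto
        qed
      qed
    qed (use u XF in simp)
  qed
  define \<rho> :: "'v \<Rightarrow> ('v + 'a sd + 'a sd set) + 'a sd faces" where "\<rho> u = Inl (Inl u)" for u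
  interpret T: triangulation "?T" by (rule T)
  have stp: "adj ?T (Inl i) (Inl j)" if "adj L s t" "i \<noteq> j" "i = p s \<and> j = q s t \<or> i = q s t \<and> j = p t" for i j s t
    using that unfolding adj_def coned_mem steps_def by blast
  have qF: "q (Inr f) t = Inr (Inr {Inr f, t})" "q t (Inr f) = Inr (Inr {t, Inr f})" "p (Inr f) = Inr (Inl (Inr f))" if "t \<noteq> Inr f" for f t
    using that p_out[of "Inr f"] XF p_eq[of "Inr f" t] p_eq[of t "Inr f"] unfolding q_def K_def by auto
  have v: "\<rho> u \<in> verts ?T" if u: "u \<in> V" for u
  proof -
    obtain y where "adj F (r u) y" using verts_adj WF[OF u] r[OF u] by blast
    then obtain f where "adj L (Inl (Inl (r u))) (Inr f)" using adj_face LF L.face_adj by meson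
    from stp[OF this, of "p (Inl (Inl (r u)))"] qF(2)[of "Inl (Inl (r u))" f] p_in[OF u, of "Inl (Inl (r u))"] XV r[OF u]
    have "adj ?T (\<rho> u) (Inl (Inr (Inr {Inl (Inl (r u)), Inr f})))" by (simp add: \<rho>_def)
    thus ?thesis using T.adj_verts by blast
  qed
  have ad: "adj ?T (\<rho> u) (\<rho> v) \<longleftrightarrow> {u, v} \<in> E" if uv: "u \<in> V" "v \<in> V" "u \<noteq> v" for u v
  proof
    assume "adj ?T (\<rho> u) (\<rho> v)"
    then obtain s t where o: "Inl u = p s \<and> Inl v = q s t \<or> Inl u = q s t \<and> Inl v = p t"
      by (auto simp: adj_def \<rho>_def coned_mem steps_def)
    have ne: "Inl u \<noteq> (Inl v :: 'v + 'a sd + 'a sd set)" using uv by simp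
    have pp: "p s = Inl u \<and> p t = Inl v \<or> p s = Inl v \<and> p t = Inl u" "q s t \<noteq> Inr (Inr {s, t})"
      using o ne q_cases[of s t] by (metis Inl_Inr_False, metis Inl_Inr_False)
    hence "(s, t) \<in> K \<or> (t, s) \<in> K" using ne by (auto simp: q_def split: if_splits)
    hence "\<exists>e\<in>E. {cu e, cv e} = {u, v}" using KD[of s t] KD[of t s] pp(1) by auto
    thus "{u, v} \<in> E" using c by metis
  next
    assume e: "{u, v} \<in> E"
    define e where "e = {u, v}"
    have eE: "e \<in> E" using e by (simp add: e_def)
    note ce = c[OF eE]
    let ?s = "Inl (Inr {cx e, cy e})" and ?t = "Inl (Inl (cy e))"
    have K: "(?s, ?t) \<in> K" using eE by (auto simp: K_def)
    have ps: "p ?s = Inl (cu e)" "p ?t = Inl (cv e)" using KD[OF K] p_in[of "cu e" ?s] p_in[of "cv e" ?t] ce eE by (auto simp: X_def)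
    have "adj L ?s ?t" using L1[of "cy e" "cx e"] adj_sym ce L.adj_sym by (metis insert_commute)
    moreover have "q ?s ?t = Inl (cu e)" using ps K ce by (auto simp: q_def)
    ultimately have "adj ?T (\<rho> (cu e)) (\<rho> (cv e))" unfolding \<rho>_def using ps ce by (intro stp) auto
    moreover have "{cu e, cv e} = {u, v}" using ce e_def by metis
    ultimately show "adj ?T (\<rho> u) (\<rho> v)" using T.adj_sym by (auto simp: doubleton_eq_iff)
  qed
  \<comment> \<open>The centre of a face of \<open>F\<close> belongs to no tree, so a triangle at it
    has no vertex that represents an element of \<open>V\<close>.\<close>
  obtain o1 o2 o3 where o: "(o1, o2, o3) \<in> ?T" "\<rho> ` V \<inter> {o1, o2, o3} = {}"
  proof -
    obtain x y z where f: "(x, y, z) \<in> F" using neF by auto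
    let ?s = "Inr (orbit x y z)" and ?t = "Inl (Inl x)"
    obtain w where w: "(?s, ?t, w) \<in> L" using L.rot2[OF LF[OF f]] by blast
    have "(Inl (p ?s), Inl (q ?s ?t), Inr (orbit ?s ?t w)) \<in> ?T"
      unfolding coned_mem steps_def using w qF(1,3)[of ?t "orbit x y z"] by force
    moreover have "\<rho> ` V \<inter> {Inl (p ?s), Inl (q ?s ?t), Inr (orbit ?s ?t w)} = {}"
      using qF(1,3)[of ?t "orbit x y z"] by (auto simp: \<rho>_def)
    ultimately show ?thesis by (rule that)
  qed
  have "\<rho> ` V \<subseteq> verts ?T" using v by blast
  moreover have "inj_on \<rho> V" by (auto simp: \<rho>_def inj_on_def)
  ultimately show ?thesis using ad
    by (intro exI[of _ "?T"] exI[of _ \<rho>] exI[of _ o1] exI[of _ o2] exI[of _ o3] conjI T o) auto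
qed

end

section \<open>A cylindrical grid\<close>

text \<open>Rings of the cyclically ordered set \<open>I\<close> at the heights \<open>1\<close>, \dots, \<open>m\<close>, with all squares
  cut by diagonals. The rings at the heights \<open>0\<close> and \<open>m + 1\<close> are collapsed to poles.\<close>

locale cylinder =
  fixes I :: "'i set" and \<sigma> :: "'i \<Rightarrow> 'i" and i0 :: 'i and m :: nat
  assumes finI: "finite I" and i0: "i0 \<in> I" and \<sigma>I: "\<And>i. i \<in> I \<Longrightarrow> \<sigma> i \<in> I" and \<sigma>inj: "inj_on \<sigma> I"
    and \<sigma>1: "\<And>i. i \<in> I \<Longrightarrow> \<sigma> i \<noteq> i" and \<sigma>2: "\<And>i. i \<in> I \<Longrightarrow> \<sigma> (\<sigma> i) \<noteq> i"
    and cyclic: "\<And>Z i. i0 \<in> Z \<Longrightarrow> (\<And>i. i \<in> I \<Longrightarrow> i \<in> Z \<Longrightarrow> \<sigma> i \<in> Z) \<Longrightarrow> i \<in> I \<Longrightarrow> i \<in> Z"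
    and m1: "1 \<le> m"
begin

definition \<nu> :: "'i \<Rightarrow> nat \<Rightarrow> 'i \<times> nat" where
  "\<nu> i j = (if 1 \<le> j \<and> j \<le> m then i else i0, j)"

definition grid :: "('i \<times> nat) faces" where
  "grid = (\<Union>i\<in>I. \<Union>j\<in>{1..m}. orbit (\<nu> i j) (\<nu> (\<sigma> i) j) (\<nu> (\<sigma> i) (Suc j)))
    \<union> (\<Union>i\<in>I. \<Union>j\<in>{..<m}. orbit (\<nu> i j) (\<nu> (\<sigma> i) (Suc j)) (\<nu> i (Suc j)))"

lemma grid_cases [consumes 1, case_names A1 A2 A3 B1 B2 B3]:
  assumes "(a, b, c) \<in> grid"
  obtains i j where "i \<in> I" "1 \<le> j" "j \<le> m" "a = \<nu> i j" "b = \<nu> (\<sigma> i) j" "c = \<nu> (\<sigma> i) (Suc j)"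
    | i j where "i \<in> I" "1 \<le> j" "j \<le> m" "a = \<nu> (\<sigma> i) j" "b = \<nu> (\<sigma> i) (Suc j)" "c = \<nu> i j"
    | i j where "i \<in> I" "1 \<le> j" "j \<le> m" "a = \<nu> (\<sigma> i) (Suc j)" "b = \<nu> i j" "c = \<nu> (\<sigma> i) j"
    | i j where "i \<in> I" "j < m" "a = \<nu> i j" "b = \<nu> (\<sigma> i) (Suc j)" "c = \<nu> i (Suc j)"
    | i j where "i \<in> I" "j < m" "a = \<nu> (\<sigma> i) (Suc j)" "b = \<nu> i (Suc j)" "c = \<nu> i j"
    | i j where "i \<in> I" "j < m" "a = \<nu> i (Suc j)" "b = \<nu> i j" "c = \<nu> (\<sigma> i) (Suc j)"
proof -
  from assms consider i j where "i \<in> I" "1 \<le> j" "j \<le> m" "(a, b, c) \<in> orbit (\<nu> i j) (\<nu> (\<sigma> i) j) (\<nu> (\<sigma> i) (Suc j))"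
    | i j where "i \<in> I" "j < m" "(a, b, c) \<in> orbit (\<nu> i j) (\<nu> (\<sigma> i) (Suc j)) (\<nu> i (Suc j))"
    unfolding grid_def by auto
  thus ?thesis
  proof cases
    case (1 i j)
    thus ?thesis using that(1-3)[of i j] unfolding orbit_def by blast
  next
    case (2 i j)
    thus ?thesis using that(4-6)[of i j] unfolding orbit_def by blast
  qed
qed

lemma gridA:
  assumes "i \<in> I" "1 \<le> j" "j \<le> m"
  shows "(\<nu> i j, \<nu> (\<sigma> i) j, \<nu> (\<sigma> i) (Suc j)) \<in> grid" "(\<nu> (\<sigma> i) j, \<nu> (\<sigma> i) (Suc j), \<nu> i j) \<in> grid"
    "(\<nu> (\<sigma> i) (Suc j), \<nu> i j, \<nu> (\<sigma> i) j) \<in> grid"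
proof -
  have t: "t \<in> grid" if "t \<in> orbit (\<nu> i j) (\<nu> (\<sigma> i) j) (\<nu> (\<sigma> i) (Suc j))" for t
    unfolding grid_def by (rule UnI1, rule UN_I[OF assms(1)], rule UN_I[of j]) (use assms that in auto)
  show "(\<nu> i j, \<nu> (\<sigma> i) j, \<nu> (\<sigma> i) (Suc j)) \<in> grid" "(\<nu> (\<sigma> i) j, \<nu> (\<sigma> i) (Suc j), \<nu> i j) \<in> grid"
    "(\<nu> (\<sigma> i) (Suc j), \<nu> i j, \<nu> (\<sigma> i) j) \<in> grid"
    by (auto intro!: t simp: orbit_def)
qed

lemma gridB:
  assumes "i \<in> I" "j < m"
  shows "(\<nu> i j, \<nu> (\<sigma> i) (Suc j), \<nu> i (Suc j)) \<in> grid" "(\<nu> (\<sigma> i) (Suc j), \<nu> i (Suc j), \<nu> i j) \<in> grid"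
    "(\<nu> i (Suc j), \<nu> i j, \<nu> (\<sigma> i) (Suc j)) \<in> grid"
proof -
  have t: "t \<in> grid" if "t \<in> orbit (\<nu> i j) (\<nu> (\<sigma> i) (Suc j)) (\<nu> i (Suc j))" for t
    unfolding grid_def by (rule UnI2, rule UN_I[OF assms(1)], rule UN_I[of j]) (use assms that in auto)
  show "(\<nu> i j, \<nu> (\<sigma> i) (Suc j), \<nu> i (Suc j)) \<in> grid" "(\<nu> (\<sigma> i) (Suc j), \<nu> i (Suc j), \<nu> i j) \<in> grid"
    "(\<nu> i (Suc j), \<nu> i j, \<nu> (\<sigma> i) (Suc j)) \<in> grid"
    by (auto intro!: t simp: orbit_def)
qed

lemma grid_rot: "(a, b, c) \<in> grid \<Longrightarrow> (b, c, a) \<in> grid"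
  by (erule grid_cases) (auto intro: gridA gridB)

lemma \<sigma>_onto: "i \<in> I \<Longrightarrow> \<exists>i'\<in>I. \<sigma> i' = i"
  using endo_inj_surj[OF finI _ \<sigma>inj] \<sigma>I by (metis image_iff image_subsetI)

lemma \<nu>_collapse: "\<not> (1 \<le> j \<and> j \<le> m) \<Longrightarrow> \<nu> i j = \<nu> i' j"
  by (auto simp: \<nu>_def)

lemma \<nu>_eq: "\<nu> i j = \<nu> i' j' \<longleftrightarrow> j = j' \<and> (1 \<le> j \<and> j \<le> m \<longrightarrow> i = i')"
  by (auto simp: \<nu>_def)

lemma grid_uniq:
  assumes "(a, b, c) \<in> grid" "(a, b, d) \<in> grid"
  shows "c = d"
proof -
  note [simp] = \<nu>_eq inj_on_eq_iff[OF \<sigma>inj] \<sigma>1 \<sigma>2 \<sigma>1[THEN not_sym] \<sigma>I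
  from assms(1) show ?thesis
  proof (cases rule: grid_cases)
    case (A1 i j)
    from assms(2) show ?thesis by (cases rule: grid_cases) (use A1 m1 in auto)
  next
    case (A2 i j)
    from assms(2) show ?thesis by (cases rule: grid_cases) (use A2 m1 in auto)
  next
    case (A3 i j)
    from assms(2) show ?thesis by (cases rule: grid_cases) (use A3 m1 in auto)
  next
    case (B1 i j)
    from assms(2) show ?thesis by (cases rule: grid_cases) (use B1 m1 in auto)
  next
    case (B2 i j)
    from assms(2) show ?thesis by (cases rule: grid_cases) (use B2 m1 in auto)
  next
    case (B3 i j)
    from assms(2) show ?thesis by (cases rule: grid_cases) (use B3 m1 in auto)
  qed
qed

lemma adjI: "(a, b, c) \<in> F \<Longrightarrow> adj F a b"
  unfolding adj_def by blast

lemma adjA: "adj grid (\<nu> i j) (\<nu> (\<sigma> i) j)" "adj grid (\<nu> (\<sigma> i) j) (\<nu> (\<sigma> i) (Suc j))" "adj grid (\<nu> (\<sigma> i) (Suc j)) (\<nu> i j)"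
  if "i \<in> I" "1 \<le> j" "j \<le> m"
  by (rule adjI[OF gridA(1)[OF that]], rule adjI[OF gridA(2)[OF that]], rule adjI[OF gridA(3)[OF that]])

lemma adjB: "adj grid (\<nu> i j) (\<nu> (\<sigma> i) (Suc j))" "adj grid (\<nu> (\<sigma> i) (Suc j)) (\<nu> i (Suc j))" "adj grid (\<nu> i (Suc j)) (\<nu> i j)"
  if "i \<in> I" "j < m"
  by (rule adjI[OF gridB(1)[OF that]], rule adjI[OF gridB(2)[OF that]], rule adjI[OF gridB(3)[OF that]])

lemma grid_opp: "(a, b, c) \<in> grid \<Longrightarrow> adj grid b a"
proof (erule grid_cases)
  fix i j assume i: "i \<in> I" "1 \<le> j" "j \<le> m" and [simp]: "a = \<nu> i j" "b = \<nu> (\<sigma> i) j"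
  show ?thesis using adjB(2)[OF i(1), of "j - 1"] i by auto
next
  fix i j assume i: "i \<in> I" "1 \<le> j" "j \<le> m" and [simp]: "a = \<nu> (\<sigma> i) j" "b = \<nu> (\<sigma> i) (Suc j)"
  show ?thesis
  proof (cases "j < m")
    case True
    thus ?thesis using adjB(3)[OF \<sigma>I[OF i(1)]] by auto
  next
    case False
    thus ?thesis using adjA(3)[OF \<sigma>I[OF i(1)] i(2,3)] \<nu>_collapse[of "Suc j" "\<sigma> i" "\<sigma> (\<sigma> i)"] by auto
  qed
next
  fix i j assume i: "i \<in> I" "1 \<le> j" "j \<le> m" and [simp]: "a = \<nu> (\<sigma> i) (Suc j)" "b = \<nu> i j"
  obtain i' where i': "i' \<in> I" "\<sigma> i' = i" using \<sigma>_onto[OF i(1)] by blast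
  show ?thesis
  proof (cases "j < m")
    case True
    thus ?thesis using adjB(1)[OF i(1)] by auto
  next
    case False
    thus ?thesis using adjA(2)[OF i'(1) i(2,3)] \<nu>_collapse[of "Suc j" "\<sigma> i" i] i'(2) by auto
  qed
next
  fix i j assume i: "i \<in> I" "j < m" and [simp]: "a = \<nu> i j" "b = \<nu> (\<sigma> i) (Suc j)"
  show ?thesis
  proof (cases "1 \<le> j")
    case True
    thus ?thesis using adjA(3)[OF i(1)] i by auto
  next
    case False
    thus ?thesis using adjB(3)[OF \<sigma>I[OF i(1)] i(2)] \<nu>_collapse[of j i "\<sigma> i"] by auto
  qed
next
  fix i j assume i: "i \<in> I" "j < m" and [simp]: "a = \<nu> (\<sigma> i) (Suc j)" "b = \<nu> i (Suc j)"
  show ?thesis using adjA(1)[OF i(1), of "Suc j"] i by auto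
next
  fix i j assume i: "i \<in> I" "j < m" and [simp]: "a = \<nu> i (Suc j)" "b = \<nu> i j"
  obtain i' where i': "i' \<in> I" "\<sigma> i' = i" using \<sigma>_onto[OF i(1)] by blast
  show ?thesis
  proof (cases "1 \<le> j")
    case True
    thus ?thesis using adjA(2)[OF i'(1), of j] i i'(2) by auto
  next
    case False
    thus ?thesis using adjB(1)[OF i'(1) i(2)] \<nu>_collapse[of j i i'] i'(2) by auto
  qed
qed

text \<open>For exactness \<open>d\<close> is integrated along the meridians from the bottom pole;
  induction on the height shows that neighbouring meridians differ by the horizontal step, hence
  agree at the top pole. Connectedness follows by climbing a column of triangles and passing to the
  next column at the bottom pole.\<close>

theorem triangulation_grid: "triangulation grid"
proof
  show "finite grid" using finI by (auto simp: grid_def orbit_def)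
  show "grid \<noteq> {}" using gridA(1)[OF i0 order_refl m1] by blast
  show "a \<noteq> b" if "(a, b, c) \<in> grid" for a b c
    using that by (cases rule: grid_cases) (auto simp: \<nu>_eq \<sigma>1 \<sigma>1[THEN not_sym])
next
  fix d :: "'i \<times> nat \<Rightarrow> 'i \<times> nat \<Rightarrow> real"
  assume anti: "\<And>a b c. (a, b, c) \<in> grid \<Longrightarrow> d a b = - d b a"
    and closed: "\<And>a b c. (a, b, c) \<in> grid \<Longrightarrow> d a b + d b c + d c a = 0"
  \<comment> \<open>At the poles a horizontal step degenerates to a point and counts zero.\<close>
  define e where "e a b = (if a = b then 0 else d a b)" for a b
  define G where "G i j = (\<Sum>k<j. d (\<nu> i k) (\<nu> i (Suc k)))" for i j
  have up: "G i (Suc j) = G i j + d (\<nu> i j) (\<nu> i (Suc j))" for i j by (simp add: G_def)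
  have upA: "d (\<nu> i j) (\<nu> i (Suc j)) = - d (\<nu> i (Suc j)) (\<nu> i j)" if ij: "i \<in> I" "j \<le> m" for i j
  proof -
    obtain i' where i': "i' \<in> I" "\<sigma> i' = i" using \<sigma>_onto[OF ij(1)] by blast
    show ?thesis
    proof (cases "j < m")
      case True
      thus ?thesis using anti[OF gridB(3)[OF ij(1), of j]] by simp
    next
      case False
      thus ?thesis using anti[OF gridA(2)[OF i'(1), of j]] ij m1 i'(2) by simp
    qed
  qed
  have eB: "e (\<nu> i (Suc j)) (\<nu> (\<sigma> i) (Suc j)) = d (\<nu> i j) (\<nu> (\<sigma> i) (Suc j)) - d (\<nu> i j) (\<nu> i (Suc j))" if "i \<in> I" "j < m" for i j
    using closed[OF gridB(1)[OF that]] anti[OF gridB(2)[OF that]] upA[of i j] that \<sigma>1[OF that(1)] by (auto simp: e_def \<nu>_eq)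
  have eA: "e (\<nu> i j) (\<nu> (\<sigma> i) j) = d (\<nu> i j) (\<nu> (\<sigma> i) (Suc j)) - d (\<nu> (\<sigma> i) j) (\<nu> (\<sigma> i) (Suc j))" if "i \<in> I" "1 \<le> j" "j \<le> m" for i j
    using closed[OF gridA(1)[OF that]] anti[OF gridA(3)[OF that]] that \<sigma>1[OF that(1)] by (auto simp: e_def \<nu>_def)
  have H: "e (\<nu> i j) (\<nu> (\<sigma> i) j) = G (\<sigma> i) j - G i j" if i: "i \<in> I" and "j \<le> Suc m" for i j
    using that(2)
  proof (induction j)
    case 0
    thus ?case by (simp add: e_def G_def \<nu>_def)
  next
    case (Suc j)
    have IH: "e (\<nu> i j) (\<nu> (\<sigma> i) j) = G (\<sigma> i) j - G i j" using Suc by simp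
    have diag: "d (\<nu> i j) (\<nu> (\<sigma> i) (Suc j)) = G (\<sigma> i) (Suc j) - G i j"
    proof (cases "1 \<le> j")
      case True
      thus ?thesis using IH eA[OF i, of j] Suc.prems by (simp add: up)
    next
      case False
      hence [simp]: "j = 0" by simp
      have "\<nu> (\<sigma> i) 0 = \<nu> i 0" by (simp add: \<nu>_def)
      thus ?thesis by (simp add: up) (simp add: G_def)
    qed
    show ?case
    proof (cases "j < m")
      case True
      thus ?thesis using eB[OF i True] diag by (simp add: up)
    next
      case False
      have "\<nu> (\<sigma> i) (Suc j) = \<nu> i (Suc j)" using False by (simp add: \<nu>_def)
      thus ?thesis using diag by (simp add: e_def up)
    qed
  qed
  have top: "G i (Suc m) = G i0 (Suc m)" if "i \<in> I" for i
  proof -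
    have "i \<in> {i. G i (Suc m) = G i0 (Suc m)}"
    proof (rule cyclic[OF _ _ that])
      fix i assume "i \<in> I" "i \<in> {i. G i (Suc m) = G i0 (Suc m)}"
      thus "\<sigma> i \<in> {i. G i (Suc m) = G i0 (Suc m)}" using H[of i "Suc m"] by (simp add: e_def \<nu>_def)
    qed simp
    thus ?thesis by simp
  qed
  define g where "g a = G (fst a) (snd a)" for a
  have g: "g (\<nu> i j) = G i j" if i: "i \<in> I" and "j \<le> Suc m" for i j
  proof -
    have "j = 0 \<or> 1 \<le> j \<and> j \<le> m \<or> j = Suc m" using that(2) by linarith
    thus ?thesis using top[OF i] by (elim disjE) (auto simp: g_def \<nu>_def G_def)
  qed
  have hor: "d (\<nu> i j) (\<nu> (\<sigma> i) j) = g (\<nu> (\<sigma> i) j) - g (\<nu> i j)" if "i \<in> I" "1 \<le> j" "j \<le> m" for i j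
    using H[OF that(1), of j] g[OF that(1), of j] g[OF \<sigma>I[OF that(1)], of j] that \<sigma>1[OF that(1)] by (auto simp: e_def \<nu>_def)
  have ver: "d (\<nu> i j) (\<nu> i (Suc j)) = g (\<nu> i (Suc j)) - g (\<nu> i j)" if "i \<in> I" "j \<le> m" for i j
    using g[OF that(1), of j] g[OF that(1), of "Suc j"] up[of i j] that(2) by simp
  show "\<exists>g. \<forall>a b c. (a, b, c) \<in> grid \<longrightarrow> d a b = g b - g a"
  proof (intro exI[of _ g] allI impI)
    fix a b c assume "(a, b, c) \<in> grid"
    thus "d a b = g b - g a"
    proof (cases rule: grid_cases)
      case (A1 i j)
      thus ?thesis using hor by simp
    next
      case (A2 i j)
      thus ?thesis using ver[OF \<sigma>I[OF A2(1)]] by simp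
    next
      case (A3 i j)
      thus ?thesis using closed[OF gridA(1)[OF A3(1-3)]] hor[OF A3(1-3)] ver[OF \<sigma>I[OF A3(1)] A3(3)] by simp
    next
      case (B1 i j)
      have "d (\<nu> (\<sigma> i) (Suc j)) (\<nu> i (Suc j)) = - d (\<nu> i (Suc j)) (\<nu> (\<sigma> i) (Suc j))" by (rule anti[OF gridB(2)[OF B1(1,2)]])
      thus ?thesis using B1 closed[OF gridB(1)[OF B1(1,2)]] hor[OF B1(1), of "Suc j"] ver[OF B1(1), of j] upA[OF B1(1), of j] by simp
    next
      case (B2 i j)
      have "d (\<nu> (\<sigma> i) (Suc j)) (\<nu> i (Suc j)) = - d (\<nu> i (Suc j)) (\<nu> (\<sigma> i) (Suc j))" by (rule anti[OF gridB(2)[OF B2(1,2)]])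
      thus ?thesis using B2 hor[OF B2(1), of "Suc j"] by simp
    next
      case (B3 i j)
      thus ?thesis using ver[OF B3(1), of j] upA[OF B3(1), of j] by simp
    qed
  qed
next
  fix S assume S: "S \<subseteq> grid" "S \<noteq> {}" and Srot: "\<And>a b c. (a, b, c) \<in> S \<Longrightarrow> (b, c, a) \<in> S"
    and Sopp: "\<And>a b c d. (a, b, c) \<in> S \<Longrightarrow> (b, a, d) \<in> grid \<Longrightarrow> (b, a, d) \<in> S"
  define A where "A i j \<longleftrightarrow> (\<nu> i j, \<nu> (\<sigma> i) j, \<nu> (\<sigma> i) (Suc j)) \<in> S" for i j
  define B where "B i j \<longleftrightarrow> (\<nu> i j, \<nu> (\<sigma> i) (Suc j), \<nu> i (Suc j)) \<in> S" for i j
  have rA: "(\<nu> (\<sigma> i) j, \<nu> (\<sigma> i) (Suc j), \<nu> i j) \<in> S \<longleftrightarrow> A i j" "(\<nu> (\<sigma> i) (Suc j), \<nu> i j, \<nu> (\<sigma> i) j) \<in> S \<longleftrightarrow> A i j" for i j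
    unfolding A_def using Srot by (metis, metis)
  have rB: "(\<nu> (\<sigma> i) (Suc j), \<nu> i (Suc j), \<nu> i j) \<in> S \<longleftrightarrow> B i j" "(\<nu> i (Suc j), \<nu> i j, \<nu> (\<sigma> i) (Suc j)) \<in> S \<longleftrightarrow> B i j" for i j
    unfolding B_def using Srot by (metis, metis)
  have swap: "(a, b, c) \<in> S \<longleftrightarrow> (b, a, d) \<in> S" if "(a, b, c) \<in> grid" "(b, a, d) \<in> grid" for a b c d
    using Sopp that by blast
  have AB: "A i j \<longleftrightarrow> B i j" if "i \<in> I" "1 \<le> j" "j < m" for i j
    using swap[OF gridA(3)[of i j] gridB(1)[of i j]] that unfolding rA B_def by simp
  have BA: "B i j \<longleftrightarrow> A i (Suc j)" if "i \<in> I" "j < m" for i j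
    using swap[OF gridB(2)[of i j] gridA(1)[of i "Suc j"]] that unfolding rB A_def by simp
  have B0: "B i j \<longleftrightarrow> B i 0" if "i \<in> I" "j < m" for i j
    using that(2)
  proof (induction j)
    case (Suc j)
    thus ?case using AB[OF that(1), of "Suc j"] BA[OF that(1), of j] by simp
  qed simp
  have A0: "A i j \<longleftrightarrow> B i 0" if "i \<in> I" "1 \<le> j" "j \<le> m" for i j
    using BA[OF that(1), of "j - 1"] B0[OF that(1), of "j - 1"] that by simp
  have around: "B i 0 \<longleftrightarrow> B (\<sigma> i) 0" if "i \<in> I" for i
  proof -
    have [simp]: "\<nu> i 0 = \<nu> (\<sigma> i) 0" by (rule \<nu>_collapse) simp
    have "0 < m" using m1 by simp
    from swap[OF gridB(1)[OF that this, simplified] gridB(3)[OF \<sigma>I[OF that] this]] show ?thesis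
      unfolding rB by (simp add: B_def)
  qed
  have const: "B i 0 \<longleftrightarrow> B i0 0" if "i \<in> I" for i
    using cyclic[of "{i. B i 0 \<longleftrightarrow> B i0 0}" i] around that by auto
  have "B i0 0"
  proof -
    obtain a b c where "(a, b, c) \<in> S" using S(2) by force
    moreover from this S(1) have "(a, b, c) \<in> grid" by blast
    ultimately have "(\<exists>i j. i \<in> I \<and> 1 \<le> j \<and> j \<le> m \<and> A i j) \<or> (\<exists>i j. i \<in> I \<and> j < m \<and> B i j)"
      by (elim grid_cases) (auto simp: rA rB A_def[symmetric] B_def[symmetric])
    thus ?thesis using A0 B0 const by blast
  qed
  hence "A i j" if "i \<in> I" "1 \<le> j" "j \<le> m" for i j using A0 const that by simp
  moreover have "B i j" if "i \<in> I" "j < m" for i j using \<open>B i0 0\<close> B0 const that by simp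
  ultimately have "(a, b, c) \<in> S" if "(a, b, c) \<in> grid" for a b c
    using that by (elim grid_cases) (auto simp: rA rB A_def[symmetric] B_def[symmetric])
  thus "S = grid" using S(1) by auto
qed (use grid_rot grid_uniq grid_opp in \<open>auto simp: adj_def\<close>)

lemma grid_verts: "i \<in> I \<Longrightarrow> 1 \<le> j \<Longrightarrow> j \<le> m \<Longrightarrow> (i, j) \<in> verts grid"
  using gridA(1)[of i j] unfolding verts_def by (auto simp: \<nu>_def)

lemma grid_adj:
  assumes "i \<in> I" "1 \<le> j" "j \<le> m"
  shows "adj grid (i, j) (\<sigma> i, j)" "j < m \<Longrightarrow> adj grid (i, j) (\<sigma> i, Suc j)" "j < m \<Longrightarrow> adj grid (i, j) (i, Suc j)"
proof -
  show "adj grid (i, j) (\<sigma> i, j)" using adjA(1)[OF assms] assms by (auto simp: \<nu>_def)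
  show "adj grid (i, j) (\<sigma> i, Suc j)" if "j < m" using adjB(1)[OF assms(1) that] assms that by (auto simp: \<nu>_def)
  obtain i' where i': "i' \<in> I" "\<sigma> i' = i" using \<sigma>_onto[OF assms(1)] by blast
  show "adj grid (i, j) (i, Suc j)" if "j < m" using adjA(2)[OF i'(1) assms(2,3)] assms that i'(2) by (auto simp: \<nu>_def)
qed

end

section \<open>Planar graphs are minors of grids\<close>

definition linked :: "('a \<Rightarrow> 'a \<Rightarrow> bool) \<Rightarrow> 'a set \<Rightarrow> bool" where
  "linked R A \<longleftrightarrow> (\<forall>x\<in>A. \<forall>y\<in>A. (x, y) \<in> {(x, y). x \<in> A \<and> y \<in> A \<and> R x y}\<^sup>*)"

text \<open>The tiles that can be reached from \<open>t\<close> and those that cannot form two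
  disjoint closed sets, which would disconnect \<open>A\<close>.\<close>

lemma linked_tiles:
  fixes A :: "'b :: topological_space set"
  assumes D: "finite D" "\<And>t. t \<in> D \<Longrightarrow> closed (tile t)" "A \<subseteq> (\<Union>t\<in>D. tile t)" "\<And>t. t \<in> D \<Longrightarrow> tile t \<inter> A \<noteq> {}"
    and A: "connected A" and R: "\<And>t t' z. t \<in> D \<Longrightarrow> t' \<in> D \<Longrightarrow> z \<in> tile t \<Longrightarrow> z \<in> tile t' \<Longrightarrow> t = t' \<or> R t t'"
  shows "linked R D"
  unfolding linked_def
proof (intro ballI)
  fix t t' assume t: "t \<in> D" "t' \<in> D"
  define Q where "Q = {(x, y). x \<in> D \<and> y \<in> D \<and> R x y}"
  define C where "C = {s \<in> D. (t, s) \<in> Q\<^sup>*}"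
  let ?U = "\<lambda>X. \<Union>s\<in>X. tile s"
  have "t' \<in> C"
  proof (rule ccontr)
    assume t': "t' \<notin> C"
    have "?U C \<inter> ?U (D - C) \<inter> A = {}"
    proof (rule ccontr)
      assume "\<not> ?thesis"
      then obtain z s s' where s: "s \<in> C" "s' \<in> D - C" "z \<in> tile s" "z \<in> tile s'" by blast
      hence "(s, s') \<in> Q" using R[of s s' z] by (auto simp: Q_def C_def)
      thus False using s by (auto simp: C_def intro: rtrancl_into_rtrancl)
    qed
    moreover have "closed (?U X)" if "X \<subseteq> D" for X using D(1,2) that by (intro closed_UN) (auto intro: finite_subset)
    moreover have "C \<subseteq> D" by (auto simp: C_def)
    moreover have "A \<subseteq> ?U C \<union> ?U (D - C)" using D(3) by blast
    ultimately have "?U C \<inter> A = {} \<or> ?U (D - C) \<inter> A = {}" using connected_closedD[OF A] by (metis Diff_subset)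
    moreover have "?U C \<inter> A \<noteq> {}" using D(4)[OF t(1)] t(1) by (fastforce simp: C_def)
    moreover have "?U (D - C) \<inter> A \<noteq> {}" using D(4)[OF t(2)] t(2) t' by blast
    ultimately show False by blast
  qed
  thus "(t, t') \<in> {(x, y). x \<in> D \<and> y \<in> D \<and> R x y}\<^sup>*" by (simp add: C_def Q_def)
qed

lemma linked_Un:
  assumes sym: "\<And>x y. R x y \<Longrightarrow> R y x" and A: "linked R A" and Z: "\<And>i. i \<in> I \<Longrightarrow> linked R (Z i) \<and> Z i \<inter> A \<noteq> {}"
  shows "linked R (A \<union> (\<Union>i\<in>I. Z i))"
  unfolding linked_def
proof (intro ballI)
  define B where "B = A \<union> (\<Union>i\<in>I. Z i)"
  define Q where "Q = {(x, y). x \<in> B \<and> y \<in> B \<and> R x y}"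
  have mono: "(x, y) \<in> Q\<^sup>*" if "linked R C" "C \<subseteq> B" "x \<in> C" "y \<in> C" for C x y
    using that rtrancl_mono[of "{(x, y). x \<in> C \<and> y \<in> C \<and> R x y}" Q] unfolding linked_def Q_def by blast
  have toA: "\<exists>y\<in>A. (x, y) \<in> Q\<^sup>* \<and> (y, x) \<in> Q\<^sup>*" if "x \<in> B" for x
  proof (cases "x \<in> A")
    case False
    then obtain i where i: "i \<in> I" "x \<in> Z i" using \<open>x \<in> B\<close> by (auto simp: B_def)
    then obtain y where y: "y \<in> Z i" "y \<in> A" using Z[OF i(1)] by blast
    thus ?thesis using mono[of "Z i" x y] mono[of "Z i" y x] Z[OF i(1)] i unfolding B_def by blast
  qed blast
  have AB: "A \<subseteq> B" by (simp add: B_def)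
  fix x y assume "x \<in> A \<union> (\<Union>i\<in>I. Z i)" "y \<in> A \<union> (\<Union>i\<in>I. Z i)"
  then obtain x' y' where "x' \<in> A" "(x, x') \<in> Q\<^sup>*" "y' \<in> A" "(y', y) \<in> Q\<^sup>*" using toA by (metis B_def)
  hence "(x, y) \<in> Q\<^sup>*" using mono[OF A AB] by (meson rtrancl_trans)
  thus "(x, y) \<in> {(x, y). x \<in> A \<union> (\<Union>i\<in>I. Z i) \<and> y \<in> A \<union> (\<Union>i\<in>I. Z i) \<and> R x y}\<^sup>*" by (simp add: Q_def B_def)
qed

text \<open>\<open>Z\<close> is the component of \<open>t0\<close> in \<open>M - B\<close>; a path
  in \<open>M\<close> from \<open>t0\<close> to \<open>t1\<close> leaves it by a step into
  \<open>B\<close>.\<close>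

lemma ex_linked_reaching:
  assumes sym: "\<And>x y. R x y \<Longrightarrow> R y x" and M: "linked R M" and t: "t0 \<in> M" "t0 \<notin> B" "t1 \<in> M" "t1 \<in> B"
  shows "\<exists>Z. t0 \<in> Z \<and> Z \<subseteq> M - B \<and> linked R Z \<and> (\<exists>x\<in>Z. \<exists>y\<in>B. R x y)"
proof -
  define Q where "Q = {(x, y). x \<in> M - B \<and> y \<in> M - B \<and> R x y}"
  define Z where "Z = {x. (t0, x) \<in> Q\<^sup>*}"
  have ZM: "Z \<subseteq> M - B"
  proof
    fix x assume "x \<in> Z"
    hence "(t0, x) \<in> Q\<^sup>*" by (simp add: Z_def)
    thus "x \<in> M - B" by (induction rule: rtrancl_induct) (use t in \<open>auto simp: Q_def\<close>)
  qed
  define P where "P = {(x, y). x \<in> Z \<and> y \<in> Z \<and> R x y}"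
  have "(t0, x) \<in> P\<^sup>*" if "x \<in> Z" for x
  proof -
    have "(t0, x) \<in> Q\<^sup>*" using that by (simp add: Z_def)
    thus ?thesis
    proof (induction rule: rtrancl_induct)
      case (step y z)
      have "y \<in> Z" "z \<in> Z" using step(1,2) by (auto simp: Z_def)
      hence "(y, z) \<in> P" using step(2) by (simp add: P_def Q_def)
      thus ?case using step(3) by simp
    qed simp
  qed
  moreover have "sym (P\<^sup>*)" by (rule sym_rtrancl) (auto simp: P_def sym_def intro: sym)
  ultimately have "(x, y) \<in> P\<^sup>*" if "x \<in> Z" "y \<in> Z" for x y using that by (meson rtrancl_trans symD)
  hence "linked R Z" by (simp add: linked_def P_def)
  moreover have "\<exists>x\<in>Z. \<exists>y\<in>B. R x y"
  proof -
    have "x \<in> Z \<or> (\<exists>x\<in>Z. \<exists>y\<in>B. R x y)" if "(t0, x) \<in> {(x, y). x \<in> M \<and> y \<in> M \<and> R x y}\<^sup>*" for x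
      using that
    proof (induction rule: rtrancl_induct)
      case (step y z)
      show ?case
      proof (cases "y \<in> Z \<and> z \<notin> B")
        case True
        hence "(y, z) \<in> Q" using step(2) ZM by (auto simp: Q_def)
        thus ?thesis using True by (auto simp: Z_def intro: rtrancl_into_rtrancl)
      qed (use step in blast)
    qed (simp add: Z_def)
    from this[of t1] show ?thesis using M t ZM unfolding linked_def by blast
  qed
  moreover have "t0 \<in> Z" by (simp add: Z_def)
  ultimately show ?thesis using ZM by blast
qed

lemma uniformly_separated:
  fixes C :: "'i \<Rightarrow> 'b :: heine_borel set"
  assumes "finite I" "\<And>i. i \<in> I \<Longrightarrow> compact (C i)"
  shows "\<exists>d>0. \<forall>i\<in>I. \<forall>j\<in>I. C i \<inter> C j = {} \<longrightarrow> (\<forall>x\<in>C i. \<forall>y\<in>C j. d \<le> dist x y)"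
proof -
  have "\<exists>d>0. C i \<inter> C j = {} \<longrightarrow> (\<forall>x\<in>C i. \<forall>y\<in>C j. d \<le> dist x y)" if "i \<in> I" "j \<in> I" for i j
    using separate_compact_closed[of "C i" "C j"] assms(2) that compact_imp_closed zero_less_one by metis
  then obtain d where d: "\<And>i j. i \<in> I \<Longrightarrow> j \<in> I \<Longrightarrow> 0 < d i j \<and> (C i \<inter> C j = {} \<longrightarrow> (\<forall>x\<in>C i. \<forall>y\<in>C j. d i j \<le> dist x y))"
    by metis
  define \<delta> where "\<delta> = Min (insert 1 ((\<lambda>(i, j). d i j) ` (I \<times> I)))"
  have f: "finite (insert 1 ((\<lambda>(i, j). d i j) ` (I \<times> I)))" using assms(1) by simp
  have "0 < \<delta>" unfolding \<delta>_def using f d by (subst Min_gr_iff) auto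
  moreover have "\<delta> \<le> d i j" if "i \<in> I" "j \<in> I" for i j unfolding \<delta>_def using f that by (intro Min_le) auto
  ultimately show ?thesis using d by (meson order_trans)
qed

lemma cylinder_nat:
  assumes "3 \<le> n" "1 \<le> m"
  shows "cylinder {..<n} (\<lambda>i. if Suc i = n then 0 else Suc i) 0 m"
proof
  show "i \<in> Z" if "0 \<in> Z" "\<And>i. i \<in> {..<n} \<Longrightarrow> i \<in> Z \<Longrightarrow> (if Suc i = n then 0 else Suc i) \<in> Z" "i \<in> {..<n}" for Z i
    using that(3)
  proof (induction i)
    case (Suc i)
    thus ?case using that(2)[of i] by auto
  qed (rule that(1))
qed (use assms in \<open>auto simp: inj_on_def split: if_splits\<close>)

text \<open>The bricks of a wall with the bond shifted by half a brick in each row meet exactly when they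
  are adjacent in the triangular lattice.\<close>

definition brick :: "real \<Rightarrow> real \<Rightarrow> nat \<times> nat \<Rightarrow> complex set" where
  "brick s B = (\<lambda>(i, j). {z. real j \<le> s * (Im z + B) + 2 \<and> s * (Im z + B) + 2 \<le> real j + 1 \<and>
     real i \<le> s * (Re z + B) + real j / 2 \<and> s * (Re z + B) + real j / 2 \<le> real i + 1})"

lemma closed_brick: "closed (brick s B t)"
  unfolding brick_def by (cases t) (auto intro!: closed_Collect_conj closed_Collect_le continuous_intros)

lemma brick_cover:
  assumes "0 < s" "norm z \<le> B"
  shows "\<exists>t. z \<in> brick s B t"
proof -
  have "0 \<le> s * (Im z + B)" "0 \<le> s * (Re z + B)"
    using assms abs_Im_le_cmod[of z] abs_Re_le_cmod[of z] by (auto intro!: mult_nonneg_nonneg)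
  define j where "j = nat \<lfloor>s * (Im z + B) + 2\<rfloor>"
  define i where "i = nat \<lfloor>s * (Re z + B) + real j / 2\<rfloor>"
  have "real j \<le> s * (Im z + B) + 2 \<and> s * (Im z + B) + 2 \<le> real j + 1" using \<open>0 \<le> s * (Im z + B)\<close> unfolding j_def by linarith
  moreover have "real i \<le> s * (Re z + B) + real j / 2 \<and> s * (Re z + B) + real j / 2 \<le> real i + 1"
    using \<open>0 \<le> s * (Re z + B)\<close> unfolding i_def by linarith
  ultimately show ?thesis by (intro exI[of _ "(i, j)"]) (simp add: brick_def)
qed

lemma brick_dist:
  assumes s: "0 < s" and "z \<in> brick s B t" "w \<in> brick s B t"
  shows "dist z w \<le> 2 / s"
proof -
  have "\<bar>s * (Re z - Re w)\<bar> \<le> 1" "\<bar>s * (Im z - Im w)\<bar> \<le> 1"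
    using assms by (auto simp: brick_def abs_le_iff algebra_simps)
  hence "\<bar>Re (z - w)\<bar> \<le> 1 / s" "\<bar>Im (z - w)\<bar> \<le> 1 / s" using s by (simp_all add: abs_mult pos_le_divide_eq mult.commute)
  thus ?thesis using cmod_le[of "z - w"] by (simp add: dist_norm)
qed

text \<open>The offset 2 in the row coordinate of \<open>brick\<close> keeps the row number
  positive, since row 0 is a pole of the cylinder. The column bound includes half of the row bound
  because of the shifted bond.\<close>

lemma brick_range:
  assumes "0 < s" "norm z \<le> B" "z \<in> brick s B (i, j)"
  shows "1 \<le> j" "real j \<le> 2 * s * B + 2" "real i \<le> 3 * s * B + 1"
proof -
  have "0 \<le> Im z + B" "Im z + B \<le> 2 * B" "Re z + B \<le> 2 * B" using assms(2) abs_Im_le_cmod[of z] abs_Re_le_cmod[of z] by auto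
  hence b: "0 \<le> s * (Im z + B)" "s * (Im z + B) \<le> 2 * s * B" "s * (Re z + B) \<le> 2 * s * B"
    using mult_left_mono[of _ "2 * B" s] assms(1) by (simp_all add: mult.assoc mult.left_commute)
  have z: "real j \<le> s * (Im z + B) + 2" "s * (Im z + B) + 2 \<le> real j + 1" "real i \<le> s * (Re z + B) + real j / 2"
    using assms(3) by (auto simp: brick_def)
  show "1 \<le> j" using b z by linarith
  show "real j \<le> 2 * s * B + 2" using b z by linarith
  show "real i \<le> 3 * s * B + 1" using b z by linarith
qed

lemma brick_meet:
  assumes "z \<in> brick s B (i, j)" "z \<in> brick s B (i', j')"
  shows "j = j' \<and> (i = i' \<or> i' = Suc i \<or> i = Suc i') \<or> j' = Suc j \<and> (i' = i \<or> i' = Suc i) \<or> j = Suc j' \<and> (i = i' \<or> i = Suc i')"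
proof -
  have z: "real j \<le> s * (Im z + B) + 2" "s * (Im z + B) + 2 \<le> real j + 1" "real i \<le> s * (Re z + B) + real j / 2"
    "s * (Re z + B) + real j / 2 \<le> real i + 1"
    "real j' \<le> s * (Im z + B) + 2" "s * (Im z + B) + 2 \<le> real j' + 1" "real i' \<le> s * (Re z + B) + real j' / 2"
    "s * (Re z + B) + real j' / 2 \<le> real i' + 1"
    using assms by (auto simp: brick_def)
  have "real j \<le> real j' + 1" "real j' \<le> real j + 1" using z by auto
  hence "j' = j \<or> j' = Suc j \<or> j = Suc j'" by linarith
  then consider "j' = j" | "j' = Suc j" | "j = Suc j'" by blast
  thus ?thesis
  proof cases
    case 1
    hence "real i \<le> real i' + 1" "real i' \<le> real i + 1" using z by auto
    thus ?thesis using 1 by linarith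
  next
    case 2
    hence r: "real j' = real j + 1" by simp
    have "real i \<le> real i' + 1/2" "real i' \<le> real i + 3/2" using z(3,8) z(4,7) unfolding r by (auto simp: add_divide_distrib)
    thus ?thesis using 2 by linarith
  next
    case 3
    hence r: "real j = real j' + 1" by simp
    have "real i' \<le> real i + 1/2" "real i \<le> real i' + 3/2" using z(3,8) z(4,7) unfolding r by (auto simp: add_divide_distrib)
    thus ?thesis using 3 by linarith
  qed
qed

text \<open>Each arc is cut into thirds: \<open>K u\<close> is the point of \<open>u\<close> with
  the adjacent thirds of its arcs, \<open>M e\<close> is a middle third. These compact connected
  sets meet only where a middle third joins its two ends, so bricks smaller than the distances
  between the others show no further incidences. The bricks of a middle third that can be reached
  from its first end without entering the second are given to the first end.\<close>

theorem planar_grid_minor: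
  assumes G: "finite_simple_graph (V, E)" and emb: "planar_embedding (V, E) p g"
  shows "\<exists>(F :: (nat \<times> nat) faces) W. triangulation F \<and>
    (\<forall>u\<in>V. W u \<subseteq> verts F \<and> W u \<noteq> {} \<and> linked (adj F) (W u)) \<and>
    (\<forall>u\<in>V. \<forall>v\<in>V. u \<noteq> v \<longrightarrow> W u \<inter> W v = {}) \<and>
    (\<forall>e\<in>E. \<exists>u v x y. e = {u, v} \<and> u \<in> V \<and> v \<in> V \<and> u \<noteq> v \<and> x \<in> W u \<and> y \<in> W v \<and> adj F x y)"
proof -
  have finV: "finite V" and EV: "\<And>e. e \<in> E \<Longrightarrow> e \<subseteq> V \<and> card e = 2" using G by (auto simp: finite_simple_graph_def)
  have finE: "finite E" by (rule finite_subset[of _ "Pow V"]) (use finV EV in auto)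
  have pinj: "inj_on p V" and ge: "\<And>e. e \<in> E \<Longrightarrow> arc (g e) \<and> {pathstart (g e), pathfinish (g e)} = p ` e \<and> path_image (g e) \<inter> p ` V = p ` e"
    and gef: "\<And>e f. e \<in> E \<Longrightarrow> f \<in> E \<Longrightarrow> e \<noteq> f \<Longrightarrow> path_image (g e) \<inter> path_image (g f) \<subseteq> p ` (e \<inter> f)"
    using emb by (auto simp: planar_embedding_def)
  have "\<exists>a b. e = {a, b} \<and> a \<in> V \<and> b \<in> V \<and> a \<noteq> b \<and> g e 0 = p a \<and> g e 1 = p b" if e: "e \<in> E" for e
  proof -
    obtain u v where uv: "e = {u, v}" "u \<noteq> v" using EV[OF e] by (auto simp: card_2_iff)
    hence "{g e 0, g e 1} = {p u, p v}" using ge[OF e] by (simp add: pathstart_def pathfinish_def)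
    hence "g e 0 = p u \<and> g e 1 = p v \<or> g e 0 = p v \<and> g e 1 = p u" by (auto simp: doubleton_eq_iff)
    thus ?thesis using uv EV[OF e] by blast
  qed
  then obtain a b where ab: "\<And>e. e \<in> E \<Longrightarrow> e = {a e, b e} \<and> a e \<in> V \<and> b e \<in> V \<and> a e \<noteq> b e \<and> g e 0 = p (a e) \<and> g e 1 = p (b e)"
    by metis
  have arc: "continuous_on {0..1} (g e)" "inj_on (g e) {0..1}" if "e \<in> E" for e using ge[OF that] by (auto simp: arc_def path_def)
  have F1: "t = 0 \<and> w = a e \<or> t = 1 \<and> w = b e" if "e \<in> E" "t \<in> {0..1}" "w \<in> V" "g e t = p w" for e t w
  proof -
    have "g e t \<in> path_image (g e)" using that(2) unfolding path_image_def by (rule imageI)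
    hence "p w \<in> p ` e" using ge[OF that(1)] that(3,4) by auto
    hence "w \<in> e" using pinj EV[OF that(1)] that(3) by (auto dest: inj_onD)
    hence "w = a e \<and> g e t = g e 0 \<or> w = b e \<and> g e t = g e 1" using ab[OF that(1)] that(4) by force
    thus ?thesis using inj_onD[OF arc(2)[OF that(1)], of t 0] inj_onD[OF arc(2)[OF that(1)], of t 1] that(2) by auto
  qed
  have F2: "\<exists>w\<in>V. g e t = p w" if "e \<in> E" "f \<in> E" "e \<noteq> f" "t \<in> {0..1}" "s \<in> {0..1}" "g e t = g f s" for e f t s
  proof -
    have "g e t \<in> path_image (g e)" "g f s \<in> path_image (g f)" using that(4,5) unfolding path_image_def by (auto intro: imageI)
    hence "g e t \<in> path_image (g e) \<inter> path_image (g f)" using that(6) by simp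
    thus ?thesis using gef[OF that(1-3)] EV[OF that(1)] by blast
  qed
  have F3: "t = s" if "e \<in> E" "t \<in> {0..1}" "s \<in> {0..1}" "g e t = g e s" for e t s
    using inj_onD[OF arc(2)[OF that(1)] that(4,2,3)] .
  define K where "K u = {p u} \<union> (\<Union>e\<in>{e \<in> E. a e = u}. g e ` {0..1/3}) \<union> (\<Union>e\<in>{e \<in> E. b e = u}. g e ` {2/3..1})" for u
  define M where "M e = g e ` {1/3..2/3}" for e
  have KD: "z = p u \<or> (\<exists>e t. e \<in> E \<and> t \<in> {0..1} \<and> z = g e t \<and> (a e = u \<and> t \<le> 1/3 \<or> b e = u \<and> 2/3 \<le> t))" if "z \<in> K u" for z u
    using that unfolding K_def by fastforce
  have MD: "\<exists>t. t \<in> {0..1} \<and> 1/3 \<le> t \<and> t \<le> 2/3 \<and> z = g e t" if zM: "z \<in> M e" for z e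
  proof -
    obtain t where "t \<in> {1/3..2/3}" "z = g e t" using zM unfolding M_def by blast
    thus ?thesis by (intro exI[of _ t]) auto
  qed
  have Kp: "w = u" if "p w \<in> K u" "w \<in> V" "u \<in> V" for u w
    using KD[OF that(1)]
  proof (elim disjE exE conjE)
    assume "p w = p u"
    thus ?thesis using inj_onD[OF pinj] that by blast
  next
    fix e t assume "e \<in> E" "t \<in> {0..1}" "p w = g e t" "a e = u" "t \<le> 1/3"
    thus ?thesis using F1[of e t w] that(2) by auto
  next
    fix e t assume "e \<in> E" "t \<in> {0..1}" "p w = g e t" "b e = u" "2/3 \<le> t"
    thus ?thesis using F1[of e t w] that(2) by auto
  qed
  have KK: "K u \<inter> K v = {}" if uv: "u \<in> V" "v \<in> V" "u \<noteq> v" for u v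
  proof (rule ccontr)
    assume "K u \<inter> K v \<noteq> {}"
    then obtain z where z: "z \<in> K u" "z \<in> K v" by blast
    have nV: "z \<noteq> p w" if "w \<in> V" for w using Kp[of w u] Kp[of w v] z uv that by blast
    obtain e t where e: "e \<in> E" "t \<in> {0..1}" "z = g e t" "a e = u \<and> t \<le> 1/3 \<or> b e = u \<and> 2/3 \<le> t" using KD[OF z(1)] nV uv by blast
    obtain f s where f: "f \<in> E" "s \<in> {0..1}" "z = g f s" "a f = v \<and> s \<le> 1/3 \<or> b f = v \<and> 2/3 \<le> s" using KD[OF z(2)] nV uv by blast
    have "e = f" using F2[OF e(1) f(1) _ e(2) f(2)] e(3) f(3) nV by metis
    hence "t = s" using F3[OF e(1,2) f(2)] e(3) f(3) by simp
    thus False using e(4) f(4) uv(3) \<open>e = f\<close> by auto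
  qed
  have MV: "z \<noteq> p w" if z: "z \<in> M e" "e \<in> E" "w \<in> V" for z e w
  proof
    assume "z = p w"
    obtain t where "t \<in> {0..1}" "1/3 \<le> t" "t \<le> 2/3" "z = g e t" using MD[OF z(1)] by blast
    thus False using F1[OF z(2), of t w] \<open>z = p w\<close> z(3) by auto
  qed
  have MK: "M e \<inter> K w = {}" if e: "e \<in> E" "w \<in> V" "w \<notin> e" for e w
  proof (rule ccontr)
    assume "M e \<inter> K w \<noteq> {}"
    then obtain z where z: "z \<in> M e" "z \<in> K w" by blast
    obtain t where t: "t \<in> {0..1}" "1/3 \<le> t" "t \<le> 2/3" "z = g e t" using MD[OF z(1)] by blast
    obtain f s where f: "f \<in> E" "s \<in> {0..1}" "z = g f s" "a f = w \<and> s \<le> 1/3 \<or> b f = w \<and> 2/3 \<le> s"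
      using KD[OF z(2)] MV[OF z(1) e(1)] e(2) by blast
    have "e = f" using F2[OF e(1) f(1) _ t(1) f(2)] t(4) f(3) MV[OF z(1) e(1)] by metis
    thus False using f(4) ab[OF e(1)] e(3) by blast
  qed
  have MM: "M e \<inter> M f = {}" if e: "e \<in> E" "f \<in> E" "e \<noteq> f" for e f
  proof (rule ccontr)
    assume "M e \<inter> M f \<noteq> {}"
    then obtain z where z: "z \<in> M e" "z \<in> M f" by blast
    obtain t s where "t \<in> {0..1}" "z = g e t" "s \<in> {0..1}" "z = g f s" using MD[OF z(1)] MD[OF z(2)] by blast
    thus False using F2[OF e, of t s] MV[OF z(1) e(1)] by metis
  qed
  have cont: "continuous_on {x..y} (g e)" if "e \<in> E" "0 \<le> x" "y \<le> 1" for e x y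
    by (rule continuous_on_subset[OF arc(1)[OF that(1)]]) (use that in auto)
  have Kc: "compact (K u)" for u
    unfolding K_def using finE by (intro compact_Un compact_UN compact_continuous_image) (auto intro: cont)
  have Kconn: "connected (K u)" for u
  proof -
    define \<C> where "\<C> = insert {p u} ((\<lambda>e. insert (p u) (g e ` {0..1/3})) ` {e \<in> E. a e = u} \<union> (\<lambda>e. insert (p u) (g e ` {2/3..1})) ` {e \<in> E. b e = u})"
    have "connected (\<Union>\<C>)"
    proof (rule connected_Union)
      fix C assume "C \<in> \<C>"
      then consider "C = {p u}" | e where "e \<in> E" "a e = u" "C = insert (p u) (g e ` {0..1/3})"
        | e where "e \<in> E" "b e = u" "C = insert (p u) (g e ` {2/3..1})" by (auto simp: \<C>_def)
      thus "connected C"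
      proof cases
        case (2 e)
        hence "C = g e ` {0..1/3}" using ab[OF 2(1)] by (auto intro: rev_image_eqI[of 0])
        thus ?thesis using cont[OF 2(1)] by (auto intro!: connected_continuous_image)
      next
        case (3 e)
        hence "C = g e ` {2/3..1}" using ab[OF 3(1)] by (auto intro: rev_image_eqI[of 1])
        thus ?thesis using cont[OF 3(1)] by (auto intro!: connected_continuous_image)
      qed simp
    qed (auto simp: \<C>_def)
    moreover have "\<Union>\<C> = K u" by (auto simp: \<C>_def K_def)
    ultimately show ?thesis by simp
  qed
  have Mc: "compact (M e)" "connected (M e)" if "e \<in> E" for e
    unfolding M_def using cont[OF that] by (auto intro!: compact_continuous_image connected_continuous_image)
  define J where "J = Inl ` V \<union> Inr ` E"
  define C where "C i = (case i of Inl u \<Rightarrow> K u | Inr e \<Rightarrow> M e)" for i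
  have finJ: "finite J" using finV finE by (simp add: J_def)
  have Cc: "compact (C i)" if "i \<in> J" for i using that Kc Mc by (auto simp: J_def C_def)
  obtain d where d: "0 < d" "\<And>i j x y. i \<in> J \<Longrightarrow> j \<in> J \<Longrightarrow> C i \<inter> C j = {} \<Longrightarrow> x \<in> C i \<Longrightarrow> y \<in> C j \<Longrightarrow> d \<le> dist x y"
    using uniformly_separated[OF finJ Cc] by force
  have "bounded (\<Union>i\<in>J. C i)" using finJ Cc by (auto intro!: bounded_UN compact_imp_bounded)
  then obtain B where "\<forall>x\<in>(\<Union>i\<in>J. C i). norm x \<le> B" unfolding bounded_iff by blast
  hence B: "norm x \<le> B" if "i \<in> J" "x \<in> C i" for i x using that by blast
  \<comment> \<open>A brick has diameter at most \<open>2 / s\<close>, which is less than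
    \<open>d\<close>.\<close>
  define s where "s = 3 / d"
  have s: "0 < s" "2 / s < d" using d(1) by (auto simp: s_def)
  \<comment> \<open>\<open>n\<close> and \<open>m\<close> keep the relevant bricks off the last
    column and the top row, where the cylinder wraps around or closes up.\<close>
  define n where "n = nat \<lceil>3 * s * B + 1\<rceil> + 3"
  define m where "m = nat \<lceil>2 * s * B + 2\<rceil> + 1"
  interpret cyl: cylinder "{..<n}" "\<lambda>i. if Suc i = n then 0 else Suc i" 0 m
    by (rule cylinder_nat) (auto simp: n_def m_def)
  interpret T: triangulation cyl.grid by (rule cyl.triangulation_grid)
  define D where "D i = {t. brick s B t \<inter> C i \<noteq> {}}" for i
  have rng: "1 \<le> j \<and> j < m \<and> Suc i < n" if k: "k \<in> J" "(i, j) \<in> D k" for i j k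
  proof -
    obtain z where z: "z \<in> brick s B (i, j)" "z \<in> C k" using k(2) by (auto simp: D_def)
    note r = brick_range[OF s(1) B[OF k(1) z(2)] z(1)]
    have "j \<le> nat \<lceil>2 * s * B + 2\<rceil>" using r(2) by linarith
    moreover have "i \<le> nat \<lceil>3 * s * B + 1\<rceil>" using r(3) by linarith
    ultimately show ?thesis using r(1) by (simp add: n_def m_def)
  qed
  have adj: "t = t' \<or> adj cyl.grid t t'" if k: "k \<in> J" "t \<in> D k" "t' \<in> D k" and z: "z \<in> brick s B t" "z \<in> brick s B t'" for k t t' z
  proof -
    obtain i j i' j' where [simp]: "t = (i, j)" "t' = (i', j')" by force
    note r = rng[OF k(1), of i j] rng[OF k(1), of i' j'] brick_meet[of z s B i j i' j']
    show ?thesis using r k z cyl.grid_adj[of i j] cyl.grid_adj[of i' j'] T.adj_commute[of "(i, j)" "(i', j')"] by auto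
  qed
  have D_verts: "D k \<subseteq> verts cyl.grid" if "k \<in> J" for k
    using rng[OF that] cyl.grid_verts by fastforce
  have link: "linked (adj cyl.grid) (D k)" if k: "k \<in> J" "connected (C k)" for k
  proof (rule linked_tiles[of _ "brick s B" "C k"])
    show "finite (D k)" by (rule finite_subset[OF D_verts[OF k(1)] T.finite_verts])
    show "C k \<subseteq> (\<Union>t\<in>D k. brick s B t)" using brick_cover[OF s(1) B[OF k(1)]] by (fastforce simp: D_def)
    show "t = t' \<or> adj cyl.grid t t'" if "t \<in> D k" "t' \<in> D k" "z \<in> brick s B t" "z \<in> brick s B t'" for t t' z
      by (rule adj[OF k(1) that])
  qed (auto simp: D_def closed_brick k)
  have Ddisj: "D i \<inter> D j = {}" if ij: "i \<in> J" "j \<in> J" "C i \<inter> C j = {}" for i j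
  proof (rule ccontr)
    assume "D i \<inter> D j \<noteq> {}"
    then obtain t x y where "x \<in> brick s B t" "x \<in> C i" "y \<in> brick s B t" "y \<in> C j" by (auto simp: D_def)
    thus False using brick_dist[OF s(1), of x B t y] d(2)[OF ij, of x y] s(2) by linarith
  qed
  have ex_tile: "\<exists>t. t \<in> D i \<and> t \<in> D j" if "i \<in> J" "z \<in> C i" "z \<in> C j" for i j z
    using brick_cover[OF s(1) B[OF that(1,2)]] that by (auto simp: D_def)
  have JV: "Inl u \<in> J" if "u \<in> V" for u using that by (simp add: J_def)
  have JE: "Inr e \<in> J" if "e \<in> E" for e using that by (simp add: J_def)
  define reach where "reach e Z \<longleftrightarrow> Z \<subseteq> D (Inr e) - D (Inl (b e)) \<and> Z \<inter> D (Inl (a e)) \<noteq> {} \<and> linked (adj cyl.grid) Z \<and>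
    (\<exists>x\<in>Z. \<exists>y\<in>D (Inl (b e)). adj cyl.grid x y)" for e Z
  have "\<exists>Z. reach e Z" if e: "e \<in> E" for e
  proof -
    have M3: "g e (1/3) \<in> M e" "g e (2/3) \<in> M e" by (auto simp: M_def)
    have K3: "g e (1/3) \<in> K (a e)" "g e (2/3) \<in> K (b e)" using e by (auto simp: K_def)
    obtain t0 where t0: "t0 \<in> D (Inr e)" "t0 \<in> D (Inl (a e))" using ex_tile[OF JE[OF e], of "g e (1/3)" "Inl (a e)"] M3 K3 by (auto simp: C_def)
    obtain t1 where t1: "t1 \<in> D (Inr e)" "t1 \<in> D (Inl (b e))" using ex_tile[OF JE[OF e], of "g e (2/3)" "Inl (b e)"] M3 K3 by (auto simp: C_def)
    have "t0 \<notin> D (Inl (b e))" using Ddisj[OF JV JV, of "a e" "b e"] ab[OF e] KK t0 by (auto simp: C_def)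
    moreover have "linked (adj cyl.grid) (D (Inr e))" using Mc[OF e] by (intro link JE e) (simp add: C_def)
    ultimately obtain Z where "t0 \<in> Z" "Z \<subseteq> D (Inr e) - D (Inl (b e))" "linked (adj cyl.grid) Z" "\<exists>x\<in>Z. \<exists>y\<in>D (Inl (b e)). adj cyl.grid x y"
      using ex_linked_reaching[of "adj cyl.grid" "D (Inr e)" t0 "D (Inl (b e))" t1] T.adj_sym t0(1) t1 by blast
    thus ?thesis using t0(2) unfolding reach_def by blast
  qed
  then obtain Z where "\<And>e. e \<in> E \<Longrightarrow> reach e (Z e)" by metis
  note Z = this[unfolded reach_def]
  define W where "W u = D (Inl u) \<union> (\<Union>e\<in>{e \<in> E. a e = u}. Z e)" for u
  have ZD: "Z e \<inter> D (Inl w) = {}" if e: "e \<in> E" "w \<in> V" "w \<noteq> a e" for e w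
  proof (cases "w = b e")
    case False
    hence "w \<notin> e" using ab[OF e(1)] e(3) by blast
    hence "D (Inr e) \<inter> D (Inl w) = {}" using MK[OF e(1,2)] by (intro Ddisj JE JV e) (simp add: C_def)
    thus ?thesis using Z[OF e(1)] by blast
  qed (use Z[OF e(1)] in blast)
  have ZZ: "Z e \<inter> Z f = {}" if "e \<in> E" "f \<in> E" "e \<noteq> f" for e f
  proof -
    have "D (Inr e) \<inter> D (Inr f) = {}" using MM[OF that] by (intro Ddisj JE that) (simp add: C_def)
    thus ?thesis using Z[OF that(1)] Z[OF that(2)] by blast
  qed
  have "W u \<subseteq> verts cyl.grid \<and> W u \<noteq> {} \<and> linked (adj cyl.grid) (W u)" if u: "u \<in> V" for u
  proof (intro conjI)
    show "W u \<subseteq> verts cyl.grid" using D_verts JV[OF u] JE Z unfolding W_def by blast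
    have "p u \<in> C (Inl u)" by (simp add: C_def K_def)
    thus "W u \<noteq> {}" using ex_tile[OF JV[OF u]] unfolding W_def by blast
    show "linked (adj cyl.grid) (W u)" unfolding W_def
    proof (rule linked_Un[OF T.adj_sym])
      show "linked (adj cyl.grid) (D (Inl u))" using Kconn by (intro link JV u) (simp add: C_def)
    qed (use Z in auto)
  qed
  moreover have "W u \<inter> W v = {}" if uv: "u \<in> V" "v \<in> V" "u \<noteq> v" for u v
  proof -
    have "D (Inl u) \<inter> D (Inl v) = {}" using KK[OF uv] by (intro Ddisj JV uv) (simp add: C_def)
    moreover have "Z e \<inter> D (Inl v) = {}" if "e \<in> E" "a e = u" for e using ZD[of e v] that uv by auto
    moreover have "Z e \<inter> D (Inl u) = {}" if "e \<in> E" "a e = v" for e using ZD[of e u] that uv by auto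
    moreover have "Z e \<inter> Z f = {}" if "e \<in> E" "a e = u" "f \<in> E" "a f = v" for e f using ZZ[of e f] that uv by auto
    ultimately show ?thesis unfolding W_def by blast
  qed
  moreover have "\<exists>u v x y. e = {u, v} \<and> u \<in> V \<and> v \<in> V \<and> u \<noteq> v \<and> x \<in> W u \<and> y \<in> W v \<and> adj cyl.grid x y" if e: "e \<in> E" for e
  proof -
    obtain x y where "x \<in> Z e" "y \<in> D (Inl (b e))" "adj cyl.grid x y" using Z[OF e] by blast
    moreover from this have "x \<in> W (a e)" "y \<in> W (b e)" using e by (auto simp: W_def)
    ultimately show ?thesis using ab[OF e] by blast
  qed
  ultimately show ?thesis using cyl.triangulation_grid by (intro exI[of _ cyl.grid] exI[of _ W]) simp
qed

section \<open>The packing theorem\<close>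

theorem mainTheorem7:
  fixes V :: "'v set" and E :: "'v set set" and P :: "'v \<Rightarrow> complex set"
  assumes "finite_simple_graph (V, E)"
    and "planar_graph (V, E)"
    and "\<And>v. v \<in> V \<Longrightarrow> smooth_convex_body (P v)"
  shows "\<exists>Q :: 'v \<Rightarrow> complex set.
           (\<forall>v\<in>V. homothetic (P v) (Q v)) \<and> packing V Q \<and> nerve V Q = (V, E)"
proof -
  have fin: "finite V" using assms(1) by (auto simp: finite_simple_graph_def)
  obtain p g where "planar_embedding (V, E) p g" using assms(2) by (auto simp: planar_graph_def)
  from planar_grid_minor[OF assms(1) this] obtain F :: "(nat \<times> nat) faces" and W where
    F: "triangulation F" and "\<forall>u\<in>V. W u \<subseteq> verts F \<and> W u \<noteq> {} \<and> linked (adj F) (W u)"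
      "\<forall>u\<in>V. \<forall>v\<in>V. u \<noteq> v \<longrightarrow> W u \<inter> W v = {}"
      "\<forall>e\<in>E. \<exists>u v x y. e = {u, v} \<and> u \<in> V \<and> v \<in> V \<and> u \<noteq> v \<and> x \<in> W u \<and> y \<in> W v \<and> adj F x y"
    by auto
  note W = this(2-)[rule_format]
  have W1: "W u \<subseteq> verts F" "W u \<noteq> {}" "linked (adj F) (W u)" if "u \<in> V" for u using W(1)[OF that] by auto
  have Wd: "u = v" if "u \<in> V" "v \<in> V" "x \<in> W u" "x \<in> W v" for u v x using W(2)[OF that(1,2)] that(3,4) by blast
  have Wl: "(x, y) \<in> {(x, y). x \<in> W u \<and> y \<in> W u \<and> adj F x y}\<^sup>*" if "u \<in> V" "x \<in> W u" "y \<in> W u" for u x y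
    using W1(3)[OF that(1)] that(2,3) by (simp add: linked_def)
  interpret F: triangulation F by (rule F)
  obtain T and
    \<rho> :: "'v \<Rightarrow> ('v + (nat \<times> nat) sd + (nat \<times> nat) sd set) + (nat \<times> nat) sd faces" and o1 o2 o3
    where T: "triangulation T" "inj_on \<rho> V" "\<rho> ` V \<subseteq> verts T"
      and T4: "\<forall>u\<in>V. \<forall>v\<in>V. u \<noteq> v \<longrightarrow> (adj T (\<rho> u) (\<rho> v) \<longleftrightarrow> {u, v} \<in> E)"
      and out: "(o1, o2, o3) \<in> T" "\<rho> ` V \<inter> {o1, o2, o3} = {}"
    by (atomize_elim, rule F.ex_contracted_triangulation) (fact W1(1), fact W1(2), fact Wd, fact Wl, fact W(3))
  interpret T: triangulation T by (rule T(1))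
  define P' where "P' x = (if x \<in> \<rho> ` V then P (the_inv_into V \<rho> x) else cball 0 1)" for x
  have P'\<rho>: "P' (\<rho> v) = P v" if "v \<in> V" for v using that T(2) by (simp add: P'_def the_inv_into_f_f)
  have "smooth_body (P' x)" for x
    using assms(3) smooth_body_disc T(2) smooth_convex_body_imp_smooth_body by (auto simp: P'_def the_inv_into_f_f)
  from T.ex_packing[where P = P', OF out(1) this] obtain y r where "contact_packing T {o1, o2, o3} P' y r" by blast
  note R = this[unfolded contact_packing_def]
  note r = R[THEN conjunct1, rule_format] and dis = R[THEN conjunct2, THEN conjunct1, rule_format]
    and tch = R[THEN conjunct2, THEN conjunct2, THEN conjunct1, rule_format]
    and far = R[THEN conjunct2, THEN conjunct2, THEN conjunct2, THEN conjunct1, rule_format]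
    and tri = R[THEN conjunct2, THEN conjunct2, THEN conjunct2, THEN conjunct2, rule_format]
  define Q where "Q v = place (y (\<rho> v)) (r (\<rho> v)) (P v)" for v
  have \<rho>v: "\<rho> v \<in> verts T" "\<rho> v \<in> verts T - {o1, o2, o3}" if "v \<in> V" for v using that T(3) out(2) by auto
  have \<rho>n: "\<rho> u \<noteq> \<rho> v" if "u \<in> V" "v \<in> V" "u \<noteq> v" for u v using T(2) that by (auto dest: inj_onD)
  have Qb: "smooth_body (Q v)" if "v \<in> V" for v
    unfolding Q_def by (rule smooth_place[OF smooth_convex_body_imp_smooth_body[OF assms(3)[OF that]] r[OF \<rho>v(1)[OF that]]])
  \<comment> \<open>Touching requires the interior of one body to miss the whole other body; for
    convex bodies this follows from disjoint interiors.\<close>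
  have Qi: "interior (Q u) \<inter> Q v = {}" if uv: "u \<in> V" "v \<in> V" "u \<noteq> v" for u v
  proof (rule interior_disjoint_convex)
    show "convex (Q v)" "interior (Q v) \<noteq> {}" using Qb[OF uv(2)] by (auto simp: smooth_body_def)
    show "interior (Q u) \<inter> interior (Q v) = {}"
      using dis[OF \<rho>v(1)[OF uv(1)] \<rho>v(1)[OF uv(2)] \<rho>n[OF uv]] unfolding Q_def P'\<rho>[OF uv(1)] P'\<rho>[OF uv(2)] .
  qed
  have Qt: "touch (Q u) (Q v) \<longleftrightarrow> Q u \<inter> Q v \<noteq> {}" if uv: "u \<in> V" "v \<in> V" "u \<noteq> v" for u v
    using Qi[OF uv] Qi[OF uv(2,1)] uv(3) by (auto simp: touch_def)
  \<comment> \<open>The outer face avoids the graph, so \<open>far\<close> applies to any two of its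
    vertices.\<close>
  have QE: "Q u \<inter> Q v \<noteq> {} \<longleftrightarrow> {u, v} \<in> E" if uv: "u \<in> V" "v \<in> V" "u \<noteq> v" for u v
    using tch[of "\<rho> u" "\<rho> v"] far[OF \<rho>v(2)[OF uv(1)] \<rho>v(2)[OF uv(2)] \<rho>n[OF uv]] T4[rule_format, OF uv] by (auto simp: Q_def P'\<rho> uv)
  have "homothetic (P v) (Q v)" if "v \<in> V" for v
    unfolding homothetic_def Q_def place_def using r[OF \<rho>v(1)[OF that]] by blast
  moreover have "packing V Q"
    unfolding packing_def fst_conv
  proof (intro conjI ballI impI fin)
    fix v assume v: "v \<in> V"
    note b = Qb[OF v, unfolded smooth_body_def]
    show "closed (Q v)" "connected (Q v)" "Q v \<noteq> {}" using b by (auto simp: compact_imp_closed convex_connected)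
    show "\<nexists>z. Q v = {z}" using b by auto
  next
    fix u v assume "u \<in> V" "v \<in> V" "u \<noteq> v"
    thus "\<not> intersect_nontrivially (Q u) (Q v)" using Qt by (auto simp: intersect_nontrivially_def)
  next
    fix u v w assume "u \<in> V" "v \<in> V" "w \<in> V" "u \<noteq> v \<and> u \<noteq> w \<and> v \<noteq> w"
    thus "Q u \<inter> Q v \<inter> Q w = {}" using tri[of "\<rho> u" "\<rho> v" "\<rho> w"] \<rho>v \<rho>n P'\<rho> by (simp add: Q_def)
  qed
  moreover have "nerve V Q = (V, E)"
  proof -
    have "{{u, v} | u v. u \<in> V \<and> v \<in> V \<and> u \<noteq> v \<and> touch (Q u) (Q v)} = E"
    proof (intro equalityI subsetI)
      fix e assume e: "e \<in> E"
      then obtain u v where uv: "e = {u, v}" "u \<in> V" "v \<in> V" "u \<noteq> v" using W(3)[OF e] by blast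
      have "touch (Q u) (Q v)" using Qt[OF uv(2-4)] QE[OF uv(2-4)] e uv(1) by simp
      thus "e \<in> {{u, v} | u v. u \<in> V \<and> v \<in> V \<and> u \<noteq> v \<and> touch (Q u) (Q v)}" using uv by blast
    qed (use Qt QE in auto)
    thus ?thesis by (simp add: nerve_def)
  qed
  ultimately show ?thesis by blast
qed

end
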